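(* The weighted Clément quasi-interpolator $J^{\mathrm{Cl},\varphi}_{\mathcal T}$ satisfies: (i) $J^{\mathrm{Cl},\varphi}_{\mathcal T}v=J^{\mathrm{Cl},\varphi}_{\mathcal T}\Pi^0_{\mathcal T}v$ for all $v\in L^2(\Omega)$; (ii) $\|(1-J^{\mathrm{Cl},\varphi}_{\mathcal T})v\|_{L^2(T)}\lesssim h_T\|\nabla v\|_{L^2(\Omega_T)}$ for all $T\in\mathcal T$ and $v\in H^1_0(\Omega)$; (iii) $\|(1-J^{\mathrm{Cl},\varphi}_{\mathcal T})v\|_{L^2(T)}\lesssim h_T^2\|D^2v\|_{L^2(\Omega_T)}$ for all $T\in\mathcal T$ and $v\in H^2(\Omega)\cap H^1_0(\Omega)$; (iv) $\|J^{\mathrm{Cl},\varphi}_{\mathcal T}v\|\lesssim\|v\|$ for all $v\in L^2(\Omega)$, and $\|\nabla J^{\mathrm{Cl},\varphi}_{\mathcal T}v\|\lesssim\|\nabla v\|$ for all $v\in H^1_0(\Omega)$.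
   Context: $\Omega\subset\mathbb R^n$, $n\in\{2,3\}$, is a bounded Lipschitz domain with polytopal boundary $\Gamma$. $\mathcal T$ is a conforming shape-regular simplicial mesh of $\Omega$ with shape-regularity constant $\kappa_{\mathcal T}=\max_{T}\mathrm{diam}(T)^n/|T|$; $h_T=\mathrm{diam}(T)$. $\mathcal V$ is the set of vertices, $\mathcal V_0=\mathcal V\setminus\Gamma$ the interior vertices, $\mathcal V_T$ the vertices of $T$. For $z\in\mathcal V$, $\omega_z$ is the set of elements containing $z$ and $\Omega_z$ the interior of the union of their closures; $\Omega_T$ is the domain covered by $\bigcup_{z\in\mathcal V_T}\omega_z$. $\eta_z$ ($z\in\mathcal V_0$) is the nodal hat function in $\mathcal P^1(\mathcal T)\cap H^1_0(\Omega)$ with $\eta_z(z')=\delta_{zz'}$. $\Pi^0_{\mathcal T}$ is the $L^2$-orthogonal projection onto piecewise constants $\mathcal P^0(\mathcal T)$; $\|\cdot\|$, $\langle\cdot,\cdot\rangle$ denote the $L^2(\Omega)$ norm/inner product. For $T\in\mathcal T$ let $s_T$ be its barycenter. For each $z\in\mathcal V_0$ fix coefficients $\alpha_{z,T}\ge0$ ($T\in\omega_z$) with $\sum_{T\in\omega_z}\alpha_{z,T}=1$ and $\sum_{T\in\omega_z}\alpha_{z,T}s_T=z$ (such exist; they need not be unique), and define $\varphi_z\in\mathcal P^0(\mathcal T)$ by $\varphi_z|_T=\alpha_{z,T}/|T|$ for $T\in\omega_z$ and $\varphi_z|_T=0$ otherwise. The weighted Clément quasi-interpolator is $J^{\mathrm{Cl},\varphi}_{\mathcal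 T}v=\sum_{z\in\mathcal V_0}\langle v,\varphi_z\rangle\eta_z$ for $v\in L^1(\Omega)$. $A\lesssim B$ means $A\le CB$ with $C$ depending only on $\kappa_{\mathcal T}$ and $\Omega$. *)

theory Defs
  imports "HOL-Analysis.Analysis"
begin

definition lipschitz_domain :: "'a::euclidean_space set \<Rightarrow> bool" where
  "lipschitz_domain \<Omega> \<longleftrightarrow> open \<Omega> \<and> bounded \<Omega> \<and> \<Omega> \<noteq> {} \<and>
     (\<forall>x\<in>frontier \<Omega>. \<exists>r>0. \<exists>e L f. norm e = 1 \<and> L-lipschitz_on UNIV (f :: 'a \<Rightarrow> real) \<and>
        \<Omega> \<inter> ball x r = {y\<in>ball x r. y \<bullet> e < f (y - (y \<bullet> e) *\<^sub>R e)})"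

section \<open>Simplicial meshes (a simplex is represented by its finite vertex set)\<close>

definition simplicial_mesh :: "'a::euclidean_space set \<Rightarrow> 'a set set \<Rightarrow> bool" where
  "simplicial_mesh \<Omega> \<T> \<longleftrightarrow> finite \<T> \<and>
     (\<forall>T\<in>\<T>. finite T \<and> card T = DIM('a) + 1 \<and> \<not> affine_dependent T) \<and>
     \<Union>((\<lambda>T. convex hull T) ` \<T>) = closure \<Omega> \<and>
     (\<forall>T\<in>\<T>. \<forall>T'\<in>\<T>. (convex hull T) \<inter> (convex hull T') = convex hull (T \<inter> T'))"

definition shape_regular_by :: "real \<Rightarrow> 'a::euclidean_space set set \<Rightarrow> bool" where
  "shape_regular_by \<kappa> \<T> \<longleftrightarrow>
     (\<forall>T\<in>\<T>. diameter T ^ DIM('a) \<le> \<kappa> * measure lebesgue (convex hull T))"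

definition mesh_vertices :: "'a set set \<Rightarrow> 'a set" where
  "mesh_vertices \<T> = \<Union>\<T>"

definition interior_vertices :: "'a::euclidean_space set \<Rightarrow> 'a set set \<Rightarrow> 'a set" where
  "interior_vertices \<Omega> \<T> = {z\<in>mesh_vertices \<T>. z \<notin> frontier \<Omega>}"

definition star :: "'a set set \<Rightarrow> 'a \<Rightarrow> 'a set set" where
  "star \<T> z = {T\<in>\<T>. z \<in> T}"

definition patch :: "'a::euclidean_space set set \<Rightarrow> 'a set \<Rightarrow> 'a set" where
  "patch \<T> T = \<Union>((\<lambda>T'. convex hull T') ` (\<Union>z\<in>T. star \<T> z))"

definition barycenter :: "'a::euclidean_space set \<Rightarrow> 'a" where
  "barycenter T = (1 / real (card T)) *\<^sub>R (\<Sum>v\<in>T. v)"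

definition bary :: "'a::euclidean_space set \<Rightarrow> 'a \<Rightarrow> 'a \<Rightarrow> real" where
  "bary V z x = (THE c. \<exists>u. (\<forall>v\<in>V. 0 \<le> u v) \<and> sum u V = 1 \<and>
                             (\<Sum>v\<in>V. u v *\<^sub>R v) = x \<and> c = u z)"

definition hat :: "'a::euclidean_space set set \<Rightarrow> 'a \<Rightarrow> 'a \<Rightarrow> real" where
  "hat \<T> z x = (if \<exists>T\<in>\<T>. z \<in> T \<and> x \<in> convex hull T
                then bary (SOME T. T \<in> \<T> \<and> z \<in> T \<and> x \<in> convex hull T) z x else 0)"

definition L2 :: "'a::euclidean_space set \<Rightarrow> ('a \<Rightarrow> real) \<Rightarrow> bool" where
  "L2 S f \<longleftrightarrow> f \<in> borel_measurable (lebesgue_on S) \<and> integrable (lebesgue_on S) (\<lambda>x. (f x)\<^sup>2)"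

definition L2v :: "'a::euclidean_space set \<Rightarrow> ('a \<Rightarrow> 'a) \<Rightarrow> bool" where
  "L2v S g \<longleftrightarrow> g \<in> borel_measurable (lebesgue_on S) \<and>
               integrable (lebesgue_on S) (\<lambda>x. (norm (g x))\<^sup>2)"

definition L2norm :: "'a::euclidean_space set \<Rightarrow> ('a \<Rightarrow> real) \<Rightarrow> real" where
  "L2norm S f = sqrt (integral\<^sup>L (lebesgue_on S) (\<lambda>x. (f x)\<^sup>2))"

definition L2normv :: "'a::euclidean_space set \<Rightarrow> ('a \<Rightarrow> 'a) \<Rightarrow> real" where
  "L2normv S g = sqrt (integral\<^sup>L (lebesgue_on S) (\<lambda>x. (norm (g x))\<^sup>2))"

fun iterd :: "'a::euclidean_space list \<Rightarrow> ('a \<Rightarrow> real) \<Rightarrow> 'a \<Rightarrow> real" where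
  "iterd [] f = f"
| "iterd (e # es) f = (\<lambda>x. frechet_derivative (iterd es f) (at x) e)"

definition smooth_fun :: "('a::euclidean_space \<Rightarrow> real) \<Rightarrow> bool" where
  "smooth_fun f \<longleftrightarrow> (\<forall>es. iterd es f differentiable_on UNIV)"

definition test_fn :: "'a::euclidean_space set \<Rightarrow> ('a \<Rightarrow> real) \<Rightarrow> bool" where
  "test_fn \<Omega> \<phi> \<longleftrightarrow> smooth_fun \<phi> \<and> compact (closure {x. \<phi> x \<noteq> 0}) \<and>
                     closure {x. \<phi> x \<noteq> 0} \<subseteq> \<Omega>"

definition grad :: "('a::euclidean_space \<Rightarrow> real) \<Rightarrow> 'a \<Rightarrow> 'a" where
  "grad f x = (\<Sum>i\<in>Basis. frechet_derivative f (at x) i *\<^sub>R i)"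

definition has_weak_grad :: "'a::euclidean_space set \<Rightarrow> ('a \<Rightarrow> real) \<Rightarrow> ('a \<Rightarrow> 'a) \<Rightarrow> bool" where
  "has_weak_grad \<Omega> v g \<longleftrightarrow> integrable (lebesgue_on \<Omega>) v \<and>
     (\<forall>i\<in>Basis. integrable (lebesgue_on \<Omega>) (\<lambda>x. g x \<bullet> i)) \<and>
     (\<forall>\<phi>. test_fn \<Omega> \<phi> \<longrightarrow> (\<forall>i\<in>Basis.
        integral\<^sup>L (lebesgue_on \<Omega>) (\<lambda>x. v x * frechet_derivative \<phi> (at x) i)
        = - integral\<^sup>L (lebesgue_on \<Omega>) (\<lambda>x. (g x \<bullet> i) * \<phi> x)))"

definition H10 :: "'a::euclidean_space set \<Rightarrow> ('a \<Rightarrow> real) \<Rightarrow> ('a \<Rightarrow> 'a) \<Rightarrow> bool" where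
  "H10 \<Omega> v g \<longleftrightarrow> L2 \<Omega> v \<and> L2v \<Omega> g \<and> has_weak_grad \<Omega> v g \<and>
     (\<exists>\<phi>s. (\<forall>k. test_fn \<Omega> (\<phi>s k)) \<and>
        (\<lambda>k. (L2norm \<Omega> (\<lambda>x. v x - \<phi>s k x))\<^sup>2 + (L2normv \<Omega> (\<lambda>x. g x - grad (\<phi>s k) x))\<^sup>2)
          \<longlonglongrightarrow> 0)"

definition valid_weights :: "'a::euclidean_space set \<Rightarrow> 'a set set \<Rightarrow> ('a \<Rightarrow> 'a set \<Rightarrow> real) \<Rightarrow> bool" where
  "valid_weights \<Omega> \<T> \<alpha> \<longleftrightarrow> (\<forall>z\<in>interior_vertices \<Omega> \<T>.
     (\<forall>T\<in>star \<T> z. 0 \<le> \<alpha> z T) \<and> (\<Sum>T\<in>star \<T> z. \<alpha> z T) = 1 \<and>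
     (\<Sum>T\<in>star \<T> z. \<alpha> z T *\<^sub>R barycenter T) = z)"

text \<open>phi_z: piecewise constant, equal to alpha_{z,T}/|T| on T \<in> omega_z, zero elsewhere
 (values on the null set of element boundaries are set to 0).\<close>
definition phi :: "'a::euclidean_space set set \<Rightarrow> ('a \<Rightarrow> 'a set \<Rightarrow> real) \<Rightarrow> 'a \<Rightarrow> 'a \<Rightarrow> real" where
  "phi \<T> \<alpha> z x = (\<Sum>T\<in>star \<T> z.
      if x \<in> interior (convex hull T) then \<alpha> z T / measure lebesgue (convex hull T) else 0)"

text \<open>L2-orthogonal projection onto piecewise constants.\<close>
definition P0 :: "'a::euclidean_space set set \<Rightarrow> ('a \<Rightarrow> real) \<Rightarrow> 'a \<Rightarrow> real" where
  "P0 \<T> v x = (\<Sum>T\<in>\<T>. if x \<in> interior (convex hull T)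
      then integral\<^sup>L (lebesgue_on (convex hull T)) v / measure lebesgue (convex hull T) else 0)"

definition clement :: "'a::euclidean_space set \<Rightarrow> 'a set set \<Rightarrow> ('a \<Rightarrow> 'a set \<Rightarrow> real)
                        \<Rightarrow> ('a \<Rightarrow> real) \<Rightarrow> 'a \<Rightarrow> real" where
  "clement \<Omega> \<T> \<alpha> v x = (\<Sum>z\<in>interior_vertices \<Omega> \<T>.
      integral\<^sup>L (lebesgue_on \<Omega>) (\<lambda>y. v y * phi \<T> \<alpha> z y) * hat \<T> z x)"

end

theory Submission
  imports Defs
begin

text \<open>On a cell \<open>T\<close> the interpolant is \<open>\<Sum>z\<in>T. cz z v * lam T z\<close>, where \<open>cz z v\<close> is a weighted mean of \<open>v\<close> over the
  star of \<open>z\<close> for an interior vertex and \<open>0\<close> for a boundary vertex. The barycentre condition on the weights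
  makes \<open>cz z\<close> exact for affine functions at interior vertices. Both error estimates thus reduce to
  comparing \<open>cz z v\<close> with the value at \<open>z\<close> of a constant, respectively affine, approximation of \<open>v\<close> on \<open>T\<close>.
  At an interior vertex this is a Poincare inequality on the star, whose cells all contract into one
  common ball about \<open>z\<close>. At a boundary vertex the constant is compared with \<open>0\<close> by shifting \<open>v\<close> out of the
  domain. For the second-order estimate there one uses \<open>v - 2 * v o dil (1/2) z\<close> instead of \<open>v\<close>: near \<open>z\<close>
  the domain is a cone, so this function vanishes on the boundary too, it takes an affine function to minus
  its value at \<open>z\<close>, and its gradient is a difference of gradients of \<open>v\<close>, hence of second order.
  Stability follows by summing the local bounds, since every cell lies in boundedly many stars.\<close>

text \<open>The difficulty is to keep every constant dependent only on the domain and the shape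
  constant. Shape regularity bounds the number of cells at a vertex, but it compares the diameters
  of two cells directly only when they share an edge. Cells that touch only in a vertex are compared
  along chains of cells, and such chains exist because the closed domain stays linked around the
  vertex after the vertex is removed; this uses the Lipschitz boundary and dimension at least two.
  Compactness of the boundary supplies one chart radius and one Lipschitz constant for all boundary
  points. Together these give, around every vertex, a ball of radius proportional to the diameter of
  any cell at that vertex, inside which the star fills the closed domain; the estimates at vertices
  live in this ball. The cone structure at a boundary vertex is read off the mesh: in that ball,
  coordinates other than that of the vertex only scale under a dilation. Inequalities are proved for
  C1 functions and carried over by mollification on compact subsets of the domain; where zero
  boundary values matter, the approximants are test functions.\<close>

section \<open>Squared integrals\<close>

text \<open>Squared \<open>L\<^sup>2\<close> norms are taken in \<^typ>\<open>ennreal\<close>, so that estimates need no integrability side conditions.\<close>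

definition sqint :: "'a::euclidean_space set \<Rightarrow> ('a \<Rightarrow> real) \<Rightarrow> ennreal" where
  "sqint A f = (\<integral>\<^sup>+x\<in>A. ennreal ((f x)\<^sup>2) \<partial>lebesgue)"

lemma sqint_mono: "A \<subseteq> B \<Longrightarrow> sqint A f \<le> sqint B f"
  unfolding sqint_def by (intro nn_integral_mono) (auto simp: indicator_def)

lemma sqint_mono_fun: "(\<And>x. x \<in> A \<Longrightarrow> \<bar>f x\<bar> \<le> \<bar>g x\<bar>) \<Longrightarrow> sqint A f \<le> sqint A g"
  unfolding sqint_def
  by (intro nn_integral_mono) (auto simp: indicator_def abs_le_square_iff intro!: ennreal_leI)

lemma sqint_cong: "(\<And>x. x \<in> A \<Longrightarrow> \<bar>f x\<bar> = \<bar>g x\<bar>) \<Longrightarrow> sqint A f = sqint A g"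
  by (intro antisym sqint_mono_fun) auto

lemma sqint_cong_AE: "AE x in lebesgue. x \<in> A \<longrightarrow> f x = g x \<Longrightarrow> sqint A f = sqint A g"
  unfolding sqint_def by (intro nn_integral_cong_AE) (auto simp: indicator_def)

lemma sqint_null_diff:
  assumes "negligible (A - B)" shows "sqint A f \<le> sqint B f"
  unfolding sqint_def
proof (intro nn_integral_mono_AE)
  have "A - B \<in> null_sets lebesgue" using assms negligible_iff_null_sets by blast
  then show "AE x in lebesgue. ennreal ((f x)\<^sup>2) * indicator A x \<le> ennreal ((f x)\<^sup>2) * indicator B x"
    by (rule AE_I') (auto simp: indicator_def)
qed

text \<open>The factor 2 is that of \<open>(a + b)^2 <= 2 a^2 + 2 b^2\<close>. This replaces the
  triangle inequality and keeps square roots out of \<open>ennreal\<close>, at the price of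
  constants that double with every splitting.\<close>

lemma sqint_add:
  assumes [measurable]: "f \<in> borel_measurable lebesgue" "g \<in> borel_measurable lebesgue" "A \<in> sets lebesgue"
  shows "sqint A (\<lambda>x. f x + g x) \<le> 2 * sqint A f + 2 * sqint A g"
proof -
  have *: "(a + b)\<^sup>2 \<le> 2 * a\<^sup>2 + 2 * b\<^sup>2" for a b :: real
    using zero_le_power2[of "a - b"] by (simp add: power2_eq_square algebra_simps)
  have "sqint A (\<lambda>x. f x + g x) \<le>
     (\<integral>\<^sup>+x. (2 * (ennreal ((f x)\<^sup>2) * indicator A x) + 2 * (ennreal ((g x)\<^sup>2) * indicator A x)) \<partial>lebesgue)"
    unfolding sqint_def
  proof (intro nn_integral_mono)
    fix x
    have "ennreal ((f x + g x)\<^sup>2) \<le> ennreal (2 * (f x)\<^sup>2 + 2 * (g x)\<^sup>2)"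
      by (rule ennreal_leI[OF *])
    also have "\<dots> = 2 * ennreal ((f x)\<^sup>2) + 2 * ennreal ((g x)\<^sup>2)"
      by (simp add: ennreal_plus ennreal_mult)
    finally show "ennreal ((f x + g x)\<^sup>2) * indicator A x \<le>
       2 * (ennreal ((f x)\<^sup>2) * indicator A x) + 2 * (ennreal ((g x)\<^sup>2) * indicator A x)"
      by (auto simp: indicator_def)
  qed
  also have "\<dots> = 2 * sqint A f + 2 * sqint A g"
    unfolding sqint_def by (simp add: nn_integral_add nn_integral_cmult)
  finally show ?thesis .
qed

lemma sqint_uminus: "sqint A (\<lambda>x. - f x) = sqint A f"
  by (rule sqint_cong) auto

lemma sqint_diff:
  assumes [measurable]: "f \<in> borel_measurable lebesgue" "g \<in> borel_measurable lebesgue" "A \<in> sets lebesgue"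
  shows "sqint A (\<lambda>x. f x - g x) \<le> 2 * sqint A f + 2 * sqint A g"
  using sqint_add[of f "\<lambda>x. - g x" A] assms by (simp add: sqint_uminus)

lemma sqint_triangle:
  assumes "f \<in> borel_measurable lebesgue" "g \<in> borel_measurable lebesgue" "h \<in> borel_measurable lebesgue" "A \<in> sets lebesgue"
  shows "sqint A (\<lambda>x. f x - h x) \<le> 2 * sqint A (\<lambda>x. f x - g x) + 2 * sqint A (\<lambda>x. g x - h x)"
  using sqint_add[of "\<lambda>x. f x - g x" "\<lambda>x. g x - h x" A] assms by simp

lemma sqint_cmult:
  assumes [measurable]: "f \<in> borel_measurable lebesgue" "A \<in> sets lebesgue"
  shows "sqint A (\<lambda>x. c * f x) = ennreal (c\<^sup>2) * sqint A f"
  unfolding sqint_def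
  by (simp add: power_mult_distrib ennreal_mult mult.assoc nn_integral_cmult)

lemma sqint_const:
  assumes [measurable]: "A \<in> sets lebesgue"
  shows "sqint A (\<lambda>x. c) = ennreal (c\<^sup>2) * emeasure lebesgue A"
  unfolding sqint_def by (simp add: nn_integral_cmult)

lemma sqint_sum:
  assumes "finite I" and m: "\<And>i. i \<in> I \<Longrightarrow> f i \<in> borel_measurable lebesgue" and [measurable]: "A \<in> sets lebesgue"
  shows "sqint A (\<lambda>x. \<Sum>i\<in>I. f i x) \<le> ennreal (real (card I)) * (\<Sum>i\<in>I. sqint A (f i))"
proof -
  have "sqint A (\<lambda>x. \<Sum>i\<in>I. f i x) \<le>
     (\<integral>\<^sup>+x. ennreal (real (card I)) * (\<Sum>i\<in>I. ennreal ((f i x)\<^sup>2) * indicator A x) \<partial>lebesgue)"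
    unfolding sqint_def
  proof (intro nn_integral_mono)
    fix x
    \<comment> \<open>Cauchy-Schwarz against the constant 1.\<close>
    have "(\<Sum>i\<in>I. f i x)\<^sup>2 \<le> real (card I) * (\<Sum>i\<in>I. (f i x)\<^sup>2)"
      using Cauchy_Schwarz_ineq_sum[of "\<lambda>_. 1" "\<lambda>i. f i x" I] by simp
    then have "ennreal ((\<Sum>i\<in>I. f i x)\<^sup>2) \<le> ennreal (real (card I) * (\<Sum>i\<in>I. (f i x)\<^sup>2))"
      by (rule ennreal_leI)
    also have "\<dots> = ennreal (real (card I)) * (\<Sum>i\<in>I. ennreal ((f i x)\<^sup>2))"
      by (subst ennreal_mult) (auto simp: sum_nonneg sum_ennreal)
    finally show "ennreal ((\<Sum>i\<in>I. f i x)\<^sup>2) * indicator A x \<le>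
      ennreal (real (card I)) * (\<Sum>i\<in>I. ennreal ((f i x)\<^sup>2) * indicator A x)"
      by (auto simp: indicator_def)
  qed
  also have "\<dots> = ennreal (real (card I)) * (\<Sum>i\<in>I. sqint A (f i))"
    unfolding sqint_def using m by (subst nn_integral_cmult) (auto simp: nn_integral_sum)
  finally show ?thesis .
qed

lemma sqint_Union_le:
  assumes "finite I" "A \<subseteq> (\<Union>i\<in>I. B i)" and [measurable]: "f \<in> borel_measurable lebesgue" "\<And>i. i \<in> I \<Longrightarrow> B i \<in> sets lebesgue"
  shows "sqint A f \<le> (\<Sum>i\<in>I. sqint (B i) f)"
proof -
  have "sqint A f \<le> (\<integral>\<^sup>+x. (\<Sum>i\<in>I. ennreal ((f x)\<^sup>2) * indicator (B i) x) \<partial>lebesgue)"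
    unfolding sqint_def
  proof (intro nn_integral_mono)
    fix x show "ennreal ((f x)\<^sup>2) * indicator A x \<le> (\<Sum>i\<in>I. ennreal ((f x)\<^sup>2) * indicator (B i) x)"
    proof (cases "x \<in> A")
      case True
      then obtain i where "i \<in> I" "x \<in> B i" using assms(2) by blast
      then have "ennreal ((f x)\<^sup>2) * indicator A x = (\<Sum>i\<in>{i}. ennreal ((f x)\<^sup>2) * indicator (B i) x)"
        using True by simp
      also have "\<dots> \<le> (\<Sum>i\<in>I. ennreal ((f x)\<^sup>2) * indicator (B i) x)"
        using \<open>i \<in> I\<close> assms(1) by (intro sum_mono2) auto
      finally show ?thesis .
    qed auto
  qed
  also have "\<dots> = (\<Sum>i\<in>I. sqint (B i) f)"
    unfolding sqint_def by (intro nn_integral_sum) measurable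
  finally show ?thesis .
qed

text \<open>Serves to pass from compact subsets of an open cell, where C1 approximation is
  available, to the whole cell.\<close>

lemma sqint_SUP:
  assumes [measurable]: "f \<in> borel_measurable lebesgue" "\<And>k. A k \<in> sets lebesgue"
    and "\<And>k. A k \<subseteq> A (Suc k)" and bd: "\<And>k. sqint (A k) f \<le> M"
  shows "sqint (\<Union>k. A k) f \<le> M"
proof -
  have inc: "incseq A" using assms(3) by (rule incseq_SucI)
  have "sqint (\<Union>k. A k) f = (\<integral>\<^sup>+x. (SUP k. ennreal ((f x)\<^sup>2) * indicator (A k) x) \<partial>lebesgue)"
    unfolding sqint_def
  proof (intro nn_integral_cong)
    fix x
    have "indicator (\<Union>k. A k) x = (SUP k. indicator (A k) x :: ennreal)"
    proof (cases "x \<in> (\<Union>k. A k)")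
      case True
      then obtain k where "x \<in> A k" by auto
      then have "1 \<le> (SUP k. indicator (A k) x :: ennreal)"
        by (intro SUP_upper2[of k]) auto
      moreover have "(SUP k. indicator (A k) x :: ennreal) \<le> 1"
        by (intro SUP_least) (auto simp: indicator_def)
      ultimately have "(SUP k. indicator (A k) x :: ennreal) = 1" by (rule antisym[rotated])
      then show ?thesis using True by simp
    qed auto
    then show "ennreal ((f x)\<^sup>2) * indicator (\<Union>k. A k) x = (SUP k. ennreal ((f x)\<^sup>2) * indicator (A k) x)"
      by (simp add: SUP_mult_left_ennreal)
  qed
  also have "\<dots> = (SUP k. sqint (A k) f)"
    unfolding sqint_def
    using inc by (intro nn_integral_monotone_convergence_SUP)
      (auto simp: incseq_def le_fun_def indicator_def)
  also have "\<dots> \<le> M" using bd by (intro SUP_least)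
  finally show ?thesis .
qed

section \<open>Dilations and translations of smooth functions\<close>

text \<open>The homothety with centre \<open>z\<close> and ratio \<open>t\<close>.\<close>

definition dil :: "real \<Rightarrow> 'a::real_vector \<Rightarrow> 'a \<Rightarrow> 'a" where
  "dil t z x = z + t *\<^sub>R (x - z)"

lemma dil_lebesgue_measurable:
  fixes z :: "'a::euclidean_space"
  assumes "t \<noteq> 0" shows "dil t z \<in> lebesgue \<rightarrow>\<^sub>M lebesgue"
proof -
  have "dil t z = (\<lambda>x. (z - t *\<^sub>R z) + (\<Sum>j\<in>Basis. (t * (x \<bullet> j)) *\<^sub>R j))"
    unfolding scaleR_scaleR[symmetric] scaleR_sum_right[symmetric] euclidean_representation
    by (auto simp: dil_def fun_eq_iff algebra_simps)
  then show ?thesis using lebesgue_affine_measurable[of "\<lambda>_. t"] assms by auto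
qed

lemma lebesgue_dil:
  fixes z :: "'a::euclidean_space"
  assumes "t \<noteq> 0"
  shows "lebesgue = density (distr lebesgue lebesgue (dil t z)) (\<lambda>_. ennreal (\<bar>t\<bar> ^ DIM('a)))"
proof -
  have "dil t z = (\<lambda>x. (z - t *\<^sub>R z) + (\<Sum>j\<in>Basis. (t * (x \<bullet> j)) *\<^sub>R j))"
    unfolding scaleR_scaleR[symmetric] scaleR_sum_right[symmetric] euclidean_representation
    by (auto simp: dil_def fun_eq_iff algebra_simps)
  then show ?thesis using lebesgue_affine_euclidean[of "\<lambda>_. t" "z - t *\<^sub>R z"] assms by simp
qed

lemma nn_integral_dil:
  fixes z :: "'a::euclidean_space"
  assumes f[measurable]: "f \<in> borel_measurable lebesgue" and t: "t > 0"
  shows "(\<integral>\<^sup>+x. f x \<partial>lebesgue) = ennreal (t ^ DIM('a)) * (\<integral>\<^sup>+x. f (dil t z x) \<partial>lebesgue)"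
proof -
  have [measurable]: "dil t z \<in> lebesgue \<rightarrow>\<^sub>M lebesgue" using t by (simp add: dil_lebesgue_measurable)
  have "(\<integral>\<^sup>+x. f x \<partial>lebesgue) =
    (\<integral>\<^sup>+x. f x \<partial>density (distr lebesgue lebesgue (dil t z)) (\<lambda>_. ennreal (\<bar>t\<bar> ^ DIM('a))))"
    using lebesgue_dil[of t z] t by auto
  also have "\<dots> = (\<integral>\<^sup>+x. ennreal (\<bar>t\<bar> ^ DIM('a)) * f x \<partial>distr lebesgue lebesgue (dil t z))"
    by (subst nn_integral_density) auto
  also have "\<dots> = ennreal (\<bar>t\<bar> ^ DIM('a)) * (\<integral>\<^sup>+x. f (dil t z x) \<partial>lebesgue)"
    by (subst nn_integral_cmult) (auto simp: nn_integral_distr)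
  finally show ?thesis using t by simp
qed

lemma measurable_comp_dil:
  fixes z :: "'a::euclidean_space"
  assumes "f \<in> borel_measurable lebesgue" "t > 0"
  shows "(\<lambda>x. f (dil t z x)) \<in> borel_measurable lebesgue"
  using measurable_compose[OF dil_lebesgue_measurable[of t z] assms(1)] assms(2) by simp

text \<open>The factor is the inverse Jacobian of the homothety. Only an inclusion of the image of
  \<open>A\<close> in \<open>B\<close> is asked for, so \<open>A\<close> may be any set whose
  contraction fits.\<close>

lemma sqint_dil:
  fixes z :: "'a::euclidean_space"
  assumes [measurable]: "f \<in> borel_measurable lebesgue" "B \<in> sets lebesgue"
    and t: "t > 0" and AB: "\<And>x. x \<in> A \<Longrightarrow> dil t z x \<in> B"
  shows "sqint A (\<lambda>x. f (dil t z x)) \<le> ennreal (1 / t ^ DIM('a)) * sqint B f"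
proof -
  have "sqint B f = ennreal (t ^ DIM('a)) * (\<integral>\<^sup>+x. ennreal ((f (dil t z x))\<^sup>2) * indicator B (dil t z x) \<partial>lebesgue)"
    unfolding sqint_def by (subst nn_integral_dil[of _ t z]) (use t in auto)
  also have "\<dots> \<ge> ennreal (t ^ DIM('a)) * sqint A (\<lambda>x. f (dil t z x))"
    unfolding sqint_def by (intro mult_left_mono nn_integral_mono) (auto simp: indicator_def AB)
  finally have "ennreal (1 / t ^ DIM('a)) * (ennreal (t ^ DIM('a)) * sqint A (\<lambda>x. f (dil t z x))) \<le> ennreal (1 / t ^ DIM('a)) * sqint B f"
    by (intro mult_left_mono) auto
  moreover have "ennreal (1 / t ^ DIM('a)) * (ennreal (t ^ DIM('a)) * X) = X" for X
    using t by (simp add: mult.assoc[symmetric] ennreal_mult[symmetric])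
  ultimately show ?thesis by simp
qed

section \<open>Differences of C1 functions along displacements\<close>

definition C1 :: "('a::euclidean_space \<Rightarrow> real) \<Rightarrow> ('a \<Rightarrow> 'a) \<Rightarrow> bool" where
  "C1 u D \<longleftrightarrow> (\<forall>x. (u has_derivative (\<lambda>h. D x \<bullet> h)) (at x)) \<and> continuous_on UNIV D"

lemma C1_continuous: "C1 u D \<Longrightarrow> continuous_on UNIV u"
  unfolding C1_def by (meson continuous_at_imp_continuous_on has_derivative_continuous)

lemma C1_measurable:
  assumes "C1 u D"
  shows "u \<in> borel_measurable borel" "D \<in> borel_measurable borel"
    "u \<in> borel_measurable lebesgue" "D \<in> borel_measurable lebesgue"
proof -
  show *: "u \<in> borel_measurable borel" "D \<in> borel_measurable borel"
    using C1_continuous[OF assms] assms by (auto simp: C1_def intro!: borel_measurable_continuous_onI)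
  show "u \<in> borel_measurable lebesgue" "D \<in> borel_measurable lebesgue"
    using * by (auto intro: measurable_completion)
qed

text \<open>Fundamental theorem of calculus along the segment from \<open>x\<close> to
  \<open>x + d\<close>, followed by Cauchy-Schwarz in the path parameter.\<close>

lemma C1_path:
  assumes "C1 u D"
  shows "ennreal ((u (x + d) - u x)\<^sup>2) \<le>
    ennreal ((norm d)\<^sup>2) * (\<integral>\<^sup>+s\<in>{0..1}. ennreal ((norm (D (x + s *\<^sub>R d)))\<^sup>2) \<partial>lborel)"
proof -
  define m where "m = u (x + d) - u x"
  define F where "F s = (norm (D (x + s *\<^sub>R d)))\<^sup>2" for s
  have contD: "continuous_on {0..1} (\<lambda>s. D (x + s *\<^sub>R d))"
    using assms unfolding C1_def
    by (auto intro!: continuous_intros continuous_on_compose2[of UNIV D "{0..1}" "\<lambda>s. x + s *\<^sub>R d"])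
  have 1: "((\<lambda>s. D (x + s *\<^sub>R d) \<bullet> d) has_integral (u (x + 1 *\<^sub>R d) - u (x + 0 *\<^sub>R d))) {0..1}"
  proof (rule fundamental_theorem_of_calculus)
    fix s :: real assume "s \<in> {0..1}"
    have "((\<lambda>s. x + s *\<^sub>R d) has_derivative (\<lambda>k. k *\<^sub>R d)) (at s within {0..1})"
      by (auto intro!: derivative_eq_intros)
    moreover have "(u has_derivative (\<lambda>h. D (x + s *\<^sub>R d) \<bullet> h)) (at (x + s *\<^sub>R d))"
      using assms by (simp add: C1_def)
    ultimately have "((\<lambda>s. u (x + s *\<^sub>R d)) has_derivative (\<lambda>k. D (x + s *\<^sub>R d) \<bullet> (k *\<^sub>R d))) (at s within {0..1})"
      using has_derivative_compose by blast
    then show "((\<lambda>s. u (x + s *\<^sub>R d)) has_vector_derivative D (x + s *\<^sub>R d) \<bullet> d) (at s within {0..1})"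
      by (simp add: has_vector_derivative_def)
  qed simp
  \<comment> \<open>Integrating \<open>2 m b - m^2 <= b^2\<close> for the directional derivative
    \<open>b\<close> with mean \<open>m\<close> gives \<open>m^2\<close> on the left. This is
    Cauchy-Schwarz for integrals without a product of integrals.\<close>
  have 2: "((\<lambda>s. 2 * m * (D (x + s *\<^sub>R d) \<bullet> d) - m\<^sup>2) has_integral (2 * m * m - m\<^sup>2 * 1)) {0..1}"
    using has_integral_diff[OF has_integral_mult_right[OF 1, of "2*m"] has_integral_const_real[of "m\<^sup>2" 0 1]]
    by (simp add: m_def)
  have Fi: "F integrable_on {0..1}"
    unfolding F_def by (intro integrable_continuous_real continuous_intros contD)
  have "2 * m * m - m\<^sup>2 * 1 \<le> (norm d)\<^sup>2 * integral {0..1} F"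
  proof (rule has_integral_le[OF 2])
    show "((\<lambda>s. (norm d)\<^sup>2 * F s) has_integral (norm d)\<^sup>2 * integral {0..1} F) {0..1}"
      using Fi by (intro has_integral_mult_right) (auto simp: integrable_integral)
    fix s
    have "(D (x + s *\<^sub>R d) \<bullet> d)\<^sup>2 \<le> (norm (D (x + s *\<^sub>R d)))\<^sup>2 * (norm d)\<^sup>2"
      using Cauchy_Schwarz_ineq[of "D (x + s *\<^sub>R d)" d] by (simp add: power2_norm_eq_inner)
    moreover have "2 * m * (D (x + s *\<^sub>R d) \<bullet> d) - m\<^sup>2 \<le> (D (x + s *\<^sub>R d) \<bullet> d)\<^sup>2"
      using zero_le_power2[of "m - D (x + s *\<^sub>R d) \<bullet> d"] by (simp add: power2_diff algebra_simps)
    ultimately show "2 * m * (D (x + s *\<^sub>R d) \<bullet> d) - m\<^sup>2 \<le> (norm d)\<^sup>2 * F s"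
      by (simp add: F_def algebra_simps)
  qed
  then have "m\<^sup>2 \<le> (norm d)\<^sup>2 * integral {0..1} F" by (simp add: power2_eq_square)
  then have "ennreal (m\<^sup>2) \<le> ennreal ((norm d)\<^sup>2) * ennreal (integral {0..1} F)"
    by (metis ennreal_leI ennreal_mult' zero_le_power2)
  also have "ennreal (integral {0..1} F) = (\<integral>\<^sup>+s. indicator {0..1} s * F s \<partial>lborel)"
    using nn_integral_has_integral_lebesgue[OF _ integrable_integral[OF Fi]] by (simp add: F_def)
  also have "(\<integral>\<^sup>+s. indicator {0..1} s * F s \<partial>lborel) = (\<integral>\<^sup>+s\<in>{0..1}. F s \<partial>lborel)"
    by (intro nn_integral_cong) (auto simp: indicator_def)
  finally show ?thesis by (simp add: m_def F_def)
qed

text \<open>The displacement field \<open>d\<close> covers both dilations towards a point and translations.\<close>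

lemma C1_displacement:
  fixes d :: "'a::euclidean_space \<Rightarrow> 'a"
  assumes "C1 u D" and d: "continuous_on UNIV d" and [measurable]: "A \<in> sets borel"
    and h: "\<And>x. x \<in> A \<Longrightarrow> norm (d x) \<le> h"
    and M: "\<And>s. s \<in> {0..1} \<Longrightarrow> sqint A (\<lambda>x. norm (D (x + s *\<^sub>R d x))) \<le> M"
  shows "sqint A (\<lambda>x. u (x + d x) - u x) \<le> ennreal (h\<^sup>2) * M"
proof -
  have [measurable]: "D \<in> borel_measurable borel" "d \<in> borel_measurable borel"
    using C1_measurable[OF assms(1)] d by (auto intro: borel_measurable_continuous_onI)
  let ?f = "\<lambda>x s. ennreal (h\<^sup>2) * (ennreal ((norm (D (x + s *\<^sub>R d x)))\<^sup>2) * indicator {0..1::real} s * indicator A x)"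
  have m: "(\<lambda>(x,s). ?f x s) \<in> borel_measurable (lborel \<Otimes>\<^sub>M lborel)"
    unfolding borel_prod[symmetric] split_beta by measurable
  have "sqint A (\<lambda>x. u (x + d x) - u x) = (\<integral>\<^sup>+x\<in>A. ennreal ((u (x + d x) - u x)\<^sup>2) \<partial>lborel)"
    unfolding sqint_def by (simp add: nn_integral_completion)
  also have "\<dots> \<le> (\<integral>\<^sup>+x. (\<integral>\<^sup>+s. ?f x s \<partial>lborel) \<partial>lborel)"
  proof (intro nn_integral_mono)
    fix x
    show "ennreal ((u (x + d x) - u x)\<^sup>2) * indicator A x \<le> (\<integral>\<^sup>+s. ?f x s \<partial>lborel)"
    proof (cases "x \<in> A")
      case True
      have "ennreal ((u (x + d x) - u x)\<^sup>2) \<le>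
        ennreal ((norm (d x))\<^sup>2) * (\<integral>\<^sup>+s\<in>{0..1}. ennreal ((norm (D (x + s *\<^sub>R d x)))\<^sup>2) \<partial>lborel)"
        by (rule C1_path[OF assms(1)])
      also have "\<dots> \<le> ennreal (h\<^sup>2) * (\<integral>\<^sup>+s\<in>{0..1}. ennreal ((norm (D (x + s *\<^sub>R d x)))\<^sup>2) \<partial>lborel)"
        using h[OF True] by (intro mult_right_mono ennreal_leI power_mono) auto
      also have "\<dots> = (\<integral>\<^sup>+s. ?f x s \<partial>lborel)"
        using True by (subst nn_integral_cmult[symmetric]) (auto simp: mult_ac)
      finally show ?thesis using True by simp
    qed auto
  qed
  \<comment> \<open>Tonelli: with the path parameter outside, the hypothesis on each fixed
    \<open>s\<close> applies.\<close>
  also have "\<dots> = (\<integral>\<^sup>+s. (\<integral>\<^sup>+x. ?f x s \<partial>lborel) \<partial>lborel)"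
    using lborel_pair.Fubini'[OF m] by simp
  also have "\<dots> \<le> (\<integral>\<^sup>+s. (ennreal (h\<^sup>2) * M) * indicator {0..1::real} s \<partial>lborel)"
  proof (intro nn_integral_mono)
    fix s :: real
    have "(\<integral>\<^sup>+x. ?f x s \<partial>lborel) = ennreal (h\<^sup>2) * (sqint A (\<lambda>x. norm (D (x + s *\<^sub>R d x))) * indicator {0..1} s)"
    proof -
      have "(\<integral>\<^sup>+x. ?f x s \<partial>lborel) =
        (\<integral>\<^sup>+x. ennreal (h\<^sup>2) * indicator {0..1} s * (ennreal ((norm (D (x + s *\<^sub>R d x)))\<^sup>2) * indicator A x) \<partial>lborel)"
        by (intro nn_integral_cong) (simp add: mult_ac)
      also have "\<dots> = ennreal (h\<^sup>2) * indicator {0..1} s * (\<integral>\<^sup>+x. (ennreal ((norm (D (x + s *\<^sub>R d x)))\<^sup>2) * indicator A x) \<partial>lborel)"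
        by (intro nn_integral_cmult) measurable
      finally show ?thesis by (simp add: sqint_def nn_integral_completion mult_ac)
    qed
    also have "\<dots> \<le> (ennreal (h\<^sup>2) * M) * indicator {0..1::real} s"
      using M[of s] by (auto simp: indicator_def intro: mult_left_mono)
    finally show "(\<integral>\<^sup>+x. ?f x s \<partial>lborel) \<le> (ennreal (h\<^sup>2) * M) * indicator {0..1::real} s" .
  qed
  also have "\<dots> = ennreal (h\<^sup>2) * M"
    by (simp add: nn_integral_cmult)
  finally show ?thesis .
qed

text \<open>Every point on the way from \<open>x\<close> to its image is itself a dilation of
  \<open>x\<close>, with ratio between \<open>t\<close> and 1, so each intermediate Jacobian factor
  is at most \<open>1 / t ^ DIM('a)\<close>.\<close>

lemma C1_dilation:
  fixes z :: "'a::euclidean_space"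
  assumes "C1 u D" and A: "A \<in> sets borel" and A': "A' \<in> sets borel" and t: "0 < t" "t \<le> 1"
    and Ah: "\<And>x. x \<in> A \<Longrightarrow> dist z x \<le> h"
    and AA': "\<And>x s. x \<in> A \<Longrightarrow> t \<le> s \<Longrightarrow> s \<le> 1 \<Longrightarrow> dil s z x \<in> A'"
  shows "sqint A (\<lambda>x. u (dil t z x) - u x) \<le> ennreal (h\<^sup>2 / t ^ DIM('a)) * sqint A' (\<lambda>x. norm (D x))"
proof -
  define d where "d x = (1 - t) *\<^sub>R (z - x)" for x
  have eq: "x + s *\<^sub>R d x = dil (1 - s * (1 - t)) z x" for x s
    by (simp add: d_def dil_def algebra_simps)
  have [measurable]: "D \<in> borel_measurable lebesgue" using C1_measurable[OF assms(1)] by auto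
  have "sqint A (\<lambda>x. u (x + d x) - u x) \<le> ennreal (h\<^sup>2) * (ennreal (1 / t ^ DIM('a)) * sqint A' (\<lambda>x. norm (D x)))"
  proof (rule C1_displacement[OF assms(1)])
    show "continuous_on UNIV d" unfolding d_def by (intro continuous_intros)
    show "A \<in> sets borel" by (rule A)
    show "norm (d x) \<le> h" if "x \<in> A" for x
    proof -
      have "norm (d x) = (1 - t) * dist z x" using t by (simp add: d_def dist_norm)
      also have "\<dots> \<le> 1 * dist z x" using t by (intro mult_right_mono) auto
      finally show ?thesis using Ah[OF that] by simp
    qed
    fix s :: real assume s: "s \<in> {0..1}"
    let ?s = "1 - s * (1 - t)"
    have "s * (1 - t) \<le> 1 * (1 - t)" using s t by (intro mult_right_mono) auto
    then have s': "t \<le> ?s" "?s \<le> 1" using s t by auto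
    have "sqint A (\<lambda>x. norm (D (x + s *\<^sub>R d x))) \<le> ennreal (1 / ?s ^ DIM('a)) * sqint A' (\<lambda>x. norm (D x))"
      unfolding eq using s' t AA' A' by (intro sqint_dil) auto
    also have "\<dots> \<le> ennreal (1 / t ^ DIM('a)) * sqint A' (\<lambda>x. norm (D x))"
      using s' t by (intro mult_right_mono ennreal_leI divide_left_mono power_mono mult_pos_pos zero_less_power) auto
    finally show "sqint A (\<lambda>x. norm (D (x + s *\<^sub>R d x))) \<le> ennreal (1 / t ^ DIM('a)) * sqint A' (\<lambda>x. norm (D x))" .
  qed
  moreover have "x + d x = dil t z x" for x using eq[of x 1] by simp
  ultimately show ?thesis using t by (simp add: ennreal_mult[symmetric] mult.assoc[symmetric])
qed

lemma sqint_translate: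
  fixes f :: "'a::euclidean_space \<Rightarrow> real"
  assumes f: "f \<in> borel_measurable borel" and A': "A' \<in> sets borel" and AA': "\<And>x. x \<in> A \<Longrightarrow> x + c \<in> A'"
  shows "sqint A (\<lambda>x. f (x + c)) \<le> sqint A' f"
proof -
  have "sqint A (\<lambda>x. f (x + c)) \<le> (\<integral>\<^sup>+x. ennreal ((f (c + x))\<^sup>2) * indicator A' (c + x) \<partial>lborel)"
    unfolding sqint_def nn_integral_completion
    by (intro nn_integral_mono) (auto simp: indicator_def add.commute dest: AA')
  also have "\<dots> = (\<integral>\<^sup>+x. ennreal ((f x)\<^sup>2) * indicator A' x \<partial>distr lborel borel ((+) c))"
    using f A' by (subst nn_integral_distr) auto
  also have "\<dots> = sqint A' f"
    using lborel_distr_plus[of c] by (simp add: sqint_def nn_integral_completion)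
  finally show ?thesis .
qed

lemma C1_translation:
  fixes e :: "'a::euclidean_space"
  assumes "C1 u D" and A: "A \<in> sets borel" and A': "A' \<in> sets borel"
    and AA': "\<And>x s. x \<in> A \<Longrightarrow> 0 \<le> s \<Longrightarrow> s \<le> 1 \<Longrightarrow> x + s *\<^sub>R e \<in> A'"
  shows "sqint A (\<lambda>x. u (x + e) - u x) \<le> ennreal ((norm e)\<^sup>2) * sqint A' (\<lambda>x. norm (D x))"
proof (rule C1_displacement[OF assms(1), of "\<lambda>_. e"])
  show "sqint A (\<lambda>x. norm (D (x + s *\<^sub>R e))) \<le> sqint A' (\<lambda>x. norm (D x))" if "s \<in> {0..1}" for s
    by (rule sqint_translate) (use C1_measurable[OF assms(1)] A' AA' that in auto)
qed (use A in auto)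

text \<open>Comparing \<open>u x\<close> and \<open>u y\<close> with the value at the midpoint reduces the Poincare inequality to
  dilations with factor \<open>1/2\<close>; the constant is the value of \<open>u\<close> at a suitable point.\<close>

lemma C1_poincare:
  fixes B :: "'a::euclidean_space set"
  assumes "C1 u D" and B: "compact B" "convex B" and h: "\<And>x y. x \<in> B \<Longrightarrow> y \<in> B \<Longrightarrow> dist x y \<le> h"
    and pos: "emeasure lebesgue B > 0"
  shows "\<exists>c. sqint B (\<lambda>x. u x - c) \<le> ennreal (4 * h\<^sup>2 * 2 ^ DIM('a)) * sqint B (\<lambda>x. norm (D x))"
proof -
  have Bb[measurable]: "B \<in> sets borel" using B(1) by (simp add: compact_imp_closed)
  have [measurable]: "u \<in> borel_measurable borel" "u \<in> borel_measurable lebesgue" using C1_measurable[OF assms(1)] by auto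
  define P where "P = ennreal (h\<^sup>2 * 2 ^ DIM('a)) * sqint B (\<lambda>x. norm (D x))"
  have half: "sqint B (\<lambda>x. u (dil (1/2) y x) - u x) \<le> P" if "y \<in> B" for y
  proof -
    have "sqint B (\<lambda>x. u (dil (1/2) y x) - u x) \<le> ennreal (h\<^sup>2 / (1/2) ^ DIM('a)) * sqint B (\<lambda>x. norm (D x))"
    proof (rule C1_dilation[OF assms(1) Bb Bb])
      fix x and s :: real assume "x \<in> B" "1 / 2 \<le> s" "s \<le> 1"
      then have "(1 - s) *\<^sub>R y + s *\<^sub>R x \<in> B" using B(2) that by (intro convexD) auto
      then show "dil s y x \<in> B" by (simp add: dil_def algebra_simps)
    qed (use h that in auto)
    then show ?thesis by (simp add: P_def power_one_over)
  qed
  \<comment> \<open>Both factors \<open>indicator\<close> are inside the kernel so that it is a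
    Borel function on the product and the two variables can be exchanged.\<close>
  let ?k = "\<lambda>x y. ennreal ((u (dil (1/2) y x) - u x)\<^sup>2) * indicator B x * indicator B y"
  let ?I = "\<lambda>y. sqint B (\<lambda>x. u x - u y)"
  have mid: "dil (1/2) y x = (1/2) *\<^sub>R (x + y)" for x y :: 'a
    by (auto simp: dil_def euclidean_eq_iff[where 'a='a] inner_simps field_simps)
  have mk[measurable]: "(\<lambda>(x,y). ?k x y) \<in> borel_measurable (lborel \<Otimes>\<^sub>M lborel)"
    unfolding borel_prod[symmetric] split_beta mid by measurable
  have mk'[measurable]: "(\<lambda>(x,y). ?k y x) \<in> borel_measurable (lborel \<Otimes>\<^sub>M lborel)"
    unfolding borel_prod[symmetric] split_beta mid by measurable
  have K: "(\<integral>\<^sup>+y. (\<integral>\<^sup>+x. ?k x y \<partial>lborel) \<partial>lborel) \<le> P * emeasure lebesgue B"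
  proof -
    have "(\<integral>\<^sup>+y. (\<integral>\<^sup>+x. ?k x y \<partial>lborel) \<partial>lborel) \<le> (\<integral>\<^sup>+y. P * indicator B y \<partial>lborel)"
    proof (intro nn_integral_mono)
      fix y
      show "(\<integral>\<^sup>+x. ?k x y \<partial>lborel) \<le> P * indicator B y"
        using half[of y] by (cases "y \<in> B") (auto simp: sqint_def nn_integral_completion)
    qed
    also have "\<dots> = P * emeasure lebesgue B" by (simp add: nn_integral_cmult)
    finally show ?thesis .
  qed
  have "(\<integral>\<^sup>+y. ?I y * indicator B y \<partial>lborel) \<le>
     (\<integral>\<^sup>+y. (\<integral>\<^sup>+x. 2 * ?k x y + 2 * ?k y x \<partial>lborel) \<partial>lborel)"
  proof (intro nn_integral_mono)
    fix y
    have "?I y * indicator B y = (\<integral>\<^sup>+x. ennreal ((u x - u y)\<^sup>2) * indicator B x * indicator B y \<partial>lborel)"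
      by (simp add: sqint_def nn_integral_completion nn_integral_multc)
    also have "\<dots> \<le> (\<integral>\<^sup>+x. 2 * ?k x y + 2 * ?k y x \<partial>lborel)"
    proof (intro nn_integral_mono)
      fix x
      let ?m = "u (dil (1/2) y x)"
      have sym: "dil (1/2) x y = dil (1/2) y x" by (simp add: mid add.commute)
      have "(u x - u y)\<^sup>2 \<le> 2 * (?m - u x)\<^sup>2 + 2 * (?m - u y)\<^sup>2"
        using zero_le_power2[of "2 * ?m - u x - u y"] by (simp add: power2_eq_square algebra_simps)
      then have "ennreal ((u x - u y)\<^sup>2) \<le> ennreal (2 * (?m - u x)\<^sup>2 + 2 * (?m - u y)\<^sup>2)"
        by (rule ennreal_leI)
      also have "\<dots> = 2 * ennreal ((?m - u x)\<^sup>2) + 2 * ennreal ((?m - u y)\<^sup>2)"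
        by (simp add: ennreal_plus ennreal_mult)
      finally show "ennreal ((u x - u y)\<^sup>2) * indicator B x * indicator B y \<le> 2 * ?k x y + 2 * ?k y x"
        unfolding sym by (cases "x \<in> B \<and> y \<in> B") auto
    qed
    finally show "?I y * indicator B y \<le> (\<integral>\<^sup>+x. 2 * ?k x y + 2 * ?k y x \<partial>lborel)" .
  qed
  also have "\<dots> = 2 * (\<integral>\<^sup>+y. (\<integral>\<^sup>+x. ?k x y \<partial>lborel) \<partial>lborel) + 2 * (\<integral>\<^sup>+y. (\<integral>\<^sup>+x. ?k y x \<partial>lborel) \<partial>lborel)"
    by (simp add: nn_integral_add nn_integral_cmult)
  also have "(\<integral>\<^sup>+y. (\<integral>\<^sup>+x. ?k y x \<partial>lborel) \<partial>lborel) = (\<integral>\<^sup>+y. (\<integral>\<^sup>+x. ?k x y \<partial>lborel) \<partial>lborel)"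
    using lborel_pair.Fubini'[OF mk] by simp
  also have "2 * (\<integral>\<^sup>+y. (\<integral>\<^sup>+x. ?k x y \<partial>lborel) \<partial>lborel) + 2 * (\<integral>\<^sup>+y. (\<integral>\<^sup>+x. ?k x y \<partial>lborel) \<partial>lborel)
      \<le> 2 * (P * emeasure lebesgue B) + 2 * (P * emeasure lebesgue B)"
    by (intro add_mono mult_left_mono K) auto
  also have "\<dots> = 4 * P * emeasure lebesgue B"
    by (simp add: distrib_right[symmetric] mult.assoc[symmetric])
  finally have tot: "(\<integral>\<^sup>+y. ?I y * indicator B y \<partial>lborel) \<le> 4 * P * emeasure lebesgue B" .
  \<comment> \<open>Pigeonhole for integrals: if the bound failed at all points of \<open>B\<close>,
    the mean over \<open>B\<close>, a set of positive finite measure, would exceed it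
    strictly.\<close>
  have "\<exists>y\<in>B. ?I y \<le> 4 * P"
  proof (rule ccontr)
    assume "\<not> ?thesis"
    then have gt: "\<And>y. y \<in> B \<Longrightarrow> 4 * P < ?I y" by auto
    have fin: "4 * P * emeasure lebesgue B < \<infinity>"
    proof -
      have "emeasure lebesgue B < \<infinity>" using emeasure_compact_finite[OF B(1)] by simp
      moreover have "4 * P < \<infinity>" using gt pos
        by (metis emeasure_empty equals0I infinity_ennreal_def less_irrefl order_less_le_trans top_greatest)
      ultimately show ?thesis by (simp add: ennreal_mult_less_top)
    qed
    have mI: "(\<lambda>y. ?I y * indicator B y) \<in> borel_measurable lborel"
    proof -
      have "(\<lambda>(y,x). ennreal ((u x - u y)\<^sup>2) * indicator B x) \<in> borel_measurable (lborel \<Otimes>\<^sub>M lborel)"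
        unfolding borel_prod[symmetric] split_beta by measurable
      then have "?I \<in> borel_measurable lborel"
        unfolding sqint_def nn_integral_completion by (rule lborel.borel_measurable_nn_integral)
      then show ?thesis by measurable
    qed
    have "4 * P * emeasure lebesgue B = (\<integral>\<^sup>+y. 4 * P * indicator B y \<partial>lborel)"
      by (simp add: nn_integral_cmult)
    also have "\<dots> < (\<integral>\<^sup>+y. ?I y * indicator B y \<partial>lborel)"
    proof (rule nn_integral_less)
      show "\<not> (AE x in lborel. ?I x * indicator B x \<le> 4 * P * indicator B x)"
      proof
        assume "AE x in lborel. ?I x * indicator B x \<le> 4 * P * indicator B x"
        then have "AE x in lborel. x \<notin> B"
        proof eventually_elim
          case (elim x)
          show ?case
          proof
            assume "x \<in> B"
            then show False using elim gt[of x] by (simp add: leD)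
          qed
        qed
        then have "emeasure lborel B = 0" using Bb by (subst (asm) AE_iff_measurable[of B]) auto
        then show False using pos by (simp add: emeasure_completion)
      qed
      show "(\<integral>\<^sup>+y. 4 * P * indicator B y \<partial>lborel) \<noteq> \<infinity>"
        using fin by (simp add: nn_integral_cmult)
      show "AE x in lborel. 4 * P * indicator B x \<le> ?I x * indicator B x"
      proof (rule AE_I2)
        fix x show "4 * P * indicator B x \<le> ?I x * indicator B x"
          using gt[of x] by (cases "x \<in> B") (auto intro: less_imp_le)
      qed
    qed (use mI in auto)
    finally show False using tot by (meson leD)
  qed
  then obtain y where "?I y \<le> 4 * P" by auto
  moreover have "ennreal (4 * h\<^sup>2 * 2 ^ DIM('a)) = 4 * ennreal (h\<^sup>2 * 2 ^ DIM('a))"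
    by (subst ennreal_numeral[symmetric], subst ennreal_mult[symmetric]) (auto simp: mult.assoc)
  ultimately have "sqint B (\<lambda>x. u x - u y) \<le> ennreal (4 * h\<^sup>2 * 2 ^ DIM('a)) * sqint B (\<lambda>x. norm (D x))"
    by (simp only: P_def mult.assoc)
  then show ?thesis by blast
qed

section \<open>Mollification\<close>

text \<open>For \<open>k = 0\<close> this is the classical smooth function that is flat at the
  origin. The powers in the denominator make the family closed under differentiation up to linear
  combinations, so no explicit higher derivatives are needed.\<close>

definition flat :: "nat \<Rightarrow> real \<Rightarrow> real" where
  "flat k t = (if t \<le> 0 then 0 else exp (- 1 / t) / t ^ k)"

lemma flat_deriv: "(flat k has_real_derivative (flat (k + 2) t - real k * flat (k + 1) t)) (at t)"
proof -
  consider "t < 0" | "t > 0" | "t = 0" by linarith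
  then show ?thesis
  proof cases
    case 1
    have "((\<lambda>t. 0) has_real_derivative 0) (at t)" by simp
    then have "(flat k has_real_derivative 0) (at t)"
      by (rule has_field_derivative_transform_within_open[where S = "{..<0}"]) (use 1 in \<open>auto simp: flat_def\<close>)
    then show ?thesis using 1 by (simp add: flat_def)
  next
    case 2
    have "((\<lambda>t. exp (- 1 / t) / t ^ k) has_real_derivative
       ((exp (- 1 / t) * (1 / t\<^sup>2)) * t ^ k - exp (- 1 / t) * (real k * t ^ (k - 1))) / (t ^ k * t ^ k)) (at t)"
      using 2 by (auto intro!: derivative_eq_intros simp: power2_eq_square)
    then have "(flat k has_real_derivative
       ((exp (- 1 / t) * (1 / t\<^sup>2)) * t ^ k - exp (- 1 / t) * (real k * t ^ (k - 1))) / (t ^ k * t ^ k)) (at t)"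
      by (rule has_field_derivative_transform_within_open[where S = "{0<..}"]) (use 2 in \<open>auto simp: flat_def\<close>)
    moreover have "((exp (- 1 / t) * (1 / t\<^sup>2)) * t ^ k - exp (- 1 / t) * (real k * t ^ (k - 1))) / (t ^ k * t ^ k)
       = flat (k + 2) t - real k * flat (k + 1) t"
      using 2 by (cases k) (auto simp: flat_def field_simps power2_eq_square)
    ultimately show ?thesis by simp
  next
    case 3
    \<comment> \<open>With \<open>s = 1/t\<close> the difference quotient at the origin from the
      right becomes \<open>s ^ (k + 1) / exp s\<close>.\<close>
    have "((\<lambda>s::real. s ^ (k + 1) / exp s) \<longlongrightarrow> 0) at_top" by (rule tendsto_power_div_exp_0)
    then have "((\<lambda>t. (inverse t) ^ (k + 1) / exp (inverse t)) \<longlongrightarrow> (0::real)) (at_right 0)"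
      by (rule filterlim_compose[OF _ filterlim_inverse_at_top_right])
    then have r: "((\<lambda>t. (flat k t - flat k 0) / (t - 0)) \<longlongrightarrow> 0) (at_right 0)"
    proof (rule Lim_transform_eventually)
      show "\<forall>\<^sub>F t in at_right 0. inverse t ^ (k + 1) / exp (inverse t) = (flat k t - flat k 0) / (t - 0)"
        by (rule eventually_at_right_less[THEN eventually_mono])
           (auto simp: flat_def field_simps exp_minus)
    qed
    have l: "((\<lambda>t. (flat k t - flat k 0) / (t - 0)) \<longlongrightarrow> 0) (at_left 0)"
    proof (rule Lim_transform_eventually[OF tendsto_const])
      show "\<forall>\<^sub>F t in at_left 0. 0 = (flat k t - flat k 0) / (t - 0)"
        unfolding eventually_at_filter by (auto simp: flat_def)
    qed
    have "((\<lambda>t. (flat k t - flat k 0) / (t - 0)) \<longlongrightarrow> 0) (at 0)"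
      using l r by (rule filterlim_split_at)
    then show ?thesis using 3 by (simp add: has_field_derivative_iff flat_def)
  qed
qed

text \<open>An algebra of functions that contains radial bumps about \<open>a\<close> and is closed
  under directional derivatives. Hence every iterated derivative of a member is again
  differentiable, which is what \<open>smooth_fun\<close> demands.\<close>

inductive_set bumps :: "real \<Rightarrow> 'a::euclidean_space \<Rightarrow> ('a \<Rightarrow> real) set" for m a where
  const: "(\<lambda>x. c) \<in> bumps m a"
| inner: "(\<lambda>x. (x - a) \<bullet> b) \<in> bumps m a"
| flat: "(\<lambda>x. flat k (1 - m * ((x - a) \<bullet> (x - a)))) \<in> bumps m a"
| add: "f \<in> bumps m a \<Longrightarrow> g \<in> bumps m a \<Longrightarrow> (\<lambda>x. f x + g x) \<in> bumps m a"
| mult: "f \<in> bumps m a \<Longrightarrow> g \<in> bumps m a \<Longrightarrow> (\<lambda>x. f x * g x) \<in> bumps m a"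

lemma bumps_derivative:
  assumes "f \<in> bumps m a"
  shows "\<exists>D. (\<forall>x. (f has_derivative D x) (at x)) \<and> (\<forall>e. (\<lambda>x. D x e) \<in> bumps m a)"
  using assms
proof induction
  case (const c)
  show ?case by (rule exI[of _ "\<lambda>x e. 0"]) (auto intro: bumps.const)
next
  case (inner b)
  show ?case
    by (rule exI[of _ "\<lambda>x e. e \<bullet> b"]) (auto intro: bumps.const intro!: derivative_eq_intros)
next
  case (flat k)
  let ?q = "\<lambda>x. 1 - m * ((x - a) \<bullet> (x - a))"
  let ?D = "\<lambda>x e. (flat (k + 2) (?q x) + (- real k) * flat (k + 1) (?q x)) * ((- 2 * m) * ((x - a) \<bullet> e))"
  show ?case
  proof (intro exI[of _ ?D] conjI allI)
    fix x
    have "(?q has_derivative (\<lambda>e. (- 2 * m) * ((x - a) \<bullet> e))) (at x)"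
      by (auto intro!: derivative_eq_intros simp: inner_commute algebra_simps)
    moreover have "(flat k has_derivative (*) (flat (k + 2) (?q x) - real k * flat (k + 1) (?q x))) (at (?q x))"
      using flat_deriv[of k "?q x"] by (simp add: has_field_derivative_def)
    ultimately show "((\<lambda>x. flat k (?q x)) has_derivative ?D x) (at x)"
      using has_derivative_compose by fastforce
    show "(\<lambda>x. ?D x e) \<in> bumps m a" for e
      by (intro bumps.mult bumps.add bumps.const bumps.flat bumps.inner)
  qed
next
  case (add f g)
  then obtain D E where *: "\<And>x. (f has_derivative D x) (at x)" "\<And>e. (\<lambda>x. D x e) \<in> bumps m a"
    "\<And>x. (g has_derivative E x) (at x)" "\<And>e. (\<lambda>x. E x e) \<in> bumps m a" by blast
  show ?case
    by (rule exI[of _ "\<lambda>x e. D x e + E x e"]) (auto intro: bumps.add has_derivative_add *)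
next
  case (mult f g)
  then obtain D E where *: "\<And>x. (f has_derivative D x) (at x)" "\<And>e. (\<lambda>x. D x e) \<in> bumps m a"
    "\<And>x. (g has_derivative E x) (at x)" "\<And>e. (\<lambda>x. E x e) \<in> bumps m a" by blast
  show ?case
  proof (intro exI[of _ "\<lambda>x e. f x * E x e + D x e * g x"] conjI allI)
    show "(\<lambda>x. f x * E x e + D x e * g x) \<in> bumps m a" for e
      by (intro bumps.add bumps.mult mult.hyps *)
  qed (intro has_derivative_mult *)
qed

lemma bumps_iterd: "f \<in> bumps m a \<Longrightarrow> iterd es f \<in> bumps m a"
proof (induction es)
  case (Cons e es)
  then obtain D where D: "\<And>x. (iterd es f has_derivative D x) (at x)" "\<And>e. (\<lambda>x. D x e) \<in> bumps m a"
    using bumps_derivative by blast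
  have "frechet_derivative (iterd es f) (at x) = D x" for x
    using frechet_derivative_at[OF D(1)] by simp
  then show ?case using D(2) by simp
qed auto

lemma bumps_smooth:
  assumes "f \<in> bumps m a" shows "smooth_fun f"
  unfolding smooth_fun_def
proof
  fix es
  obtain D where "\<And>x. (iterd es f has_derivative D x) (at x)"
    using bumps_derivative[OF bumps_iterd[OF assms]] by blast
  then show "iterd es f differentiable_on UNIV"
    by (auto simp: differentiable_on_def differentiable_def)
qed

lemma smooth_C1:
  assumes "smooth_fun f" shows "C1 f (grad f)"
proof -
  have d: "f differentiable (at x)" for x
    using assms[unfolded smooth_fun_def, rule_format, of "[]"] by (simp add: differentiable_on_def)
  have fr: "(f has_derivative frechet_derivative f (at x)) (at x)" for x
    using d frechet_derivative_works by blast
  have "frechet_derivative f (at x) = (\<lambda>h. grad f x \<bullet> h)" for x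
  proof
    fix h
    interpret bounded_linear "frechet_derivative f (at x)" using fr by (rule has_derivative_bounded_linear)
    have "frechet_derivative f (at x) h = frechet_derivative f (at x) (\<Sum>i\<in>Basis. (h \<bullet> i) *\<^sub>R i)"
      by (simp add: euclidean_representation)
    also have "\<dots> = grad f x \<bullet> h"
      by (simp add: sum scaleR grad_def inner_sum_left inner_commute mult.commute inner_sum_right)
    finally show "frechet_derivative f (at x) h = grad f x \<bullet> h" .
  qed
  moreover have "continuous_on UNIV (grad f)"
  proof -
    have "(\<lambda>x. frechet_derivative f (at x) i) differentiable_on UNIV" for i
      using assms[unfolded smooth_fun_def, rule_format, of "[i]"] by simp
    then have "continuous_on UNIV (\<lambda>x. frechet_derivative f (at x) i)" for i
      by (rule differentiable_imp_continuous_on)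
    then show ?thesis unfolding grad_def by (intro continuous_intros)
  qed
  ultimately show ?thesis using fr by (simp add: C1_def)
qed

section \<open>Mollifiers\<close>

lemma C1_frechet:
  assumes "C1 u D" shows "frechet_derivative u (at x) = (\<lambda>h. D x \<bullet> h)"
  using assms frechet_derivative_at unfolding C1_def by metis

text \<open>A mollifier of radius \<open>\<epsilon>\<close> bundled with its gradient
  \<open>R\<close>. The last conjunct makes its translates admissible in the definition of a weak
  gradient as soon as the closed ball about \<open>x\<close> lies in the domain.\<close>

definition kernel :: "real \<Rightarrow> ('a::euclidean_space \<Rightarrow> real) \<Rightarrow> ('a \<Rightarrow> 'a) \<Rightarrow> bool" where
  "kernel \<epsilon> \<rho> R \<longleftrightarrow> C1 \<rho> R \<and> (\<forall>w. 0 \<le> \<rho> w) \<and> (\<forall>w. norm w \<ge> \<epsilon> \<longrightarrow> \<rho> w = 0 \<and> R w = 0) \<and>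
    (\<integral>\<^sup>+w. ennreal (\<rho> w) \<partial>lborel) = 1 \<and> (\<forall>x \<Omega>. cball x \<epsilon> \<subseteq> \<Omega> \<longrightarrow> test_fn \<Omega> (\<lambda>y. \<rho> (y - x)))"

lemma kernel_exists:
  assumes "\<epsilon> > 0" shows "\<exists>(\<rho>::'a::euclidean_space \<Rightarrow> real) R. kernel \<epsilon> \<rho> R"
proof -
  \<comment> \<open>With this scaling the argument of \<open>flat\<close> changes sign exactly on
    the sphere of radius \<open>\<epsilon>\<close>.\<close>
  define m where "m = 1 / \<epsilon>\<^sup>2"
  define K where "K w = flat 0 (1 - m * (w \<bullet> w))" for w :: 'a
  have Kb: "(\<lambda>y. c * K (y - x)) \<in> bumps m x" for x c
    unfolding K_def by (intro bumps.intros)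
  have C: "C1 K (grad K)" using smooth_C1[OF bumps_smooth[OF Kb[of 1 0]]] by simp
  have K0: "0 \<le> K w" for w by (simp add: K_def flat_def)
  have Kz: "K w = 0" if "norm w \<ge> \<epsilon>" for w
  proof -
    have "\<epsilon>\<^sup>2 \<le> (norm w)\<^sup>2" using that assms by (intro power_mono) auto
    then show ?thesis using assms by (simp add: K_def flat_def m_def power2_norm_eq_inner[symmetric] field_simps)
  qed
  have Kpos: "K w > 0" if "norm w < \<epsilon>" for w
  proof -
    have "(norm w)\<^sup>2 < \<epsilon>\<^sup>2" using that by (intro power_strict_mono) auto
    then show ?thesis using assms that by (simp add: K_def flat_def m_def power2_norm_eq_inner[symmetric] field_simps)
  qed
  have [measurable]: "K \<in> borel_measurable borel" using C1_measurable[OF C] by simp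
  have K1: "K w \<le> 1" for w by (simp add: K_def flat_def)
  define I where "I = (\<integral>\<^sup>+w. ennreal (K w) \<partial>lborel)"
  have "I \<le> (\<integral>\<^sup>+w. 1 * indicator (cball (0::'a) \<epsilon>) w \<partial>lborel)"
    unfolding I_def
  proof (intro nn_integral_mono)
    fix w :: 'a show "ennreal (K w) \<le> 1 * indicator (cball 0 \<epsilon>) w"
      using K1[of w] Kz[of w] by (auto simp: indicator_def)
  qed
  then have Ifin: "I < \<infinity>"
    using emeasure_compact_finite[of "cball (0::'a) \<epsilon>"] by (simp add: order_le_less_trans)
  have I0: "I \<noteq> 0"
  proof
    assume "I = 0"
    then have "AE w in lborel. K w = 0"
      unfolding I_def by (subst (asm) nn_integral_0_iff_AE) (use K0 in \<open>auto simp: ennreal_eq_0_iff antisym\<close>)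
    then have "AE w in lborel. w \<notin> ball (0::'a) \<epsilon>" by eventually_elim (use Kpos in force)
    then have "ball (0::'a) \<epsilon> \<in> null_sets lborel" by (subst (asm) AE_iff_null_sets[symmetric]) auto
    then have "negligible (ball (0::'a) \<epsilon>)" by (simp add: negligible_iff_null_sets null_sets_completionI)
    then show False using assms open_not_negligible[of "ball (0::'a) \<epsilon>"] by simp
  qed
  define c where "c = 1 / enn2real I"
  have eI: "enn2real I > 0" using I0 Ifin by (simp add: enn2real_positive_iff zero_less_iff_neq_zero)
  have c: "c > 0" using eI by (simp add: c_def)
  let ?\<rho> = "\<lambda>w. c * K w"
  have C\<rho>: "C1 ?\<rho> (grad ?\<rho>)" using smooth_C1[OF bumps_smooth[OF Kb[of c 0]]] by simp
  have "kernel \<epsilon> ?\<rho> (grad ?\<rho>)"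
    unfolding kernel_def
  proof (intro conjI allI impI)
    show "C1 ?\<rho> (grad ?\<rho>)" by fact
    show "0 \<le> c * K w" for w using c K0[of w] by simp
    fix w :: 'a assume w: "\<epsilon> \<le> norm w"
    show "c * K w = 0" using Kz[OF w] by simp
    \<comment> \<open>At a zero the nonnegative mollifier attains its minimum, so its gradient
      vanishes there, also on the sphere bounding the support.\<close>
    show "grad ?\<rho> w = 0"
    proof -
      have "(?\<rho> has_derivative (\<lambda>h. grad ?\<rho> w \<bullet> h)) (at w)" using C\<rho> by (simp add: C1_def)
      then have "(\<lambda>h. grad ?\<rho> w \<bullet> h) = (\<lambda>h. 0)"
        by (rule differential_zero_maxmin[of w UNIV ?\<rho>, rotated 2]) (use Kz[OF w] c K0 in auto)
      then have "grad ?\<rho> w \<bullet> grad ?\<rho> w = 0" by metis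
      then show ?thesis by simp
    qed
  next
    have "(\<integral>\<^sup>+w. ennreal (c * K w) \<partial>lborel) = ennreal c * I"
      unfolding I_def using c by (subst nn_integral_cmult[symmetric]) (auto simp: ennreal_mult K0)
    also have "\<dots> = ennreal c * ennreal (enn2real I)" using Ifin by simp
    also have "\<dots> = 1" using eI c by (simp add: ennreal_mult[symmetric] c_def)
    finally show "(\<integral>\<^sup>+w. ennreal (c * K w) \<partial>lborel) = 1" .
  next
    fix x :: 'a and \<Omega> assume sub: "cball x \<epsilon> \<subseteq> \<Omega>"
    have "{y. c * K (y - x) \<noteq> 0} \<subseteq> cball x \<epsilon>" using Kz by (force simp: dist_norm norm_minus_commute)
    then have "bounded {y. c * K (y - x) \<noteq> 0}" and cl: "closure {y. c * K (y - x) \<noteq> 0} \<subseteq> cball x \<epsilon>"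
      by (meson bounded_cball bounded_subset) (rule closure_minimal, use \<open>{y. c * K (y - x) \<noteq> 0} \<subseteq> cball x \<epsilon>\<close> in auto)
    then show "test_fn \<Omega> (\<lambda>y. c * K (y - x))"
      unfolding test_fn_def compact_closure
      by (intro conjI bumps_smooth[OF Kb] subset_trans[OF cl sub])
  qed
  then show ?thesis by blast
qed

text \<open>The argument is \<open>y - x\<close> rather than \<open>x - y\<close>, so that the
  weight is literally a translate of \<open>\<rho>\<close> in \<open>y\<close> and can serve as a
  test function. Differentiation in \<open>x\<close> then brings the minus sign seen in
  \<open>moll_C1\<close>.\<close>

definition moll :: "('a::euclidean_space \<Rightarrow> real) \<Rightarrow> ('a \<Rightarrow> real) \<Rightarrow> 'a \<Rightarrow> real" where
  "moll \<rho> f x = (LINT y|lebesgue. f y * \<rho> (y - x))"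

lemma nn_integral_reflect:
  fixes f :: "'a::euclidean_space \<Rightarrow> ennreal"
  assumes [measurable]: "f \<in> borel_measurable borel"
  shows "(\<integral>\<^sup>+x. f (x - t) \<partial>lborel) = (\<integral>\<^sup>+x. f x \<partial>lborel)"
    and "(\<integral>\<^sup>+x. f (t - x) \<partial>lborel) = (\<integral>\<^sup>+x. f x \<partial>lborel)"
proof -
  have "lborel = density (distr lborel borel (\<lambda>x. x - t)) (\<lambda>_. 1)"
    using lborel_affine[of 1 "- t"] by simp
  then have "(\<integral>\<^sup>+x. f x \<partial>lborel) = (\<integral>\<^sup>+x. f x \<partial>density (distr lborel borel (\<lambda>x. x - t)) (\<lambda>_. 1))"
    by (rule arg_cong)
  then show "(\<integral>\<^sup>+x. f (x - t) \<partial>lborel) = (\<integral>\<^sup>+x. f x \<partial>lborel)"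
    by (simp add: nn_integral_density nn_integral_distr)
  have "lborel = density (distr lborel borel (\<lambda>x. t - x)) (\<lambda>_. 1)"
    using lborel_affine[of "-1" t] by simp
  then have "(\<integral>\<^sup>+x. f x \<partial>lborel) = (\<integral>\<^sup>+x. f x \<partial>density (distr lborel borel (\<lambda>x. t - x)) (\<lambda>_. 1))"
    by (rule arg_cong)
  then show "(\<integral>\<^sup>+x. f (t - x) \<partial>lborel) = (\<integral>\<^sup>+x. f x \<partial>lborel)"
    by (simp add: nn_integral_density nn_integral_distr)
qed

text \<open>Continuity is uniform on a ball slightly larger than the support. If one of two points
  at distance below 1 leaves that ball, both lie outside the support and both gradients
  vanish.\<close>

lemma kernel_uniform:
  fixes R :: "'a::euclidean_space \<Rightarrow> 'a"
  assumes k: "kernel \<epsilon> \<rho> R" and "\<eta> > 0"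
  shows "\<exists>\<delta>>0. \<forall>v w. dist v w < \<delta> \<longrightarrow> norm (R v - R w) \<le> \<eta>"
proof -
  have "uniformly_continuous_on (cball 0 (\<epsilon> + 1)) R"
    by (rule compact_uniformly_continuous)
       (use k in \<open>auto simp: kernel_def C1_def intro: continuous_on_subset\<close>)
  then obtain \<delta> where \<delta>: "\<delta> > 0" "\<And>v w. v \<in> cball 0 (\<epsilon> + 1) \<Longrightarrow> w \<in> cball 0 (\<epsilon> + 1) \<Longrightarrow> dist v w < \<delta> \<Longrightarrow> dist (R v) (R w) < \<eta>"
    using \<open>\<eta> > 0\<close> unfolding uniformly_continuous_on_def by (metis dist_commute)
  have "norm (R v - R w) \<le> \<eta>" if vw: "dist v w < min \<delta> 1" for v w
  proof (cases "v \<in> cball 0 (\<epsilon> + 1) \<and> w \<in> cball 0 (\<epsilon> + 1)")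
    case True then show ?thesis using \<delta>(2)[of v w] vw by (simp add: dist_norm)
  next
    case False
    have "norm v \<le> norm w + dist v w" "norm w \<le> norm v + dist v w"
      by (metis dist_norm norm_triangle_sub) (metis dist_commute dist_norm norm_triangle_sub)
    then have "\<epsilon> \<le> norm v" "\<epsilon> \<le> norm w" using False vw by auto
    then have "R v = 0" "R w = 0" using k by (auto simp: kernel_def)
    then show ?thesis using \<open>\<eta> > 0\<close> by simp
  qed
  then show ?thesis using \<delta>(1) by (intro exI[of _ "min \<delta> 1"]) auto
qed

lemma kernel_bounded:
  fixes R :: "'a::euclidean_space \<Rightarrow> 'a"
  assumes k: "kernel \<epsilon> \<rho> R"
  shows "\<exists>M. \<forall>w. \<bar>\<rho> w\<bar> \<le> M \<and> norm (R w) \<le> M"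
proof -
  have c: "continuous_on (cball 0 \<epsilon>) \<rho>" "continuous_on (cball 0 \<epsilon>) R"
    using k C1_continuous[of \<rho> R] by (auto simp: kernel_def C1_def intro: continuous_on_subset)
  obtain M1 where M1: "\<forall>w\<in>cball 0 \<epsilon>. norm (\<rho> w) \<le> M1"
    using compact_imp_bounded[OF compact_continuous_image[OF c(1) compact_cball]] by (auto simp: bounded_iff simp del: mem_cball_0)
  obtain M2 where M2: "\<forall>w\<in>cball 0 \<epsilon>. norm (R w) \<le> M2"
    using compact_imp_bounded[OF compact_continuous_image[OF c(2) compact_cball]] by (auto simp: bounded_iff simp del: mem_cball_0)
  have "\<bar>\<rho> w\<bar> \<le> max (max M1 M2) 0 \<and> norm (R w) \<le> max (max M1 M2) 0" for w
  proof (cases "w \<in> cball 0 \<epsilon>")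
    case True then show ?thesis using bspec[OF M1 True] bspec[OF M2 True] by auto
  next
    case False
    then have "\<rho> w = 0" "R w = 0" using k by (auto simp: kernel_def)
    then show ?thesis by simp
  qed
  then show ?thesis by blast
qed

lemma kernel_measurable:
  assumes "kernel \<epsilon> \<rho> R"
  shows "\<rho> \<in> borel_measurable borel" "R \<in> borel_measurable borel"
    "(\<lambda>y. \<rho> (y - x)) \<in> borel_measurable lebesgue" "(\<lambda>y. R (y - x)) \<in> borel_measurable lebesgue"
proof -
  show [measurable]: "\<rho> \<in> borel_measurable borel" "R \<in> borel_measurable borel"
    using assms C1_measurable[of \<rho> R] by (auto simp: kernel_def)
  have "(\<lambda>y. \<rho> (y - x)) \<in> borel_measurable borel" "(\<lambda>y. R (y - x)) \<in> borel_measurable borel"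
    by measurable
  then show "(\<lambda>y. \<rho> (y - x)) \<in> borel_measurable lebesgue" "(\<lambda>y. R (y - x)) \<in> borel_measurable lebesgue"
    by (auto intro: measurable_completion)
qed

lemma moll_integrable:
  fixes f :: "'a::euclidean_space \<Rightarrow> real"
  assumes f: "integrable lebesgue f" and k: "kernel \<epsilon> \<rho> R"
  shows "integrable lebesgue (\<lambda>y. f y * \<rho> (y - x))" "integrable lebesgue (\<lambda>y. f y *\<^sub>R R (y - x))"
proof -
  obtain M where M: "\<And>w. \<bar>\<rho> w\<bar> \<le> M" "\<And>w. norm (R w) \<le> M" using kernel_bounded[OF k] by blast
  have M0: "0 \<le> M" using M(1)[of 0] by linarith
  have [measurable]: "f \<in> borel_measurable lebesgue" "(\<lambda>y. \<rho> (y - x)) \<in> borel_measurable lebesgue"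
    "(\<lambda>y. R (y - x)) \<in> borel_measurable lebesgue" using f kernel_measurable[OF k] by auto
  have i: "integrable lebesgue (\<lambda>y. M * f y)" using f by simp
  show "integrable lebesgue (\<lambda>y. f y * \<rho> (y - x))"
    by (rule Bochner_Integration.integrable_bound[OF i])
       (use M0 M(1) in \<open>auto simp: abs_mult intro!: mult_mono simp: mult.commute[of "\<bar>f _\<bar>"]\<close>)
  show "integrable lebesgue (\<lambda>y. f y *\<^sub>R R (y - x))"
    by (rule Bochner_Integration.integrable_bound[OF i])
       (use M0 M(2) in \<open>auto simp: abs_mult intro!: mult_mono simp: mult.commute[of "\<bar>f _\<bar>"]\<close>)
qed

text \<open>The mean value inequality for \<open>\<rho>\<close> minus its linear part at
  \<open>w\<close>. The bound does not depend on \<open>w\<close>, so it can be integrated against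
  \<open>f\<close> when differentiating under the integral.\<close>

lemma C1_remainder:
  assumes "C1 \<rho> R" and R: "\<And>v w. dist v w < \<delta> \<Longrightarrow> norm (R v - R w) \<le> \<eta>" and h: "norm h < \<delta>"
  shows "\<bar>\<rho> (w + h) - \<rho> w - R w \<bullet> h\<bar> \<le> \<eta> * norm h"
proof -
  let ?f = "\<lambda>v. \<rho> v - R w \<bullet> v"
  have "norm (?f (w + h) - ?f w) \<le> \<eta> * norm (w + h - w)"
  proof (rule differentiable_bound[of "ball w \<delta>" ?f "\<lambda>v k. (R v - R w) \<bullet> k"])
    fix v assume "v \<in> ball w \<delta>"
    have "(\<rho> has_derivative (\<lambda>k. R v \<bullet> k)) (at v)" using assms(1) by (simp add: C1_def)
    then have "(?f has_derivative (\<lambda>k. R v \<bullet> k - R w \<bullet> k)) (at v)"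
      by (auto intro!: derivative_eq_intros)
    then show "(?f has_derivative (\<lambda>k. (R v - R w) \<bullet> k)) (at v within ball w \<delta>)"
      by (simp add: inner_diff_left has_derivative_at_withinI)
    show "onorm (\<lambda>k. (R v - R w) \<bullet> k) \<le> \<eta>"
    proof (rule onorm_le)
      fix k
      have "norm ((R v - R w) \<bullet> k) \<le> norm (R v - R w) * norm k" by (simp add: Cauchy_Schwarz_ineq2)
      also have "\<dots> \<le> \<eta> * norm k" using R[of v w] \<open>v \<in> ball w \<delta>\<close>
        by (intro mult_right_mono) (auto simp: dist_commute)
      finally show "norm ((R v - R w) \<bullet> k) \<le> \<eta> * norm k" .
    qed
  next
    show "w + h \<in> ball w \<delta>" using h by (simp add: dist_norm)
    show "w \<in> ball w \<delta>" using h by (metis centre_in_ball le_less_trans norm_ge_zero)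
  qed simp
  then show ?thesis by (simp add: inner_add_right algebra_simps)
qed

lemma moll_C1:
  fixes f :: "'a::euclidean_space \<Rightarrow> real"
  assumes f: "integrable lebesgue f" and k: "kernel \<epsilon> \<rho> R"
  shows "C1 (moll \<rho> f) (\<lambda>x. - (LINT y|lebesgue. f y *\<^sub>R R (y - x)))" (is "C1 _ ?D")
proof -
  define I where "I = (LINT y|lebesgue. \<bar>f y\<bar>)"
  have I0: "0 \<le> I" unfolding I_def by simp
  have CR: "C1 \<rho> R" using k by (simp add: kernel_def)
  note ints = moll_integrable[OF f k]
  \<comment> \<open>The tolerance is divided by the L1 norm of \<open>f\<close>; the added 1 covers
    the case of norm zero.\<close>
  have small: "\<exists>\<delta>>0. \<forall>v w. dist v w < \<delta> \<longrightarrow> norm (R v - R w) \<le> e / (I + 1)" if "e > 0" for e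
    using kernel_uniform[OF k, of "e / (I + 1)"] that I0 by auto
  have bd: "norm (LINT y|lebesgue. g y) \<le> c * I"
    if "integrable lebesgue g" "\<And>y. norm (g y) \<le> c * \<bar>f y\<bar>" for g :: "'a \<Rightarrow> 'b::{banach,second_countable_topology}" and c
  proof -
    have "norm (LINT y|lebesgue. g y) \<le> (LINT y|lebesgue. norm (g y))" by (rule integral_norm_bound)
    also have "\<dots> \<le> (LINT y|lebesgue. c * \<bar>f y\<bar>)"
      using that f by (intro integral_mono) auto
    finally show ?thesis by (simp add: I_def)
  qed
  show ?thesis unfolding C1_def
  proof (intro conjI allI)
    fix x
    show "(moll \<rho> f has_derivative (\<lambda>h. ?D x \<bullet> h)) (at x)"
      unfolding has_derivative_at_alt
    proof (intro conjI allI impI)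
      show "bounded_linear (\<lambda>h. ?D x \<bullet> h)" by (rule bounded_linear_inner_right)
      fix e :: real assume e: "e > 0"
      obtain \<delta> where \<delta>: "\<delta> > 0" "\<And>v w. dist v w < \<delta> \<Longrightarrow> norm (R v - R w) \<le> e / (I + 1)" using small[OF e] by blast
      show "\<exists>d>0. \<forall>y. norm (y - x) < d \<longrightarrow> norm (moll \<rho> f y - moll \<rho> f x - ?D x \<bullet> (y - x)) \<le> e * norm (y - x)"
      proof (intro exI[of _ \<delta>] conjI allI impI \<delta>(1))
        fix x' assume x': "norm (x' - x) < \<delta>"
        let ?g = "\<lambda>y. f y * \<rho> (y - x') - f y * \<rho> (y - x) + (f y *\<^sub>R R (y - x)) \<bullet> (x' - x)"
        have ig: "integrable lebesgue ?g" using ints by (intro Bochner_Integration.integrable_add Bochner_Integration.integrable_diff integrable_inner_left) auto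
        have "moll \<rho> f x' - moll \<rho> f x - ?D x \<bullet> (x' - x) = (LINT y|lebesgue. ?g y)"
          using ints by (simp add: moll_def integral_inner_left del: inner_scaleR_left)
        also have "norm \<dots> \<le> (e / (I + 1) * norm (x' - x)) * I"
        proof (rule bd[OF ig])
          fix y
          have "\<bar>\<rho> ((y - x) + (x - x')) - \<rho> (y - x) - R (y - x) \<bullet> (x - x')\<bar> \<le> e / (I + 1) * norm (x - x')"
            using x' by (intro C1_remainder[OF CR \<delta>(2)]) (auto simp: norm_minus_commute)
          then have "\<bar>f y\<bar> * \<bar>\<rho> (y - x') - \<rho> (y - x) - R (y - x) \<bullet> (x - x')\<bar> \<le> \<bar>f y\<bar> * (e / (I + 1) * norm (x - x'))"
            by (intro mult_left_mono) auto
          moreover have "?g y = f y * (\<rho> (y - x') - \<rho> (y - x) - R (y - x) \<bullet> (x - x'))"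
            by (simp add: algebra_simps inner_simps)
          ultimately show "norm (?g y) \<le> e / (I + 1) * norm (x' - x) * \<bar>f y\<bar>"
            by (simp add: abs_mult norm_minus_commute mult.commute)
        qed
        also have "\<dots> \<le> e * norm (x' - x)"
        proof -
          have "e / (I + 1) * I \<le> e" using I0 e by (simp add: field_simps)
          then have "(e / (I + 1) * I) * norm (x' - x) \<le> e * norm (x' - x)" by (intro mult_right_mono) auto
          then show ?thesis by (simp add: mult_ac)
        qed
        finally show "norm (moll \<rho> f x' - moll \<rho> f x - ?D x \<bullet> (x' - x)) \<le> e * norm (x' - x)" .
      qed
    qed
  next
    show "continuous_on UNIV ?D"
      unfolding continuous_on_iff
    proof (intro ballI allI impI)
      fix x and e :: real assume e: "e > 0"
      obtain \<delta> where \<delta>: "\<delta> > 0" "\<And>v w. dist v w < \<delta> \<Longrightarrow> norm (R v - R w) \<le> e / (I + 1)" using small[OF e] by blast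
      show "\<exists>d>0. \<forall>x'\<in>UNIV. dist x' x < d \<longrightarrow> dist (?D x') (?D x) < e"
      proof (intro exI[of _ \<delta>] conjI ballI impI \<delta>(1))
        fix x' assume x': "dist x' x < \<delta>"
        have "dist (?D x') (?D x) = norm (LINT y|lebesgue. f y *\<^sub>R R (y - x') - f y *\<^sub>R R (y - x))"
          using ints by (simp add: dist_norm norm_minus_commute)
        also have "\<dots> \<le> (e / (I + 1)) * I"
        proof (rule bd)
          show "integrable lebesgue (\<lambda>y. f y *\<^sub>R R (y - x') - f y *\<^sub>R R (y - x))" using ints by auto
          fix y
          have "norm (R (y - x') - R (y - x)) \<le> e / (I + 1)"
            by (rule \<delta>(2)) (use x' in \<open>simp add: dist_norm norm_minus_commute\<close>)
          then have "\<bar>f y\<bar> * norm (R (y - x') - R (y - x)) \<le> \<bar>f y\<bar> * (e / (I + 1))" by (rule mult_left_mono) simp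
          moreover have "norm (f y *\<^sub>R R (y - x') - f y *\<^sub>R R (y - x)) = \<bar>f y\<bar> * norm (R (y - x') - R (y - x))"
            by (simp add: scaleR_diff_right[symmetric])
          ultimately show "norm (f y *\<^sub>R R (y - x') - f y *\<^sub>R R (y - x)) \<le> e / (I + 1) * \<bar>f y\<bar>"
            by (simp add: mult.commute)
        qed
        also have "\<dots> < e" using I0 e by (simp add: field_simps)
        finally show "dist (?D x') (?D x) < e" .
      qed
    qed
  qed
qed

text \<open>Mollification commutes with the weak derivative at points whose ball of radius
  \<open>\<epsilon>\<close> stays in the domain: there the translated mollifier is a test function,
  and its gradient is moved onto \<open>u\<close>.\<close>

lemma moll_gradient:
  fixes u :: "'a::euclidean_space \<Rightarrow> real"
  assumes wg: "has_weak_grad \<Omega> u G" and k: "kernel \<epsilon> \<rho> R" and \<Omega>: "\<Omega> \<in> sets lebesgue"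
    and u: "integrable lebesgue u"
    and z: "\<And>x. x \<notin> \<Omega> \<Longrightarrow> u x = 0" "\<And>x. x \<notin> \<Omega> \<Longrightarrow> G x = 0" and x: "cball x \<epsilon> \<subseteq> \<Omega>" and i: "i \<in> Basis"
  shows "(- (LINT y|lebesgue. u y *\<^sub>R R (y - x))) \<bullet> i = moll \<rho> (\<lambda>y. G y \<bullet> i) x"
proof -
  let ?\<phi> = "\<lambda>y. \<rho> (y - x)"
  have "C1 ?\<phi> (\<lambda>y. R (y - x))"
  proof -
    have "(\<rho> has_derivative (\<lambda>h. R w \<bullet> h)) (at w)" for w using k by (simp add: kernel_def C1_def)
    then have "(?\<phi> has_derivative (\<lambda>h. R (y - x) \<bullet> h)) (at y)" for y
      by (rule has_derivative_compose[rotated]) (auto intro!: derivative_eq_intros)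
    moreover have "continuous_on UNIV (\<lambda>y. R (y - x))"
      using k by (auto simp: kernel_def C1_def intro!: continuous_on_compose2[of UNIV R] continuous_intros)
    ultimately show ?thesis by (simp add: C1_def)
  qed
  then have fd: "frechet_derivative ?\<phi> (at y) i = R (y - x) \<bullet> i" for y by (simp add: C1_frechet)
  have "test_fn \<Omega> ?\<phi>" using k x by (simp add: kernel_def)
  then have "integral\<^sup>L (lebesgue_on \<Omega>) (\<lambda>y. u y * frechet_derivative ?\<phi> (at y) i) = - integral\<^sup>L (lebesgue_on \<Omega>) (\<lambda>y. (G y \<bullet> i) * \<rho> (y - x))"
    using wg i unfolding has_weak_grad_def by blast
  then have "integral\<^sup>L (lebesgue_on \<Omega>) (\<lambda>y. u y * (R (y - x) \<bullet> i)) = - integral\<^sup>L (lebesgue_on \<Omega>) (\<lambda>y. (G y \<bullet> i) * \<rho> (y - x))"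
    by (simp add: fd)
  moreover have "integral\<^sup>L (lebesgue_on \<Omega>) (\<lambda>y. u y * (R (y - x) \<bullet> i)) = (LINT y|lebesgue. u y * (R (y - x) \<bullet> i))"
    using \<Omega> z(1) by (subst integral_restrict_space) (auto simp: indicator_def intro!: Bochner_Integration.integral_cong)
  moreover have "integral\<^sup>L (lebesgue_on \<Omega>) (\<lambda>y. (G y \<bullet> i) * \<rho> (y - x)) = (LINT y|lebesgue. (G y \<bullet> i) * \<rho> (y - x))"
    using \<Omega> z(2) by (subst integral_restrict_space) (auto simp: indicator_def intro!: Bochner_Integration.integral_cong)
  moreover have "(LINT y|lebesgue. u y *\<^sub>R R (y - x)) \<bullet> i = (LINT y|lebesgue. u y * (R (y - x) \<bullet> i))"
    using moll_integrable(2)[OF u k, of x] by (simp add: integral_inner_left[symmetric])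
  ultimately show ?thesis by (simp add: moll_def)
qed

text \<open>Writing the weight as the product of two square roots, Cauchy-Schwarz with respect to a
  weight of mass 1 bounds the squared mean by the mean of the squares; Tonelli then integrates the
  weight out in \<open>x\<close>.\<close>

lemma moll_sqint:
  fixes f :: "'a::euclidean_space \<Rightarrow> real"
  assumes f: "f \<in> borel_measurable lebesgue" and k: "kernel \<epsilon> \<rho> R"
  shows "sqint UNIV (moll \<rho> f) \<le> sqint UNIV f"
proof -
  \<comment> \<open>A Borel representative is needed because Tonelli is applied on the product of
    Borel measures.\<close>
  obtain g where g[measurable]: "g \<in> borel_measurable borel" and ae: "AE x in lborel. f x = g x"
    using completion_ex_borel_measurable_real[OF f] by auto
  have ae': "AE x in lebesgue. f x = g x" using ae by (rule AE_completion)
  have [measurable]: "\<rho> \<in> borel_measurable borel" using kernel_measurable[OF k] by simp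
  have r0: "0 \<le> \<rho> w" for w using k by (simp add: kernel_def)
  have r1: "(\<integral>\<^sup>+w. ennreal (\<rho> w) \<partial>lborel) = 1" using k by (simp add: kernel_def)
  have pt: "ennreal ((moll \<rho> f x)\<^sup>2) \<le> (\<integral>\<^sup>+y. ennreal ((g y)\<^sup>2 * \<rho> (y - x)) \<partial>lborel)" for x
  proof -
    have [measurable]: "(\<lambda>y. g y * \<rho> (y - x)) \<in> borel_measurable borel" by measurable
    have "moll \<rho> f x = (LINT y|lebesgue. g y * \<rho> (y - x))"
      unfolding moll_def using f g kernel_measurable(3)[OF k, of x] ae'
      by (intro integral_cong_AE) (auto intro: measurable_completion)
    also have "\<dots> = (LINT y|lborel. g y * \<rho> (y - x))"
      by (rule integral_completion) simp
    finally have "ennreal \<bar>moll \<rho> f x\<bar> \<le> (\<integral>\<^sup>+y. ennreal \<bar>g y * \<rho> (y - x)\<bar> \<partial>lborel)"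
      using integral_norm_bound_ennreal[of lborel "\<lambda>y. g y * \<rho> (y - x)"]
      by (cases "integrable lborel (\<lambda>y. g y * \<rho> (y - x))") (auto simp: not_integrable_integral_eq)
    also have "\<dots> = (\<integral>\<^sup>+y. ennreal (\<bar>g y\<bar> * sqrt (\<rho> (y - x))) * ennreal (sqrt (\<rho> (y - x))) \<partial>lborel)"
      using r0 by (intro nn_integral_cong) (simp add: ennreal_mult[symmetric] abs_mult mult.assoc)
    finally have "(ennreal \<bar>moll \<rho> f x\<bar>)\<^sup>2 \<le>
        (\<integral>\<^sup>+y. ennreal (\<bar>g y\<bar> * sqrt (\<rho> (y - x))) * ennreal (sqrt (\<rho> (y - x))) \<partial>lborel)\<^sup>2"
      by (rule power_mono) simp
    also have "\<dots> \<le> (\<integral>\<^sup>+y. (ennreal (\<bar>g y\<bar> * sqrt (\<rho> (y - x))))\<^sup>2 \<partial>lborel) * (\<integral>\<^sup>+y. (ennreal (sqrt (\<rho> (y - x))))\<^sup>2 \<partial>lborel)"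
      by (rule Cauchy_Schwarz_nn_integral) measurable
    also have "(\<integral>\<^sup>+y. (ennreal (sqrt (\<rho> (y - x))))\<^sup>2 \<partial>lborel) = 1"
      using r1 nn_integral_reflect(1)[of "\<lambda>y. ennreal (\<rho> y)" x] r0 by (simp add: ennreal_power)
    also have "(\<integral>\<^sup>+y. (ennreal (\<bar>g y\<bar> * sqrt (\<rho> (y - x))))\<^sup>2 \<partial>lborel) = (\<integral>\<^sup>+y. ennreal ((g y)\<^sup>2 * \<rho> (y - x)) \<partial>lborel)"
      using r0 by (simp add: ennreal_power power_mult_distrib)
    finally show ?thesis by (simp add: ennreal_power)
  qed
  have m: "(\<lambda>(x,y). ennreal ((g y)\<^sup>2 * \<rho> (y - x))) \<in> borel_measurable (lborel \<Otimes>\<^sub>M lborel)"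
    unfolding split_beta by measurable
  have "sqint UNIV (moll \<rho> f) \<le> (\<integral>\<^sup>+x. (\<integral>\<^sup>+y. ennreal ((g y)\<^sup>2 * \<rho> (y - x)) \<partial>lborel) \<partial>lborel)"
    unfolding sqint_def nn_integral_completion by (intro nn_integral_mono) (simp add: pt)
  also have "\<dots> = (\<integral>\<^sup>+y. (\<integral>\<^sup>+x. ennreal ((g y)\<^sup>2 * \<rho> (y - x)) \<partial>lborel) \<partial>lborel)"
    using lborel_pair.Fubini'[OF m] by simp
  also have "\<dots> = (\<integral>\<^sup>+y. ennreal ((g y)\<^sup>2) \<partial>lborel)"
  proof (intro nn_integral_cong)
    fix y
    have "(\<integral>\<^sup>+x. ennreal ((g y)\<^sup>2 * \<rho> (y - x)) \<partial>lborel) = (\<integral>\<^sup>+x. ennreal ((g y)\<^sup>2) * ennreal (\<rho> (y - x)) \<partial>lborel)"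
      using r0 by (simp add: ennreal_mult)
    also have "\<dots> = ennreal ((g y)\<^sup>2) * (\<integral>\<^sup>+x. ennreal (\<rho> (y - x)) \<partial>lborel)"
      by (rule nn_integral_cmult) measurable
    also have "(\<integral>\<^sup>+x. ennreal (\<rho> (y - x)) \<partial>lborel) = 1"
      using r1 nn_integral_reflect(2)[of "\<lambda>y. ennreal (\<rho> y)" y] by simp
    finally show "(\<integral>\<^sup>+x. ennreal ((g y)\<^sup>2 * \<rho> (y - x)) \<partial>lborel) = ennreal ((g y)\<^sup>2)" by simp
  qed
  also have "\<dots> = (\<integral>\<^sup>+y. ennreal ((f y)\<^sup>2) \<partial>lborel)"
    using ae by (intro nn_integral_cong_AE) auto
  also have "\<dots> = sqint UNIV f" by (simp add: sqint_def nn_integral_completion)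
  finally show ?thesis .
qed

section \<open>Mean square convergence of mollifications\<close>

lemma L2_bounded_support_integrable:
  fixes f :: "'a::euclidean_space \<Rightarrow> real"
  assumes f: "f \<in> borel_measurable lebesgue" and fin: "sqint UNIV f < \<infinity>" and z: "\<And>x. x \<notin> cball 0 r \<Longrightarrow> f x = 0"
  shows "integrable lebesgue f"
proof (rule integrableI_bounded[OF f])
  have "(\<integral>\<^sup>+x. ennreal (norm (f x)) \<partial>lebesgue) \<le> (\<integral>\<^sup>+x. (indicator (cball 0 r) x + ennreal ((f x)\<^sup>2)) \<partial>lebesgue)"
  proof (intro nn_integral_mono)
    fix x
    have "\<bar>f x\<bar> \<le> 1 + (f x)\<^sup>2" using zero_le_power2[of "\<bar>f x\<bar> - 1"] by (simp add: power2_diff)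
    then have "ennreal \<bar>f x\<bar> \<le> ennreal (1 + (f x)\<^sup>2)" by (rule ennreal_leI)
    then have "ennreal \<bar>f x\<bar> \<le> 1 + ennreal ((f x)\<^sup>2)" by (simp add: ennreal_plus)
    then show "ennreal (norm (f x)) \<le> indicator (cball 0 r) x + ennreal ((f x)\<^sup>2)"
      using z[of x] by (cases "x \<in> cball 0 r") auto
  qed
  also have "\<dots> = emeasure lebesgue (cball (0::'a) r) + sqint UNIV f"
  proof -
    have "(indicator (cball 0 r) :: 'a \<Rightarrow> ennreal) \<in> borel_measurable lebesgue"
      by (rule borel_measurable_indicator) simp
    then show ?thesis using f by (subst nn_integral_add) (auto simp: sqint_def)
  qed
  also have "\<dots> < \<infinity>" using fin emeasure_compact_finite[of "cball (0::'a) r"] by (simp add: ennreal_add_less_top)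
  finally show "(\<integral>\<^sup>+x. ennreal (norm (f x)) \<partial>lebesgue) < \<infinity>" .
qed

lemma L2_truncation:
  fixes f :: "'a::euclidean_space \<Rightarrow> real"
  assumes f[measurable]: "f \<in> borel_measurable lebesgue" and fin: "sqint UNIV f < \<infinity>" and "\<delta> > 0"
  shows "\<exists>k::nat. sqint UNIV (\<lambda>x. f x - max (- real k) (min (real k) (f x))) < ennreal \<delta>"
proof -
  let ?t = "\<lambda>k x. max (- real k) (min (real k) (f x))"
  have "(\<lambda>k. \<integral>\<^sup>+x. ennreal ((f x - ?t k x)\<^sup>2) \<partial>lebesgue) \<longlonglongrightarrow> (\<integral>\<^sup>+x. 0 \<partial>(lebesgue :: 'a measure))"
  proof (rule nn_integral_dominated_convergence[where w = "\<lambda>x. ennreal ((f x)\<^sup>2)"])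
    show "(\<integral>\<^sup>+x. ennreal ((f x)\<^sup>2) \<partial>lebesgue) < \<infinity>" using fin by (simp add: sqint_def)
    show "AE x in lebesgue. ennreal ((f x - ?t k x)\<^sup>2) \<le> ennreal ((f x)\<^sup>2)" for k
      by (intro AE_I2 ennreal_leI) (auto simp: abs_le_square_iff[symmetric])
    show "AE x in lebesgue. (\<lambda>k. ennreal ((f x - ?t k x)\<^sup>2)) \<longlonglongrightarrow> 0"
    proof (rule AE_I2)
      fix x
      obtain n :: nat where n: "\<bar>f x\<bar> \<le> real n" using real_arch_simple by blast
      have "\<forall>\<^sub>F k in sequentially. 0 = ennreal ((f x - ?t k x)\<^sup>2)"
        using eventually_ge_at_top[of n] by eventually_elim (use n in auto)
      then show "(\<lambda>k. ennreal ((f x - ?t k x)\<^sup>2)) \<longlonglongrightarrow> 0" by (rule Lim_transform_eventually[OF tendsto_const])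
    qed
  qed auto
  then have "\<forall>\<^sub>F k in sequentially. (\<integral>\<^sup>+x. ennreal ((f x - ?t k x)\<^sup>2) \<partial>lebesgue) < ennreal \<delta>"
    using \<open>\<delta> > 0\<close> by (auto simp: order_tendsto_iff)
  then show ?thesis by (auto simp: sqint_def eventually_sequentially)
qed

text \<open>A bounded truncation of \<open>f\<close> is an almost everywhere limit of continuous
  functions. Clipping these at the same height and multiplying by a cutoff makes them dominated by a
  constant on a ball, so dominated convergence turns the pointwise limit into a mean square
  limit.\<close>

lemma L2_dense_continuous:
  fixes f :: "'a::euclidean_space \<Rightarrow> real"
  assumes f[measurable]: "f \<in> borel_measurable lebesgue" and fin: "sqint UNIV f < \<infinity>"
    and z: "\<And>x. x \<notin> cball 0 r \<Longrightarrow> f x = 0" and "\<delta> > 0"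
  shows "\<exists>g. continuous_on UNIV g \<and> (\<forall>x. x \<notin> cball 0 (r + 1) \<longrightarrow> g x = 0) \<and> sqint UNIV (\<lambda>x. f x - g x) \<le> ennreal \<delta>"
proof -
  obtain k :: nat where k: "sqint UNIV (\<lambda>x. f x - max (- real k) (min (real k) (f x))) < ennreal (\<delta> / 4)"
    using L2_truncation[OF f fin, of "\<delta> / 4"] \<open>\<delta> > 0\<close> by auto
  define t where "t s = max (- real k) (min (real k) s)" for s :: real
  define F where "F x = t (f x)" for x
  have F[measurable]: "F \<in> borel_measurable lebesgue" unfolding F_def t_def by measurable
  obtain N g where N: "negligible N" and g: "\<And>n. continuous_on UNIV (g n)" and lim: "\<And>x. x \<notin> N \<Longrightarrow> (\<lambda>n. g n x) \<longlonglongrightarrow> F x"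
    using lebesgue_measurable_imp_measurable_on_real[OF F, of UNIV] unfolding measurable_on_def by auto
  define cut where "cut x = max 0 (min 1 (r + 1 - norm x))" for x :: 'a
  define h where "h n x = cut x * t (g n x)" for n x
  have hc: "continuous_on UNIV (h n)" for n
    unfolding h_def cut_def t_def by (intro continuous_intros g)
  have t_bd: "\<bar>t s\<bar> \<le> real k" for s by (auto simp: t_def)
  have cut_bd: "0 \<le> cut x" "cut x \<le> 1" for x by (auto simp: cut_def)
  have hm[measurable]: "h n \<in> borel_measurable lebesgue" for n
    using borel_measurable_continuous_onI[OF hc] by (auto intro: measurable_completion)
  have h0: "h n x = 0" if "x \<notin> cball 0 (r + 1)" for n x using that by (auto simp: h_def cut_def)
  have F0: "F x = 0" if "x \<notin> cball 0 r" for x using z[OF that] by (auto simp: F_def t_def)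
  have Fcut: "cut x * F x = F x" for x using F0[of x] by (cases "x \<in> cball 0 r") (auto simp: cut_def)
  have "(\<lambda>n. \<integral>\<^sup>+x. ennreal ((F x - h n x)\<^sup>2) \<partial>lebesgue) \<longlonglongrightarrow> (\<integral>\<^sup>+x. 0 \<partial>(lebesgue :: 'a measure))"
  proof (rule nn_integral_dominated_convergence[where w = "\<lambda>x. ennreal ((2 * real k)\<^sup>2) * indicator (cball 0 (r + 1)) x"])
    show "(\<lambda>x::'a. ennreal ((2 * real k)\<^sup>2) * indicator (cball 0 (r + 1)) x) \<in> borel_measurable lebesgue"
      by (rule borel_measurable_times_ennreal[OF borel_measurable_const borel_measurable_indicator]) simp
    show "(\<integral>\<^sup>+x. ennreal ((2 * real k)\<^sup>2) * indicator (cball (0::'a) (r + 1)) x \<partial>lebesgue) < \<infinity>"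
      using emeasure_compact_finite[of "cball (0::'a) (r + 1)"]
      by (subst nn_integral_cmult_indicator) (auto simp: ennreal_mult_less_top)
    show "AE x in lebesgue. ennreal ((F x - h n x)\<^sup>2) \<le> ennreal ((2 * real k)\<^sup>2) * indicator (cball 0 (r + 1)) x" for n
    proof (rule AE_I2)
      fix x
      have "\<bar>h n x\<bar> \<le> 1 * real k" unfolding h_def abs_mult using t_bd cut_bd[of x] by (intro mult_mono) auto
      then have "\<bar>F x - h n x\<bar> \<le> 2 * real k" using t_bd[of "f x"] unfolding F_def by linarith
      then have "(F x - h n x)\<^sup>2 \<le> (2 * real k)\<^sup>2" by (metis abs_ge_zero power2_abs power_mono)
      then show "ennreal ((F x - h n x)\<^sup>2) \<le> ennreal ((2 * real k)\<^sup>2) * indicator (cball 0 (r + 1)) x"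
        using F0[of x] h0[of x n] by (cases "x \<in> cball 0 (r + 1)") (auto intro: ennreal_leI)
    qed
    show "AE x in lebesgue. (\<lambda>n. ennreal ((F x - h n x)\<^sup>2)) \<longlonglongrightarrow> 0"
    proof (rule AE_I'[of N])
      show "N \<in> null_sets lebesgue" using N negligible_iff_null_sets by blast
      have "(\<lambda>n. ennreal ((F x - h n x)\<^sup>2)) \<longlonglongrightarrow> 0" if "x \<notin> N" for x
      proof -
        have "(\<lambda>n. h n x) \<longlonglongrightarrow> cut x * t (F x)"
          unfolding h_def t_def by (intro tendsto_intros lim[OF that])
        moreover have "t (F x) = F x" by (auto simp: F_def t_def)
        ultimately have "(\<lambda>n. h n x) \<longlonglongrightarrow> F x" using Fcut by simp
        then have "(\<lambda>n. (F x - h n x)\<^sup>2) \<longlonglongrightarrow> (F x - F x)\<^sup>2" by (intro tendsto_intros)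
        then show ?thesis using tendsto_ennrealI by fastforce
      qed
      then show "{x \<in> space lebesgue. \<not> (\<lambda>n. ennreal ((F x - h n x)\<^sup>2)) \<longlonglongrightarrow> 0} \<subseteq> N" by blast
    qed
  qed auto
  then have "\<forall>\<^sub>F n in sequentially. (\<integral>\<^sup>+x. ennreal ((F x - h n x)\<^sup>2) \<partial>lebesgue) < ennreal (\<delta> / 4)"
    using \<open>\<delta> > 0\<close> by (auto simp: order_tendsto_iff)
  then obtain n where n: "sqint UNIV (\<lambda>x. F x - h n x) < ennreal (\<delta> / 4)"
    by (auto simp: sqint_def eventually_sequentially)
  have "sqint UNIV (\<lambda>x. f x - h n x) \<le> 2 * sqint UNIV (\<lambda>x. f x - F x) + 2 * sqint UNIV (\<lambda>x. F x - h n x)"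
    by (rule sqint_triangle) auto
  also have "\<dots> \<le> 2 * ennreal (\<delta> / 4) + 2 * ennreal (\<delta> / 4)"
    using k n by (intro add_mono mult_left_mono) (auto simp: F_def t_def)
  also have "\<dots> = ennreal \<delta>"
    using \<open>\<delta> > 0\<close> by (simp add: ennreal_numeral[symmetric] ennreal_mult[symmetric] ennreal_plus[symmetric] del: ennreal_numeral ennreal_plus)
  finally show ?thesis using hc h0 by blast
qed

lemma moll_uniform:
  fixes g :: "'a::euclidean_space \<Rightarrow> real"
  assumes g: "integrable lebesgue g" and k: "kernel \<epsilon> \<rho> R"
    and osc: "\<And>y. norm (y - x) < \<epsilon> \<Longrightarrow> \<bar>g y - g x\<bar> \<le> \<eta>" and "\<eta> \<ge> 0"
  shows "\<bar>moll \<rho> g x - g x\<bar> \<le> \<eta>"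
proof -
  have r0: "0 \<le> \<rho> w" for w using k by (simp add: kernel_def)
  have [measurable]: "\<rho> \<in> borel_measurable borel" using kernel_measurable[OF k] by simp
  have "(\<integral>\<^sup>+y. ennreal (\<rho> (y - x)) \<partial>lebesgue) = 1"
    using nn_integral_reflect(1)[of "\<lambda>y. ennreal (\<rho> y)" x] k by (simp add: kernel_def nn_integral_completion)
  then have hb: "has_bochner_integral lebesgue (\<lambda>y. \<rho> (y - x)) 1"
    using r0 kernel_measurable(3)[OF k, of x] by (intro has_bochner_integral_nn_integral) auto
  then have i1: "integrable lebesgue (\<lambda>y. \<rho> (y - x))" and e1: "(LINT y|lebesgue. \<rho> (y - x)) = 1"
    by (auto simp: has_bochner_integral_iff)
  have i2: "integrable lebesgue (\<lambda>y. g y * \<rho> (y - x))" by (rule moll_integrable[OF g k])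
  have "moll \<rho> g x - g x = (LINT y|lebesgue. g y * \<rho> (y - x) - g x * \<rho> (y - x))"
    using i1 i2 e1 by (simp add: moll_def)
  also have "\<bar>\<dots>\<bar> \<le> (LINT y|lebesgue. \<eta> * \<rho> (y - x))"
  proof (rule order_trans[OF integral_abs_bound integral_mono])
    show "integrable lebesgue (\<lambda>y. \<bar>g y * \<rho> (y - x) - g x * \<rho> (y - x)\<bar>)" using i1 i2 by auto
    show "integrable lebesgue (\<lambda>y. \<eta> * \<rho> (y - x))" using i1 by simp
    fix y
    have "\<bar>g y - g x\<bar> * \<rho> (y - x) \<le> \<eta> * \<rho> (y - x)"
    proof (cases "norm (y - x) < \<epsilon>")
      case True then show ?thesis using osc[OF True] r0 by (intro mult_right_mono) auto
    next
      case False then have "\<rho> (y - x) = 0" using k by (simp add: kernel_def)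
      then show ?thesis by simp
    qed
    then show "\<bar>g y * \<rho> (y - x) - g x * \<rho> (y - x)\<bar> \<le> \<eta> * \<rho> (y - x)"
      using r0[of "y - x"] by (simp add: abs_mult left_diff_distrib[symmetric])
  qed
  also have "\<dots> = \<eta>" using e1 by simp
  finally show ?thesis .
qed

text \<open>The threshold \<open>\<epsilon>0\<close> is independent of the mollifier. This lets one
  mollifier serve a function and all components of its weak gradient at once.\<close>

lemma moll_converges:
  fixes f :: "'a::euclidean_space \<Rightarrow> real"
  assumes f[measurable]: "f \<in> borel_measurable lebesgue" and fin: "sqint UNIV f < \<infinity>"
    and z: "\<And>x. x \<notin> cball 0 r \<Longrightarrow> f x = 0" and "\<delta> > 0" and A: "compact A"
  shows "\<exists>\<epsilon>0>0. \<forall>\<epsilon> \<rho> R. \<epsilon> \<le> \<epsilon>0 \<longrightarrow> kernel \<epsilon> \<rho> R \<longrightarrow> sqint A (\<lambda>x. moll \<rho> f x - f x) \<le> ennreal \<delta>"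
proof -
  have Ab: "A \<in> sets borel" and Am[measurable]: "A \<in> sets lebesgue" using A by (auto simp: compact_imp_closed)
  have Afin: "emeasure lebesgue A < \<infinity>" using emeasure_compact_finite[OF A] Ab by simp
  define a where "a = measure lebesgue A"
  have a: "emeasure lebesgue A = ennreal a" "a \<ge> 0"
    using Afin by (auto simp: a_def emeasure_eq_ennreal_measure)
  \<comment> \<open>Three errors are split off: the mollified difference, the oscillation of
    \<open>g\<close>, and the difference itself. With the doubling factors they use up ten
    sixteenths of \<open>\<delta>\<close>.\<close>
  obtain g where g: "continuous_on UNIV g" "\<And>x. x \<notin> cball 0 (r + 1) \<Longrightarrow> g x = 0"
    and fg: "sqint UNIV (\<lambda>x. f x - g x) \<le> ennreal (\<delta> / 16)"
    using L2_dense_continuous[where r = r and \<delta> = "\<delta> / 16", OF f fin z] \<open>\<delta> > 0\<close> by auto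
  have gm[measurable]: "g \<in> borel_measurable lebesgue"
    using borel_measurable_continuous_onI[OF g(1)] by (auto intro: measurable_completion)
  have fi: "integrable lebesgue f" by (rule L2_bounded_support_integrable[OF f fin z])
  have fgi: "integrable lebesgue (\<lambda>x. f x - g x)"
  proof (rule L2_bounded_support_integrable)
    show "sqint UNIV (\<lambda>x. f x - g x) < \<infinity>" using fg by (rule order_le_less_trans) simp
    show "f x - g x = 0" if "x \<notin> cball 0 (max r (r + 1))" for x using that z[of x] g(2)[of x] by auto
  qed measurable
  have gi: "integrable lebesgue g" using Bochner_Integration.integrable_diff[OF fi fgi] by simp
  obtain b where "\<forall>x\<in>A. norm x \<le> b" using compact_imp_bounded[OF A] unfolding bounded_iff by blast
  then have b: "A \<subseteq> cball 0 b" by auto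
  define \<eta> where "\<eta> = sqrt (\<delta> / (16 * (a + 1)))"
  have \<eta>: "\<eta> > 0" "\<eta>\<^sup>2 * a \<le> \<delta> / 16" using \<open>\<delta> > 0\<close> a(2) by (auto simp: \<eta>_def field_simps)
  have "uniformly_continuous_on (cball 0 (b + 1)) g"
    by (rule compact_uniformly_continuous) (auto intro: continuous_on_subset[OF g(1)])
  then obtain d where d: "d > 0" "\<And>x y. x \<in> cball 0 (b + 1) \<Longrightarrow> y \<in> cball 0 (b + 1) \<Longrightarrow> dist y x < d \<Longrightarrow> dist (g y) (g x) < \<eta>"
    using \<eta>(1) unfolding uniformly_continuous_on_def by metis
  have "sqint A (\<lambda>x. moll \<rho> f x - f x) \<le> ennreal \<delta>" if "\<epsilon> \<le> min d 1" and k: "kernel \<epsilon> \<rho> R" for \<epsilon> \<rho> R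
  proof -
    have moll_split: "moll \<rho> f x = moll \<rho> (\<lambda>x. f x - g x) x + moll \<rho> g x" for x
      using moll_integrable(1)[OF fgi k, of x] moll_integrable(1)[OF gi k, of x]
      by (simp add: moll_def left_diff_distrib Bochner_Integration.integral_add[symmetric] del: Bochner_Integration.integral_add Bochner_Integration.integral_diff)
    have [measurable]: "moll \<rho> (\<lambda>x. f x - g x) \<in> borel_measurable lebesgue" "moll \<rho> g \<in> borel_measurable lebesgue"
      using C1_measurable(3)[OF moll_C1[OF fgi k]] C1_measurable(3)[OF moll_C1[OF gi k]] by auto
    have osc: "\<bar>moll \<rho> g x - g x\<bar> \<le> \<eta>" if "x \<in> A" for x
    proof (rule moll_uniform[OF gi k])
      fix y assume "norm (y - x) < \<epsilon>"
      then have "norm (y - x) < d" "norm (y - x) < 1" using \<open>\<epsilon> \<le> min d 1\<close> by auto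
      moreover have "norm x \<le> b" using that b by (auto simp: subset_iff)
      moreover have "norm y \<le> norm x + norm (y - x)" by (metis norm_triangle_sub)
      ultimately show "\<bar>g y - g x\<bar> \<le> \<eta>" using d(2)[of x y] by (simp add: dist_norm)
    qed (use \<eta> in simp)
    have "sqint A (\<lambda>x. moll \<rho> f x - f x) = sqint A (\<lambda>x. moll \<rho> (\<lambda>x. f x - g x) x + ((moll \<rho> g x - g x) - (f x - g x)))"
      by (rule sqint_cong) (simp add: moll_split)
    also have "\<dots> \<le> 2 * sqint A (moll \<rho> (\<lambda>x. f x - g x)) + 2 * sqint A (\<lambda>x. (moll \<rho> g x - g x) - (f x - g x))"
      by (rule sqint_add) measurable
    also have "\<dots> \<le> 2 * ennreal (\<delta> / 16) + 2 * (2 * ennreal (\<delta> / 16) + 2 * ennreal (\<delta> / 16))"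
    proof (intro add_mono mult_left_mono)
      show "sqint A (moll \<rho> (\<lambda>x. f x - g x)) \<le> ennreal (\<delta> / 16)"
        by (rule order_trans[OF sqint_mono[of A UNIV] order_trans[OF moll_sqint[OF _ k] fg]]) auto
      have "sqint A (\<lambda>x. moll \<rho> g x - g x) \<le> sqint A (\<lambda>x. \<eta>)"
        by (rule sqint_mono_fun) (use osc \<eta> in auto)
      also have "\<dots> = ennreal (\<eta>\<^sup>2 * a)" using a by (simp add: sqint_const ennreal_mult)
      also have "\<dots> \<le> ennreal (\<delta> / 16)" using \<eta> by (intro ennreal_leI)
      finally have 1: "sqint A (\<lambda>x. moll \<rho> g x - g x) \<le> ennreal (\<delta> / 16)" .
      have 2: "sqint A (\<lambda>x. f x - g x) \<le> ennreal (\<delta> / 16)"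
        by (rule order_trans[OF sqint_mono[of A UNIV] fg]) auto
      show "sqint A (\<lambda>x. moll \<rho> g x - g x - (f x - g x)) \<le> 2 * ennreal (\<delta> / 16) + 2 * ennreal (\<delta> / 16)"
        by (rule order_trans[OF sqint_diff add_mono[OF mult_left_mono[OF 1] mult_left_mono[OF 2]]]) auto
    qed auto
    also have "\<dots> \<le> ennreal \<delta>"
      using \<open>\<delta> > 0\<close> by (simp add: ennreal_numeral[symmetric] ennreal_mult[symmetric] ennreal_plus[symmetric] ennreal_leI del: ennreal_numeral ennreal_plus)
    finally show ?thesis .
  qed
  then show ?thesis using d(1) by (intro exI[of _ "min d 1"]) auto
qed

lemma sqint_norm_le:
  fixes F :: "'a::euclidean_space \<Rightarrow> 'b::euclidean_space"
  assumes [measurable]: "F \<in> borel_measurable lebesgue" "A \<in> sets lebesgue"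
  shows "sqint A (\<lambda>x. norm (F x)) = (\<Sum>i\<in>Basis. sqint A (\<lambda>x. F x \<bullet> i))"
proof -
  have "sqint A (\<lambda>x. norm (F x)) = (\<integral>\<^sup>+x. (\<Sum>i\<in>Basis. ennreal ((F x \<bullet> i)\<^sup>2) * indicator A x) \<partial>lebesgue)"
    unfolding sqint_def
  proof (intro nn_integral_cong)
    fix x
    have "(norm (F x))\<^sup>2 = (\<Sum>i\<in>Basis. (F x \<bullet> i)\<^sup>2)"
      unfolding power2_norm_eq_inner by (subst euclidean_inner) (simp add: power2_eq_square)
    then show "ennreal ((norm (F x))\<^sup>2) * indicator A x = (\<Sum>i\<in>Basis. ennreal ((F x \<bullet> i)\<^sup>2) * indicator A x)"
      by (cases "x \<in> A") (simp_all add: sum_ennreal)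
  qed
  also have "\<dots> = (\<Sum>i\<in>Basis. sqint A (\<lambda>x. F x \<bullet> i))"
    unfolding sqint_def by (rule nn_integral_sum) measurable
  finally show ?thesis .
qed

section \<open>Weak gradients and Poincare inequalities\<close>

text \<open>The values outside the domain are set to zero only so that dilations, mollifications and
  measurability make sense on the whole space. The weak gradient is taken inside the domain, and
  \<open>u\<close> need not have zero boundary values.\<close>

definition weak_pair :: "'a::euclidean_space set \<Rightarrow> ('a \<Rightarrow> real) \<Rightarrow> ('a \<Rightarrow> 'a) \<Rightarrow> bool" where
  "weak_pair \<Omega> u G \<longleftrightarrow> open \<Omega> \<and> bounded \<Omega> \<and> has_weak_grad \<Omega> u G \<and>
     u \<in> borel_measurable lebesgue \<and> G \<in> borel_measurable lebesgue \<and>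
     sqint UNIV u < \<infinity> \<and> sqint UNIV (\<lambda>x. norm (G x)) < \<infinity> \<and>
     (\<forall>x. x \<notin> \<Omega> \<longrightarrow> u x = 0 \<and> G x = 0)"

text \<open>Approximation is claimed only on compact subsets: the extension by zero may jump across
  the boundary, and the mollified gradient is the right one only at points whose ball stays
  inside.\<close>

proposition weak_pair_approx:
  fixes u :: "'a::euclidean_space \<Rightarrow> real"
  assumes wp: "weak_pair \<Omega> u G" and A: "compact A" "A \<subseteq> \<Omega>" and "\<delta> > 0"
  shows "\<exists>w D. C1 w D \<and> sqint A (\<lambda>x. w x - u x) \<le> ennreal \<delta> \<and> sqint A (\<lambda>x. norm (D x - G x)) \<le> ennreal \<delta>"
proof -
  have \<Omega>: "open \<Omega>" "bounded \<Omega>" and wg: "has_weak_grad \<Omega> u G"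
    and um[measurable]: "u \<in> borel_measurable lebesgue" and Gm[measurable]: "G \<in> borel_measurable lebesgue"
    and fin: "sqint UNIV u < \<infinity>" "sqint UNIV (\<lambda>x. norm (G x)) < \<infinity>"
    and z: "\<And>x. x \<notin> \<Omega> \<Longrightarrow> u x = 0" "\<And>x. x \<notin> \<Omega> \<Longrightarrow> G x = 0"
    using wp by (auto simp: weak_pair_def)
  obtain r where "\<forall>x\<in>\<Omega>. norm x \<le> r" using \<Omega>(2) unfolding bounded_iff by blast
  then have r: "\<Omega> \<subseteq> cball 0 r" by auto
  have zr: "\<And>x. x \<notin> cball 0 r \<Longrightarrow> u x = 0" "\<And>x i. x \<notin> cball 0 r \<Longrightarrow> G x \<bullet> i = 0"
    using r z by (blast, metis inner_zero_left subsetD)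
  have ui: "integrable lebesgue u" by (rule L2_bounded_support_integrable[OF um fin(1) zr(1)])
  define \<delta>' where "\<delta>' = \<delta> / real DIM('a)"
  have \<delta>': "\<delta>' > 0" using \<open>\<delta> > 0\<close> by (simp add: \<delta>'_def)
  obtain e1 where e1: "e1 > 0" "\<And>\<epsilon> \<rho> R. \<epsilon> \<le> e1 \<Longrightarrow> kernel \<epsilon> \<rho> R \<Longrightarrow> sqint A (\<lambda>x. moll \<rho> u x - u x) \<le> ennreal \<delta>"
    using moll_converges[OF um fin(1) zr(1) \<open>\<delta> > 0\<close> A(1)] by blast
  have "\<forall>i\<in>Basis. \<exists>e>0. \<forall>\<epsilon> \<rho> R. \<epsilon> \<le> e \<longrightarrow> kernel \<epsilon> \<rho> R \<longrightarrow> sqint A (\<lambda>x. moll \<rho> (\<lambda>x. G x \<bullet> i) x - G x \<bullet> i) \<le> ennreal \<delta>'"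
  proof
    fix i :: 'a assume i: "i \<in> Basis"
    have "sqint UNIV (\<lambda>x. G x \<bullet> i) \<le> sqint UNIV (\<lambda>x. norm (G x))"
      by (rule sqint_mono_fun) (use i in \<open>auto simp: Basis_le_norm\<close>)
    then have "sqint UNIV (\<lambda>x. G x \<bullet> i) < \<infinity>" using fin(2) by (rule order_le_less_trans)
    then show "\<exists>e>0. \<forall>\<epsilon> \<rho> R. \<epsilon> \<le> e \<longrightarrow> kernel \<epsilon> \<rho> R \<longrightarrow> sqint A (\<lambda>x. moll \<rho> (\<lambda>x. G x \<bullet> i) x - G x \<bullet> i) \<le> ennreal \<delta>'"
      by (intro moll_converges[OF _ _ zr(2) \<delta>' A(1)]) auto
  qed
  then obtain e where e: "\<And>i. i \<in> Basis \<Longrightarrow> e i > 0"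
    "\<And>i \<epsilon> \<rho> R. i \<in> Basis \<Longrightarrow> \<epsilon> \<le> e i \<Longrightarrow> kernel \<epsilon> \<rho> R \<Longrightarrow> sqint A (\<lambda>x. moll \<rho> (\<lambda>x. G x \<bullet> i) x - G x \<bullet> i) \<le> ennreal \<delta>'"
    by metis
  obtain e2 where e2: "e2 > 0" "(\<Union>x\<in>A. cball x e2) \<subseteq> \<Omega>"
    using compact_subset_open_imp_cball_epsilon_subset[OF A(1) \<Omega>(1) A(2)] by blast
  \<comment> \<open>One radius for the function, for each component of its gradient, and for staying
    inside the domain.\<close>
  define \<epsilon> where "\<epsilon> = Min (insert e1 (insert e2 (e ` Basis)))"
  have \<epsilon>: "\<epsilon> > 0" "\<epsilon> \<le> e1" "\<epsilon> \<le> e2" "\<And>i. i \<in> Basis \<Longrightarrow> \<epsilon> \<le> e i"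
  proof -
    have fin': "finite (insert e1 (insert e2 (e ` Basis)))" by simp
    show "\<epsilon> > 0" unfolding \<epsilon>_def using e1(1) e2(1) e(1) by (subst Min_gr_iff[OF fin']) auto
    show "\<epsilon> \<le> e1" "\<epsilon> \<le> e2" "\<And>i. i \<in> Basis \<Longrightarrow> \<epsilon> \<le> e i"
      unfolding \<epsilon>_def by (rule Min_le[OF fin'], blast)+
  qed
  obtain \<rho> :: "'a \<Rightarrow> real" and R where k: "kernel \<epsilon> \<rho> R" using kernel_exists[OF \<epsilon>(1)] by blast
  define D where "D x = - (LINT y|lebesgue. u y *\<^sub>R R (y - x))" for x
  have C: "C1 (moll \<rho> u) D" unfolding D_def by (rule moll_C1[OF ui k])
  have Am: "A \<in> sets lebesgue" using A(1) by (simp add: compact_imp_closed)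
  have Dm[measurable]: "D \<in> borel_measurable lebesgue" using C1_measurable[OF C] by simp
  have "sqint A (\<lambda>x. norm (D x - G x)) = (\<Sum>i\<in>Basis. sqint A (\<lambda>x. (D x - G x) \<bullet> i))"
    by (rule sqint_norm_le) (use Am in auto)
  also have "\<dots> \<le> (\<Sum>i\<in>(Basis::'a set). ennreal \<delta>')"
  proof (rule sum_mono)
    fix i :: 'a assume i: "i \<in> Basis"
    have "sqint A (\<lambda>x. (D x - G x) \<bullet> i) = sqint A (\<lambda>x. moll \<rho> (\<lambda>x. G x \<bullet> i) x - G x \<bullet> i)"
    proof (rule sqint_cong)
      fix x assume "x \<in> A"
      then have "cball x \<epsilon> \<subseteq> \<Omega>" using e2(2) \<epsilon>(3) by force
      then have "D x \<bullet> i = moll \<rho> (\<lambda>x. G x \<bullet> i) x"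
        unfolding D_def by (intro moll_gradient[OF wg k _ ui z]) (use i \<Omega>(1) in auto)
      then show "\<bar>(D x - G x) \<bullet> i\<bar> = \<bar>moll \<rho> (\<lambda>x. G x \<bullet> i) x - G x \<bullet> i\<bar>" by (simp add: inner_diff_left)
    qed
    also have "\<dots> \<le> ennreal \<delta>'" by (rule e(2)[OF i \<epsilon>(4)[OF i] k])
    finally show "sqint A (\<lambda>x. (D x - G x) \<bullet> i) \<le> ennreal \<delta>'" .
  qed
  also have "\<dots> = ennreal \<delta>"
    using \<delta>' by (simp add: \<delta>'_def ennreal_of_nat_eq_real_of_nat ennreal_mult[symmetric])
  finally show ?thesis using C e1(2)[OF \<epsilon>(2) k] by blast
qed

section \<open>Norms, means and limits\<close>

lemma sqint_lebesgue_on: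
  assumes "S \<in> sets lebesgue"
  shows "sqint S f = (\<integral>\<^sup>+x. ennreal ((f x)\<^sup>2) \<partial>lebesgue_on S)"
  unfolding sqint_def using assms by (subst nn_integral_restrict_space) auto

lemma sqint_L2norm:
  assumes "S \<in> sets lebesgue" "L2 S f"
  shows "sqint S f = ennreal ((L2norm S f)\<^sup>2)"
proof -
  have "(\<integral>\<^sup>+x. ennreal ((f x)\<^sup>2) \<partial>lebesgue_on S) = ennreal (integral\<^sup>L (lebesgue_on S) (\<lambda>x. (f x)\<^sup>2))"
    using assms(2) by (intro nn_integral_eq_integral) (auto simp: L2_def)
  then show ?thesis using assms(1) by (simp add: sqint_lebesgue_on L2norm_def)
qed

lemma L2I_sqint:
  assumes "S \<in> sets lebesgue" "f \<in> borel_measurable (lebesgue_on S)" "sqint S f < \<infinity>"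
  shows "L2 S f"
  unfolding L2_def using assms
  by (auto simp: sqint_lebesgue_on intro!: integrableI_bounded)

lemma L2v_norm:
  assumes "L2v S g" shows "L2 S (\<lambda>x. norm (g x))"
  using assms by (auto simp: L2v_def L2_def)

lemma L2normv_norm: "L2normv S g = L2norm S (\<lambda>x. norm (g x))"
  by (simp add: L2normv_def L2norm_def)

text \<open>The mean minimises the mean square distance. Its use is to replace a constant that
  belongs to an approximation of \<open>u\<close> by one that depends on \<open>u\<close> alone, so
  that the approximation error can be sent to zero.\<close>

lemma sqint_minus_mean:
  fixes u :: "'a::euclidean_space \<Rightarrow> real"
  assumes B: "B \<in> sets lebesgue" and mB: "measure lebesgue B > 0"
    and u[measurable]: "u \<in> borel_measurable lebesgue" and fin: "sqint UNIV u < \<infinity>"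
  shows "sqint B (\<lambda>x. u x - integral\<^sup>L (lebesgue_on B) u / measure lebesgue B) \<le> sqint B (\<lambda>x. u x - c)"
proof -
  let ?M = "lebesgue_on B"
  define m where "m = integral\<^sup>L ?M u / measure lebesgue B"
  have eB: "emeasure lebesgue B < \<infinity>"
    using mB unfolding measure_def by (metis enn2real_top infinity_ennreal_def less_irrefl top.not_eq_extremum)
  interpret finite_measure ?M
    by (rule finite_measure_lebesgue_on, rule fmeasurableI) (use eB B in auto)
  have um: "u \<in> borel_measurable ?M" using u by (rule measurable_restrict_space1)
  have "sqint B u < \<infinity>" using fin sqint_mono[of B UNIV u] by (simp add: order_le_less_trans)
  then have u2: "integrable ?M (\<lambda>x. (u x)\<^sup>2)" using L2I_sqint[OF B um] by (simp add: L2_def)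
  then have u1: "integrable ?M u" by (rule square_integrable_imp_integrable[OF um])
  have int2: "integrable ?M (\<lambda>x. (u x - a)\<^sup>2)" for a
    using u1 u2 by (simp add: power2_diff)
  have one: "(LINT x|?M. 1) = measure lebesgue B"
    using B by (simp add: measure_restrict_space)
  have "integral\<^sup>L ?M (\<lambda>x. (u x - c)\<^sup>2) = integral\<^sup>L ?M (\<lambda>x. (u x - m)\<^sup>2 + (2 * (m - c) * u x + ((m - c)\<^sup>2 - 2 * (m - c) * m)))"
    by (intro Bochner_Integration.integral_cong) (auto simp: power2_eq_square algebra_simps)
  also have "\<dots> = integral\<^sup>L ?M (\<lambda>x. (u x - m)\<^sup>2) + (2 * (m - c) * integral\<^sup>L ?M u + ((m - c)\<^sup>2 - 2 * (m - c) * m) * measure lebesgue B)"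
    using int2[of m] u1 B by (simp add: measure_restrict_space)
  also have "integral\<^sup>L ?M u = m * measure lebesgue B" using mB by (simp add: m_def)
  finally have "integral\<^sup>L ?M (\<lambda>x. (u x - c)\<^sup>2) = integral\<^sup>L ?M (\<lambda>x. (u x - m)\<^sup>2) + (m - c)\<^sup>2 * measure lebesgue B"
    by (simp add: algebra_simps)
  then have "integral\<^sup>L ?M (\<lambda>x. (u x - m)\<^sup>2) \<le> integral\<^sup>L ?M (\<lambda>x. (u x - c)\<^sup>2)" using mB by simp
  moreover have "sqint B (\<lambda>x. u x - a) = ennreal (integral\<^sup>L ?M (\<lambda>x. (u x - a)\<^sup>2))" for a
    using int2[of a] B by (simp add: sqint_lebesgue_on nn_integral_eq_integral)
  ultimately show ?thesis unfolding m_def[symmetric] by (simp add: ennreal_leI)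
qed

lemma ennreal_numeral_mult: "ennreal (numeral k * x) = numeral k * ennreal x"
  by (metis ennreal_mult' ennreal_numeral zero_le_numeral)

lemma weak_pair_facts:
  assumes "weak_pair \<Omega> u G"
  shows "open \<Omega>" "bounded \<Omega>" "u \<in> borel_measurable lebesgue" "G \<in> borel_measurable lebesgue"
    "sqint UNIV u < \<infinity>" "sqint UNIV (\<lambda>x. norm (G x)) < \<infinity>"
    "\<And>x. x \<notin> \<Omega> \<Longrightarrow> u x = 0" "\<And>x. x \<notin> \<Omega> \<Longrightarrow> G x = 0"
  using assms by (auto simp: weak_pair_def)

text \<open>Removes the approximation error at the end of each transfer; \<open>K\<close> collects
  the factors it has picked up.\<close>

lemma ennreal_le_limit:
  fixes a b :: ennreal
  assumes "\<And>\<delta>::real. \<delta> > 0 \<Longrightarrow> a \<le> b + ennreal (K * \<delta>)" and "K \<ge> 0"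
  shows "a \<le> b"
proof (rule ennreal_le_epsilon)
  fix e :: real assume "e > 0"
  then have "a \<le> b + ennreal (K * (e / (K + 1)))" using assms by (intro assms) auto
  also have "K * (e / (K + 1)) \<le> e" using assms(2) \<open>e > 0\<close> by (simp add: field_simps)
  then have "b + ennreal (K * (e / (K + 1))) \<le> b + ennreal e" by (intro add_left_mono ennreal_leI)
  finally show "a \<le> b + ennreal e" .
qed

section \<open>From C1 functions to weakly differentiable functions\<close>

lemma sqint_norm_grad_le:
  fixes D G :: "'a::euclidean_space \<Rightarrow> 'a"
  assumes [measurable]: "D \<in> borel_measurable lebesgue" "G \<in> borel_measurable lebesgue" "A \<in> sets lebesgue"
  shows "sqint A (\<lambda>x. norm (D x)) \<le> 2 * sqint A (\<lambda>x. norm (D x - G x)) + 2 * sqint A (\<lambda>x. norm (G x))"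
proof -
  have "sqint A (\<lambda>x. norm (D x)) \<le> sqint A (\<lambda>x. norm (D x - G x) + norm (G x))"
    by (rule sqint_mono_fun) (simp add: norm_triangle_sub add.commute)
  also have "\<dots> \<le> 2 * sqint A (\<lambda>x. norm (D x - G x)) + 2 * sqint A (\<lambda>x. norm (G x))"
    by (rule sqint_add) measurable
  finally show ?thesis .
qed

text \<open>Each splitting of a sum doubles: one for the comparison with the dilated approximation,
  one for the undilated approximation, one for the gradient. This yields the factor 8.\<close>

lemma H1_dilation_compact:
  fixes u :: "'a::euclidean_space \<Rightarrow> real"
  assumes wp: "weak_pair \<Omega> u G" and A: "compact A" and A': "compact A'" "A' \<subseteq> \<Omega>"
    and t: "0 < t" "t \<le> 1" and h: "\<And>x. x \<in> A \<Longrightarrow> dist z x \<le> h"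
    and AA': "\<And>x s. x \<in> A \<Longrightarrow> t \<le> s \<Longrightarrow> s \<le> 1 \<Longrightarrow> dil s z x \<in> A'"
  shows "sqint A (\<lambda>x. u (dil t z x) - u x) \<le> ennreal (8 * h\<^sup>2 / t ^ DIM('a)) * sqint A' (\<lambda>x. norm (G x))"
proof (rule ennreal_le_limit)
  note [measurable] = weak_pair_facts(3,4)[OF wp]
  have Am[measurable]: "A \<in> sets borel" "A \<in> sets lebesgue" "A' \<in> sets borel" "A' \<in> sets lebesgue"
    using A A' by (auto simp: compact_imp_closed)
  have sub: "A \<subseteq> A'" using AA'[of _ 1] t by (auto simp: dil_def)
  define q where "q = 1 / t ^ DIM('a)"
  have q: "q > 0" using t by (simp add: q_def)
  show "0 \<le> 2 * q + 16 * h\<^sup>2 * q / 2 + 4" using q by simp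
  fix \<delta> :: real assume \<delta>: "\<delta> > 0"
  obtain w D where C: "C1 w D" and w: "sqint A' (\<lambda>x. w x - u x) \<le> ennreal \<delta>" and D: "sqint A' (\<lambda>x. norm (D x - G x)) \<le> ennreal \<delta>"
    using weak_pair_approx[OF wp A' \<delta>] by blast
  note [measurable] = C1_measurable(3,4)[OF C]
  have [measurable]: "(\<lambda>x. w (dil t z x)) \<in> borel_measurable lebesgue" "(\<lambda>x. u (dil t z x)) \<in> borel_measurable lebesgue"
    using t by (auto intro!: measurable_comp_dil)
  have "sqint A (\<lambda>x. u (dil t z x) - u x) = sqint A (\<lambda>x. (w (dil t z x) - w x + (w x - u x)) - (w (dil t z x) - u (dil t z x)))"
    by (rule sqint_cong) simp
  also have "\<dots> \<le> 2 * sqint A (\<lambda>x. w (dil t z x) - w x + (w x - u x)) + 2 * sqint A (\<lambda>x. w (dil t z x) - u (dil t z x))"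
    by (rule sqint_diff) measurable
  also have "\<dots> \<le> 2 * (2 * (ennreal (h\<^sup>2 * q) * (2 * ennreal \<delta> + 2 * sqint A' (\<lambda>x. norm (G x)))) + 2 * ennreal \<delta>) + 2 * (ennreal q * ennreal \<delta>)"
  proof (intro add_mono mult_left_mono)
    show "sqint A (\<lambda>x. w (dil t z x) - u (dil t z x)) \<le> ennreal q * ennreal \<delta>"
      unfolding q_def
      by (rule order_trans[OF sqint_dil[of "\<lambda>x. w x - u x" A' t A z] mult_left_mono[OF w]])
         (use t AA' in auto)
    have "sqint A (\<lambda>x. w (dil t z x) - w x) \<le> ennreal (h\<^sup>2 * q) * sqint A' (\<lambda>x. norm (D x))"
      unfolding q_def using C1_dilation[OF C Am(1,3) t h AA'] by simp
    also have "\<dots> \<le> ennreal (h\<^sup>2 * q) * (2 * ennreal \<delta> + 2 * sqint A' (\<lambda>x. norm (G x)))"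
    proof (rule mult_left_mono)
      show "sqint A' (\<lambda>x. norm (D x)) \<le> 2 * ennreal \<delta> + 2 * sqint A' (\<lambda>x. norm (G x))"
        by (rule order_trans[OF sqint_norm_grad_le[of D G A'] add_right_mono[OF mult_left_mono[OF D]]]) auto
    qed simp
    finally have 1: "sqint A (\<lambda>x. w (dil t z x) - w x) \<le> ennreal (h\<^sup>2 * q) * (2 * ennreal \<delta> + 2 * sqint A' (\<lambda>x. norm (G x)))" .
    have 2: "sqint A (\<lambda>x. w x - u x) \<le> ennreal \<delta>" by (rule order_trans[OF sqint_mono[OF sub] w])
    show "sqint A (\<lambda>x. w (dil t z x) - w x + (w x - u x)) \<le> 2 * (ennreal (h\<^sup>2 * q) * (2 * ennreal \<delta> + 2 * sqint A' (\<lambda>x. norm (G x)))) + 2 * ennreal \<delta>"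
      by (rule order_trans[OF sqint_add add_mono[OF mult_left_mono[OF 1] mult_left_mono[OF 2]]]) auto
  qed auto
  also have "\<dots> = ennreal (8 * h\<^sup>2 / t ^ DIM('a)) * sqint A' (\<lambda>x. norm (G x)) + ennreal ((2 * q + 16 * h\<^sup>2 * q / 2 + 4) * \<delta>)"
  proof -
    have e: "ennreal (8 * h\<^sup>2 / t ^ DIM('a)) = 8 * ennreal (h\<^sup>2 * q)"
      using ennreal_numeral_mult[of "num.Bit0 (num.Bit0 (num.Bit0 num.One))" "h\<^sup>2 * q"] by (simp add: q_def)
    have "ennreal ((2 * q + 16 * h\<^sup>2 * q / 2 + 4) * \<delta>) = 2 * (ennreal q * ennreal \<delta>) + 8 * (ennreal (h\<^sup>2 * q) * ennreal \<delta>) + 4 * ennreal \<delta>"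
      using q \<delta> by (simp add: ennreal_mult[symmetric] ennreal_plus[symmetric] ennreal_numeral[symmetric] algebra_simps del: ennreal_plus ennreal_numeral)
    then show ?thesis unfolding e by (simp add: algebra_simps)
  qed
  finally show "sqint A (\<lambda>x. u (dil t z x) - u x) \<le> ennreal (8 * h\<^sup>2 / t ^ DIM('a)) * sqint A' (\<lambda>x. norm (G x)) + ennreal ((2 * q + 16 * h\<^sup>2 * q / 2 + 4) * \<delta>)" .
qed

text \<open>The centre \<open>z\<close> may lie on the boundary of the domain. A dilation with
  centre in a convex set maps its interior into itself, so compact subsets of the interior sweep out
  compact subsets of the interior and the previous estimate applies to an exhaustion.\<close>

lemma H1_dilation:
  fixes u :: "'a::euclidean_space \<Rightarrow> real"
  assumes wp: "weak_pair \<Omega> u G" and K: "convex K" "interior K \<noteq> {}" "interior K \<subseteq> \<Omega>" "z \<in> K" "closed K"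
    and t: "0 < t" "t \<le> 1" and h: "\<And>x. x \<in> K \<Longrightarrow> dist z x \<le> h"
  shows "sqint K (\<lambda>x. u (dil t z x) - u x) \<le> ennreal (8 * h\<^sup>2 / t ^ DIM('a)) * sqint K (\<lambda>x. norm (G x))"
proof -
  let ?f = "\<lambda>x. u (dil t z x) - u x" and ?M = "ennreal (8 * h\<^sup>2 / t ^ DIM('a)) * sqint K (\<lambda>x. norm (G x))"
  note [measurable] = weak_pair_facts(3,4)[OF wp]
  have [measurable]: "(\<lambda>x. u (dil t z x)) \<in> borel_measurable lebesgue"
    using t by (auto intro!: measurable_comp_dil)
  obtain C where C: "\<And>n. compact (C n)" "\<And>n. C n \<subseteq> interior K" "\<And>n. C n \<subseteq> interior (C (Suc n))" "\<Union>(range C) = interior K"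
    using open_Union_compact_subsets[OF open_interior[of K]] by metis
  have "sqint (\<Union>k. C k) ?f \<le> ?M"
  proof (rule sqint_SUP)
    show "C k \<in> sets lebesgue" for k using C(1)[of k] by (simp add: compact_imp_closed)
    show "C k \<subseteq> C (Suc k)" for k using C(3)[of k] interior_subset by blast
    fix k
    \<comment> \<open>All positions passed during the contraction; compact as a continuous image,
      since the ratios form a compact interval away from 0.\<close>
    define A' where "A' = (\<lambda>(s,x). dil s z x) ` ({t..1} \<times> C k)"
    have "compact A'" unfolding A'_def
      by (intro compact_continuous_image compact_Times C(1))
         (auto simp: dil_def split_beta intro!: continuous_intros)
    moreover have sub: "A' \<subseteq> interior K"
    proof -
      have "dil s z x \<in> interior K" if "x \<in> C k" "t \<le> s" "s \<le> 1" for x s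
      proof -
        have "z - s *\<^sub>R (z - x) \<in> interior K"
          by (rule mem_interior_convex_shrink[OF K(1) _ K(4)]) (use that t C(2)[of k] in auto)
        then show ?thesis by (simp add: dil_def algebra_simps)
      qed
      then show ?thesis by (auto simp: A'_def)
    qed
    ultimately have "sqint (C k) ?f \<le> ennreal (8 * h\<^sup>2 / t ^ DIM('a)) * sqint A' (\<lambda>x. norm (G x))"
      using K(3) C(2)[of k] interior_subset[of K]
      by (intro H1_dilation_compact[OF wp C(1)] t h) (auto simp: A'_def)
    also have "\<dots> \<le> ?M"
      by (intro mult_left_mono sqint_mono) (use sub interior_subset in auto)
    finally show "sqint (C k) ?f \<le> ?M" .
  qed measurable
  then have "sqint (interior K) ?f \<le> ?M" using C(4) by simp
  moreover have "negligible (K - interior K)"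
    using negligible_convex_frontier[OF K(1)] K(5) by (simp add: frontier_def)
  ultimately show ?thesis using sqint_null_diff order_trans by blast
qed

text \<open>The inequality is first shown for the mean of \<open>u\<close>. A constant taken from an
  approximating function would change with the accuracy and block the limit.\<close>

lemma H1_poincare_ball:
  fixes u :: "'a::euclidean_space \<Rightarrow> real"
  assumes wp: "weak_pair \<Omega> u G" and r: "r > 0" and B: "cball z r \<subseteq> \<Omega>"
  shows "\<exists>c. sqint (cball z r) (\<lambda>x. u x - c) \<le> ennreal (64 * r\<^sup>2 * 2 ^ DIM('a)) * sqint (cball z r) (\<lambda>x. norm (G x))"
proof -
  let ?B = "cball z r"
  let ?m = "integral\<^sup>L (lebesgue_on ?B) u / measure lebesgue ?B"
  let ?g = "sqint ?B (\<lambda>x. norm (G x))"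
  note [measurable] = weak_pair_facts(3,4)[OF wp]
  have mB: "measure lebesgue ?B > 0" using r by (simp add: content_cball_pos)
  then have eB: "emeasure lebesgue ?B > 0" by (simp add: measure_def enn2real_positive_iff)
  define P where "P = 16 * r\<^sup>2 * 2 ^ DIM('a)"
  have P: "P \<ge> 0" by (simp add: P_def)
  have "sqint ?B (\<lambda>x. u x - ?m) \<le> ennreal (4 * P) * ?g"
  proof (rule ennreal_le_limit)
    show "0 \<le> 2 + 4 * P" using P by simp
    fix \<delta> :: real assume \<delta>: "\<delta> > 0"
    obtain w D where C: "C1 w D" and w: "sqint ?B (\<lambda>x. w x - u x) \<le> ennreal \<delta>" and D: "sqint ?B (\<lambda>x. norm (D x - G x)) \<le> ennreal \<delta>"
      using weak_pair_approx[OF wp compact_cball B \<delta>] by blast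
    note [measurable] = C1_measurable(3,4)[OF C]
    have dist2: "dist x y \<le> 2 * r" if "x \<in> ?B" "y \<in> ?B" for x y
      using that dist_triangle2[of x y z] by (simp add: dist_commute)
    obtain c where c: "sqint ?B (\<lambda>x. w x - c) \<le> ennreal (4 * (2 * r)\<^sup>2 * 2 ^ DIM('a)) * sqint ?B (\<lambda>x. norm (D x))"
      using C1_poincare[OF C compact_cball convex_cball dist2 eB] by blast
    have "sqint ?B (\<lambda>x. u x - ?m) \<le> sqint ?B (\<lambda>x. u x - c)"
      by (rule sqint_minus_mean) (use mB weak_pair_facts[OF wp] in auto)
    also have "\<dots> = sqint ?B (\<lambda>x. (w x - c) - (w x - u x))" by simp
    also have "\<dots> \<le> 2 * sqint ?B (\<lambda>x. w x - c) + 2 * sqint ?B (\<lambda>x. w x - u x)"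
      by (rule sqint_diff) auto
    also have "\<dots> \<le> 2 * (ennreal P * (2 * ennreal \<delta> + 2 * ?g)) + 2 * ennreal \<delta>"
    proof (intro add_mono mult_left_mono w)
      have "sqint ?B (\<lambda>x. w x - c) \<le> ennreal P * sqint ?B (\<lambda>x. norm (D x))"
        using c by (simp add: P_def power_mult_distrib)
      also have "\<dots> \<le> ennreal P * (2 * ennreal \<delta> + 2 * ?g)"
        by (intro mult_left_mono order_trans[OF sqint_norm_grad_le[of D G ?B] add_right_mono[OF mult_left_mono[OF D]]]) auto
      finally show "sqint ?B (\<lambda>x. w x - c) \<le> ennreal P * (2 * ennreal \<delta> + 2 * ?g)" .
    qed auto
    also have "\<dots> = ennreal (4 * P) * ?g + ennreal ((2 + 4 * P) * \<delta>)"
    proof -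
      have e: "ennreal (4 * P) = 4 * ennreal P"
        using P by (simp add: ennreal_mult)
      have "ennreal ((2 + 4 * P) * \<delta>) = 2 * ennreal \<delta> + 4 * (ennreal P * ennreal \<delta>)"
        using P \<delta> by (simp add: ennreal_mult[symmetric] ennreal_plus[symmetric] ennreal_numeral[symmetric] algebra_simps del: ennreal_plus ennreal_numeral)
      then show ?thesis unfolding e by (simp add: algebra_simps)
    qed
    finally show "sqint ?B (\<lambda>x. u x - ?m) \<le> ennreal (4 * P) * ?g + ennreal ((2 + 4 * P) * \<delta>)" .
  qed
  then show ?thesis unfolding P_def by (intro exI[of _ ?m]) (simp add: mult.assoc)
qed

text \<open>The constant is the same for all \<open>K\<close>: every \<open>K\<close> is contracted into one common ball about \<open>z\<close>.\<close>

lemma H1_poincare_star: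
  fixes u :: "'a::euclidean_space \<Rightarrow> real"
  assumes wp: "weak_pair \<Omega> u G" and r: "r > 0" and B: "cball z r \<subseteq> \<Omega>"
  shows "\<exists>c. \<forall>K h. convex K \<longrightarrow> compact K \<longrightarrow> interior K \<noteq> {} \<longrightarrow> interior K \<subseteq> \<Omega> \<longrightarrow> z \<in> K \<longrightarrow>
    K \<subseteq> cball z h \<longrightarrow> r \<le> h \<longrightarrow>
    sqint K (\<lambda>x. u x - c) \<le> ennreal (144 * 2 ^ DIM('a) * h\<^sup>2 * (h / r) ^ DIM('a)) *
      (sqint K (\<lambda>x. norm (G x)) + sqint (cball z r) (\<lambda>x. norm (G x)))"
proof -
  let ?n = "DIM('a)"
  note [measurable] = weak_pair_facts(3,4)[OF wp]
  obtain c where c: "sqint (cball z r) (\<lambda>x. u x - c) \<le> ennreal (64 * r\<^sup>2 * 2 ^ DIM('a)) * sqint (cball z r) (\<lambda>x. norm (G x))"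
    using H1_poincare_ball[OF wp r B] by blast
  show ?thesis
  proof (intro exI[of _ c] allI impI)
    fix K h assume K: "convex K" "compact K" "interior K \<noteq> {}" "interior K \<subseteq> \<Omega>" "z \<in> K" "K \<subseteq> cball z h" "r \<le> h"
    let ?gK = "sqint K (\<lambda>x. norm (G x))" and ?gB = "sqint (cball z r) (\<lambda>x. norm (G x))"
    \<comment> \<open>The ratio that carries the ball of radius \<open>h\<close>, hence
      \<open>K\<close>, into the ball of radius \<open>r\<close>.\<close>
    define t where "t = r / h"
    have h: "h > 0" using r K(7) by simp
    have t: "0 < t" "t \<le> 1" using r K(7) h by (auto simp: t_def)
    have Km[measurable]: "K \<in> sets lebesgue" using K(2) by (simp add: compact_imp_closed)
    have [measurable]: "(\<lambda>x. u (dil t z x)) \<in> borel_measurable lebesgue"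
      using t by (auto intro!: measurable_comp_dil)
    define Q where "Q = (h / r) ^ ?n"
    have Q: "Q = 1 / t ^ ?n" "Q > 0" using h r by (auto simp: Q_def t_def power_divide)
    \<comment> \<open>Covers both contributions, the dilation with factor 8 and the Poincare
      inequality on the ball with factor 64.\<close>
    define X where "X = 72 * 2 ^ ?n * h\<^sup>2 * Q"
    have X: "8 * h\<^sup>2 * Q \<le> X" "Q * (64 * r\<^sup>2 * 2 ^ ?n) \<le> X" "0 \<le> X"
    proof -
      have "8 * 1 * h\<^sup>2 * Q \<le> 72 * 2 ^ ?n * h\<^sup>2 * Q" using Q(2) by (intro mult_right_mono mult_mono) auto
      then show "8 * h\<^sup>2 * Q \<le> X" by (simp add: X_def)
      have "64 * 2 ^ ?n * r\<^sup>2 * Q \<le> 72 * 2 ^ ?n * h\<^sup>2 * Q"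
        using Q(2) r K(7) by (intro mult_right_mono mult_mono power_mono) auto
      then show "Q * (64 * r\<^sup>2 * 2 ^ ?n) \<le> X" by (simp add: X_def mult_ac)
      show "0 \<le> X" using Q(2) by (simp add: X_def)
    qed
    have 1: "sqint K (\<lambda>x. u (dil t z x) - u x) \<le> ennreal X * ?gK"
    proof -
      have "sqint K (\<lambda>x. u (dil t z x) - u x) \<le> ennreal (8 * h\<^sup>2 / t ^ ?n) * ?gK"
        by (rule H1_dilation[OF wp K(1,3,4,5) compact_imp_closed[OF K(2)] t]) (use K(6) in auto)
      also have "\<dots> \<le> ennreal X * ?gK" using X(1) Q(1) by (intro mult_right_mono ennreal_leI) auto
      finally show ?thesis .
    qed
    have 2: "sqint K (\<lambda>x. u (dil t z x) - c) \<le> ennreal X * ?gB"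
    proof -
      have "sqint K (\<lambda>x. u (dil t z x) - c) \<le> ennreal (1 / t ^ ?n) * sqint (cball z r) (\<lambda>x. u x - c)"
      proof (rule sqint_dil[of "\<lambda>x. u x - c" "cball z r" t K z])
        show "dil t z x \<in> cball z r" if "x \<in> K" for x
        proof -
          have "dist z (dil t z x) = t * dist z x" using t by (simp add: dil_def dist_norm norm_minus_commute)
          also have "\<dots> \<le> t * h" using that K(6) t by (intro mult_left_mono) auto
          also have "\<dots> = r" using h by (simp add: t_def)
          finally show ?thesis by simp
        qed
      qed (use t in auto)
      also have "\<dots> \<le> ennreal Q * (ennreal (64 * r\<^sup>2 * 2 ^ ?n) * ?gB)"
        unfolding Q(1) by (intro mult_left_mono c) auto
      also have "\<dots> = ennreal (Q * (64 * r\<^sup>2 * 2 ^ ?n)) * ?gB" using Q(2) by (simp add: ennreal_mult mult.assoc)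
      also have "\<dots> \<le> ennreal X * ?gB" using X(2) by (intro mult_right_mono ennreal_leI) auto
      finally show ?thesis .
    qed
    have "sqint K (\<lambda>x. u x - c) = sqint K (\<lambda>x. (u (dil t z x) - c) - (u (dil t z x) - u x))" by simp
    also have "\<dots> \<le> 2 * sqint K (\<lambda>x. u (dil t z x) - c) + 2 * sqint K (\<lambda>x. u (dil t z x) - u x)"
      by (rule sqint_diff) measurable
    also have "\<dots> \<le> 2 * (ennreal X * ?gB) + 2 * (ennreal X * ?gK)"
      by (intro add_mono mult_left_mono 1 2) auto
    also have "\<dots> = (2 * ennreal X) * (?gK + ?gB)" by (simp add: algebra_simps)
    also have "2 * ennreal X = ennreal (144 * 2 ^ ?n * h\<^sup>2 * (h / r) ^ ?n)"
      unfolding ennreal_numeral_mult[symmetric] by (simp add: X_def Q_def mult.assoc)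
    finally show "sqint K (\<lambda>x. u x - c) \<le> ennreal (144 * 2 ^ ?n * h\<^sup>2 * (h / r) ^ ?n) * (?gK + ?gB)" .
  qed
qed

section \<open>Simplices and barycentric coordinates\<close>

definition full_simplex :: "'a::euclidean_space set \<Rightarrow> bool" where
  "full_simplex T \<longleftrightarrow> finite T \<and> card T = DIM('a) + 1 \<and> \<not> affine_dependent T"

text \<open>The gradient of the barycentric coordinate of \<open>z\<close>: that coordinate falls
  from 1 to 0 along each edge leaving \<open>z\<close>.\<close>

definition lgrad :: "'a::euclidean_space set \<Rightarrow> 'a \<Rightarrow> 'a" where
  "lgrad T z = (SOME a. \<forall>v\<in>T - {z}. a \<bullet> (v - z) = - 1)"

text \<open>The barycentric coordinate continued as an affine function to the whole space. Unlike
  \<open>bary\<close>, it is meaningful outside the simplex, where its sign detects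
  membership.\<close>

definition lam :: "'a::euclidean_space set \<Rightarrow> 'a \<Rightarrow> 'a \<Rightarrow> real" where
  "lam T z x = 1 + lgrad T z \<bullet> (x - z)"

lemma lgrad_exists:
  fixes T :: "'a::euclidean_space set"
  assumes T: "full_simplex T" and z: "z \<in> T"
  shows "\<exists>a. \<forall>v\<in>T - {z}. a \<bullet> (v - z) = - 1"
proof -
  have "insert z (T - {z}) = T" using z by auto
  then have "independent ((\<lambda>v. - z + v) ` (T - {z}))"
    using affine_dependent_iff_dependent[of z "T - {z}"] T by (auto simp: full_simplex_def)
  then obtain g :: "'a \<Rightarrow> real" where g: "linear g" "\<forall>y\<in>(\<lambda>v. - z + v) ` (T - {z}). g y = - 1"
    using real_vector.linear_independent_extend[of _ "\<lambda>_. - 1 :: real"] by blast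
  \<comment> \<open>The Riesz vector of the linear functional \<open>g\<close>.\<close>
  have "adjoint g 1 \<bullet> y = g y" for y using adjoint_works[OF g(1), of y 1] by (simp add: inner_commute)
  then show ?thesis using g(2) by (intro exI[of _ "adjoint g 1"]) auto
qed

lemma lam_vertex:
  assumes "full_simplex T" "z \<in> T" "v \<in> T"
  shows "lam T z v = (if v = z then 1 else 0)"
  using someI_ex[OF lgrad_exists[OF assms(1,2)]] assms(3) by (auto simp: lam_def lgrad_def)

lemma lam_affine:
  assumes "sum u S = 1" "finite S"
  shows "lam T z (\<Sum>v\<in>S. u v *\<^sub>R v) = (\<Sum>v\<in>S. u v * lam T z v)"
proof -
  have "(\<Sum>v\<in>S. u v * lam T z v) = sum u S * (1 - lgrad T z \<bullet> z) + lgrad T z \<bullet> (\<Sum>v\<in>S. u v *\<^sub>R v)"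
    by (simp add: lam_def inner_diff_right inner_sum_right algebra_simps sum.distrib sum_subtractf sum_distrib_right sum_distrib_left)
  then show ?thesis using assms(1) by (simp add: lam_def inner_diff_right)
qed

lemma lam_combination:
  fixes T :: "'a::euclidean_space set"
  assumes T: "full_simplex T"
  shows "(\<Sum>v\<in>T. lam T v x) = 1" "(\<Sum>v\<in>T. lam T v x *\<^sub>R v) = x"
proof -
  have "affine hull T = UNIV" using T affine_independent_span_eq[of T] by (auto simp: full_simplex_def)
  then have "x \<in> affine hull T" by simp
  then obtain u where u: "sum u T = 1" "(\<Sum>v\<in>T. u v *\<^sub>R v) = x"
    using T by (auto simp: affine_hull_finite full_simplex_def)
  have "lam T z x = u z" if "z \<in> T" for z
  proof -
    have "lam T z x = (\<Sum>v\<in>T. u v * lam T z v)" using lam_affine[OF u(1), of T z] T u(2) by (simp add: full_simplex_def)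
    also have "\<dots> = (\<Sum>v\<in>T. if v = z then u v else 0)"
      using lam_vertex[OF T that] by (intro sum.cong) auto
    also have "\<dots> = u z" using T that by (simp add: full_simplex_def)
    finally show ?thesis .
  qed
  then show "(\<Sum>v\<in>T. lam T v x) = 1" "(\<Sum>v\<in>T. lam T v x *\<^sub>R v) = x" using u by auto
qed

lemma lam_unique:
  assumes T: "full_simplex T" and u: "sum u T = 1" "(\<Sum>v\<in>T. u v *\<^sub>R v) = x" and z: "z \<in> T"
  shows "u z = lam T z x"
proof -
  have "lam T z x = (\<Sum>v\<in>T. u v * lam T z v)" using lam_affine[OF u(1), of T z] T u(2) by (simp add: full_simplex_def)
  also have "\<dots> = (\<Sum>v\<in>T. if v = z then u v else 0)"
    using lam_vertex[OF T z] by (intro sum.cong) auto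
  also have "\<dots> = u z" using T z by (simp add: full_simplex_def)
  finally show ?thesis ..
qed

lemma in_hull_iff:
  assumes T: "full_simplex T"
  shows "x \<in> convex hull T \<longleftrightarrow> (\<forall>v\<in>T. 0 \<le> lam T v x)"
proof
  assume "x \<in> convex hull T"
  then obtain u where "\<forall>v\<in>T. 0 \<le> u v" "sum u T = 1" "(\<Sum>v\<in>T. u v *\<^sub>R v) = x"
    using T by (auto simp: convex_hull_finite full_simplex_def)
  then show "\<forall>v\<in>T. 0 \<le> lam T v x" using lam_unique[OF T] by metis
next
  assume "\<forall>v\<in>T. 0 \<le> lam T v x"
  then show "x \<in> convex hull T"
    using T lam_combination[OF T, of x] by (auto simp: convex_hull_finite full_simplex_def)
qed

lemma lam_le_1:
  assumes T: "full_simplex T" "z \<in> T" "x \<in> convex hull T" shows "lam T z x \<le> 1"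
proof -
  have "lam T z x \<le> (\<Sum>v\<in>T. lam T v x)"
    using T in_hull_iff[OF T(1)] by (intro member_le_sum) (auto simp: full_simplex_def)
  then show ?thesis using lam_combination[OF T(1)] by simp
qed

text \<open>Describes faces by vanishing coordinates. In this form the conformity condition, that
  two cells meet in the hull of their common vertices, becomes a statement about
  \<open>lam\<close>.\<close>

lemma in_subhull_iff:
  assumes T: "full_simplex T" and V: "V \<subseteq> T"
  shows "x \<in> convex hull V \<longleftrightarrow> x \<in> convex hull T \<and> (\<forall>v\<in>T - V. lam T v x = 0)"
proof
  have fT: "finite T" "finite V" using T V by (auto simp: full_simplex_def intro: finite_subset)
  {
    assume x: "x \<in> convex hull V"
    then obtain u where u: "\<forall>v\<in>V. 0 \<le> u v" "sum u V = 1" "(\<Sum>v\<in>V. u v *\<^sub>R v) = x"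
      using fT by (auto simp: convex_hull_finite)
    let ?u = "\<lambda>v. if v \<in> V then u v else 0"
    have "T \<inter> V = V" using V by auto
    then have "sum ?u T = 1" "(\<Sum>v\<in>T. ?u v *\<^sub>R v) = x"
      using u fT V by (simp_all add: sum.inter_restrict[symmetric] if_distrib[of "\<lambda>c. c *\<^sub>R _"] cong: if_cong)
    then have "\<forall>v\<in>T. ?u v = lam T v x" using lam_unique[OF T] by blast
    moreover have "x \<in> convex hull T" using x hull_mono[OF V] by blast
    ultimately show "x \<in> convex hull T \<and> (\<forall>v\<in>T - V. lam T v x = 0)" by force
  }
  assume x: "x \<in> convex hull T \<and> (\<forall>v\<in>T - V. lam T v x = 0)"
  have "(\<Sum>v\<in>V. lam T v x) = (\<Sum>v\<in>T. lam T v x)" "(\<Sum>v\<in>V. lam T v x *\<^sub>R v) = (\<Sum>v\<in>T. lam T v x *\<^sub>R v)"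
    using x fT V by (auto intro!: sum.mono_neutral_left)
  then have "(\<Sum>v\<in>V. lam T v x) = 1" "(\<Sum>v\<in>V. lam T v x *\<^sub>R v) = x"
    using lam_combination[OF T] by auto
  moreover have "\<forall>v\<in>V. 0 \<le> lam T v x" using x V in_hull_iff[OF T] by blast
  ultimately show "x \<in> convex hull V" 
    unfolding convex_hull_finite[OF fT(2)] by (intro CollectI exI[of _ "\<lambda>v. lam T v x"] conjI)
qed

lemma bary_eq_lam:
  assumes T: "full_simplex T" "z \<in> T" "x \<in> convex hull T"
  shows "bary T z x = lam T z x"
  unfolding bary_def
proof (rule the_equality)
  show "\<exists>u. (\<forall>v\<in>T. 0 \<le> u v) \<and> sum u T = 1 \<and> (\<Sum>v\<in>T. u v *\<^sub>R v) = x \<and> lam T z x = u z"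
    by (rule exI[of _ "\<lambda>v. lam T v x"]) (use in_hull_iff[OF T(1)] T(3) lam_combination[OF T(1)] in auto)
  show "c = lam T z x" if "\<exists>u. (\<forall>v\<in>T. 0 \<le> u v) \<and> sum u T = 1 \<and> (\<Sum>v\<in>T. u v *\<^sub>R v) = x \<and> c = u z" for c
  proof -
    from that obtain u where "sum u T = 1" "(\<Sum>v\<in>T. u v *\<^sub>R v) = x" "c = u z" by blast
    then show ?thesis using lam_unique[OF T(1) _ _ T(2)] by metis
  qed
qed

lemma lam_convex_combination:
  "lam T z ((1 - t) *\<^sub>R x + t *\<^sub>R y) = (1 - t) * lam T z x + t * lam T z y"
  by (simp add: lam_def algebra_simps inner_simps)

lemma lam_diff: "lam T z x - lam T z y = lgrad T z \<bullet> (x - y)"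
  by (simp add: lam_def inner_diff_right)

lemma lam_lipschitz: "\<bar>lam T z x - lam T z y\<bar> \<le> norm (lgrad T z) * dist x y"
  by (simp add: lam_diff Cauchy_Schwarz_ineq2 dist_norm)

lemma lam_interior:
  assumes T: "full_simplex T" and pos: "\<And>v. v \<in> T \<Longrightarrow> 0 < lam T v x"
  shows "x \<in> interior (convex hull T)"
proof -
  have "open (\<Inter>v\<in>T. {x. 0 < lam T v x})"
    unfolding lam_def using T by (intro open_INT ballI open_Collect_less continuous_intros) (auto simp: full_simplex_def)
  moreover have "(\<Inter>v\<in>T. {x. 0 < lam T v x}) \<subseteq> convex hull T"
    using in_hull_iff[OF T] by (auto intro: less_imp_le)
  ultimately show ?thesis using pos by (intro interiorI) auto
qed

section \<open>Volume, diameter and coordinate gradients of a simplex\<close>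

lemma measure_cball_le:
  fixes z :: "'a::euclidean_space"
  assumes "r \<ge> 0"
  shows "measure lebesgue (cball z r) \<le> (2 * r) ^ DIM('a)"
proof -
  let ?B = "cbox (z - r *\<^sub>R One) (z + r *\<^sub>R One)"
  have "cball z r \<subseteq> ?B"
  proof
    fix x assume "x \<in> cball z r"
    then have "\<bar>(x - z) \<bullet> i\<bar> \<le> r" if "i \<in> Basis" for i
      using Basis_le_norm[OF that, of "x - z"] by (simp add: dist_norm norm_minus_commute)
    then show "x \<in> ?B" by (force simp: mem_box inner_simps abs_le_iff)
  qed
  then have "measure lebesgue (cball z r) \<le> measure lebesgue ?B"
    by (intro measure_mono_fmeasurable) auto
  also have "\<dots> = (2 * r) ^ DIM('a)"
    using assms by (simp add: content_cbox' box_ne_empty inner_simps content_cbox)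
  finally show ?thesis .
qed

lemma hull_lmeasurable: "finite T \<Longrightarrow> convex hull T \<in> lmeasurable" for T :: "'a::euclidean_space set"
  by (simp add: lmeasurable_compact finite_imp_compact_convex_hull)

lemma simplex_diameter:
  fixes T :: "'a::euclidean_space set"
  assumes "full_simplex T"
  shows "diameter (convex hull T) = diameter T" "diameter T > 0"
    "x \<in> convex hull T \<Longrightarrow> y \<in> convex hull T \<Longrightarrow> dist x y \<le> diameter T"
proof -
  have fin: "finite T" and c: "card T \<ge> 2" using assms DIM_positive[where 'a='a] by (auto simp: full_simplex_def)
  have bT: "bounded T" using fin by (rule finite_imp_bounded)
  have d: "dist x y \<le> diameter T" if x: "x \<in> convex hull T" and y: "y \<in> convex hull T" for x y
  proof -
    have 1: "convex hull T \<subseteq> cball v (diameter T)" if "v \<in> T" for v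
      by (rule hull_minimal) (use that diameter_bounded_bound[OF bT] in auto)
    then have "T \<subseteq> cball x (diameter T)" using x by (auto simp: dist_commute subset_iff)
    then have "convex hull T \<subseteq> cball x (diameter T)" by (rule hull_minimal) auto
    then show ?thesis using y by auto
  qed
  show "x \<in> convex hull T \<Longrightarrow> y \<in> convex hull T \<Longrightarrow> dist x y \<le> diameter T" by (rule d)
  obtain v w where "v \<in> T" "w \<in> T" "v \<noteq> w" using c card_le_Suc0_iff_eq[OF fin] by force
  then show "diameter T > 0" using diameter_bounded_bound[OF bT, of v w] by (smt (verit) dist_pos_lt)
  have T0: "T \<noteq> {}" using c by auto
  show "diameter (convex hull T) = diameter T"
  proof (rule antisym)
    show "diameter T \<le> diameter (convex hull T)"
      using bounded_convex_hull[OF bT] by (intro diameter_subset hull_subset) auto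
    show "diameter (convex hull T) \<le> diameter T"
      using d T0 by (intro diameter_le) (auto simp: dist_norm)
  qed
qed

lemma simplex_interior:
  fixes T :: "'a::euclidean_space set"
  assumes "full_simplex T" shows "interior (convex hull T) \<noteq> {}"
  using assms interior_convex_hull_eq_empty[of T] by (auto simp: full_simplex_def)

lemma simplex_measure:
  fixes T :: "'a::euclidean_space set"
  assumes "full_simplex T"
  shows "measure lebesgue (convex hull T) > 0" "measure lebesgue (convex hull T) \<le> (2 * diameter T) ^ DIM('a)"
proof -
  have lm: "convex hull T \<in> lmeasurable" using assms by (intro hull_lmeasurable) (simp add: full_simplex_def)
  show "measure lebesgue (convex hull T) > 0"
  proof (rule ccontr)
    assume "\<not> ?thesis"
    then have "measure lebesgue (convex hull T) = 0" by (simp add: not_less measure_le_0_iff)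
    then have "negligible (convex hull T)" using lm by (simp add: negligible_iff_measure)
    then have "negligible (interior (convex hull T))" by (rule negligible_subset[OF _ interior_subset])
    then show False using simplex_interior[OF assms] open_not_negligible[OF open_interior] by blast
  qed
  obtain z where "z \<in> T" using assms by (auto simp: full_simplex_def) (metis all_not_in_conv card.empty nat.distinct(1))
  then have "convex hull T \<subseteq> cball z (diameter T)" using simplex_diameter(3)[OF assms] hull_inc by (metis mem_cball subsetI)
  then have "measure lebesgue (convex hull T) \<le> measure lebesgue (cball z (diameter T))"
    using lm by (intro measure_mono_fmeasurable) auto
  also have "\<dots> \<le> (2 * diameter T) ^ DIM('a)" using simplex_diameter(2)[OF assms] by (intro measure_cball_le) simp
  finally show "measure lebesgue (convex hull T) \<le> (2 * diameter T) ^ DIM('a)" .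
qed

text \<open>The translates of \<open>T\<close> by multiples of \<open>2 / norm (lgrad T z)\<close> in the direction of \<open>lgrad T z\<close>
  are disjoint, so a long gradient leaves little room for \<open>T\<close> in a ball of radius \<open>2 * diameter T\<close>.\<close>

lemma lgrad_bound:
  fixes T :: "'a::euclidean_space set"
  assumes T: "full_simplex T" "z \<in> T" and sr: "diameter T ^ DIM('a) \<le> \<kappa> * measure lebesgue (convex hull T)"
  shows "norm (lgrad T z) * diameter T \<le> 2 * 4 ^ DIM('a) * \<kappa>"
proof (cases "lgrad T z = 0")
  case True
  have "0 \<le> diameter T ^ DIM('a)" using simplex_diameter(2)[OF T(1)] by simp
  then have "0 \<le> \<kappa>" using sr simplex_measure(1)[OF T(1)] by (smt (verit) mult_neg_pos)
  then show ?thesis using True by simp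
next
  case False
  define a where "a = lgrad T z"
  \<comment> \<open>A shift by \<open>d\<close> along the unit vector of \<open>a\<close> raises the
    coordinate of \<open>z\<close> by 2, while on one copy of the simplex it varies only within an
    interval of length 1.\<close>
  define d where "d = 2 / norm a"
  define h where "h = diameter T"
  define K where "K = convex hull T"
  \<comment> \<open>Enough copies to cover a distance \<open>h\<close>, yet all shifts of copies
    with index below \<open>N\<close> are at most \<open>h\<close>, so the copies stay in the ball
    of radius \<open>2 * h\<close>.\<close>
  define N where "N = nat \<lceil>h / d\<rceil>"
  define F where "F k = (\<lambda>x. x + (real k * d / norm a) *\<^sub>R a) ` K" for k :: nat
  have na: "norm a > 0" using False by (simp add: a_def)
  have d: "d > 0" using na by (simp add: d_def)
  have h: "h > 0" using simplex_diameter(2)[OF T(1)] by (simp add: h_def)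
  have N: "h / d \<le> real N" "real N < h / d + 1" using h d by (auto simp: N_def) linarith
  have lmK: "K \<in> lmeasurable" using T(1) by (auto simp: K_def full_simplex_def intro: hull_lmeasurable)
  have Flm: "F k \<in> lmeasurable" and Fm: "measure lebesgue (F k) = measure lebesgue K" for k
    using measurable_translation[OF lmK, of "(real k * d / norm a) *\<^sub>R a"] measure_translation[of "(real k * d / norm a) *\<^sub>R a" K]
    by (auto simp: F_def add.commute)
  have lamF: "2 * real k \<le> lam T z y \<and> lam T z y \<le> 2 * real k + 1" if yF: "y \<in> F k" for y k
  proof -
    obtain x where x: "x \<in> K" "y = x + (real k * d / norm a) *\<^sub>R a" using yF by (auto simp: F_def)
    have "lam T z y - lam T z x = a \<bullet> (y - x)" by (simp add: lam_diff a_def)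
    also have "\<dots> = 2 * real k" using na by (simp add: x(2) d_def dot_square_norm power2_eq_square)
    finally show ?thesis using in_hull_iff[OF T(1)] lam_le_1[OF T] x(1) T(2) by (force simp: K_def)
  qed
  have disj: "F k \<inter> F l = {}" if "k \<noteq> l" for k l
  proof -
    have "2 * real k + 1 < 2 * real l \<or> 2 * real l + 1 < 2 * real k" using that by linarith
    then show ?thesis using lamF[of _ k] lamF[of _ l] by fastforce
  qed
  have sub: "F k \<subseteq> cball z (2 * h)" if "k < N" for k
  proof
    fix y assume "y \<in> F k"
    then obtain x where x: "x \<in> K" "y = x + (real k * d / norm a) *\<^sub>R a" by (auto simp: F_def)
    have "real k * d \<le> h"
    proof -
      have "real k + 1 \<le> real N" using that by simp
      then have "real k \<le> h / d" using N(2) by linarith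
      then show ?thesis using d by (simp add: field_simps)
    qed
    moreover have "dist x y = real k * d" using na d by (simp add: x(2) dist_norm)
    moreover have "dist z x \<le> h" using simplex_diameter(3)[OF T(1), of z x] x(1) T(2) by (simp add: K_def h_def hull_inc)
    ultimately show "y \<in> cball z (2 * h)" using dist_triangle[of z y x] by simp
  qed
  \<comment> \<open>Volume count: disjoint copies in a ball whose volume is bounded, through shape
    regularity, by a multiple of the volume of one copy.\<close>
  have "real N * measure lebesgue K = (\<Sum>k<N. measure lebesgue (F k))" by (simp add: Fm)
  also have "\<dots> = measure lebesgue (\<Union>(F ` {..<N}))"
    by (rule measure_negligible_finite_Union_image[symmetric]) (auto simp: Flm disj pairwise_def)
  also have "\<dots> \<le> measure lebesgue (cball z (2 * h))"
    by (rule measure_mono_fmeasurable) (use sub Flm in \<open>auto intro!: fmeasurableD\<close>)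
  also have "\<dots> \<le> (2 * (2 * h)) ^ DIM('a)" using h by (intro measure_cball_le) simp
  also have "\<dots> = 4 ^ DIM('a) * h ^ DIM('a)" by (simp add: power_mult_distrib)
  also have "\<dots> \<le> 4 ^ DIM('a) * (\<kappa> * measure lebesgue K)"
    using sr by (intro mult_left_mono) (auto simp: h_def K_def)
  finally have "real N * measure lebesgue K \<le> (4 ^ DIM('a) * \<kappa>) * measure lebesgue K" by simp
  then have "real N \<le> 4 ^ DIM('a) * \<kappa>" using simplex_measure(1)[OF T(1)] by (simp add: K_def)
  then have "h / d \<le> 4 ^ DIM('a) * \<kappa>" using N(1) by linarith
  then show ?thesis using na by (simp add: d_def h_def a_def field_simps)
qed

section \<open>Lipschitz boundaries\<close>

text \<open>One boundary chart with its radius and Lipschitz constant exposed, so that they can be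
  chosen independently of the boundary point.\<close>

definition graph_at :: "'a::euclidean_space set \<Rightarrow> real \<Rightarrow> real \<Rightarrow> 'a \<Rightarrow> 'a \<Rightarrow> ('a \<Rightarrow> real) \<Rightarrow> bool" where
  "graph_at \<Omega> R L z e f \<longleftrightarrow> norm e = 1 \<and> L-lipschitz_on UNIV f \<and>
     \<Omega> \<inter> ball z R = {y\<in>ball z R. y \<bullet> e < f (y - (y \<bullet> e) *\<^sub>R e)}"

text \<open>A finite subcover by charts of half radius: a ball of radius at most half a chart radius
  about any boundary point then lies in the full chart. Direction \<open>e\<close> and graph
  \<open>f\<close> still vary with the point.\<close>

lemma lipschitz_domain_uniform:
  fixes \<Omega> :: "'a::euclidean_space set"
  assumes "lipschitz_domain \<Omega>"
  shows "\<exists>R>0. \<exists>L\<ge>0. \<forall>z\<in>frontier \<Omega>. \<exists>e f. graph_at \<Omega> R L z e f"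
proof -
  have \<Omega>: "open \<Omega>" "bounded \<Omega>" and
    ex: "\<And>x. x \<in> frontier \<Omega> \<Longrightarrow> \<exists>r>0. \<exists>L e f. graph_at \<Omega> r L x e f"
    using assms unfolding lipschitz_domain_def graph_at_def by (blast, blast, meson)
  obtain r L where rL: "\<And>x. x \<in> frontier \<Omega> \<Longrightarrow> r x > 0 \<and> (\<exists>e f. graph_at \<Omega> (r x) (L x) x e f)"
    using ex by metis
  have cf: "compact (frontier \<Omega>)" using \<Omega>(2) by (rule compact_frontier_bounded)
  have "frontier \<Omega> \<subseteq> (\<Union>x\<in>frontier \<Omega>. ball x (r x / 2))" using rL by force
  then obtain D where D: "D \<subseteq> frontier \<Omega>" "finite D" "frontier \<Omega> \<subseteq> (\<Union>x\<in>D. ball x (r x / 2))"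
    using compactE_image[OF cf, of "frontier \<Omega>" "\<lambda>x. ball x (r x / 2)"] by (metis open_ball)
  define R where "R = Min (insert 1 ((\<lambda>x. r x / 2) ` D))"
  define L' where "L' = Max (insert 0 (L ` D))"
  have R: "R > 0" unfolding R_def using D rL by (subst Min_gr_iff) (auto simp: subset_iff)
  have L': "L' \<ge> 0" unfolding L'_def using D(2) by (intro Max_ge) auto
  have "\<exists>e f. graph_at \<Omega> R L' z e f" if z: "z \<in> frontier \<Omega>" for z
  proof -
    obtain x where x: "x \<in> D" "z \<in> ball x (r x / 2)" using D(3) z by blast
    obtain e f where g: "graph_at \<Omega> (r x) (L x) x e f" using rL x(1) D(1) by blast
    have "R \<le> r x / 2" unfolding R_def using D(2) x(1) by (intro Min_le) auto
    then have sub: "ball z R \<subseteq> ball x (r x)"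
      using x(2) by (auto simp: subset_iff) (smt (verit) dist_triangle field_sum_of_halves)
    have "L x \<le> L'" unfolding L'_def using D(2) x(1) by (intro Max_ge) auto
    then have "L'-lipschitz_on UNIV f" using g lipschitz_on_mono[of "L x" UNIV f UNIV L'] by (auto simp: graph_at_def)
    moreover have "\<Omega> \<inter> ball z R = {y\<in>ball z R. y \<bullet> e < f (y - (y \<bullet> e) *\<^sub>R e)}"
      using g sub unfolding graph_at_def by blast
    ultimately have "graph_at \<Omega> R L' z e f" using g by (simp add: graph_at_def)
    then show ?thesis by blast
  qed
  then show ?thesis using R L' by blast
qed

lemma norm_proj_le:
  fixes e x :: "'a::euclidean_space"
  assumes "norm e = 1" shows "norm (x - (x \<bullet> e) *\<^sub>R e) \<le> norm x"
proof (rule power2_le_imp_le)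
  have ee: "e \<bullet> e = 1" using assms by (simp add: dot_square_norm)
  show "(norm (x - (x \<bullet> e) *\<^sub>R e))\<^sup>2 \<le> (norm x)\<^sup>2"
    unfolding power2_norm_eq_inner by (simp add: inner_diff_left inner_diff_right ee inner_commute[of e x])
qed simp

lemma graph_at_closure:
  assumes g: "graph_at \<Omega> R L z e f" and y: "y \<in> closure \<Omega>" "y \<in> ball z R"
  shows "y \<bullet> e \<le> f (y - (y \<bullet> e) *\<^sub>R e)"
proof (rule ccontr)
  assume n: "\<not> ?thesis"
  have fc: "continuous_on UNIV f" using g by (auto simp: graph_at_def intro: lipschitz_on_continuous_on)
  have "open {y. f (y - (y \<bullet> e) *\<^sub>R e) < y \<bullet> e}"
    by (intro open_Collect_less continuous_intros continuous_on_compose2[OF fc]) auto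
  then have "open ({y. f (y - (y \<bullet> e) *\<^sub>R e) < y \<bullet> e} \<inter> ball z R)" by auto
  moreover have "y \<in> {y. f (y - (y \<bullet> e) *\<^sub>R e) < y \<bullet> e} \<inter> ball z R" using n y(2) by auto
  ultimately obtain w where "w \<in> \<Omega>" "w \<in> {y. f (y - (y \<bullet> e) *\<^sub>R e) < y \<bullet> e} \<inter> ball z R"
    using y(1) closure_iff_nhds_not_empty by blast
  then show False using g unfolding graph_at_def by force
qed

lemma graph_at_inside:
  assumes "graph_at \<Omega> R L z e f" "y \<in> ball z R" "y \<bullet> e < f (y - (y \<bullet> e) *\<^sub>R e)"
  shows "y \<in> \<Omega>"
  using assms unfolding graph_at_def by blast

lemma graph_at_base:
  assumes g: "graph_at \<Omega> R L z e f" and z: "z \<in> frontier \<Omega>" "R > 0" "open \<Omega>"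
  shows "f (z - (z \<bullet> e) *\<^sub>R e) = z \<bullet> e"
proof (rule antisym)
  have "z \<notin> \<Omega>" using z(1,3) by (simp add: frontier_def interior_open)
  then show "f (z - (z \<bullet> e) *\<^sub>R e) \<le> z \<bullet> e"
    using graph_at_inside[OF g, of z] z(2) by force
  show "z \<bullet> e \<le> f (z - (z \<bullet> e) *\<^sub>R e)"
    using graph_at_closure[OF g, of z] z by (simp add: frontier_def)
qed

lemma graph_at_lip:
  assumes "graph_at \<Omega> R L z e f"
  shows "\<bar>f (x - (x \<bullet> e) *\<^sub>R e) - f (y - (y \<bullet> e) *\<^sub>R e)\<bar> \<le> L * norm ((x - y) - ((x - y) \<bullet> e) *\<^sub>R e)"
proof -
  have "dist (f (x - (x \<bullet> e) *\<^sub>R e)) (f (y - (y \<bullet> e) *\<^sub>R e)) \<le> L * dist (x - (x \<bullet> e) *\<^sub>R e) (y - (y \<bullet> e) *\<^sub>R e)"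
    using assms by (intro lipschitz_onD[of L UNIV f]) (auto simp: graph_at_def)
  moreover have "dist (x - (x \<bullet> e) *\<^sub>R e) (y - (y \<bullet> e) *\<^sub>R e) = norm ((x - y) - ((x - y) \<bullet> e) *\<^sub>R e)"
    by (simp add: dist_norm algebra_simps inner_diff_left)
  ultimately show ?thesis by (simp add: dist_real_def)
qed

text \<open>Relative to the height of \<open>z\<close>, the point \<open>x\<close> lies at most
  \<open>dist x z\<close> below and the graph over it at most \<open>L * dist x z\<close> above.
  Moving up by the sum of the two leaves the domain.\<close>

lemma graph_at_exit:
  assumes g: "graph_at \<Omega> R L z e f" and z: "z \<in> frontier \<Omega>" "R > 0" "open \<Omega>" and L: "L \<ge> 0"
    and x: "x + s *\<^sub>R e \<in> ball z R" "(1 + L) * dist x z \<le> s"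
  shows "x + s *\<^sub>R e \<notin> \<Omega>"
proof
  assume "x + s *\<^sub>R e \<in> \<Omega>"
  have ee: "e \<bullet> e = 1" using g by (simp add: graph_at_def dot_square_norm)
  let ?p = "\<lambda>x. x - (x \<bullet> e) *\<^sub>R e"
  have p: "?p (x + s *\<^sub>R e) = ?p x" by (simp add: inner_add_left ee algebra_simps)
  have "(x + s *\<^sub>R e) \<bullet> e < f (?p (x + s *\<^sub>R e))"
    using g \<open>x + s *\<^sub>R e \<in> \<Omega>\<close> x(1) unfolding graph_at_def by blast
  then have "x \<bullet> e + s < f (?p x)" unfolding p by (simp add: inner_add_left ee)
  also have "f (?p x) \<le> f (?p z) + L * norm (x - z)"
    using graph_at_lip[OF g, of x z] norm_proj_le[of e "x - z"] L g
    by (smt (verit) graph_at_def mult_left_mono)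
  also have "f (?p z) = z \<bullet> e" by (rule graph_at_base[OF g z])
  also have "z \<bullet> e \<le> x \<bullet> e + norm (x - z)"
    using Cauchy_Schwarz_ineq2[of "x - z" e] g by (simp add: graph_at_def inner_diff_left abs_le_iff)
  finally show False using x(2) by (simp add: dist_norm algebra_simps)
qed

text \<open>Near a boundary point every point of the domain is connected, by moving against \<open>e\<close>, to the
  convex interior cone, without passing through \<open>z\<close>.\<close>

lemma graph_at_link:
  fixes \<Omega> :: "'a::euclidean_space set"
  assumes g: "graph_at \<Omega> R L z e f" and z: "z \<in> frontier \<Omega>" "R > 0" "open \<Omega>" and L: "L \<ge> 0"
    and \<rho>: "\<rho> > 0" "(2 + L) * \<rho> \<le> R"
  shows "\<exists>U. connected U \<and> closure \<Omega> \<inter> ball z \<rho> - {z} \<subseteq> U \<and> U \<subseteq> closure \<Omega> \<inter> ball z ((2 + L) * \<rho>) - {z}"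
proof -
  have ne: "norm e = 1" and ee: "e \<bullet> e = 1" using g by (auto simp: graph_at_def dot_square_norm)
  let ?p = "\<lambda>x. x - (x \<bullet> e) *\<^sub>R e"
  \<comment> \<open>The open cone below \<open>z\<close> with slope \<open>L\<close>. The Lipschitz
    bound puts it below the graph; it is convex and does not contain its apex.\<close>
  define W where "W = {w. (w - z) \<bullet> e + L * norm (?p (w - z)) < 0} \<inter> ball z ((2 + L) * \<rho>)"
  have sub: "ball z ((2 + L) * \<rho>) \<subseteq> ball z R" using \<rho>(2) by auto
  have zz: "f (?p z) = z \<bullet> e" by (rule graph_at_base[OF g z])
  have W1: "W \<subseteq> closure \<Omega> - {z}"
  proof
    fix w assume w: "w \<in> W"
    then have "w \<in> ball z R" using sub by (auto simp: W_def)
    moreover have "w \<bullet> e < f (?p w)"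
      using w graph_at_lip[OF g, of w z] zz by (auto simp: W_def inner_diff_left abs_le_iff)
    ultimately have "w \<in> \<Omega>" by (rule graph_at_inside[OF g])
    then show "w \<in> closure \<Omega> - {z}" using w closure_subset by (auto simp: W_def)
  qed
  have "convex W"
  proof -
    have "convex {w. (w - z) \<bullet> e + L * norm (?p (w - z)) < 0}"
    proof (rule convexI)
      fix x y :: 'a and u v :: real
      assume x: "x \<in> {w. (w - z) \<bullet> e + L * norm (?p (w - z)) < 0}" and y: "y \<in> {w. (w - z) \<bullet> e + L * norm (?p (w - z)) < 0}"
        and uv: "0 \<le> u" "0 \<le> v" "u + v = 1"
      have "u *\<^sub>R x + v *\<^sub>R y - z = u *\<^sub>R x + v *\<^sub>R y - (u + v) *\<^sub>R z" using uv by simp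
      also have "\<dots> = u *\<^sub>R (x - z) + v *\<^sub>R (y - z)" by (simp add: algebra_simps)
      finally have eq: "u *\<^sub>R x + v *\<^sub>R y - z = u *\<^sub>R (x - z) + v *\<^sub>R (y - z)" .
      have "?p (u *\<^sub>R x + v *\<^sub>R y - z) = u *\<^sub>R ?p (x - z) + v *\<^sub>R ?p (y - z)"
        unfolding eq by (simp add: inner_add_left algebra_simps)
      then have "norm (?p (u *\<^sub>R x + v *\<^sub>R y - z)) \<le> u * norm (?p (x - z)) + v * norm (?p (y - z))"
        using uv norm_triangle_ineq[of "u *\<^sub>R ?p (x - z)" "v *\<^sub>R ?p (y - z)"] by simp
      then have "L * norm (?p (u *\<^sub>R x + v *\<^sub>R y - z)) \<le> L * (u * norm (?p (x - z)) + v * norm (?p (y - z)))"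
        using L by (rule mult_left_mono)
      moreover have "(u *\<^sub>R x + v *\<^sub>R y - z) \<bullet> e = u * ((x - z) \<bullet> e) + v * ((y - z) \<bullet> e)"
        unfolding eq by (simp add: inner_add_left)
      moreover have "u * ((x - z) \<bullet> e + L * norm (?p (x - z))) + v * ((y - z) \<bullet> e + L * norm (?p (y - z))) < 0"
      proof (cases "u = 0")
        case True then show ?thesis using y uv by simp
      next
        case False
        then have "u * ((x - z) \<bullet> e + L * norm (?p (x - z))) < 0" using x uv by (simp add: mult_pos_neg)
        moreover have "v * ((y - z) \<bullet> e + L * norm (?p (y - z))) \<le> 0" using y uv by (simp add: mult_nonneg_nonpos)
        ultimately show ?thesis by linarith
      qed
      ultimately show "u *\<^sub>R x + v *\<^sub>R y \<in> {w. (w - z) \<bullet> e + L * norm (?p (w - z)) < 0}"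
        by (simp add: algebra_simps)
    qed
    then show ?thesis unfolding W_def by (intro convex_Int) auto
  qed
  then have cW: "connected W" by (rule convex_connected)
  \<comment> \<open>This descent brings every point of the ball of radius \<open>\<rho>\<close> into
    the cone; the total displacement from \<open>z\<close> is what makes
    \<open>(2 + L) * \<rho>\<close> appear.\<close>
  define s where "s = (1 + L) * \<rho>"
  have s: "s > 0" using \<rho> L by (simp add: s_def)
  define Q where "Q y = closed_segment y (y - s *\<^sub>R e) \<union> W" for y
  have Wend: "y - s *\<^sub>R e \<in> W" if y: "y \<in> ball z \<rho>" for y
  proof -
    have d: "norm (y - z) < \<rho>" using y by (simp add: dist_norm norm_minus_commute)
    have pe: "?p (y - s *\<^sub>R e - z) = ?p (y - z)" by (simp add: inner_diff_left ee algebra_simps)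
    have "(y - z) \<bullet> e \<le> norm (y - z)" using Cauchy_Schwarz_ineq2[of "y - z" e] ne by (simp add: abs_le_iff)
    moreover have "L * norm (?p (y - z)) \<le> L * norm (y - z)" using norm_proj_le[OF ne] L by (rule mult_left_mono)
    moreover have "norm (y - z) + L * norm (y - z) < s"
      using mult_strict_left_mono[OF d, of "1 + L"] L by (simp add: s_def algebra_simps)
    ultimately have "(y - s *\<^sub>R e - z) \<bullet> e + L * norm (?p (y - s *\<^sub>R e - z)) < 0"
      unfolding pe by (simp add: inner_diff_left ee)
    moreover have "norm (y - s *\<^sub>R e - z) < (2 + L) * \<rho>"
    proof -
      have "norm (y - s *\<^sub>R e - z) \<le> norm (y - z) + norm (s *\<^sub>R e)"
        using norm_triangle_ineq4[of "y - z" "s *\<^sub>R e"] by (simp add: algebra_simps)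
      also have "norm (s *\<^sub>R e) = s" using s ne by simp
      also have "norm (y - z) + s < \<rho> + s" using d by simp
      finally show ?thesis by (simp add: s_def algebra_simps)
    qed
    then have "y - s *\<^sub>R e \<in> ball z ((2 + L) * \<rho>)" by (simp add: dist_norm norm_minus_commute)
    ultimately show ?thesis by (simp add: W_def)
  qed
  have cQ: "connected (Q y)" if y: "y \<in> ball z \<rho>" for y
    unfolding Q_def using Wend[OF y] cW by (intro connected_Un) auto
  have Qsub: "Q y \<subseteq> closure \<Omega> \<inter> ball z ((2 + L) * \<rho>) - {z}" if y: "y \<in> closure \<Omega> \<inter> ball z \<rho> - {z}" for y
  proof -
    have yb: "y \<in> ball z ((2 + L) * \<rho>)" and yR: "y \<in> ball z R"
    proof -
      have "1 * \<rho> \<le> (2 + L) * \<rho>" using L \<rho> by (intro mult_right_mono) auto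
      then show "y \<in> ball z ((2 + L) * \<rho>)" using y by simp
      then show "y \<in> ball z R" using sub by blast
    qed
    have seg: "closed_segment y (y - s *\<^sub>R e) \<subseteq> ball z ((2 + L) * \<rho>)"
      using yb Wend[of y] y by (intro closed_segment_subset) (auto simp: W_def)
    have "closed_segment y (y - s *\<^sub>R e) \<subseteq> closure \<Omega> - {z}"
    proof
      fix w assume w: "w \<in> closed_segment y (y - s *\<^sub>R e)"
      then obtain t where t: "0 \<le> t" "t \<le> 1" "w = (1 - t) *\<^sub>R y + t *\<^sub>R (y - s *\<^sub>R e)" by (auto simp: in_segment)
      then have we: "w = y - (t * s) *\<^sub>R e" by (simp add: algebra_simps)
      have py: "?p w = ?p y" by (simp add: we inner_diff_left ee algebra_simps)
      have yl: "y \<bullet> e \<le> f (?p y)" using graph_at_closure[OF g _ yR] y by blast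
      show "w \<in> closure \<Omega> - {z}"
      proof (cases "t = 0")
        case True then show ?thesis using y we by simp
      next
        case False
        then have ts: "t * s > 0" using t s by simp
        \<comment> \<open>After any positive descent the point is strictly below the graph, hence in
          the open domain and different from \<open>z\<close>, which lies on the graph.\<close>
        have wl: "w \<bullet> e < f (?p w)" using yl ts by (simp only: py) (simp add: we inner_diff_left ee)
        then have "w \<in> \<Omega>" using w seg sub by (intro graph_at_inside[OF g]) auto
        moreover have "w \<noteq> z" using wl zz by auto
        ultimately show ?thesis using closure_subset by blast
      qed
    qed
    then show ?thesis using seg W1 by (auto simp: Q_def W_def)
  qed
  define U where "U = W \<union> \<Union>(Q ` (closure \<Omega> \<inter> ball z \<rho> - {z}))"
  show ?thesis
  proof (intro exI[of _ U] conjI)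
    have "z \<in> ball z \<rho>" using \<rho> by simp
    then have "W \<noteq> {}" using Wend by blast
    then obtain w where w: "w \<in> W" by blast
    have "U = \<Union>(insert W (Q ` (closure \<Omega> \<inter> ball z \<rho> - {z})))" by (simp add: U_def)
    moreover have "connected (\<Union>(insert W (Q ` (closure \<Omega> \<inter> ball z \<rho> - {z}))))"
    proof (rule connected_Union)
      show "connected S" if "S \<in> insert W (Q ` (closure \<Omega> \<inter> ball z \<rho> - {z}))" for S
        using that cW cQ by auto
      have "w \<in> \<Inter>(insert W (Q ` (closure \<Omega> \<inter> ball z \<rho> - {z})))" using w by (auto simp: Q_def)
      then show "\<Inter>(insert W (Q ` (closure \<Omega> \<inter> ball z \<rho> - {z}))) \<noteq> {}" by blast
    qed
    ultimately show "connected U" by simp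
    show "closure \<Omega> \<inter> ball z \<rho> - {z} \<subseteq> U" by (auto simp: U_def Q_def)
    show "U \<subseteq> closure \<Omega> \<inter> ball z ((2 + L) * \<rho>) - {z}"
    proof -
      have "W \<subseteq> closure \<Omega> \<inter> ball z ((2 + L) * \<rho>) - {z}" using W1 by (auto simp: W_def)
      then show ?thesis unfolding U_def using Qsub by blast
    qed
  qed
qed

section \<open>Geometry of shape-regular meshes\<close>

text \<open>\<open>R\<close> and \<open>L\<close> are the uniform chart data of the domain, and
  \<open>n\<close> names the dimension. The constants defined below refer only to the domain,
  \<open>\<kappa>\<close>, \<open>R\<close>, \<open>L\<close> and \<open>n\<close>, never to the
  mesh; the uniformity of the final constant rests on this.\<close>

locale mesh_geom =
  fixes \<Omega> :: "'a::euclidean_space set" and \<T> :: "'a set set" and \<kappa> R L :: real and n :: nat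
  assumes n: "n = DIM('a)" and dim2: "2 \<le> DIM('a)"
    and open_dom: "open \<Omega>" and bounded_dom: "bounded \<Omega>" and dom_ne: "\<Omega> \<noteq> {}"
    and R: "R > 0" and L: "L \<ge> 0" and graphs: "\<And>z. z \<in> frontier \<Omega> \<Longrightarrow> \<exists>e f. graph_at \<Omega> R L z e f"
    and mesh: "simplicial_mesh \<Omega> \<T>" and shape: "shape_regular_by \<kappa> \<T>" and \<kappa>: "\<kappa> \<ge> 1"
begin

text \<open>\<open>c1\<close> bounds a coordinate gradient times the diameter, \<open>N0\<close> the
  number of cells at a vertex, and \<open>c2\<close> the ratio of diameters of two cells at a
  vertex. The exponent in \<open>c2\<close> is the largest number of links in a chain of cells,
  counted by pairs of cells.\<close>

definition "c1 = 2 * 4 ^ n * \<kappa>"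
definition "N0 = nat \<lceil>2 ^ n * \<kappa>\<rceil>"
definition "c2 = c1 ^ (N0 * N0)"

lemma c1_ge1: "c1 \<ge> 1"
proof -
  have "1 \<le> (2 * 4 ^ n :: real)" using one_le_power[of "4::real" n] by linarith
  then have "1 * 1 \<le> (2 * 4 ^ n :: real) * \<kappa>" using \<kappa> by (intro mult_mono) auto
  then show ?thesis by (simp add: c1_def)
qed

lemma c2_ge1: "c2 \<ge> 1" unfolding c2_def using c1_ge1 by (rule one_le_power)

lemma finite_mesh: "finite \<T>" using mesh by (simp add: simplicial_mesh_def)

lemma cell: "T \<in> \<T> \<Longrightarrow> full_simplex T" using mesh by (auto simp: simplicial_mesh_def full_simplex_def)

lemma cover: "\<Union>((\<lambda>T. convex hull T) ` \<T>) = closure \<Omega>" using mesh by (simp add: simplicial_mesh_def)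

lemma cell_sub: "T \<in> \<T> \<Longrightarrow> convex hull T \<subseteq> closure \<Omega>" using cover by blast

lemma cell_inter: "A \<in> \<T> \<Longrightarrow> B \<in> \<T> \<Longrightarrow> convex hull A \<inter> convex hull B = convex hull (A \<inter> B)"
  using mesh by (simp add: simplicial_mesh_def)

lemma finite_cell: "T \<in> \<T> \<Longrightarrow> finite T" using cell by (simp add: full_simplex_def)

lemma compact_cell: "T \<in> \<T> \<Longrightarrow> compact (convex hull T)"
  using finite_cell by (simp add: finite_imp_compact_convex_hull)

lemma cell_sets: "T \<in> \<T> \<Longrightarrow> convex hull T \<in> sets lebesgue"
  by (rule fmeasurableD[OF lmeasurable_compact[OF compact_cell]])

lemma shape_cell: "T \<in> \<T> \<Longrightarrow> diameter T ^ DIM('a) \<le> \<kappa> * measure lebesgue (convex hull T)"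
  using shape by (simp add: shape_regular_by_def)

lemma diam_pos: "T \<in> \<T> \<Longrightarrow> diameter T > 0"
  using simplex_diameter(2)[OF cell] .

lemma vertex_closure: "z \<in> T \<Longrightarrow> T \<in> \<T> \<Longrightarrow> z \<in> closure \<Omega>"
  by (rule subsetD[OF cell_sub hull_inc])

text \<open>A Lipschitz domain lies on one side of its boundary: arbitrarily close above a boundary
  point there are points outside the closure. The mesh is only known to cover the closure, so this
  is what puts interiors of cells inside the domain.\<close>

lemma interior_closure: "interior (closure \<Omega>) = \<Omega>"
proof
  show "\<Omega> \<subseteq> interior (closure \<Omega>)" by (rule interior_maximal[OF closure_subset open_dom])
  show "interior (closure \<Omega>) \<subseteq> \<Omega>"
  proof
    fix z assume z: "z \<in> interior (closure \<Omega>)"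
    show "z \<in> \<Omega>"
    proof (rule ccontr)
      assume "z \<notin> \<Omega>"
      then have zf: "z \<in> frontier \<Omega>" using z interior_subset open_dom by (auto simp: frontier_def interior_open)
      obtain e f where g: "graph_at \<Omega> R L z e f" using graphs[OF zf] by blast
      have ne: "norm e = 1" and ee: "e \<bullet> e = 1" using g by (auto simp: graph_at_def dot_square_norm)
      obtain \<epsilon> where \<epsilon>: "\<epsilon> > 0" "ball z \<epsilon> \<subseteq> closure \<Omega>" using z by (auto simp: mem_interior)
      define s where "s = min \<epsilon> R / 2"
      have s: "0 < s" "s < \<epsilon>" "s < R" using \<epsilon> R by (auto simp: s_def)
      have "z + s *\<^sub>R e \<in> closure \<Omega>" "z + s *\<^sub>R e \<in> ball z R"
        using \<epsilon>(2) s ne by (auto simp: dist_norm subset_iff)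
      then have "(z + s *\<^sub>R e) \<bullet> e \<le> f ((z + s *\<^sub>R e) - ((z + s *\<^sub>R e) \<bullet> e) *\<^sub>R e)"
        by (rule graph_at_closure[OF g])
      also have "(z + s *\<^sub>R e) - ((z + s *\<^sub>R e) \<bullet> e) *\<^sub>R e = z - (z \<bullet> e) *\<^sub>R e"
        by (simp add: inner_add_left ee algebra_simps)
      finally show False using graph_at_base[OF g zf R open_dom] s by (simp add: inner_add_left ee)
    qed
  qed
qed

lemma interior_cell: "T \<in> \<T> \<Longrightarrow> interior (convex hull T) \<subseteq> \<Omega>"
  using interior_mono[OF cell_sub] interior_closure by blast

text \<open>Conformity excludes hanging nodes: otherwise \<open>z\<close> would lie on a face of
  \<open>A\<close> on which its own coordinate vanishes.\<close>

lemma vertex_in_hull: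
  assumes "z \<in> A" "A \<in> \<T>" "B \<in> \<T>" "z \<in> convex hull B" shows "z \<in> B"
proof (rule ccontr)
  assume "z \<notin> B"
  have "z \<in> convex hull A \<inter> convex hull B" using assms(4) hull_inc[OF assms(1), of convex] by simp
  then have "z \<in> convex hull (A \<inter> B)" using cell_inter[OF assms(2,3)] by simp
  then have "lam A z z = 0"
    using in_subhull_iff[OF cell[OF assms(2)], of "A \<inter> B"] \<open>z \<notin> B\<close> assms(1) by auto
  then show False using lam_vertex[OF cell[OF assms(2)] assms(1) assms(1)] by simp
qed

lemma common_face:
  assumes "A \<in> \<T>" "B \<in> \<T>" "x \<in> convex hull A" "x \<in> convex hull B" "v \<in> A - B"
  shows "lam A v x = 0"
  using in_subhull_iff[OF cell[OF assms(1)], of "A \<inter> B" x] assms cell_inter[OF assms(1,2)] by auto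

lemma lam_agree:
  assumes AB: "A \<in> \<T>" "B \<in> \<T>" "x \<in> convex hull A" "x \<in> convex hull B" "v \<in> A" "v \<in> B"
  shows "lam A v x = lam B v x"
proof -
  have fin: "finite A" "finite B" using AB finite_cell by auto
  \<comment> \<open>Coordinates at vertices outside \<open>B\<close> vanish, so what remains, filled
    up with zeros, is a system of barycentric coordinates with respect to \<open>B\<close>, and
    these are unique.\<close>
  let ?u = "\<lambda>w. if w \<in> A then lam A w x else 0"
  have z: "\<And>w. w \<in> A \<Longrightarrow> w \<notin> B \<Longrightarrow> lam A w x = 0" using common_face[OF AB(1-4)] by auto
  have "sum ?u B = sum ?u (A \<inter> B)" using fin by (intro sum.mono_neutral_right) auto
  also have "\<dots> = sum ?u A" using fin z by (intro sum.mono_neutral_left) auto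
  also have "\<dots> = 1" using lam_combination(1)[OF cell[OF AB(1)]] by simp
  finally have 1: "sum ?u B = 1" .
  have "(\<Sum>w\<in>B. ?u w *\<^sub>R w) = (\<Sum>w\<in>A\<inter>B. ?u w *\<^sub>R w)" using fin by (intro sum.mono_neutral_right) auto
  also have "\<dots> = (\<Sum>w\<in>A. ?u w *\<^sub>R w)" using fin z by (intro sum.mono_neutral_left) auto
  also have "\<dots> = (\<Sum>w\<in>A. lam A w x *\<^sub>R w)" by (intro sum.cong) auto
  also have "\<dots> = x" using lam_combination(2)[OF cell[OF AB(1)]] by simp
  finally have "?u v = lam B v x" by (intro lam_unique[OF cell[OF AB(2)] 1 _ AB(6)])
  then show ?thesis using AB(5) by simp
qed

lemma negligible_inter:
  assumes "A \<in> \<T>" "B \<in> \<T>" "A \<noteq> B"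
  shows "negligible (convex hull A \<inter> convex hull B)"
proof -
  have fin: "finite A" "finite B" and c: "card A = DIM('a) + 1" "card B = DIM('a) + 1"
    using cell[OF assms(1)] cell[OF assms(2)] by (auto simp: full_simplex_def)
  have "A \<inter> B \<noteq> A"
    using assms(3) c card_subset_eq[OF fin(2), of A] by (metis inf.absorb_iff1)
  then have "A \<inter> B \<subset> A" by auto
  then have "card (A \<inter> B) < card A" by (rule psubset_card_mono[OF fin(1)])
  then have "interior (convex hull (A \<inter> B)) = {}"
    using c fin by (intro empty_interior_convex_hull) auto
  then show ?thesis using cell_inter[OF assms(1,2)] negligible_convex_interior[of "convex hull (A \<inter> B)"] by simp
qed

lemma lgrad_cell: "T \<in> \<T> \<Longrightarrow> z \<in> T \<Longrightarrow> norm (lgrad T z) * diameter T \<le> c1"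
  using lgrad_bound[OF cell _ shape_cell, of T z] unfolding c1_def by (simp add: n)

text \<open>The coordinate starts at 1 in \<open>z\<close> and its slope is at most
  \<open>c1 / diameter T\<close>.\<close>

lemma lam_pos_near:
  assumes "T \<in> \<T>" "z \<in> T" "c1 * dist x z < diameter T"
  shows "lam T z x > 0"
proof (rule ccontr)
  assume neg: "\<not> ?thesis"
  have "\<bar>lam T z z - lam T z x\<bar> \<le> norm (lgrad T z) * dist z x" by (rule lam_lipschitz)
  then have "1 \<le> norm (lgrad T z) * dist z x"
    using lam_vertex[OF cell[OF assms(1)] assms(2,2)] neg by simp
  then have "diameter T * 1 \<le> diameter T * (norm (lgrad T z) * dist z x)"
    using diam_pos[OF assms(1)] by (intro mult_left_mono) auto
  also have "\<dots> = (norm (lgrad T z) * diameter T) * dist z x" by simp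
  also have "\<dots> \<le> c1 * dist z x" using lgrad_cell[OF assms(1,2)] by (intro mult_right_mono) auto
  finally show False using assms(3) by (simp add: dist_commute)
qed

text \<open>At the other end of the edge the coordinate of \<open>z\<close> is 0, so that end cannot
  be closer than the positivity radius.\<close>

lemma edge_length:
  assumes "T \<in> \<T>" "z \<in> T" "w \<in> T" "w \<noteq> z"
  shows "diameter T \<le> c1 * dist w z"
  using lam_pos_near[OF assms(1,2), of w] lam_vertex[OF cell[OF assms(1)] assms(2,3)] assms(4) by force

lemma finite_star: "finite (star \<T> z)" using finite_mesh by (simp add: star_def)

text \<open>Rescaled towards \<open>z\<close> to a common diameter, the cells of the star stay essentially disjoint
  subsets of one ball.\<close>

lemma card_star: "card (star \<T> z) \<le> N0"
proof (cases "star \<T> z = {}")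
  case False
  define \<rho> where "\<rho> = Min (diameter ` star \<T> z)"
  have \<rho>_le: "\<rho> \<le> diameter T" if "T \<in> star \<T> z" for T
    unfolding \<rho>_def using finite_star that by (intro Min_le) auto
  have \<rho>: "\<rho> > 0"
    unfolding \<rho>_def using finite_star False diam_pos by (subst Min_gr_iff) (auto simp: star_def)
  \<comment> \<open>Contracts each cell towards \<open>z\<close> to the smallest diameter in the
    star. A cell contracted to one of its own vertices stays inside itself.\<close>
  define t where "t T = \<rho> / diameter T" for T :: "'a set"
  define F where "F T = (\<lambda>x. t T *\<^sub>R x + (z - t T *\<^sub>R z)) ` (convex hull T)" for T
  have t: "0 < t T" "t T \<le> 1" if "T \<in> star \<T> z" for T
    using \<rho> \<rho>_le[OF that] by (auto simp: t_def)
  have Fsub: "F T \<subseteq> convex hull T" and Fball: "F T \<subseteq> cball z \<rho>" if T: "T \<in> star \<T> z" for T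
  proof -
    have TT: "T \<in> \<T>" "z \<in> T" using T by (auto simp: star_def)
    show "F T \<subseteq> convex hull T"
    proof
      fix y assume "y \<in> F T"
      then obtain x where x: "x \<in> convex hull T" "y = t T *\<^sub>R x + (z - t T *\<^sub>R z)" by (auto simp: F_def)
      then have "y = (1 - t T) *\<^sub>R z + t T *\<^sub>R x" by (simp add: algebra_simps)
      then show "y \<in> convex hull T" using x(1) hull_inc[OF TT(2), of convex] t[OF T]
        by (auto intro!: convexD[OF convex_convex_hull])
    qed
    show "F T \<subseteq> cball z \<rho>"
    proof
      fix y assume "y \<in> F T"
      then obtain x where x: "x \<in> convex hull T" "y = t T *\<^sub>R x + (z - t T *\<^sub>R z)" by (auto simp: F_def)
      have "z - y = t T *\<^sub>R (z - x)" by (simp add: x(2) algebra_simps)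
      then have "dist z y = t T * dist z x" using t[OF T] by (simp add: dist_norm)
      also have "\<dots> \<le> t T * diameter T"
        using simplex_diameter(3)[OF cell[OF TT(1)], of z x] x(1) hull_inc[OF TT(2), of convex] t[OF T] by (intro mult_left_mono) auto
      also have "\<dots> = \<rho>" using diam_pos[OF TT(1)] by (simp add: t_def)
      finally show "y \<in> cball z \<rho>" by simp
    qed
  qed
  have Fm: "measure lebesgue (F T) = t T ^ DIM('a) * measure lebesgue (convex hull T)" if "T \<in> star \<T> z" for T
    unfolding F_def using measure_lebesgue_affine[of "t T" "z - t T *\<^sub>R z" "convex hull T"] t[OF that] by simp
  have Flm: "F T \<in> lmeasurable" if "T \<in> star \<T> z" for T
  proof -
    have "compact (F T)" unfolding F_def
      using that compact_cell by (intro compact_continuous_image continuous_intros) (auto simp: star_def)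
    then show ?thesis by (rule lmeasurable_compact)
  qed
  have "real (card (star \<T> z)) * (\<rho> ^ DIM('a) / \<kappa>) \<le> (\<Sum>T\<in>star \<T> z. measure lebesgue (F T))"
  proof -
    \<comment> \<open>Shape regularity is invariant under scaling and bounds the volume of each
      contracted cell from below.\<close>
    have "\<rho> ^ DIM('a) / \<kappa> \<le> measure lebesgue (F T)" if T: "T \<in> star \<T> z" for T
    proof -
      have TT: "T \<in> \<T>" using T by (simp add: star_def)
      have "\<rho> ^ DIM('a) = t T ^ DIM('a) * diameter T ^ DIM('a)"
        using diam_pos[OF TT] by (simp add: t_def power_divide)
      also have "\<dots> \<le> t T ^ DIM('a) * (\<kappa> * measure lebesgue (convex hull T))"
        using shape_cell[OF TT] t[OF T] by (intro mult_left_mono) auto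
      finally have "\<rho> ^ DIM('a) \<le> measure lebesgue (F T) * \<kappa>" using Fm[OF T] by (simp add: mult_ac)
      then show ?thesis using \<kappa> by (subst pos_divide_le_eq) auto
    qed
    then show ?thesis using sum_bounded_below[of "star \<T> z" "\<rho> ^ DIM('a) / \<kappa>" "\<lambda>T. measure lebesgue (F T)"] by simp
  qed
  also have "\<dots> = measure lebesgue (\<Union>(F ` star \<T> z))"
  proof (rule measure_negligible_finite_Union_image[symmetric])
    show "pairwise (\<lambda>A B. negligible (F A \<inter> F B)) (star \<T> z)"
    proof (rule pairwiseI)
      fix A B assume "A \<in> star \<T> z" "B \<in> star \<T> z" "A \<noteq> B"
      then have "negligible (convex hull A \<inter> convex hull B)" "F A \<inter> F B \<subseteq> convex hull A \<inter> convex hull B"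
        using Fsub negligible_inter[of A B] by (auto simp: star_def)
      then show "negligible (F A \<inter> F B)" by (rule negligible_subset)
    qed
  qed (use finite_star Flm in auto)
  also have "\<dots> \<le> measure lebesgue (cball z \<rho>)"
    using Fball Flm finite_star by (intro measure_mono_fmeasurable) (auto intro!: sets.finite_UN fmeasurableD)
  also have "\<dots> \<le> (2 * \<rho>) ^ DIM('a)" using \<rho> by (intro measure_cball_le) simp
  finally have "real (card (star \<T> z)) * (\<rho> ^ DIM('a) / \<kappa>) \<le> (2 ^ n * \<kappa>) * (\<rho> ^ DIM('a) / \<kappa>)"
    using \<kappa> by (simp add: power_mult_distrib n)
  then have "real (card (star \<T> z)) \<le> 2 ^ n * \<kappa>"
    by (rule mult_right_le_imp_le) (use \<rho> \<kappa> in simp)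
  then show ?thesis unfolding N0_def by linarith
qed simp

lemma near_star:
  assumes z: "z \<in> A" "A \<in> \<T>"
  shows "\<exists>\<rho>>0. \<forall>B\<in>\<T>. z \<notin> B \<longrightarrow> ball z \<rho> \<inter> convex hull B = {}"
proof -
  let ?S = "\<Union>((\<lambda>B. convex hull B) ` {B\<in>\<T>. z \<notin> B})"
  have "closed ?S" using finite_mesh compact_cell by (intro closed_Union) (auto intro: compact_imp_closed)
  moreover have "z \<notin> ?S" using vertex_in_hull[OF z] by auto
  ultimately have "open (- ?S)" "z \<in> - ?S" by (auto simp only: open_Compl Compl_iff)
  then obtain \<rho> where "\<rho> > 0" "ball z \<rho> \<subseteq> - ?S" by (metis open_contains_ball)
  then show ?thesis by (intro exI[of _ \<rho>]) auto
qed

text \<open>Treats interior and boundary vertices alike: inside the domain the linking set is a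
  punctured ball, connected because the dimension is at least two.\<close>

lemma link:
  assumes z: "z \<in> closure \<Omega>"
  shows "\<exists>r>0. \<forall>\<rho>. 0 < \<rho> \<longrightarrow> \<rho> \<le> r \<longrightarrow> (\<exists>U. connected U \<and> closure \<Omega> \<inter> ball z \<rho> - {z} \<subseteq> U \<and>
     U \<subseteq> closure \<Omega> \<inter> ball z ((2 + L) * \<rho>) - {z})"
proof (cases "z \<in> \<Omega>")
  case True
  then obtain r where r: "r > 0" "ball z r \<subseteq> \<Omega>" using open_dom open_contains_ball by blast
  have "\<exists>U. connected U \<and> closure \<Omega> \<inter> ball z \<rho> - {z} \<subseteq> U \<and> U \<subseteq> closure \<Omega> \<inter> ball z ((2 + L) * \<rho>) - {z}"
    if "0 < \<rho>" "\<rho> \<le> r" for \<rho>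
  proof (intro exI[of _ "ball z \<rho> - {z}"] conjI)
    show "connected (ball z \<rho> - {z})" by (rule connected_open_delete) (use dim2 in auto)
    have "1 * \<rho> \<le> (2 + L) * \<rho>" using that L by (intro mult_right_mono) auto
    then have "ball z \<rho> \<subseteq> ball z ((2 + L) * \<rho>)" by auto
    then show "ball z \<rho> - {z} \<subseteq> closure \<Omega> \<inter> ball z ((2 + L) * \<rho>) - {z}"
      using r(2) that closure_subset[of \<Omega>] by (auto simp: subset_iff)
  qed auto
  then show ?thesis using r(1) by blast
next
  case False
  then have zf: "z \<in> frontier \<Omega>" using z open_dom by (simp add: frontier_def interior_open)
  obtain e f where g: "graph_at \<Omega> R L z e f" using graphs[OF zf] by blast
  show ?thesis
  proof (intro exI[of _ "R / (2 + L)"] conjI allI impI)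
    show "0 < R / (2 + L)" using R L by simp
    fix \<rho> assume "0 < \<rho>" "\<rho> \<le> R / (2 + L)"
    then show "\<exists>U. connected U \<and> closure \<Omega> \<inter> ball z \<rho> - {z} \<subseteq> U \<and> U \<subseteq> closure \<Omega> \<inter> ball z ((2 + L) * \<rho>) - {z}"
      using L by (intro graph_at_link[OF g zf R open_dom L]) (auto simp: field_simps)
  qed
qed

lemma point_near_vertex:
  assumes A: "A \<in> \<T>" "z \<in> A" and "\<rho> > 0"
  shows "\<exists>x\<in>convex hull A. x \<in> ball z \<rho> - {z}"
proof -
  have "card A \<ge> 2" using cell[OF A(1)] dim2 by (simp add: full_simplex_def)
  then have "A \<noteq> {z}" by auto
  then obtain w where w: "w \<in> A" "w \<noteq> z" using A(2) by blast
  define s where "s = min 1 (\<rho> / (2 * dist z w))"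
  have s: "0 < s" "s \<le> 1" using w assms(3) by (auto simp: s_def)
  have "s * dist z w \<le> \<rho> / (2 * dist z w) * dist z w" unfolding s_def by (intro mult_right_mono) auto
  also have "\<dots> < \<rho>" using w(2) assms(3) by simp
  finally have sd: "s * dist z w < \<rho>" .
  let ?x = "(1 - s) *\<^sub>R z + s *\<^sub>R w"
  have "?x \<in> convex hull A" using s w(1) A(2) hull_inc[of _ A convex] by (intro convexD[OF convex_convex_hull]) auto
  moreover have "z - ?x = s *\<^sub>R (z - w)" by (simp add: algebra_simps)
  then have "dist z ?x = s * dist z w" using s by (simp add: dist_norm)
  then have "?x \<in> ball z \<rho> - {z}" using sd s w(2) by auto
  ultimately show ?thesis by blast
qed

text \<open>A second common vertex gives a common edge at \<open>z\<close>; its length is at least a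
  fraction of one diameter and at most the other.\<close>

lemma comparable_step:
  assumes "A \<in> \<T>" "B \<in> \<T>" "z \<in> A" "z \<in> B" "A \<inter> B \<noteq> {z}"
  shows "diameter A \<le> c1 * diameter B"
proof -
  obtain w where w: "w \<in> A" "w \<in> B" "w \<noteq> z" using assms by auto
  have "diameter A \<le> c1 * dist w z" using edge_length assms w by auto
  also have "\<dots> \<le> c1 * diameter B"
    using simplex_diameter(3)[OF cell[OF assms(2)]] w assms(4) c1_ge1 hull_inc[of _ B convex] by (intro mult_left_mono) auto
  finally show ?thesis .
qed

text \<open>The cells of a star are chained by cells sharing an edge at \<open>z\<close>: otherwise the punctured
  neighbourhood of \<open>z\<close> in the closed domain would be disconnected.\<close>

lemma comparable:
  assumes A: "A \<in> \<T>" "z \<in> A" and B: "B \<in> \<T>" "z \<in> B"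
  shows "diameter A \<le> c2 * diameter B"
proof -
  \<comment> \<open>Two cells are linked if they share more than the vertex
    \<open>z\<close>.\<close>
  define E where "E = {(A, B). A \<in> star \<T> z \<and> B \<in> star \<T> z \<and> A \<inter> B \<noteq> {z}}"
  have Esub: "E \<subseteq> star \<T> z \<times> star \<T> z" by (auto simp: E_def)
  then have finE: "finite E" using finite_star finite_subset by blast
  have "card E \<le> card (star \<T> z \<times> star \<T> z)" using Esub finite_star by (intro card_mono) auto
  also have "\<dots> \<le> N0 * N0" using card_star[of z] by (simp add: card_cartesian_product mult_le_mono)
  finally have cE: "card E \<le> N0 * N0" .
  define Q where "Q = {C\<in>star \<T> z. (A, C) \<in> E\<^sup>*}"
  have "star \<T> z - Q = {}"
  proof (rule ccontr)
    assume "star \<T> z - Q \<noteq> {}"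
    then obtain C where C: "C \<in> star \<T> z - Q" by blast
    obtain \<rho>0 where \<rho>0: "\<rho>0 > 0" "\<And>B. B \<in> \<T> \<Longrightarrow> z \<notin> B \<Longrightarrow> ball z \<rho>0 \<inter> convex hull B = {}"
      using near_star[OF A(2,1)] by blast
    obtain r where r: "r > 0" "\<And>\<rho>. 0 < \<rho> \<Longrightarrow> \<rho> \<le> r \<Longrightarrow> \<exists>U. connected U \<and> closure \<Omega> \<inter> ball z \<rho> - {z} \<subseteq> U \<and>
     U \<subseteq> closure \<Omega> \<inter> ball z ((2 + L) * \<rho>) - {z}" using link[OF vertex_closure[OF A(2,1)]] by blast
    define \<rho> where "\<rho> = min r (\<rho>0 / (2 + L))"
    have \<rho>: "0 < \<rho>" "\<rho> \<le> r" using r(1) \<rho>0(1) L by (auto simp: \<rho>_def)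
    have "(2 + L) * \<rho> \<le> (2 + L) * (\<rho>0 / (2 + L))" unfolding \<rho>_def using L by (intro mult_left_mono) auto
    then have \<rho>': "(2 + L) * \<rho> \<le> \<rho>0" using L by simp
    obtain U where U: "connected U" "closure \<Omega> \<inter> ball z \<rho> - {z} \<subseteq> U" "U \<subseteq> closure \<Omega> \<inter> ball z ((2 + L) * \<rho>) - {z}"
      using r(2)[OF \<rho>] by blast
    define X where "X = \<Union>((\<lambda>B. convex hull B) ` Q)"
    define Y where "Y = \<Union>((\<lambda>B. convex hull B) ` (star \<T> z - Q))"
    have "closed X" "closed Y" unfolding X_def Y_def Q_def using finite_star compact_cell
      by (auto intro!: closed_Union compact_imp_closed simp: star_def finite_mesh)
    moreover have "U \<subseteq> X \<union> Y"
    proof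
      fix x assume x: "x \<in> U"
      then have "x \<in> closure \<Omega>" "x \<in> ball z \<rho>0" using U(3) \<rho>' by auto
      then obtain D where D: "D \<in> \<T>" "x \<in> convex hull D" using cover by blast
      then have "z \<in> D" using \<rho>0(2)[of D] \<open>x \<in> ball z \<rho>0\<close> by blast
      then have "D \<in> star \<T> z" using D by (simp add: star_def)
      then show "x \<in> X \<union> Y" using D(2) by (auto simp: X_def Y_def)
    qed
    moreover have "X \<inter> Y \<inter> U = {}"
    proof (rule ccontr)
      assume "X \<inter> Y \<inter> U \<noteq> {}"
      then obtain x D F where x: "x \<in> U" "D \<in> Q" "F \<in> star \<T> z - Q" "x \<in> convex hull D" "x \<in> convex hull F"
        by (auto simp: X_def Y_def)
      then have DF: "D \<in> \<T>" "F \<in> \<T>" "D \<in> star \<T> z" "F \<in> star \<T> z" by (auto simp: Q_def star_def)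
      have "D \<inter> F = {z}"
      proof (rule ccontr)
        assume "D \<inter> F \<noteq> {z}"
        then have "(D, F) \<in> E" using DF by (simp add: E_def)
        then have "F \<in> Q" using x(2) DF(4) by (auto simp: Q_def intro: rtrancl_into_rtrancl)
        then show False using x(3) by blast
      qed
      then have "x \<in> convex hull {z}" using cell_inter[OF DF(1,2)] x(4,5) by auto
      then show False using x(1) U(3) by auto
    qed
    moreover have "X \<inter> U \<noteq> {}"
    proof -
      obtain x where "x \<in> convex hull A" "x \<in> ball z \<rho> - {z}" using point_near_vertex[OF A \<rho>(1)] by blast
      moreover have "A \<in> Q" using A by (simp add: Q_def star_def)
      ultimately have "x \<in> X" "x \<in> U" using U(2) cell_sub[OF A(1)] unfolding X_def by blast+
      then show ?thesis by blast
    qed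
    moreover have "Y \<inter> U \<noteq> {}"
    proof -
      have CC: "C \<in> \<T>" "z \<in> C" using C by (auto simp: star_def)
      obtain x where "x \<in> convex hull C" "x \<in> ball z \<rho> - {z}" using point_near_vertex[OF CC \<rho>(1)] by blast
      then have "x \<in> Y" "x \<in> U" using U(2) cell_sub[OF CC(1)] C unfolding Y_def by blast+
      then show ?thesis by blast
    qed
    ultimately show False using U(1) unfolding connected_closed by blast
  qed
  then have "(A, B) \<in> E\<^sup>*" using B by (auto simp: Q_def star_def)
  \<comment> \<open>A path in a finite relation can be shortened to at most as many steps as the
    relation has pairs.\<close>
  then obtain k where k: "k \<le> card E" "(A, B) \<in> E ^^ k"
    using rtrancl_finite_eq_relpow[OF finE] by auto
  have "(A, B) \<in> E ^^ k \<Longrightarrow> diameter A \<le> c1 ^ k * diameter B" for k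
  proof (induction k arbitrary: B)
    case (Suc k)
    then obtain D where D: "(A, D) \<in> E ^^ k" "(D, B) \<in> E" by auto
    have "diameter A \<le> c1 ^ k * diameter D" by (rule Suc.IH[OF D(1)])
    also have "\<dots> \<le> c1 ^ k * (c1 * diameter B)"
      using D(2) c1_ge1 comparable_step[of D B z] by (intro mult_left_mono) (auto simp: E_def star_def)
    finally show ?case by (simp add: mult_ac)
  qed simp
  then have "diameter A \<le> c1 ^ k * diameter B" using k(2) by blast
  also have "\<dots> \<le> c2 * diameter B" unfolding c2_def
    using k(1) cE c1_ge1 diam_pos[OF B(1)] by (intro mult_right_mono power_increasing) auto
  finally show ?thesis .
qed

end

section \<open>The star as a neighbourhood of its vertex\<close>

context mesh_geom
begin

definition "starset z = \<Union>((\<lambda>T. convex hull T) ` star \<T> z)"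
text \<open>After enlargement by the factor \<open>2 + L\<close> of the linking argument, the ball
  of radius \<open>c3 * diameter T\<close> must still fit into a chart and into the region where the
  coordinate of the vertex is positive on all cells of the star. The minimum expresses these two
  demands; dividing \<open>R\<close> by the diameter of the domain makes the first one uniform in
  \<open>T\<close>.\<close>

definition "c3 = min (R / diameter (closure \<Omega>)) (1 / (c1 * c2)) / (2 + L)"

lemma starI: "z \<in> T \<Longrightarrow> T \<in> \<T> \<Longrightarrow> T \<in> star \<T> z" by (simp add: star_def)

lemma starset_cell: "z \<in> T \<Longrightarrow> T \<in> \<T> \<Longrightarrow> convex hull T \<subseteq> starset z"
  by (auto simp: starset_def star_def)

lemma closed_starset: "closed (starset z)"
  unfolding starset_def using finite_star compact_cell
  by (intro closed_Union) (auto simp: star_def intro: compact_imp_closed)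

lemma starset_sets: "starset z \<in> sets lebesgue" using closed_starset by auto

lemma bounded_closure_dom: "bounded (closure \<Omega>)" using bounded_dom by (rule bounded_closure)

lemma diam_le: "T \<in> \<T> \<Longrightarrow> diameter T \<le> diameter (closure \<Omega>)"
  using simplex_diameter(1)[OF cell, of T] diameter_subset[OF cell_sub bounded_closure_dom, of T] by simp

lemma mesh_ne: "\<T> \<noteq> {}"
proof
  assume "\<T> = {}"
  then have "closure \<Omega> = {}" using cover by simp
  then show False using dom_ne by simp
qed

lemma diam_dom_pos: "diameter (closure \<Omega>) > 0"
  using mesh_ne diam_le diam_pos by (metis all_not_in_conv less_le_trans)

lemma c12: "c1 * c2 \<ge> 1" using mult_mono[OF c1_ge1 c2_ge1] c1_ge1 by simp

lemma c3_pos: "c3 > 0"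
  unfolding c3_def using R L diam_dom_pos c12 by (intro divide_pos_pos) auto

lemma c3_R: "T \<in> \<T> \<Longrightarrow> (2 + L) * (c3 * diameter T) \<le> R"
proof -
  assume T: "T \<in> \<T>"
  have "(2 + L) * (c3 * diameter T) = min (R / diameter (closure \<Omega>)) (1 / (c1 * c2)) * diameter T"
    using L by (simp add: c3_def)
  also have "\<dots> \<le> R / diameter (closure \<Omega>) * diameter (closure \<Omega>)"
    using diam_le[OF T] diam_pos[OF T] R diam_dom_pos by (intro mult_mono) auto
  finally show ?thesis using diam_dom_pos by simp
qed

lemma c3_rad: "T \<in> \<T> \<Longrightarrow> (2 + L) * (c3 * diameter T) \<le> diameter T / (c1 * c2)"
proof -
  assume T: "T \<in> \<T>"
  have "(2 + L) * (c3 * diameter T) = min (R / diameter (closure \<Omega>)) (1 / (c1 * c2)) * diameter T"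
    using L by (simp add: c3_def)
  also have "\<dots> \<le> 1 / (c1 * c2) * diameter T"
    using diam_pos[OF T] by (intro mult_right_mono) auto
  finally show ?thesis by simp
qed

lemma c3_le: "c3 \<le> 1/2"
proof -
  have "min (R / diameter (closure \<Omega>)) (1 / (c1 * c2)) \<le> 1" using c12 by (simp add: min_le_iff_disj)
  then have "c3 \<le> 1 / (2 + L)" unfolding c3_def using L by (intro divide_right_mono) auto
  also have "\<dots> \<le> 1 / 2" using L by (intro divide_left_mono) auto
  finally show ?thesis .
qed

lemma srad_less_rad:
  assumes "T \<in> \<T>" shows "c3 * diameter T < diameter T / (c1 * c2)"
proof -
  have p: "c3 * diameter T > 0" using c3_pos diam_pos[OF assms] by simp
  have "1 * (c3 * diameter T) < (2 + L) * (c3 * diameter T)" using L p by (intro mult_strict_right_mono) auto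
  then show ?thesis using c3_rad[OF assms] by simp
qed

text \<open>One radius, taken from a single cell \<open>T\<close>, serves every cell
  \<open>K\<close> of the star because \<open>c2\<close> compares their diameters.\<close>

lemma lam_pos_star:
  assumes T: "z \<in> T" "T \<in> \<T>" and K: "K \<in> star \<T> z" and x: "x \<in> ball z (diameter T / (c1 * c2))"
  shows "lam K z x > 0"
proof (rule lam_pos_near)
  show "K \<in> \<T>" "z \<in> K" using K by (auto simp: star_def)
  have "c1 * dist x z < c1 * (diameter T / (c1 * c2))"
    using x c1_ge1 by (intro mult_strict_left_mono) (auto simp: dist_commute)
  also have "\<dots> = diameter T / c2" using c1_ge1 by simp
  also have "\<dots> \<le> diameter K"
    using comparable[OF T(2,1), of K] K c2_ge1 by (simp add: star_def field_simps)
  finally show "c1 * dist x z < diameter K" .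
qed

text \<open>Within this ball the star does not touch cells avoiding \<open>z\<close>: a common point
  would lie on a face on which the coordinate of \<open>z\<close> vanishes.\<close>

lemma near_vertex_in_star:
  assumes T: "z \<in> T" "T \<in> \<T>" and x: "x \<in> ball z (diameter T / (c1 * c2))"
    and "x \<in> starset z" and A: "A \<in> \<T>" "x \<in> convex hull A"
  shows "z \<in> A"
proof (rule ccontr)
  assume "z \<notin> A"
  obtain K where K: "K \<in> star \<T> z" "x \<in> convex hull K" using \<open>x \<in> starset z\<close> by (auto simp: starset_def)
  have "lam K z x = 0" by (rule common_face[of K A]) (use K A \<open>z \<notin> A\<close> in \<open>auto simp: star_def\<close>)
  then show False using lam_pos_star[OF T K(1) x] by simp
qed

text \<open>Interiority is constant along the ray from an interior vertex \<open>z\<close> up to the face of \<open>K\<close>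
  opposite to \<open>z\<close>, since the local cones of the mesh along the ray agree.\<close>

lemma ray_interior:
  assumes K: "z \<in> K" "K \<in> \<T>" and z: "z \<in> \<Omega>" and w: "w \<in> convex hull K" "lam K z w > 0"
  shows "w \<in> \<Omega>"
proof -
  obtain r where r: "r > 0" "ball z r \<subseteq> \<Omega>" using z open_dom open_contains_ball by blast
  \<comment> \<open>Moves from \<open>w\<close> so far towards \<open>z\<close> that the point
    \<open>x\<close> falls into a ball about \<open>z\<close> known to lie in the domain.\<close>
  define s where "s = min 1 (r / (2 * (dist z w + 1)))"
  have d1: "dist z w + 1 > 0" by (meson add_nonneg_pos zero_le_dist zero_less_one)
  have s: "0 < s" "s \<le> 1" using r(1) d1 by (auto simp: s_def)
  define x where "x = (1 - s) *\<^sub>R z + s *\<^sub>R w"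
  have "dist z x = s * dist z w"
  proof -
    have "z - x = s *\<^sub>R (z - w)" by (simp add: x_def algebra_simps)
    then show ?thesis using s by (simp add: dist_norm)
  qed
  also have "\<dots> \<le> s * (dist z w + 1)" using s by (intro mult_left_mono) auto
  also have "\<dots> \<le> r / (2 * (dist z w + 1)) * (dist z w + 1)" using d1 by (intro mult_right_mono) (auto simp: s_def)
  also have "r / (2 * m) * m = r / 2" if "m > 0" for m using that by simp
  note this[OF d1]
  finally have "x \<in> \<Omega>" using r by (auto simp: subset_iff)
  have xK: "x \<in> convex hull K" unfolding x_def
    using w(1) hull_inc[OF K(1), of convex] s by (intro convexD[OF convex_convex_hull]) auto
  \<comment> \<open>Near \<open>x\<close> only the cells through \<open>x\<close> occur; these are
    the cells whose cones are compared at \<open>x\<close> and at \<open>w\<close>.\<close>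
  define J where "J = {A\<in>\<T>. x \<in> convex hull A}"
  let ?S = "\<Union>((\<lambda>B. convex hull B) ` (\<T> - J))"
  have "closed ?S" using finite_mesh compact_cell by (intro closed_Union) (auto intro: compact_imp_closed)
  then have "open (\<Omega> - ?S)" using open_dom by (rule open_Diff[rotated])
  moreover have "x \<in> \<Omega> - ?S" using \<open>x \<in> \<Omega>\<close> by (auto simp: J_def)
  ultimately obtain \<epsilon> where \<epsilon>: "\<epsilon> > 0" "ball x \<epsilon> \<subseteq> \<Omega> - ?S" by (metis open_contains_ball)
  have inJ: "\<exists>A\<in>J. y \<in> convex hull A" if "y \<in> ball x \<epsilon>" for y
  proof -
    have "y \<in> \<Omega>" "y \<notin> ?S" using \<epsilon>(2) that by auto
    moreover obtain A where "A \<in> \<T>" "y \<in> convex hull A" using cover closure_subset[of \<Omega>] \<open>y \<in> \<Omega>\<close> by blast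
    ultimately show ?thesis by blast
  qed
  define \<mu> where "\<mu> = lam K z w"
  have \<mu>: "0 < \<mu>" "\<mu> \<le> 1" using w lam_le_1[OF cell[OF K(2)] K(1) w(1)] by (auto simp: \<mu>_def)
  \<comment> \<open>The coordinate of \<open>z\<close> at \<open>w\<close> is \<open>\<mu>\<close>.
    Copying a perturbation \<open>u\<close> of \<open>x\<close> to \<open>w\<close> with factor
    \<open>\<delta>\<close> lowers it by at most \<open>\<delta>\<close>, so half of
    \<open>\<mu>\<close> keeps it nonnegative. The other coordinates vanish at \<open>z\<close>, so
    at \<open>x\<close> they are \<open>s\<close> times their values at \<open>w\<close> and also
    stay nonnegative.\<close>
  define \<delta> where "\<delta> = \<mu> / 2"
  have \<delta>: "0 < \<delta>" "\<delta> \<le> 1" using \<mu> by (auto simp: \<delta>_def)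
  have lamx: "lam A v x = (1 - s) * lam A v z + s * lam A v w" for A v
    unfolding x_def by (rule lam_convex_combination)
  have "ball w (\<delta> * \<epsilon>) \<subseteq> closure \<Omega>"
  proof
    fix y assume y: "y \<in> ball w (\<delta> * \<epsilon>)"
    define u where "u = (1 / \<delta>) *\<^sub>R (y - w)"
    have yu: "y = w + \<delta> *\<^sub>R u" using \<delta> by (simp add: u_def)
    have "norm u = dist w y / \<delta>" using \<delta> by (simp add: u_def dist_norm norm_minus_commute)
    also have "\<dots> < \<epsilon>" using y \<delta> by (simp add: field_simps)
    finally have "x + u \<in> ball x \<epsilon>" by (simp add: dist_norm)
    then obtain A where A: "A \<in> J" "x + u \<in> convex hull A" using inJ by blast
    have AT: "A \<in> \<T>" and xA: "x \<in> convex hull A" using A(1) by (auto simp: J_def)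
    have "lam K z x = (1 - s) + s * \<mu>" using lamx[of K z] lam_vertex[OF cell[OF K(2)] K(1,1)] by (simp add: \<mu>_def)
    then have "lam K z x > 0" using s \<mu> by (smt (verit) mult_pos_pos)
    then have zA: "z \<in> A" using common_face[OF K(2) AT xK xA, of z] K(1) by force
    have "lam K v w = 0" if v: "v \<in> K - A" for v
    proof -
      have "lam K v x = 0" by (rule common_face[OF K(2) AT xK xA v])
      moreover have "lam K v z = 0" using lam_vertex[OF cell[OF K(2)], of v z] v K(1) zA by auto
      ultimately show ?thesis using lamx[of K v] s by simp
    qed
    \<comment> \<open>The face of \<open>K\<close> in which \<open>x\<close> lies contains the whole
      ray, so \<open>w\<close> belongs to the same cell \<open>A\<close> as
      \<open>x\<close>.\<close>
    then have "w \<in> convex hull (K \<inter> A)" using in_subhull_iff[OF cell[OF K(2)], of "K \<inter> A" w] w(1) by auto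
    then have wA: "w \<in> convex hull A" using hull_mono[of "K \<inter> A" A convex] by blast
    have "lam A v y \<ge> 0" if v: "v \<in> A" for v
    proof -
      have eq: "lam A v y = lam A v w + \<delta> * (lam A v (x + u) - lam A v x)"
        by (simp add: lam_def yu inner_simps algebra_simps)
      have xu: "lam A v (x + u) \<ge> 0" and w0: "lam A v w \<ge> 0" using A(2) wA v in_hull_iff[OF cell[OF AT]] by auto
      show ?thesis
      proof (cases "v = z")
        case False
        have "lam A v x = s * lam A v w" using lamx[of A v] lam_vertex[OF cell[OF AT] v zA] False by simp
        then have "lam A v y = (1 - \<delta> * s) * lam A v w + \<delta> * lam A v (x + u)" using eq by (simp add: algebra_simps)
        moreover have "\<delta> * s \<le> 1" using \<delta> s by (simp add: mult_le_one)
        ultimately show ?thesis using xu w0 \<delta> by simp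
      next
        case True
        have "lam A z w = \<mu>" using lam_agree[OF K(2) AT w(1) wA K(1) zA] by (simp add: \<mu>_def)
        moreover have "lam A z x \<le> 1" using lam_le_1[OF cell[OF AT] zA xA] .
        moreover have "\<delta> * (lam A z (x + u) - lam A z x) \<ge> \<delta> * (- 1)"
          using xu \<open>lam A z x \<le> 1\<close> \<delta> True by (intro mult_left_mono) auto
        ultimately show ?thesis using eq True \<mu> by (simp add: \<delta>_def)
      qed
    qed
    then have "y \<in> convex hull A" using in_hull_iff[OF cell[OF AT]] by blast
    then show "y \<in> closure \<Omega>" using cell_sub[OF AT] by blast
  qed
  then have "w \<in> interior (closure \<Omega>)" using \<epsilon>(1) \<delta>(1) by (auto simp: mem_interior intro!: exI[of _ "\<delta> * \<epsilon>"])
  then show ?thesis using interior_closure by simp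
qed

text \<open>The part of the ball filled by the star is closed. It is also open, because its points
  lie in the open domain and away from all cells that avoid \<open>z\<close>. A ball is connected,
  so the star fills it.\<close>

lemma interior_ball:
  assumes T: "z \<in> T" "T \<in> \<T>" and z: "z \<in> \<Omega>"
  shows "ball z (diameter T / (c1 * c2)) \<subseteq> \<Omega> \<inter> starset z"
proof -
  let ?B = "ball z (diameter T / (c1 * c2))"
  let ?S = "\<Union>((\<lambda>B. convex hull B) ` {B\<in>\<T>. z \<notin> B})"
  define Z where "Z = ?B \<inter> starset z"
  have inO: "w \<in> \<Omega>" if w: "w \<in> Z" for w
  proof -
    obtain K where K: "K \<in> star \<T> z" "w \<in> convex hull K" using w by (auto simp: Z_def starset_def)
    have "lam K z w > 0" by (rule lam_pos_star[OF T K(1)]) (use w in \<open>simp add: Z_def\<close>)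
    then show ?thesis using ray_interior[of z K w] K z by (auto simp: star_def)
  qed
  have cS: "closed ?S" using finite_mesh compact_cell by (intro closed_Union) (auto intro: compact_imp_closed)
  have "Z = ?B \<inter> (\<Omega> - ?S)"
  proof
    show "Z \<subseteq> ?B \<inter> (\<Omega> - ?S)"
      using inO near_vertex_in_star[OF T] by (auto simp: Z_def)
    show "?B \<inter> (\<Omega> - ?S) \<subseteq> Z"
    proof
      fix w assume w: "w \<in> ?B \<inter> (\<Omega> - ?S)"
      then obtain A where "A \<in> \<T>" "w \<in> convex hull A" using cover closure_subset[of \<Omega>] by blast
      then show "w \<in> Z" using w by (auto simp: Z_def starset_def star_def)
    qed
  qed
  then have "open Z" using open_Int[OF open_ball open_Diff[OF open_dom cS]] by metis
  then have "openin (top_of_set ?B) Z" by (simp add: Z_def openin_open_eq)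
  moreover have "closedin (top_of_set ?B) Z"
    unfolding Z_def by (rule closedin_closed_Int[OF closed_starset])
  moreover have "z \<in> Z" using T diam_pos[OF T(2)] c12 hull_inc[OF T(1), of convex] starset_cell[OF T] by (auto simp: Z_def)
  ultimately have "Z = ?B" using connected_ball[of z] unfolding connected_clopen by blast
  then show ?thesis using inO Z_def by blast
qed

text \<open>At a boundary vertex the ball is replaced by the connected linking set: the star and the
  union of the other cells are closed, cover it and are disjoint on it, and the star meets
  it.\<close>

lemma star_nbhd:
  assumes T: "z \<in> T" "T \<in> \<T>"
  shows "closure \<Omega> \<inter> ball z (c3 * diameter T) \<subseteq> starset z"
proof (cases "z \<in> \<Omega>")
  case True
  have "ball z (c3 * diameter T) \<subseteq> ball z (diameter T / (c1 * c2))"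
    using srad_less_rad[OF T(2)] by (intro subset_ball) simp
  then show ?thesis using interior_ball[OF T True] by blast
next
  case False
  then have zf: "z \<in> frontier \<Omega>" using vertex_closure[OF T] open_dom by (simp add: frontier_def interior_open)
  obtain e f where g: "graph_at \<Omega> R L z e f" using graphs[OF zf] by blast
  let ?\<rho> = "c3 * diameter T"
  have \<rho>: "?\<rho> > 0" using c3_pos diam_pos[OF T(2)] by simp
  obtain U where U: "connected U" "closure \<Omega> \<inter> ball z ?\<rho> - {z} \<subseteq> U" "U \<subseteq> closure \<Omega> \<inter> ball z ((2 + L) * ?\<rho>) - {z}"
    using graph_at_link[OF g zf R open_dom L \<rho> c3_R[OF T(2)]] by blast
  have Urad: "U \<subseteq> closure \<Omega> \<inter> ball z (diameter T / (c1 * c2))"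
    using U(3) subset_ball[OF c3_rad[OF T(2)], of z] by blast
  let ?S = "\<Union>((\<lambda>B. convex hull B) ` {B\<in>\<T>. z \<notin> B})"
  have cS: "closed ?S" using finite_mesh compact_cell by (intro closed_Union) (auto intro: compact_imp_closed)
  have "closure \<Omega> = starset z \<union> ?S" unfolding cover[symmetric] by (auto simp: starset_def star_def)
  then have 1: "U \<subseteq> starset z \<union> ?S" using Urad by blast
  have 2: "starset z \<inter> ?S \<inter> U = {}" using near_vertex_in_star[OF T] Urad by blast
  obtain x where "x \<in> convex hull T" "x \<in> ball z ?\<rho> - {z}" using point_near_vertex[OF T(2,1) \<rho>] by blast
  then have 3: "starset z \<inter> U \<noteq> {}" using U(2) cell_sub[OF T(2)] starset_cell[OF T] by blast
  have "?S \<inter> U = {}"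
    using U(1) closed_starset cS 1 2 3 unfolding connected_closed by blast
  then show ?thesis using 1 U(2) starset_cell[OF T] hull_inc[OF T(1), of convex] by blast
qed

text \<open>Read backwards, halving the distance to \<open>z\<close> does not bring an outside point
  into the closed domain. Doubling from the midpoint doubles the coordinates other than that of
  \<open>z\<close>, which themselves stay nonnegative, while the coordinate of \<open>z\<close> is
  positive throughout this ball.\<close>

lemma dil_outside:
  assumes T: "z \<in> T" "T \<in> \<T>" and x: "x \<in> ball z (c3 * diameter T)" "dil (1/2) z x \<in> closure \<Omega>"
  shows "x \<in> closure \<Omega>"
proof -
  let ?y = "dil (1/2) z x"
  have "dist z ?y = dist z x / 2" by (simp add: dil_def dist_norm norm_minus_commute)
  also have "\<dots> \<le> dist z x" by simp
  finally have "?y \<in> ball z (c3 * diameter T)" using x(1) by simp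
  then obtain K where K: "K \<in> star \<T> z" "?y \<in> convex hull K" using star_nbhd[OF T] x(2) by (auto simp: starset_def)
  have KT: "K \<in> \<T>" "z \<in> K" using K by (auto simp: star_def)
  have x2: "x = 2 *\<^sub>R ?y - z" by (simp add: dil_def scaleR_2 algebra_simps)
  have "lam K v x \<ge> 0" if v: "v \<in> K" for v
  proof (cases "v = z")
    case True
    have "x \<in> ball z (diameter T / (c1 * c2))" using x(1) srad_less_rad[OF T(2)] by simp
    then show ?thesis using lam_pos_star[OF T K(1)] True by (simp add: less_imp_le)
  next
    case False
    have "lam K v x = 2 * lam K v ?y - lam K v z"
      by (subst x2) (simp add: lam_def inner_simps algebra_simps)
    also have "lam K v z = 0" using lam_vertex[OF cell[OF KT(1)] v KT(2)] False by simp
    finally show ?thesis using in_hull_iff[OF cell[OF KT(1)], of ?y] K(2) v by simp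
  qed
  then have "x \<in> convex hull K" using in_hull_iff[OF cell[OF KT(1)]] by blast
  then show ?thesis using cell_sub[OF KT(1)] by blast
qed

text \<open>The Poincare constants of a star and of a cell. The factor 288 is twice the 144 of
  \<open>H1_poincare_star\<close>; the powers are the ratios of outer to inner radius,
  \<open>c2 / c3\<close> at a vertex and \<open>2 * (real n + 1) * c1\<close> at a
  barycentre.\<close>

definition "cA = 288 * 2 ^ n * c2\<^sup>2 * (c2 / c3) ^ n"
definition "cT = 288 * 2 ^ n * (2 * (real n + 1) * c1) ^ n"

lemma star_poincare:
  assumes wp: "weak_pair \<Omega> u G" and T: "z \<in> T" "T \<in> \<T>" and z: "z \<in> \<Omega>"
  shows "\<exists>c. \<forall>K\<in>star \<T> z. sqint (convex hull K) (\<lambda>x. u x - c) \<le>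
    ennreal (cA * (diameter T)\<^sup>2) * sqint (starset z) (\<lambda>x. norm (G x))"
proof -
  let ?r = "c3 * diameter T" and ?h = "c2 * diameter T"
  let ?X = "sqint (starset z) (\<lambda>x. norm (G x))"
  have r: "?r > 0" using c3_pos diam_pos[OF T(2)] by simp
  have sub: "cball z ?r \<subseteq> ball z (diameter T / (c1 * c2))" using srad_less_rad[OF T(2)] by auto
  then have B: "cball z ?r \<subseteq> \<Omega>" "cball z ?r \<subseteq> starset z" using interior_ball[OF T z] by auto
  obtain c where c: "\<And>K h. convex K \<Longrightarrow> compact K \<Longrightarrow> interior K \<noteq> {} \<Longrightarrow> interior K \<subseteq> \<Omega> \<Longrightarrow> z \<in> K \<Longrightarrow>
    K \<subseteq> cball z h \<Longrightarrow> ?r \<le> h \<Longrightarrow>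
    sqint K (\<lambda>x. u x - c) \<le> ennreal (144 * 2 ^ DIM('a) * h\<^sup>2 * (h / ?r) ^ DIM('a)) *
      (sqint K (\<lambda>x. norm (G x)) + sqint (cball z ?r) (\<lambda>x. norm (G x)))"
    using H1_poincare_star[OF wp r B(1)] by blast
  show ?thesis
  proof (intro exI[of _ c] ballI)
    fix K assume K: "K \<in> star \<T> z"
    then have KT: "K \<in> \<T>" "z \<in> K" by (auto simp: star_def)
    have "convex hull K \<subseteq> cball z ?h"
      using simplex_diameter(3)[OF cell[OF KT(1)], of z] hull_inc[OF KT(2), of convex] comparable[OF KT T(2,1)]
      by (intro subsetI) (simp, meson order_trans)
    moreover have "?r \<le> ?h" using c3_le c2_ge1 diam_pos[OF T(2)] by (intro mult_right_mono) auto
    ultimately have "sqint (convex hull K) (\<lambda>x. u x - c) \<le> ennreal (144 * 2 ^ DIM('a) * ?h\<^sup>2 * (?h / ?r) ^ DIM('a)) *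
      (sqint (convex hull K) (\<lambda>x. norm (G x)) + sqint (cball z ?r) (\<lambda>x. norm (G x)))"
      using compact_cell[OF KT(1)] simplex_interior[OF cell[OF KT(1)]] interior_cell[OF KT(1)] hull_inc[OF KT(2), of convex]
      by (intro c) auto
    also have "\<dots> \<le> ennreal (144 * 2 ^ DIM('a) * ?h\<^sup>2 * (?h / ?r) ^ DIM('a)) * (?X + ?X)"
      by (intro mult_left_mono add_mono sqint_mono starset_cell KT B) auto
    also have "?X + ?X = 2 * ?X" by (simp add: mult_2)
    also have "ennreal (144 * 2 ^ DIM('a) * ?h\<^sup>2 * (?h / ?r) ^ DIM('a)) * (2 * ?X) = ennreal (2 * (144 * 2 ^ DIM('a) * ?h\<^sup>2 * (?h / ?r) ^ DIM('a))) * ?X"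
      unfolding ennreal_numeral_mult by (simp add: mult_ac)
    also have "2 * (144 * 2 ^ DIM('a) * ?h\<^sup>2 * (?h / ?r) ^ DIM('a)) = cA * (diameter T)\<^sup>2"
      using diam_pos[OF T(2)] by (simp add: cA_def n[symmetric] power_mult_distrib)
    finally show "sqint (convex hull K) (\<lambda>x. u x - c) \<le> ennreal (cA * (diameter T)\<^sup>2) * ?X" .
  qed
qed

lemma lam_barycenter:
  assumes "T \<in> \<T>" "v \<in> T" shows "lam T v (barycenter T) = 1 / (real n + 1)"
proof -
  have c: "card T = n + 1" "finite T" using cell[OF assms(1)] n by (auto simp: full_simplex_def)
  have "1 / (real n + 1) = lam T v (barycenter T)"
    by (rule lam_unique[OF cell[OF assms(1)], of "\<lambda>_. 1 / (real n + 1)"])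
       (use c assms(2) in \<open>auto simp: barycenter_def scaleR_sum_right add.commute\<close>)
  then show ?thesis by simp
qed

lemma cell_poincare:
  assumes wp: "weak_pair \<Omega> u G" and T: "T \<in> \<T>"
  shows "\<exists>c. sqint (convex hull T) (\<lambda>x. u x - c) \<le>
    ennreal (cT * (diameter T)\<^sup>2) * sqint (convex hull T) (\<lambda>x. norm (G x))"
proof -
  let ?s = "barycenter T"
  \<comment> \<open>All coordinates equal \<open>1 / (n + 1)\<close> at the barycentre. Over a
    distance \<open>diameter T / q\<close> they change by at most half of that, so the ball stays in
    the interior of the cell.\<close>
  define q where "q = 2 * (real n + 1) * c1"
  have q: "q \<ge> 1" using mult_mono[of 1 "2 * (real n + 1)" 1 c1] c1_ge1 by (simp add: q_def)
  define r where "r = diameter T / q"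
  have h: "diameter T > 0" by (rule diam_pos[OF T])
  have r: "r > 0" "r \<le> diameter T" using h q by (auto simp: r_def field_simps)
  let ?X = "sqint (convex hull T) (\<lambda>x. norm (G x))"
  have Bi: "cball ?s r \<subseteq> interior (convex hull T)"
  proof
    fix x assume x: "x \<in> cball ?s r"
    show "x \<in> interior (convex hull T)"
    proof (rule lam_interior[OF cell[OF T]])
      fix v assume v: "v \<in> T"
      have "\<bar>lam T v ?s - lam T v x\<bar> \<le> norm (lgrad T v) * dist ?s x" by (rule lam_lipschitz)
      also have "\<dots> \<le> norm (lgrad T v) * r" using x by (intro mult_left_mono) auto
      also have "\<dots> = (norm (lgrad T v) * diameter T) / q" by (simp add: r_def)
      also have "\<dots> \<le> c1 / q" using lgrad_cell[OF T v] q by (intro divide_right_mono) auto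
      also have "\<dots> = 1 / (2 * (real n + 1))" using c1_ge1 by (simp add: q_def)
      also have "\<dots> < 1 / (real n + 1)" by (simp add: field_simps)
      finally show "0 < lam T v x" using lam_barycenter[OF T v] by simp
    qed
  qed
  then have B: "cball ?s r \<subseteq> \<Omega>" "cball ?s r \<subseteq> convex hull T" using interior_cell[OF T] interior_subset by blast+
  then have s: "?s \<in> convex hull T" using r by (meson centre_in_cball less_imp_le subsetD)
  obtain c where c: "\<And>K h. convex K \<Longrightarrow> compact K \<Longrightarrow> interior K \<noteq> {} \<Longrightarrow> interior K \<subseteq> \<Omega> \<Longrightarrow> ?s \<in> K \<Longrightarrow>
    K \<subseteq> cball ?s h \<Longrightarrow> r \<le> h \<Longrightarrow>
    sqint K (\<lambda>x. u x - c) \<le> ennreal (144 * 2 ^ DIM('a) * h\<^sup>2 * (h / r) ^ DIM('a)) *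
      (sqint K (\<lambda>x. norm (G x)) + sqint (cball ?s r) (\<lambda>x. norm (G x)))"
    using H1_poincare_star[OF wp r(1) B(1)] by blast
  have "sqint (convex hull T) (\<lambda>x. u x - c) \<le> ennreal (144 * 2 ^ DIM('a) * (diameter T)\<^sup>2 * (diameter T / r) ^ DIM('a)) *
      (?X + sqint (cball ?s r) (\<lambda>x. norm (G x)))"
    using compact_cell[OF T] simplex_interior[OF cell[OF T]] interior_cell[OF T] s r simplex_diameter(3)[OF cell[OF T] s]
    by (intro c) auto
  also have "\<dots> \<le> ennreal (144 * 2 ^ DIM('a) * (diameter T)\<^sup>2 * (diameter T / r) ^ DIM('a)) * (?X + ?X)"
    by (intro mult_left_mono add_mono sqint_mono B) auto
  also have "?X + ?X = 2 * ?X" by (simp add: mult_2)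
  also have "ennreal (144 * 2 ^ DIM('a) * (diameter T)\<^sup>2 * (diameter T / r) ^ DIM('a)) * (2 * ?X) = ennreal (2 * (144 * 2 ^ DIM('a) * (diameter T)\<^sup>2 * (diameter T / r) ^ DIM('a))) * ?X"
    unfolding ennreal_numeral_mult by (simp add: mult_ac)
  also have "2 * (144 * 2 ^ DIM('a) * (diameter T)\<^sup>2 * (diameter T / r) ^ DIM('a)) = cT * (diameter T)\<^sup>2"
  proof -
    have "cT = 288 * 2 ^ n * q ^ n" by (simp only: cT_def q_def)
    then show ?thesis using h q by (simp add: n[symmetric] r_def)
  qed
  finally show ?thesis by blast
qed

end

section \<open>Boundary vertices\<close>

text \<open>Extension by zero of a function in \<open>H\<^sup>1\<^sub>0\<close> and of its gradient; being defined on the whole space, it can be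
  shifted and dilated across the boundary.\<close>

definition zero_pair :: "'a::euclidean_space set \<Rightarrow> ('a \<Rightarrow> real) \<Rightarrow> ('a \<Rightarrow> 'a) \<Rightarrow> bool" where
  "zero_pair \<Omega> v g \<longleftrightarrow> weak_pair \<Omega> v g \<and>
     (\<forall>\<delta>>0. \<exists>u D. C1 u D \<and> (\<forall>x. x \<notin> \<Omega> \<longrightarrow> u x = 0 \<and> D x = 0) \<and>
        sqint UNIV (\<lambda>x. u x - v x) \<le> ennreal \<delta> \<and> sqint UNIV (\<lambda>x. norm (D x - g x)) \<le> ennreal \<delta>)"

lemma sqint_mono_zero: "(\<And>x. x \<in> A \<Longrightarrow> x \<notin> B \<Longrightarrow> f x = 0) \<Longrightarrow> sqint A f \<le> sqint B f"
  unfolding sqint_def by (intro nn_integral_mono) (auto simp: indicator_def)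

text \<open>The factor 2 cancels the 1/2 of the chain rule, so the gradient becomes a difference of
  two values of \<open>D\<close>. Functions homogeneous of degree one about \<open>z\<close> are
  annihilated.\<close>

lemma C1_homogeneity_defect:
  assumes "C1 u D"
  shows "C1 (\<lambda>x. u x - 2 * u (dil (1/2) z x)) (\<lambda>x. D x - D (dil (1/2) z x))"
  unfolding C1_def
proof (intro conjI allI)
  have u: "(u has_derivative (\<lambda>h. D x \<bullet> h)) (at x)" for x using assms by (simp add: C1_def)
  fix x
  have "((\<lambda>x. dil (1/2) z x) has_derivative (\<lambda>h. (1/2) *\<^sub>R h)) (at x)"
    unfolding dil_def by (auto intro!: derivative_eq_intros)
  from has_derivative_compose[OF this u]
  have "((\<lambda>x. u (dil (1/2) z x)) has_derivative (\<lambda>h. D (dil (1/2) z x) \<bullet> ((1/2) *\<^sub>R h))) (at x)" .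
  then show "((\<lambda>x. u x - 2 * u (dil (1/2) z x)) has_derivative (\<lambda>h. (D x - D (dil (1/2) z x)) \<bullet> h)) (at x)"
    using u by (auto intro!: derivative_eq_intros simp: inner_diff_left)
next
  have c: "continuous_on UNIV D" using assms by (simp add: C1_def)
  have "continuous_on UNIV (\<lambda>x. D (dil (1/2) z x))"
    by (rule continuous_on_compose2[OF c]) (auto simp: dil_def intro!: continuous_intros)
  then show "continuous_on UNIV (\<lambda>x. D x - D (dil (1/2) z x))" using c by (intro continuous_intros)
qed

context mesh_geom
begin

text \<open>Chosen so that a ball of radius \<open>c4 * diameter T\<close>, shifted by
  \<open>1 + L\<close> times its radius, stays well inside the ball of radius
  \<open>c3 * diameter T\<close> in which the star fills the closed domain.\<close>

definition "c4 = c3 / (2 * (2 + L))"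
definition "cB = 24 / c4 ^ n"

lemma c4_pos: "c4 > 0" unfolding c4_def using c3_pos L by simp

lemma c4_L: "(2 + L) * c4 = c3 / 2" unfolding c4_def using L by (simp add: field_simps)

lemma c4_le: "c4 \<le> 1" "(1 + L) * c4 \<le> 1"
proof -
  have "(1 + L) * c4 \<le> (2 + L) * c4" using c4_pos by (intro mult_right_mono) auto
  then show *: "(1 + L) * c4 \<le> 1" using c4_L c3_le by simp
  have "1 * c4 \<le> (1 + L) * c4" using c4_pos L by (intro mult_right_mono) auto
  then show "c4 \<le> 1" using * by simp
qed

text \<open>On the ball the shifted function vanishes, so the function equals minus its own
  difference along the shift and is controlled by its gradient. Gradient values outside the closed
  domain are required to vanish only near \<open>z\<close>, because the function used for second
  order estimates has this property only there.\<close>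

lemma boundary_shift:
  assumes T: "z \<in> T" "T \<in> \<T>" and e: "norm e = 1"
    and wm[measurable]: "w \<in> borel_measurable lebesgue" "W \<in> borel_measurable lebesgue"
    and approx: "\<And>\<delta>. \<delta> > 0 \<Longrightarrow> \<exists>u D. C1 u D \<and>
      (\<forall>x\<in>cball z (c4 * diameter T). u (x + ((1 + L) * (c4 * diameter T)) *\<^sub>R e) = 0) \<and>
      (\<forall>y\<in>ball z (c3 * diameter T). y \<notin> closure \<Omega> \<longrightarrow> D y = 0) \<and>
      sqint UNIV (\<lambda>x. u x - w x) \<le> ennreal \<delta> \<and> sqint UNIV (\<lambda>x. norm (D x - W x)) \<le> ennreal \<delta>"
  shows "sqint (cball z (c4 * diameter T)) w \<le> ennreal (4 * (diameter T)\<^sup>2) * sqint (starset z) (\<lambda>x. norm (W x))"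
proof (rule ennreal_le_limit)
  let ?h = "diameter T" and ?\<rho> = "c4 * diameter T" and ?X = "sqint (starset z) (\<lambda>x. norm (W x))"
  have h: "?h > 0" by (rule diam_pos[OF T(2)])
  show "0 \<le> 2 + 4 * ?h\<^sup>2" by simp
  note [measurable] = starset_sets
  fix \<delta> :: real assume \<delta>: "\<delta> > 0"
  obtain u D where C: "C1 u D" and u0': "\<forall>x\<in>cball z ?\<rho>. u (x + ((1 + L) * ?\<rho>) *\<^sub>R e) = 0"
    and D0': "\<forall>y\<in>ball z (c3 * ?h). y \<notin> closure \<Omega> \<longrightarrow> D y = 0"
    and uw: "sqint UNIV (\<lambda>x. u x - w x) \<le> ennreal \<delta>" and DW: "sqint UNIV (\<lambda>x. norm (D x - W x)) \<le> ennreal \<delta>"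
    using approx[OF \<delta>] by (elim exE conjE)
  note u0 = bspec[OF u0'] and D0 = bspec[OF D0', THEN mp]
  note [measurable] = C1_measurable(3,4)[OF C]
  let ?e = "((1 + L) * ?\<rho>) *\<^sub>R e" and ?A = "cball z ?\<rho>" and ?A' = "cball z ((2 + L) * ?\<rho>)"
  have "sqint ?A u = sqint ?A (\<lambda>x. u (x + ?e) - u x)"
    by (rule sqint_cong) (simp add: u0)
  also have "\<dots> \<le> ennreal ((norm ?e)\<^sup>2) * sqint ?A' (\<lambda>x. norm (D x))"
  proof (rule C1_translation[OF C])
    fix x and s :: real assume x: "x \<in> ?A" and s: "0 \<le> s" "s \<le> 1"
    have "norm (s *\<^sub>R ?e) = s * ((1 + L) * ?\<rho>)" using s e L c4_pos h by (simp add: abs_mult)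
    also have "\<dots> \<le> 1 * ((1 + L) * ?\<rho>)" using s L c4_pos h by (intro mult_right_mono) auto
    finally have "dist z (x + s *\<^sub>R ?e) \<le> ?\<rho> + (1 + L) * ?\<rho>"
      using x dist_triangle[of z "x + s *\<^sub>R ?e" x] by (simp add: dist_norm norm_minus_commute)
    then show "x + s *\<^sub>R ?e \<in> ?A'" by (simp add: algebra_simps)
  qed auto
  also have "\<dots> \<le> ennreal (?h\<^sup>2) * sqint (starset z) (\<lambda>x. norm (D x))"
  proof (intro mult_mono ennreal_leI)
    have "norm ?e \<le> ?h"
    proof -
      have "norm ?e = ((1 + L) * c4) * ?h" using e L c4_pos h by (simp add: abs_mult)
      also have "\<dots> \<le> 1 * ?h" using c4_le h by (intro mult_right_mono) auto
      finally show ?thesis by simp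
    qed
    then show "(norm ?e)\<^sup>2 \<le> ?h\<^sup>2" by (intro power_mono) auto
    show "sqint ?A' (\<lambda>x. norm (D x)) \<le> sqint (starset z) (\<lambda>x. norm (D x))"
    proof (rule sqint_mono_zero)
      fix y assume y: "y \<in> ?A'" "y \<notin> starset z"
      have "(2 + L) * ?\<rho> = ((2 + L) * c4) * ?h" by simp
      also have "\<dots> = c3 / 2 * ?h" by (simp only: c4_L)
      also have "\<dots> < c3 * ?h" using c3_pos h by simp
      finally have yb: "y \<in> ball z (c3 * ?h)" using y(1) by simp
      then have "y \<notin> closure \<Omega>" using star_nbhd[OF T] y(2) by blast
      then show "norm (D y) = 0" using D0[OF yb] by simp
    qed
  qed auto
  also have "\<dots> \<le> ennreal (?h\<^sup>2) * (2 * ennreal \<delta> + 2 * ?X)"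
  proof (intro mult_left_mono)
    have "sqint (starset z) (\<lambda>x. norm (D x - W x)) \<le> ennreal \<delta>"
      by (rule order_trans[OF sqint_mono[of "starset z" UNIV] DW]) auto
    then show "sqint (starset z) (\<lambda>x. norm (D x)) \<le> 2 * ennreal \<delta> + 2 * ?X"
      by (intro order_trans[OF sqint_norm_grad_le[of D W "starset z"] add_right_mono[OF mult_left_mono]]) auto
  qed auto
  finally have 1: "sqint ?A u \<le> ennreal (?h\<^sup>2) * (2 * ennreal \<delta> + 2 * ?X)" .
  have 2: "sqint ?A (\<lambda>x. u x - w x) \<le> ennreal \<delta>"
    by (rule order_trans[OF sqint_mono[of ?A UNIV] uw]) auto
  have "sqint ?A w = sqint ?A (\<lambda>x. u x - (u x - w x))" by simp
  also have "\<dots> \<le> 2 * sqint ?A u + 2 * sqint ?A (\<lambda>x. u x - w x)" by (rule sqint_diff) auto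
  also have "\<dots> \<le> 2 * (ennreal (?h\<^sup>2) * (2 * ennreal \<delta> + 2 * ?X)) + 2 * ennreal \<delta>"
    by (intro add_mono mult_left_mono 1 2) auto
  also have "\<dots> = ennreal (4 * ?h\<^sup>2) * ?X + ennreal ((2 + 4 * ?h\<^sup>2) * \<delta>)"
  proof -
    have "ennreal ((2 + 4 * ?h\<^sup>2) * \<delta>) = 2 * ennreal \<delta> + 4 * (ennreal (?h\<^sup>2) * ennreal \<delta>)"
      using \<delta> by (simp add: ennreal_mult[symmetric] ennreal_plus[symmetric] ennreal_numeral[symmetric] algebra_simps del: ennreal_plus ennreal_numeral)
    then show ?thesis unfolding ennreal_numeral_mult by (simp add: algebra_simps)
  qed
  finally show "sqint ?A w \<le> ennreal (4 * ?h\<^sup>2) * ?X + ennreal ((2 + 4 * ?h\<^sup>2) * \<delta>)" .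
qed

text \<open>The scale \<open>t\<close> is 1 for the function itself and 1/2 for its composition with
  the halving map, whose shift is halved as well.\<close>

lemma boundary_exit:
  assumes T: "z \<in> T" "T \<in> \<T>" and zf: "z \<in> frontier \<Omega>" and g: "graph_at \<Omega> R L z e f"
    and t: "0 < t" "t \<le> 1" and x: "x \<in> cball z (t * (c4 * diameter T))"
  shows "x + (t * ((1 + L) * (c4 * diameter T))) *\<^sub>R e \<notin> \<Omega>"
proof (rule graph_at_exit[OF g zf R open_dom L])
  let ?\<rho> = "c4 * diameter T"
  have e: "norm e = 1" using g by (simp add: graph_at_def)
  have \<rho>: "?\<rho> > 0" using c4_pos diam_pos[OF T(2)] by simp
  show "(1 + L) * dist x z \<le> t * ((1 + L) * ?\<rho>)"
    using x L mult_left_mono[of "dist z x" "t * ?\<rho>" "1 + L"] by (simp add: dist_commute mult_ac)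
  have "dist z (x + (t * ((1 + L) * ?\<rho>)) *\<^sub>R e) \<le> dist z x + norm ((t * ((1 + L) * ?\<rho>)) *\<^sub>R e)"
    using dist_triangle[of z "x + (t * ((1 + L) * ?\<rho>)) *\<^sub>R e" x] by (simp add: dist_norm norm_minus_commute)
  also have "norm ((t * ((1 + L) * ?\<rho>)) *\<^sub>R e) = t * ((1 + L) * ?\<rho>)"
    using e t L \<rho> c4_pos diam_pos[OF T(2)] by (simp add: abs_mult)
  also have "dist z x + t * ((1 + L) * ?\<rho>) \<le> t * ((2 + L) * ?\<rho>)" using x by (simp add: algebra_simps)
  also have "\<dots> \<le> 1 * ((2 + L) * ?\<rho>)" using t L \<rho> by (intro mult_right_mono) auto
  also have "\<dots> = (c3 / 2) * diameter T" using c4_L by (simp add: mult.assoc[symmetric])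
  also have "\<dots> < 2 * (c3 * diameter T)" using c3_pos diam_pos[OF T(2)] by simp
  also have "\<dots> \<le> (2 + L) * (c3 * diameter T)" using L c3_pos diam_pos[OF T(2)] by (intro mult_right_mono) auto
  also have "\<dots> \<le> R" by (rule c3_R[OF T(2)])
  finally show "x + (t * ((1 + L) * ?\<rho>)) *\<^sub>R e \<in> ball z R" by simp
qed

lemma vertex_dil:
  assumes T: "z \<in> T" "T \<in> \<T>" and x: "x \<in> convex hull T" and t: "0 \<le> t" "t \<le> 1"
  shows "dil t z x \<in> convex hull T" "dil t z x \<in> cball z (t * diameter T)"
proof -
  have zT: "z \<in> convex hull T" using hull_inc[OF T(1)] .
  have "dil t z x = (1 - t) *\<^sub>R z + t *\<^sub>R x" by (simp add: dil_def algebra_simps)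
  then show "dil t z x \<in> convex hull T"
    using t x zT by (auto intro!: convexD[OF convex_convex_hull])
  have "dist z (dil t z x) = t * dist z x" using t by (simp add: dil_def dist_norm norm_minus_commute)
  also have "\<dots> \<le> t * diameter T"
    using simplex_diameter(3)[OF cell[OF T(2)] zT x] t by (intro mult_left_mono) auto
  finally show "dil t z x \<in> cball z (t * diameter T)" by simp
qed

text \<open>The whole cell is contracted by \<open>c4\<close> into the small ball where the shift
  argument works; the change caused by the contraction is of first order in the gradient. The two
  contributions 8 and 16 make up the 24 in \<open>cB\<close>.\<close>

lemma boundary_friedrichs:
  assumes zp: "zero_pair \<Omega> v g" and T: "z \<in> T" "T \<in> \<T>" and zf: "z \<in> frontier \<Omega>"
  shows "sqint (convex hull T) v \<le> ennreal (cB * (diameter T)\<^sup>2) * sqint (starset z) (\<lambda>x. norm (g x))"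
proof -
  have wp: "weak_pair \<Omega> v g" using zp by (simp add: zero_pair_def)
  note [measurable] = weak_pair_facts(3,4)[OF wp]
  let ?h = "diameter T" and ?\<rho> = "c4 * diameter T" and ?X = "sqint (starset z) (\<lambda>x. norm (g x))"
  have h: "?h > 0" by (rule diam_pos[OF T(2)])
  have [measurable]: "convex hull T \<in> sets lebesgue" by (rule cell_sets[OF T(2)])
  obtain e f where g: "graph_at \<Omega> R L z e f" using graphs[OF zf] by blast
  have small: "sqint (cball z ?\<rho>) v \<le> ennreal (4 * ?h\<^sup>2) * ?X"
  proof (rule boundary_shift[OF T])
    show "norm e = 1" using g by (simp add: graph_at_def)
    fix \<delta> :: real assume "\<delta> > 0"
    then obtain u D where uD: "C1 u D" "\<forall>x. x \<notin> \<Omega> \<longrightarrow> u x = 0 \<and> D x = 0"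
        "sqint UNIV (\<lambda>x. u x - v x) \<le> ennreal \<delta>" "sqint UNIV (\<lambda>x. norm (D x - g x)) \<le> ennreal \<delta>"
      using zp unfolding zero_pair_def by blast
    moreover have "u (x + ((1 + L) * ?\<rho>) *\<^sub>R e) = 0" if "x \<in> cball z ?\<rho>" for x
      using boundary_exit[OF T zf g, where t = 1 and x = x] that uD(2) by simp
    moreover have "D y = 0" if "y \<notin> closure \<Omega>" for y using uD(2) that closure_subset by blast
    ultimately show "\<exists>u D. C1 u D \<and>
      (\<forall>x\<in>cball z ?\<rho>. u (x + ((1 + L) * ?\<rho>) *\<^sub>R e) = 0) \<and>
      (\<forall>y\<in>ball z (c3 * ?h). y \<notin> closure \<Omega> \<longrightarrow> D y = 0) \<and>
      sqint UNIV (\<lambda>x. u x - v x) \<le> ennreal \<delta> \<and> sqint UNIV (\<lambda>x. norm (D x - g x)) \<le> ennreal \<delta>"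
      by blast
  qed measurable
  have t: "0 < c4" "c4 \<le> 1" using c4_pos c4_le by auto
  have [measurable]: "(\<lambda>x. v (dil c4 z x)) \<in> borel_measurable lebesgue"
    using t by (auto intro!: measurable_comp_dil)
  define q where "q = 1 / c4 ^ n"
  have q: "q > 0" using t by (simp add: q_def)
  have qD: "q = 1 / c4 ^ DIM('a)" by (simp add: q_def n[symmetric])
  have 1: "sqint (convex hull T) (\<lambda>x. v (dil c4 z x)) \<le> ennreal q * (ennreal (4 * ?h\<^sup>2) * ?X)"
    unfolding qD
    by (rule order_trans[OF sqint_dil mult_left_mono[OF small]]) (use t vertex_dil(2)[OF T] in auto)
  have 2: "sqint (convex hull T) (\<lambda>x. v (dil c4 z x) - v x) \<le> ennreal (8 * ?h\<^sup>2 * q) * ?X"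
  proof -
    have "sqint (convex hull T) (\<lambda>x. v (dil c4 z x) - v x) \<le> ennreal (8 * ?h\<^sup>2 / c4 ^ DIM('a)) * sqint (convex hull T) (\<lambda>x. norm (g x))"
      by (rule H1_dilation[OF wp _ simplex_interior[OF cell[OF T(2)]] interior_cell[OF T(2)] hull_inc[OF T(1)] _ t])
         (use compact_cell[OF T(2)] simplex_diameter(3)[OF cell[OF T(2)] hull_inc[OF T(1)]] in \<open>auto intro: compact_imp_closed\<close>)
    also have "\<dots> \<le> ennreal (8 * ?h\<^sup>2 / c4 ^ DIM('a)) * ?X"
      by (intro mult_left_mono sqint_mono starset_cell T) auto
    finally show ?thesis by (simp add: qD)
  qed
  have "sqint (convex hull T) v = sqint (convex hull T) (\<lambda>x. v (dil c4 z x) - (v (dil c4 z x) - v x))" by simp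
  also have "\<dots> \<le> 2 * sqint (convex hull T) (\<lambda>x. v (dil c4 z x)) + 2 * sqint (convex hull T) (\<lambda>x. v (dil c4 z x) - v x)"
    by (rule sqint_diff) measurable
  also have "\<dots> \<le> 2 * (ennreal q * (ennreal (4 * ?h\<^sup>2) * ?X)) + 2 * (ennreal (8 * ?h\<^sup>2 * q) * ?X)"
    by (intro add_mono mult_left_mono 1 2) auto
  also have "\<dots> = ennreal (8 * (?h\<^sup>2 * q)) * ?X + ennreal (16 * (?h\<^sup>2 * q)) * ?X"
  proof -
    have a: "2 * (ennreal q * (ennreal (4 * ?h\<^sup>2) * ?X)) = ennreal (2 * (q * (4 * ?h\<^sup>2))) * ?X"
    proof -
      have "ennreal (2 * (q * (4 * ?h\<^sup>2))) = 2 * (ennreal q * ennreal (4 * ?h\<^sup>2))"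
        unfolding ennreal_numeral_mult[of _ "q * (4 * ?h\<^sup>2)"] using q by (subst ennreal_mult) auto
      then show ?thesis by (simp only: mult.assoc)
    qed
    have b: "2 * (ennreal (8 * ?h\<^sup>2 * q) * ?X) = ennreal (2 * (8 * ?h\<^sup>2 * q)) * ?X"
      unfolding ennreal_numeral_mult by (simp add: mult.assoc)
    show ?thesis unfolding a b by (simp add: mult_ac)
  qed
  also have "\<dots> = ennreal (24 * (?h\<^sup>2 * q)) * ?X"
    using q by (simp add: distrib_right[symmetric] ennreal_plus[symmetric] del: ennreal_plus)
  also have "24 * (?h\<^sup>2 * q) = cB * ?h\<^sup>2" by (simp add: cB_def q_def)
  finally show ?thesis .
qed

text \<open>Near a boundary vertex \<open>z\<close> the domain is a cone with apex \<open>z\<close>, hence \<open>v - 2 * v o dil (1/2) z\<close>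
  vanishes on the boundary as well; its gradient is of second order in \<open>v\<close>.\<close>

lemma boundary_defect:
  assumes zp: "zero_pair \<Omega> v g" and T: "z \<in> T" "T \<in> \<T>" and zf: "z \<in> frontier \<Omega>"
  shows "sqint (cball z (c4 * diameter T)) (\<lambda>x. v x - 2 * v (dil (1/2) z x)) \<le>
    ennreal (4 * (diameter T)\<^sup>2) * sqint (starset z) (\<lambda>x. norm (g x - g (dil (1/2) z x)))"
proof -
  have wp: "weak_pair \<Omega> v g" using zp by (simp add: zero_pair_def)
  note m[measurable] = weak_pair_facts(3,4)[OF wp]
  obtain e f where g: "graph_at \<Omega> R L z e f" using graphs[OF zf] by blast
  have dm[measurable]: "dil (1/2) z \<in> lebesgue \<rightarrow>\<^sub>M lebesgue" by (rule dil_lebesgue_measurable) simp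
  let ?\<rho> = "c4 * diameter T"
  show ?thesis
  proof (rule boundary_shift[OF T])
    show "norm e = 1" using g by (simp add: graph_at_def)
    fix \<delta> :: real assume \<delta>: "\<delta> > 0"
    \<comment> \<open>Accounts for the accuracy lost in forming the defect: the halving map costs
      \<open>2 ^ DIM('a)\<close>, the coefficient 2 is squared, and the splitting doubles.\<close>
    define k where "k = 2 + 8 * (2::real) ^ DIM('a)"
    have k: "k > 0" unfolding k_def by (intro add_pos_pos) auto
    define \<delta>' where "\<delta>' = \<delta> / k"
    have \<delta>': "\<delta>' > 0" "k * \<delta>' = \<delta>" using \<delta> k by (auto simp: \<delta>'_def)
    obtain u D where C: "C1 u D" and z': "\<forall>x. x \<notin> \<Omega> \<longrightarrow> u x = 0 \<and> D x = 0"
       and uv: "sqint UNIV (\<lambda>x. u x - v x) \<le> ennreal \<delta>'" and Dg: "sqint UNIV (\<lambda>x. norm (D x - g x)) \<le> ennreal \<delta>'"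
      using zp \<delta>'(1) unfolding zero_pair_def by blast
    note z = z'[rule_format]
    note [measurable] = C1_measurable(3,4)[OF C]
    have [measurable]: "UNIV \<in> sets (lebesgue :: 'a measure)" by simp
    let ?u = "\<lambda>x. u x - 2 * u (dil (1/2) z x)" and ?D = "\<lambda>x. D x - D (dil (1/2) z x)"
    have "?u (x + ((1 + L) * ?\<rho>) *\<^sub>R e) = 0" if x: "x \<in> cball z ?\<rho>" for x
    proof -
      have "x + ((1 + L) * ?\<rho>) *\<^sub>R e \<notin> \<Omega>" using boundary_exit[OF T zf g, where t = 1 and x = x] x by simp
      \<comment> \<open>The halving map sends the shifted point to the halved point with half the
        shift, and that point is outside as well by the exit lemma at scale 1/2.\<close>
      moreover have "dil (1/2) z x + ((1/2) * ((1 + L) * ?\<rho>)) *\<^sub>R e \<notin> \<Omega>"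
      proof (rule boundary_exit[OF T zf g])
        have "dist z (dil (1/2) z x) = (1/2) * dist z x" by (simp add: dil_def dist_norm norm_minus_commute)
        then show "dil (1/2) z x \<in> cball z ((1/2) * ?\<rho>)" using x by simp
      qed auto
      moreover have "dil (1/2) z (x + ((1 + L) * ?\<rho>) *\<^sub>R e) = dil (1/2) z x + ((1/2) * ((1 + L) * ?\<rho>)) *\<^sub>R e"
        by (simp add: dil_def algebra_simps)
      ultimately show ?thesis using z by simp
    qed
    moreover have "?D y = 0" if "y \<in> ball z (c3 * diameter T)" "y \<notin> closure \<Omega>" for y
    proof -
      \<comment> \<open>This is where the cone structure enters: without it the gradient of the
        dilated function could be nonzero at points outside the closed domain.\<close>
      have "dil (1/2) z y \<notin> closure \<Omega>" using dil_outside[OF T that(1)] that(2) by blast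
      then have "dil (1/2) z y \<notin> \<Omega>" "y \<notin> \<Omega>" using that(2) closure_subset by blast+
      then show ?thesis using z by simp
    qed
    moreover have "sqint UNIV (\<lambda>x. ?u x - (v x - 2 * v (dil (1/2) z x))) \<le> ennreal \<delta>"
    proof -
      have "sqint UNIV (\<lambda>x. ?u x - (v x - 2 * v (dil (1/2) z x))) = sqint UNIV (\<lambda>x. (u x - v x) - 2 * (u (dil (1/2) z x) - v (dil (1/2) z x)))"
        by (rule sqint_cong) (simp add: algebra_simps)
      also have "\<dots> \<le> 2 * sqint UNIV (\<lambda>x. u x - v x) + 2 * sqint UNIV (\<lambda>x. 2 * (u (dil (1/2) z x) - v (dil (1/2) z x)))"
        by (rule sqint_diff) measurable
      also have "sqint UNIV (\<lambda>x. 2 * (u (dil (1/2) z x) - v (dil (1/2) z x))) = ennreal (2\<^sup>2) * sqint UNIV (\<lambda>x. u (dil (1/2) z x) - v (dil (1/2) z x))"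
        by (rule sqint_cmult) measurable
      also have "sqint UNIV (\<lambda>x. u (dil (1/2) z x) - v (dil (1/2) z x)) \<le> ennreal (1 / (1/2) ^ DIM('a)) * ennreal \<delta>'"
        by (rule order_trans[OF sqint_dil[of "\<lambda>x. u x - v x" UNIV "1/2" UNIV z] mult_left_mono[OF uv]]) auto
      then have "2 * sqint UNIV (\<lambda>x. u x - v x) + 2 * (ennreal (2\<^sup>2) * sqint UNIV (\<lambda>x. u (dil (1/2) z x) - v (dil (1/2) z x)))
        \<le> 2 * ennreal \<delta>' + 2 * (ennreal (2\<^sup>2) * (ennreal (1 / (1/2) ^ DIM('a)) * ennreal \<delta>'))"
        by (intro add_mono mult_left_mono uv) auto
      also have "\<dots> = ennreal (k * \<delta>')"
        using \<delta>' by (simp add: k_def power_one_over ennreal_mult[symmetric] ennreal_plus[symmetric] ennreal_numeral[symmetric] algebra_simps del: ennreal_plus ennreal_numeral)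
      finally show ?thesis using \<delta>'(2) by simp
    qed
    moreover have "sqint UNIV (\<lambda>x. norm (?D x - (g x - g (dil (1/2) z x)))) \<le> ennreal \<delta>"
    proof -
      have "sqint UNIV (\<lambda>x. norm (?D x - (g x - g (dil (1/2) z x)))) \<le> sqint UNIV (\<lambda>x. norm (D x - g x) + norm (D (dil (1/2) z x) - g (dil (1/2) z x)))"
      proof (rule sqint_mono_fun)
        fix x
        have "norm (?D x - (g x - g (dil (1/2) z x))) = norm ((D x - g x) - (D (dil (1/2) z x) - g (dil (1/2) z x)))"
          by (simp add: algebra_simps)
        also have "\<dots> \<le> norm (D x - g x) + norm (D (dil (1/2) z x) - g (dil (1/2) z x))" by (rule norm_triangle_ineq4)
        finally show "\<bar>norm (?D x - (g x - g (dil (1/2) z x)))\<bar> \<le> \<bar>norm (D x - g x) + norm (D (dil (1/2) z x) - g (dil (1/2) z x))\<bar>"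
          by simp
      qed
      also have "\<dots> \<le> 2 * sqint UNIV (\<lambda>x. norm (D x - g x)) + 2 * sqint UNIV (\<lambda>x. norm (D (dil (1/2) z x) - g (dil (1/2) z x)))"
        by (rule sqint_add) measurable
      also have "\<dots> \<le> 2 * ennreal \<delta>' + 2 * (ennreal (1 / (1/2) ^ DIM('a)) * ennreal \<delta>')"
        by (intro add_mono mult_left_mono Dg order_trans[OF sqint_dil[of "\<lambda>x. norm (D x - g x)" UNIV "1/2" UNIV z] mult_left_mono[OF Dg]]) auto
      also have "\<dots> = ennreal ((2 + 2 * 2 ^ DIM('a)) * \<delta>')"
        using \<delta>' by (simp add: power_one_over ennreal_mult[symmetric] ennreal_plus[symmetric] ennreal_numeral[symmetric] algebra_simps del: ennreal_plus ennreal_numeral)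
      also have "\<dots> \<le> ennreal (k * \<delta>')"
        using \<delta>'(1) unfolding k_def by (intro ennreal_leI mult_right_mono add_left_mono) auto
      finally show ?thesis using \<delta>'(2) by simp
    qed
    ultimately show "\<exists>u D. C1 u D \<and>
      (\<forall>x\<in>cball z ?\<rho>. u (x + ((1 + L) * ?\<rho>) *\<^sub>R e) = 0) \<and>
      (\<forall>y\<in>ball z (c3 * diameter T). y \<notin> closure \<Omega> \<longrightarrow> D y = 0) \<and>
      sqint UNIV (\<lambda>x. u x - (v x - 2 * v (dil (1/2) z x))) \<le> ennreal \<delta> \<and>
      sqint UNIV (\<lambda>x. norm (D x - (g x - g (dil (1/2) z x)))) \<le> ennreal \<delta>"
      using C1_homogeneity_defect[OF C, of z] by (intro exI[of _ ?u] exI[of _ ?D] conjI) auto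
  qed measurable
qed

end

section \<open>Cell means and weak gradients of Lipschitz functions\<close>

text \<open>Exchanging two vertices of a simplex by an affine involution preserves Lebesgue measure: up to
  a factor because of translation invariance, and the factor is 1 because the simplex is mapped onto itself.\<close>

lemma swap_vertices_nn_integral:
  fixes T :: "'a::euclidean_space set"
  assumes T: "full_simplex T" and vw: "v \<in> T" "w \<in> T" "v \<noteq> w" and f[measurable]: "f \<in> borel_measurable borel"
  defines "A \<equiv> \<lambda>x. x + (lam T v x - lam T w x) *\<^sub>R (w - v)"
  shows "(\<integral>\<^sup>+x. f (A x) \<partial>lborel) = (\<integral>\<^sup>+x. f x \<partial>lborel)"
    "A x \<in> convex hull T \<longleftrightarrow> x \<in> convex hull T" "lam T v (A x) = lam T w x"
proof -
  define a where "a = lgrad T v - lgrad T w"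
  define d where "d = w - v"
  \<comment> \<open>The linear part of \<open>A\<close>. Since \<open>a\<close> and \<open>d\<close>
    have inner product -2 it is an involution.\<close>
  define M where "M x = x + (a \<bullet> x) *\<^sub>R d" for x
  have Alam: "lam T u (A x) = lam T u x + (lam T v x - lam T w x) * (lam T u w - lam T u v)" for u x
    by (simp add: A_def lam_def inner_simps algebra_simps)
  have lv: "lam T v (A x) = lam T w x" for x using Alam[of v x] lam_vertex[OF T vw(1)] vw by auto
  have lw: "lam T w (A x) = lam T v x" for x using Alam[of w x] lam_vertex[OF T vw(2)] vw by auto
  have lo: "lam T u (A x) = lam T u x" if "u \<in> T" "u \<noteq> v" "u \<noteq> w" for u x
    using Alam[of u x] lam_vertex[OF T that(1)] vw that by auto
  show hull: "A x \<in> convex hull T \<longleftrightarrow> x \<in> convex hull T" for x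
    unfolding in_hull_iff[OF T] using lv[of x] lw[of x] lo[of _ x] vw by metis
  show "lam T v (A x) = lam T w x" by (rule lv)
  have ad: "a \<bullet> d = - 2" unfolding d_def
    using lam_diff[of T v w v] lam_diff[of T w w v] lam_vertex[OF T vw(1)] lam_vertex[OF T vw(2)] vw
    by (simp add: a_def inner_diff_left)
  have aM: "a \<bullet> M x = - (a \<bullet> x)" for x by (simp add: M_def inner_add_right ad)
  have MM: "M (M x) = x" for x
  proof -
    have "M (M x) = M x + (a \<bullet> M x) *\<^sub>R d" by (simp add: M_def)
    then show ?thesis unfolding aM by (simp add: M_def)
  qed
  define k0 where "k0 = lam T v 0 - lam T w 0"
  have lamd: "lam T v x - lam T w x = a \<bullet> x + k0" for x
    by (simp add: a_def lam_def inner_simps k0_def)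
  \<comment> \<open>Conjugation with \<open>A\<close> turns translation by \<open>M x\<close> into
    translation by \<open>x\<close>; this makes the integral over \<open>A\<close> translation
    invariant.\<close>
  have AM: "A (y - M x) = A y - x" for x y
  proof -
    have "A (y - M x) = A y - (M x + (a \<bullet> M x) *\<^sub>R d)"
      unfolding A_def lamd d_def[symmetric]
      by (simp add: inner_diff_right scaleR_add_left scaleR_diff_left)
    then have "A (y - M x) = A y - M (M x)" by (simp only: M_def[of "M x"])
    then show ?thesis by (simp add: MM)
  qed
  have [measurable]: "A \<in> borel_measurable borel"
    unfolding A_def lam_def by measurable
  let ?I = "\<lambda>f. \<integral>\<^sup>+y. f (A y) \<partial>lborel"
  \<comment> \<open>The uniqueness argument for Haar measure: the product of the two integrals is
    rewritten as a double integral of convolution type. No determinant has to be computed.\<close>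
  have conv: "?I g * (\<integral>\<^sup>+x. h x \<partial>lborel) = (\<integral>\<^sup>+y. (\<integral>\<^sup>+x. g (A y - x) * h x \<partial>lborel) \<partial>lborel)"
    if [measurable]: "g \<in> borel_measurable borel" "h \<in> borel_measurable borel" for g h :: "'a \<Rightarrow> ennreal"
  proof -
    have m: "(\<lambda>(x, y). g (A y - x) * h x) \<in> borel_measurable (lborel \<Otimes>\<^sub>M lborel)"
      unfolding split_beta by measurable
    have "(\<integral>\<^sup>+y. (\<integral>\<^sup>+x. g (A y - x) * h x \<partial>lborel) \<partial>lborel) = (\<integral>\<^sup>+x. (\<integral>\<^sup>+y. g (A y - x) * h x \<partial>lborel) \<partial>lborel)"
      using lborel_pair.Fubini'[OF m] by simp
    also have "\<dots> = (\<integral>\<^sup>+x. ?I g * h x \<partial>lborel)"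
    proof (intro nn_integral_cong)
      fix x
      have "(\<integral>\<^sup>+y. g (A y - x) * h x \<partial>lborel) = (\<integral>\<^sup>+y. g (A y - x) \<partial>lborel) * h x"
        by (rule nn_integral_multc) measurable
      also have "(\<integral>\<^sup>+y. g (A y - x) \<partial>lborel) = (\<integral>\<^sup>+y. g (A (y - M x)) \<partial>lborel)" by (simp add: AM)
      also have "\<dots> = ?I g" by (rule nn_integral_reflect(1)[of "\<lambda>y. g (A y)"]) measurable
      finally show "(\<integral>\<^sup>+y. g (A y - x) * h x \<partial>lborel) = ?I g * h x" .
    qed
    also have "\<dots> = ?I g * (\<integral>\<^sup>+x. h x \<partial>lborel)" by (rule nn_integral_cmult) measurable
    finally show ?thesis by simp
  qed
  \<comment> \<open>Reflecting the inner variable about \<open>A y\<close> exchanges the roles of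
    \<open>g\<close> and \<open>h\<close>.\<close>
  have sym: "?I g * (\<integral>\<^sup>+x. h x \<partial>lborel) = ?I h * (\<integral>\<^sup>+x. g x \<partial>lborel)"
    if [measurable]: "g \<in> borel_measurable borel" "h \<in> borel_measurable borel" for g h :: "'a \<Rightarrow> ennreal"
  proof -
    have "(\<integral>\<^sup>+x. g (A y - x) * h x \<partial>lborel) = (\<integral>\<^sup>+x. h (A y - x) * g x \<partial>lborel)" for y
      using nn_integral_reflect(2)[of "\<lambda>x. g (A y - x) * h x" "A y"] by (simp add: mult.commute)
    then show ?thesis by (simp add: conv)
  qed
  let ?K = "convex hull T"
  have cK: "compact ?K" using T by (simp add: full_simplex_def finite_imp_compact_convex_hull)
  then have Kb[measurable]: "?K \<in> sets borel" by (simp add: compact_imp_closed)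
  \<comment> \<open>\<open>A\<close> maps the simplex onto itself, so its indicator has the same
    integral before and after. As second function in \<open>sym\<close> it fixes the proportionality
    factor as 1.\<close>
  have iK: "?I (indicator ?K) = emeasure lborel ?K"
  proof -
    have "?I (indicator ?K) = (\<integral>\<^sup>+y. indicator ?K y \<partial>lborel)"
      by (intro nn_integral_cong) (simp add: indicator_def hull)
    then show ?thesis by simp
  qed
  have fin: "emeasure lborel ?K < \<infinity>" using emeasure_compact_finite[OF cK] by simp
  have pos: "emeasure lborel ?K \<noteq> 0"
    using simplex_measure(1)[OF T] by (auto simp: measure_def)
  have "?I f * emeasure lborel ?K = emeasure lborel ?K * (\<integral>\<^sup>+x. f x \<partial>lborel)"
    using sym[of f "indicator ?K"] iK by simp
  then show "?I f = (\<integral>\<^sup>+x. f x \<partial>lborel)"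
    using fin pos by (metis ennreal_mult_cancel_left infinity_ennreal_def less_irrefl mult.commute)
qed

text \<open>By the exchange symmetry all coordinates have the same integral over the simplex, and
  together they integrate to its volume.\<close>

lemma cell_mean_lam:
  fixes T :: "'a::euclidean_space set"
  assumes T: "full_simplex T" and v: "v \<in> T"
  shows "has_bochner_integral lebesgue (\<lambda>x. lam T v x * indicator (convex hull T) x)
    (measure lebesgue (convex hull T) / real (card T))"
proof -
  let ?K = "convex hull T"
  have fin: "finite T" "card T > 0" using T by (auto simp: full_simplex_def)
  have cK: "compact ?K" using fin by (simp add: finite_imp_compact_convex_hull)
  then have Kb[measurable]: "?K \<in> sets borel" by (simp add: compact_imp_closed)
  have [measurable]: "lam T w \<in> borel_measurable borel" for w unfolding lam_def by measurable
  define I where "I w = (\<integral>\<^sup>+x\<in>?K. ennreal (lam T w x) \<partial>lborel)" for w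
  have eq: "I w = I v" if w: "w \<in> T" for w
  proof (cases "v = w")
    case False
    have "(\<lambda>x. ennreal (lam T v x) * indicator ?K x) \<in> borel_measurable borel" by measurable
    note sw = swap_vertices_nn_integral[OF T v w False this]
    have "(\<integral>\<^sup>+x. ennreal (lam T v x) * indicator ?K x \<partial>lborel) =
      (\<integral>\<^sup>+x. ennreal (lam T w x) * indicator ?K x \<partial>lborel)"
      by (subst sw(1)[symmetric]) (auto simp: sw(2,3) indicator_def intro!: nn_integral_cong)
    then show ?thesis by (simp add: I_def)
  qed simp
  have "real (card T) * I v = (\<Sum>w\<in>T. I w)" using eq by (simp add: ennreal_of_nat_eq_real_of_nat)
  also have "\<dots> = (\<integral>\<^sup>+x. (\<Sum>w\<in>T. ennreal (lam T w x) * indicator ?K x) \<partial>lborel)"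
    unfolding I_def by (rule nn_integral_sum[symmetric]) measurable
  also have "\<dots> = (\<integral>\<^sup>+x. indicator ?K x \<partial>lborel)"
  proof (intro nn_integral_cong)
    fix x
    show "(\<Sum>w\<in>T. ennreal (lam T w x) * indicator ?K x) = indicator ?K x"
    proof (cases "x \<in> ?K")
      case True
      then have "(\<Sum>w\<in>T. ennreal (lam T w x)) = ennreal (\<Sum>w\<in>T. lam T w x)"
        using in_hull_iff[OF T] by (intro sum_ennreal) auto
      then show ?thesis using True lam_combination(1)[OF T] by simp
    qed simp
  qed
  also have "\<dots> = ennreal (measure lebesgue ?K)"
    using emeasure_compact_finite[OF cK] by (simp add: emeasure_eq_ennreal_measure measure_completion)
  finally have *: "ennreal (real (card T)) * I v = ennreal (measure lebesgue ?K)" by simp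
  have "I v = ennreal (measure lebesgue ?K / real (card T))"
  proof -
    have "I v = ennreal (1 / real (card T)) * (ennreal (real (card T)) * I v)"
      using fin v by (auto simp: mult.assoc[symmetric] ennreal_mult[symmetric])
    also have "\<dots> = ennreal (measure lebesgue ?K / real (card T))"
      unfolding * by (simp add: ennreal_mult[symmetric])
    finally show ?thesis .
  qed
  then have nn: "(\<integral>\<^sup>+x. ennreal (lam T v x * indicator ?K x) \<partial>lebesgue) = ennreal (measure lebesgue ?K / real (card T))"
    by (simp add: I_def nn_integral_completion ennreal_mult'' flip: ennreal_indicator)
  show ?thesis
  proof (rule has_bochner_integral_nn_integral[OF _ _ _ nn])
    have "(\<lambda>x. lam T v x * indicator ?K x) \<in> borel_measurable borel" by measurable
    then show "(\<lambda>x. lam T v x * indicator ?K x) \<in> borel_measurable lebesgue" by (auto intro: measurable_completion)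
    show "AE x in lebesgue. 0 \<le> lam T v x * indicator ?K x"
      using in_hull_iff[OF T] v by (intro AE_I2) (auto simp: indicator_def)
  qed simp
qed

text \<open>The mean of an affine function over a simplex is its value at the barycentre; this is
  how the barycentre condition on the weights comes to bear.\<close>

lemma cell_mean_affine:
  fixes T :: "'a::euclidean_space set"
  assumes T: "full_simplex T"
  shows "has_bochner_integral lebesgue (\<lambda>x. (a \<bullet> x + b) * indicator (convex hull T) x)
    (measure lebesgue (convex hull T) * (a \<bullet> barycenter T + b))"
proof -
  let ?K = "convex hull T"
  have fin: "finite T" "card T > 0" using T by (auto simp: full_simplex_def)
  have "has_bochner_integral lebesgue (\<lambda>x. \<Sum>v\<in>T. (a \<bullet> v + b) * (lam T v x * indicator ?K x))
     (\<Sum>v\<in>T. (a \<bullet> v + b) * (measure lebesgue ?K / real (card T)))"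
    by (intro has_bochner_integral_sum has_bochner_integral_mult_right cell_mean_lam[OF T])
  moreover have "(\<Sum>v\<in>T. (a \<bullet> v + b) * (lam T v x * indicator ?K x)) = (a \<bullet> x + b) * indicator ?K x" for x
  proof -
    have "(\<Sum>v\<in>T. (a \<bullet> v + b) * lam T v x) = a \<bullet> (\<Sum>v\<in>T. lam T v x *\<^sub>R v) + b * (\<Sum>v\<in>T. lam T v x)"
      by (simp add: inner_sum_right sum_distrib_left sum.distrib[symmetric] algebra_simps)
    then have "(\<Sum>v\<in>T. (a \<bullet> v + b) * lam T v x) = a \<bullet> x + b" using lam_combination[OF T] by simp
    then show ?thesis by (simp add: sum_distrib_right[symmetric] mult.assoc[symmetric])
  qed
  moreover have "(\<Sum>v\<in>T. (a \<bullet> v + b) * (measure lebesgue ?K / real (card T))) = measure lebesgue ?K * (a \<bullet> barycenter T + b)"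
  proof -
    have "(\<Sum>v\<in>T. (a \<bullet> v + b)) = real (card T) * (a \<bullet> barycenter T + b)"
      using fin by (simp add: barycenter_def inner_sum_right sum.distrib algebra_simps)
    then show ?thesis using fin unfolding sum_distrib_right[symmetric] by simp
  qed
  ultimately show ?thesis by simp
qed

section \<open>Translation invariance and difference quotients\<close>

lemma lebesgue_integral_shift:
  fixes g :: "'a::euclidean_space \<Rightarrow> real"
  assumes g: "integrable lebesgue g"
  shows "(\<lambda>x. x - c) \<in> lebesgue \<rightarrow>\<^sub>M lebesgue" "integrable lebesgue (\<lambda>x. g (x - c))"
    "(LINT x|lebesgue. g (x - c)) = (LINT x|lebesgue. g x)"
proof -
  have eq: "(\<lambda>x. - c + (\<Sum>j\<in>Basis. (1 * (x \<bullet> j)) *\<^sub>R j)) = (\<lambda>x. x - c)"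
    by (simp add: euclidean_representation)
  show m[measurable]: "(\<lambda>x. x - c) \<in> lebesgue \<rightarrow>\<^sub>M lebesgue"
    using lebesgue_affine_measurable[of "\<lambda>_. 1" "- c"] unfolding eq by simp
  have "lebesgue = density (distr lebesgue lebesgue (\<lambda>x. x - c)) (\<lambda>_. 1)"
    using lebesgue_affine_euclidean[of "\<lambda>_. 1" "- c"] unfolding eq by simp
  then have d: "distr lebesgue lebesgue (\<lambda>x. x - c) = lebesgue" by (simp add: density_1)
  have gm: "g \<in> borel_measurable lebesgue" using g by auto
  show "integrable lebesgue (\<lambda>x. g (x - c))"
    using integrable_distr_eq[OF m gm] g unfolding d by simp
  show "(LINT x|lebesgue. g (x - c)) = (LINT x|lebesgue. g x)"
    using integral_distr[OF m gm] unfolding d by simp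
qed

lemma difference_quotient_tendsto:
  fixes f :: "'a::euclidean_space \<Rightarrow> real"
  assumes "(f has_derivative (\<lambda>h. g \<bullet> h)) (at x)"
  shows "((\<lambda>s. (f (x + s *\<^sub>R i) - f x) / s) \<longlongrightarrow> g \<bullet> i) (at 0)"
proof -
  have 1: "((\<lambda>s. x + s *\<^sub>R i) has_derivative (\<lambda>s. s *\<^sub>R i)) (at (0::real))"
    by (auto intro!: derivative_eq_intros)
  have "(f has_derivative (\<lambda>h. g \<bullet> h)) (at (x + 0 *\<^sub>R i))" using assms by simp
  from has_derivative_compose[OF 1 this]
  have "((\<lambda>s. f (x + s *\<^sub>R i)) has_derivative (\<lambda>s. g \<bullet> (s *\<^sub>R i))) (at 0)" .
  moreover have "(\<lambda>s. g \<bullet> (s *\<^sub>R i)) = (*) (g \<bullet> i)" by (simp add: fun_eq_iff mult.commute)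
  ultimately have "((\<lambda>s. f (x + s *\<^sub>R i)) has_real_derivative (g \<bullet> i)) (at 0)"
    by (simp add: has_field_derivative_def)
  then show ?thesis by (simp add: has_field_derivative_iff)
qed

text \<open>Weak derivatives by discrete integration by parts: difference quotients are moved from the test
  function to \<open>f\<close>.\<close>

lemma weak_grad_lipschitz:
  fixes f :: "'a::euclidean_space \<Rightarrow> real"
  assumes \<Omega>: "open \<Omega>" "bounded \<Omega>" and fm: "f \<in> borel_measurable lebesgue" and fb: "\<And>x. x \<in> \<Omega> \<Longrightarrow> \<bar>f x\<bar> \<le> B"
    and lip: "\<And>x y. closed_segment x y \<subseteq> \<Omega> \<Longrightarrow> \<bar>f x - f y\<bar> \<le> M * dist x y" and M: "M \<ge> 0"
    and Gm: "G \<in> borel_measurable lebesgue"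
    and G: "AE x in lebesgue. x \<in> \<Omega> \<longrightarrow> (f has_derivative (\<lambda>h. G x \<bullet> h)) (at x)"
    and Gi: "\<And>i. i \<in> Basis \<Longrightarrow> integrable (lebesgue_on \<Omega>) (\<lambda>x. G x \<bullet> i)"
  shows "has_weak_grad \<Omega> f G"
  unfolding has_weak_grad_def
proof (intro conjI allI impI ballI)
  have \<Omega>s[measurable]: "\<Omega> \<in> sets lebesgue" using \<Omega>(1) by auto
  have \<Omega>lm: "\<Omega> \<in> lmeasurable" using \<Omega> by (intro bounded_set_imp_lmeasurable) auto
  interpret F: finite_measure "lebesgue_on \<Omega>" by (rule finite_measure_lebesgue_on[OF \<Omega>lm])
  show "integrable (lebesgue_on \<Omega>) f"
    by (rule F.integrable_const_bound[of _ B]) (use fb fm in \<open>auto intro: measurable_restrict_space1\<close>)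
  show "integrable (lebesgue_on \<Omega>) (\<lambda>x. G x \<bullet> i)" if "i \<in> Basis" for i using Gi[OF that] .
  fix \<phi> and i :: 'a assume \<phi>: "test_fn \<Omega> \<phi>" and i: "i \<in> Basis"
  have C: "C1 \<phi> (grad \<phi>)" using \<phi> unfolding test_fn_def by (blast intro: smooth_C1)
  define S where "S = closure {x. \<phi> x \<noteq> 0}"
  have S: "compact S" "S \<subseteq> \<Omega>" and \<phi>0: "\<And>x. x \<notin> S \<Longrightarrow> \<phi> x = 0"
    using \<phi> closure_subset[of "{x. \<phi> x \<noteq> 0}"] by (auto simp: test_fn_def S_def)
  \<comment> \<open>Shifts by at most \<open>\<tau>\<close> keep the support of the test function
    inside the domain, so at these points the truncation \<open>f0\<close> and \<open>f\<close> have
    the same difference quotients.\<close>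
  obtain \<tau> where \<tau>: "\<tau> > 0" "(\<Union>x\<in>S. cball x \<tau>) \<subseteq> \<Omega>"
    using compact_subset_open_imp_cball_epsilon_subset[OF S(1) \<Omega>(1) S(2)] by blast
  define t where "t k = \<tau> / (real k + 1)" for k :: nat
  have t: "0 < t k" "t k \<le> \<tau>" for k using \<tau>(1) by (auto simp: t_def field_simps)
  have t0: "t \<longlonglongrightarrow> 0"
    using tendsto_mult_left[OF LIMSEQ_inverse_real_of_nat, of \<tau>] by (simp add: t_def[abs_def] divide_inverse add.commute)
  have ft: "filterlim t (at 0) sequentially"
    using t0 t(1) by (auto simp: filterlim_at less_imp_neq[symmetric] intro!: always_eventually)
  have tneg: "filterlim (\<lambda>k. - t k) (at 0) sequentially"
    using tendsto_minus[OF t0] t(1) by (auto simp: filterlim_at less_imp_neq[symmetric] intro!: always_eventually)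
  define f0 where "f0 x = indicator \<Omega> x * f x" for x
  have f0m[measurable]: "f0 \<in> borel_measurable lebesgue" unfolding f0_def using fm by measurable
  have \<phi>m[measurable]: "\<phi> \<in> borel_measurable borel" "\<phi> \<in> borel_measurable lebesgue" using C1_measurable[OF C] by auto
  have B0: "\<bar>f0 x\<bar> \<le> \<bar>B\<bar> * indicator \<Omega> x" for x using fb[of x] by (auto simp: f0_def indicator_def)
  have ne: "norm i = 1" using i by simp
  have gradi: "frechet_derivative \<phi> (at x) i = grad \<phi> x \<bullet> i" for x by (simp add: C1_frechet[OF C])
  have grad0: "grad \<phi> x = 0" if "x \<notin> S" for x
  proof -
    have "open (- S)" by (rule open_Compl[OF compact_imp_closed[OF S(1)]])
    have "((\<lambda>_. 0) has_derivative (\<lambda>_. 0)) (at x)" by simp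
    then have "(\<phi> has_derivative (\<lambda>_. 0)) (at x)"
      by (rule has_derivative_transform_within_open[OF _ \<open>open (- S)\<close>]) (use that \<phi>0 in auto)
    then have "(\<lambda>h. grad \<phi> x \<bullet> h) = (\<lambda>_. 0)" using C has_derivative_unique unfolding C1_def by blast
    then have "grad \<phi> x \<bullet> grad \<phi> x = 0" by metis
    then show ?thesis by simp
  qed
  obtain N where N: "\<And>x. norm (grad \<phi> x) \<le> N" "N \<ge> 0"
  proof -
    have "continuous_on S (grad \<phi>)" using C by (auto simp: C1_def intro: continuous_on_subset)
    then have "bounded (grad \<phi> ` S)" by (rule compact_imp_bounded[OF compact_continuous_image[OF _ S(1)]])
    then obtain N where N: "\<forall>y\<in>grad \<phi> ` S. norm y \<le> N" unfolding bounded_iff by blast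
    have "norm (grad \<phi> x) \<le> \<bar>N\<bar>" for x using N grad0[of x] by (cases "x \<in> S") force+
    then show thesis by (rule that) simp
  qed
  have \<phi>lip: "\<bar>\<phi> (x + s *\<^sub>R i) - \<phi> x\<bar> \<le> N * \<bar>s\<bar>" for x s
  proof -
    have "norm (\<phi> (x + s *\<^sub>R i) - \<phi> x) \<le> N * norm (x + s *\<^sub>R i - x)"
    proof (rule differentiable_bound[of UNIV \<phi> "\<lambda>y h. grad \<phi> y \<bullet> h"])
      show "(\<phi> has_derivative (\<lambda>h. grad \<phi> y \<bullet> h)) (at y within UNIV)" for y using C by (simp add: C1_def)
      show "onorm (\<lambda>h. grad \<phi> y \<bullet> h) \<le> N" for y
        by (rule onorm_le) (use order_trans[OF Cauchy_Schwarz_ineq2 mult_right_mono[OF N(1)]] in auto)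
    qed auto
    then show ?thesis using ne by simp
  qed
  have "integrable lebesgue (\<lambda>x. indicator \<Omega> x :: real)" using \<Omega>lm by (intro integrable_real_indicator) (auto simp: fmeasurable_def)
  then have iI: "integrable lebesgue (\<lambda>x. c * indicator \<Omega> x :: real)" for c by simp
  have L1: "(\<lambda>k. LINT x|lebesgue. f0 x * ((\<phi> (x + t k *\<^sub>R i) - \<phi> x) / t k)) \<longlonglongrightarrow> (LINT x|lebesgue. f0 x * (grad \<phi> x \<bullet> i))"
  proof (rule integral_dominated_convergence[where w = "\<lambda>x. (\<bar>B\<bar> * N) * indicator \<Omega> x"])
    show "(\<lambda>x. f0 x * (grad \<phi> x \<bullet> i)) \<in> borel_measurable lebesgue" using C1_measurable(4)[OF C] by measurable
    have "(\<lambda>x. (\<phi> (x + t k *\<^sub>R i) - \<phi> x) / t k) \<in> borel_measurable borel" for k by measurable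
    then have "(\<lambda>x. (\<phi> (x + t k *\<^sub>R i) - \<phi> x) / t k) \<in> borel_measurable lebesgue" for k by (auto intro: measurable_completion)
    then show "(\<lambda>x. f0 x * ((\<phi> (x + t k *\<^sub>R i) - \<phi> x) / t k)) \<in> borel_measurable lebesgue" for k by measurable
    show "integrable lebesgue (\<lambda>x. (\<bar>B\<bar> * N) * indicator \<Omega> x)" by (rule iI)
    show "AE x in lebesgue. (\<lambda>k. f0 x * ((\<phi> (x + t k *\<^sub>R i) - \<phi> x) / t k)) \<longlonglongrightarrow> f0 x * (grad \<phi> x \<bullet> i)"
    proof (intro AE_I2 tendsto_mult tendsto_const)
      fix x
      have "(\<phi> has_derivative (\<lambda>h. grad \<phi> x \<bullet> h)) (at x)" using C by (simp add: C1_def)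
      then have "((\<lambda>s. (\<phi> (x + s *\<^sub>R i) - \<phi> x) / s) \<longlongrightarrow> grad \<phi> x \<bullet> i) (at 0)"
        by (rule difference_quotient_tendsto)
      then show "(\<lambda>k. (\<phi> (x + t k *\<^sub>R i) - \<phi> x) / t k) \<longlonglongrightarrow> grad \<phi> x \<bullet> i"
        using ft by (rule filterlim_compose)
    qed
    show "AE x in lebesgue. norm (f0 x * ((\<phi> (x + t k *\<^sub>R i) - \<phi> x) / t k)) \<le> (\<bar>B\<bar> * N) * indicator \<Omega> x" for k
    proof (rule AE_I2)
      fix x
      have "\<bar>(\<phi> (x + t k *\<^sub>R i) - \<phi> x) / t k\<bar> \<le> N" using \<phi>lip[of x "t k"] t(1)[of k] by (simp add: field_simps)
      then have "\<bar>f0 x\<bar> * \<bar>(\<phi> (x + t k *\<^sub>R i) - \<phi> x) / t k\<bar> \<le> (\<bar>B\<bar> * indicator \<Omega> x) * N"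
        using B0[of x] by (intro mult_mono) auto
      then show "norm (f0 x * ((\<phi> (x + t k *\<^sub>R i) - \<phi> x) / t k)) \<le> (\<bar>B\<bar> * N) * indicator \<Omega> x"
        by (simp add: abs_mult mult_ac)
    qed
  qed
  have \<phi>b: "\<exists>P\<ge>0. \<forall>x. \<bar>\<phi> x\<bar> \<le> P"
  proof -
    have "continuous_on S \<phi>" using C1_continuous[OF C] continuous_on_subset by blast
    then have "bounded (\<phi> ` S)" by (rule compact_imp_bounded[OF compact_continuous_image[OF _ S(1)]])
    then obtain P where P: "\<forall>y\<in>\<phi> ` S. norm y \<le> P" unfolding bounded_iff by blast
    have "\<bar>\<phi> x\<bar> \<le> \<bar>P\<bar>" for x using P \<phi>0[of x] by (cases "x \<in> S") force+
    then show ?thesis by (intro exI[of _ "\<bar>P\<bar>"]) auto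
  qed
  then obtain P where P: "P \<ge> 0" "\<And>x. \<bar>\<phi> x\<bar> \<le> P" by blast
  \<comment> \<open>Domination uses the Lipschitz bound only on short segments starting in the
    support. They lie in the domain although the domain need not be convex.\<close>
  have L2: "(\<lambda>k. LINT x|lebesgue. ((f0 (x - t k *\<^sub>R i) - f0 x) / t k) * \<phi> x) \<longlonglongrightarrow> (LINT x|lebesgue. - (indicator \<Omega> x * (G x \<bullet> i)) * \<phi> x)"
  proof (rule integral_dominated_convergence[where w = "\<lambda>x. (M * P) * indicator \<Omega> x"])
    show "(\<lambda>x. - (indicator \<Omega> x * (G x \<bullet> i)) * \<phi> x) \<in> borel_measurable lebesgue" using Gm by measurable
    have "(\<lambda>x. f0 (x - t k *\<^sub>R i)) \<in> borel_measurable lebesgue" for k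
      using lebesgue_affine_measurable[of "\<lambda>_. 1" "- t k *\<^sub>R i"] 
      by (intro measurable_compose[OF _ f0m]) (simp add: euclidean_representation algebra_simps)
    then show "(\<lambda>x. ((f0 (x - t k *\<^sub>R i) - f0 x) / t k) * \<phi> x) \<in> borel_measurable lebesgue" for k by measurable
    show "integrable lebesgue (\<lambda>x. (M * P) * indicator \<Omega> x)" by (rule iI)
    have inO: "x \<in> \<Omega>" "x - t k *\<^sub>R i \<in> \<Omega>" "closed_segment (x - t k *\<^sub>R i) x \<subseteq> \<Omega>" if x: "x \<in> S" for x k
    proof -
      have c: "x \<in> cball x \<tau>" "x - t k *\<^sub>R i \<in> cball x \<tau>" using t[of k] \<tau>(1) ne by (auto simp: dist_norm)
      have "cball x \<tau> \<subseteq> \<Omega>" using \<tau>(2) x by blast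
      then show "x \<in> \<Omega>" "x - t k *\<^sub>R i \<in> \<Omega>" using c by auto
      show "closed_segment (x - t k *\<^sub>R i) x \<subseteq> \<Omega>"
        using closed_segment_subset[OF c(2,1) convex_cball] \<open>cball x \<tau> \<subseteq> \<Omega>\<close> by blast
    qed
    show "AE x in lebesgue. (\<lambda>k. ((f0 (x - t k *\<^sub>R i) - f0 x) / t k) * \<phi> x) \<longlonglongrightarrow> - (indicator \<Omega> x * (G x \<bullet> i)) * \<phi> x"
      using G
    proof eventually_elim
      case (elim x)
      show ?case
      proof (cases "x \<in> S")
        case False then show ?thesis using \<phi>0 by simp
      next
        case True
        have fd: "(f has_derivative (\<lambda>h. G x \<bullet> h)) (at x)" using elim inO(1)[OF True] by blast
        then have "((\<lambda>s. (f (x + s *\<^sub>R i) - f x) / s) \<longlongrightarrow> G x \<bullet> i) (at 0)"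
          by (rule difference_quotient_tendsto)
        from filterlim_compose[OF this tneg]
        have "(\<lambda>k. (f (x + (- t k) *\<^sub>R i) - f x) / (- t k)) \<longlonglongrightarrow> G x \<bullet> i" .
        then have "(\<lambda>k. - ((f (x + (- t k) *\<^sub>R i) - f x) / (- t k))) \<longlonglongrightarrow> - (G x \<bullet> i)" by (rule tendsto_minus)
        moreover have "(\<lambda>k. - ((f (x + (- t k) *\<^sub>R i) - f x) / (- t k))) = (\<lambda>k. (f0 (x - t k *\<^sub>R i) - f0 x) / t k)"
          using inO(1)[OF True] inO(2)[OF True] by (intro ext) (simp add: f0_def minus_divide_left)
        ultimately have "(\<lambda>k. (f0 (x - t k *\<^sub>R i) - f0 x) / t k) \<longlonglongrightarrow> - (G x \<bullet> i)" by (simp only:)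
        moreover have "- (indicator \<Omega> x * (G x \<bullet> i)) = - (G x \<bullet> i)" using inO(1)[OF True] by simp
        ultimately have "(\<lambda>k. (f0 (x - t k *\<^sub>R i) - f0 x) / t k) \<longlonglongrightarrow> - (indicator \<Omega> x * (G x \<bullet> i))"
          by (simp only:)
        then show ?thesis by (intro tendsto_mult tendsto_const)
      qed
    qed
    show "AE x in lebesgue. norm (((f0 (x - t k *\<^sub>R i) - f0 x) / t k) * \<phi> x) \<le> (M * P) * indicator \<Omega> x" for k
    proof (rule AE_I2)
      fix x
      show "norm (((f0 (x - t k *\<^sub>R i) - f0 x) / t k) * \<phi> x) \<le> (M * P) * indicator \<Omega> x"
      proof (cases "x \<in> S")
        case False then show ?thesis using \<phi>0 M P(1) by (simp add: indicator_def)
      next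
        case True
        have "\<bar>f (x - t k *\<^sub>R i) - f x\<bar> \<le> M * dist (x - t k *\<^sub>R i) x" by (rule lip[OF inO(3)[OF True]])
        then have "\<bar>f0 (x - t k *\<^sub>R i) - f0 x\<bar> \<le> M * t k"
          using inO(1)[OF True] inO(2)[OF True, of k] ne t(1)[of k] by (simp add: f0_def dist_norm)
        then have "\<bar>(f0 (x - t k *\<^sub>R i) - f0 x) / t k\<bar> \<le> M" using t(1)[of k] by (simp add: field_simps)
        then have "\<bar>(f0 (x - t k *\<^sub>R i) - f0 x) / t k\<bar> * \<bar>\<phi> x\<bar> \<le> M * P" using P(2)[of x] M by (intro mult_mono) auto
        then show ?thesis using inO(1)[OF True] by (simp add: abs_mult)
      qed
    qed
  qed
  have eq: "(LINT x|lebesgue. f0 x * ((\<phi> (x + t k *\<^sub>R i) - \<phi> x) / t k)) = (LINT x|lebesgue. ((f0 (x - t k *\<^sub>R i) - f0 x) / t k) * \<phi> x)" for k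
  proof -
    define \<tau>' where "\<tau>' = t k *\<^sub>R i"
    have i1: "integrable lebesgue (\<lambda>x. f0 x * \<phi> x)"
    proof (rule Bochner_Integration.integrable_bound[OF iI[of "\<bar>B\<bar> * P"]])
      show "AE x in lebesgue. norm (f0 x * \<phi> x) \<le> norm (\<bar>B\<bar> * P * indicator \<Omega> x)"
      proof (rule AE_I2)
        fix x
        have "\<bar>f0 x\<bar> * \<bar>\<phi> x\<bar> \<le> (\<bar>B\<bar> * indicator \<Omega> x) * P" using B0[of x] P(2)[of x] by (intro mult_mono) auto
        then show "norm (f0 x * \<phi> x) \<le> norm (\<bar>B\<bar> * P * indicator \<Omega> x)" using P(1) by (simp add: abs_mult mult_ac)
      qed
    qed measurable
    have \<phi>sm: "(\<lambda>x. \<phi> (x + \<tau>')) \<in> borel_measurable lebesgue"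
    proof -
      have "(\<lambda>x. \<phi> (x + \<tau>')) \<in> borel_measurable borel" by measurable
      then show ?thesis by (auto intro: measurable_completion)
    qed
    have i2: "integrable lebesgue (\<lambda>x. f0 x * \<phi> (x + \<tau>'))"
    proof (rule Bochner_Integration.integrable_bound[OF iI[of "\<bar>B\<bar> * P"]])
      show "(\<lambda>x. f0 x * \<phi> (x + \<tau>')) \<in> borel_measurable lebesgue" using \<phi>sm by measurable
      show "AE x in lebesgue. norm (f0 x * \<phi> (x + \<tau>')) \<le> norm (\<bar>B\<bar> * P * indicator \<Omega> x)"
      proof (rule AE_I2)
        fix x
        have "\<bar>f0 x\<bar> * \<bar>\<phi> (x + \<tau>')\<bar> \<le> (\<bar>B\<bar> * indicator \<Omega> x) * P" using B0[of x] P(2)[of "x + \<tau>'"] by (intro mult_mono) auto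
        then show "norm (f0 x * \<phi> (x + \<tau>')) \<le> norm (\<bar>B\<bar> * P * indicator \<Omega> x)" using P(1) by (simp add: abs_mult mult_ac)
      qed
    qed
    have tr: "integrable lebesgue (\<lambda>x. g (x - \<tau>'))" "(LINT x|lebesgue. g (x - \<tau>')) = (LINT x|lebesgue. g x)"
      if "integrable lebesgue g" for g :: "'a \<Rightarrow> real"
      using lebesgue_integral_shift(2,3)[OF that] by auto
    have e1: "f0 x * ((\<phi> (x + \<tau>') - \<phi> x) / t k) = (f0 x * \<phi> (x + \<tau>') - f0 x * \<phi> x) / t k" for x
      by (simp add: algebra_simps diff_divide_distrib)
    have e2: "((f0 (x - \<tau>') - f0 x) / t k) * \<phi> x = (f0 (x - \<tau>') * \<phi> x - f0 x * \<phi> x) / t k" for x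
      by (simp add: algebra_simps diff_divide_distrib)
    have "integrable lebesgue (\<lambda>x. f0 (x - \<tau>') * \<phi> x)"
      "(LINT x|lebesgue. f0 (x - \<tau>') * \<phi> x) = (LINT x|lebesgue. f0 x * \<phi> (x + \<tau>'))"
      using tr[OF i2] by auto
    then show ?thesis using i1 i2 unfolding \<tau>'_def[symmetric] e1 e2 by simp
  qed
  have "(LINT x|lebesgue. f0 x * (grad \<phi> x \<bullet> i)) = (LINT x|lebesgue. - (indicator \<Omega> x * (G x \<bullet> i)) * \<phi> x)"
    using L1 L2 unfolding eq by (rule LIMSEQ_unique)
  moreover have "integral\<^sup>L (lebesgue_on \<Omega>) (\<lambda>x. f x * frechet_derivative \<phi> (at x) i) = (LINT x|lebesgue. f0 x * (grad \<phi> x \<bullet> i))"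
    by (subst integral_restrict_space) (auto simp: gradi f0_def mult.assoc)
  moreover have "integral\<^sup>L (lebesgue_on \<Omega>) (\<lambda>x. (G x \<bullet> i) * \<phi> x) = (LINT x|lebesgue. indicator \<Omega> x * ((G x \<bullet> i) * \<phi> x))"
    by (subst integral_restrict_space) auto
  ultimately show "integral\<^sup>L (lebesgue_on \<Omega>) (\<lambda>x. f x * frechet_derivative \<phi> (at x) i) = - integral\<^sup>L (lebesgue_on \<Omega>) (\<lambda>x. (G x \<bullet> i) * \<phi> x)"
    by (simp add: mult.assoc)
qed

section \<open>First-order approximation\<close>

text \<open>Two constants that both approximate \<open>f\<close> on the same set are close to each
  other. All comparisons between cell values and nodal values go through this.\<close>

lemma const_compare:
  assumes [measurable]: "f \<in> borel_measurable lebesgue" "A \<in> sets lebesgue"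
  shows "ennreal ((c - d)\<^sup>2) * emeasure lebesgue A \<le> 2 * sqint A (\<lambda>x. f x - c) + 2 * sqint A (\<lambda>x. f x - d)"
proof -
  have "sqint A (\<lambda>x. (f x - d) - (f x - c)) \<le> 2 * sqint A (\<lambda>x. f x - d) + 2 * sqint A (\<lambda>x. f x - c)"
    by (rule sqint_diff) measurable
  then show ?thesis using sqint_const[OF assms(2), of "c - d"] by (simp add: add.commute)
qed

locale mesh_weights = mesh_geom \<Omega> \<T> \<kappa> R L n
  for \<Omega> :: "'a::euclidean_space set" and \<T> \<kappa> R L n +
  fixes \<alpha> :: "'a \<Rightarrow> 'a set \<Rightarrow> real"
  assumes weights: "valid_weights \<Omega> \<T> \<alpha>"
begin

definition "cl z f = integral\<^sup>L (lebesgue_on \<Omega>) (\<lambda>y. f y * phi \<T> \<alpha> z y)"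
definition "cz z f = (if z \<in> \<Omega> then cl z f else 0)"
text \<open>Integration is over the open cell because \<open>phi\<close> vanishes on cell
  boundaries.\<close>

definition ci :: "'a set \<Rightarrow> ('a \<Rightarrow> real) \<Rightarrow> real" where
  "ci K f = integral\<^sup>L (lebesgue_on \<Omega>) (\<lambda>y. f y * indicator (interior (convex hull K)) y)"

lemma interior_vertices_eq: "interior_vertices \<Omega> \<T> = {z \<in> \<Union>\<T>. z \<in> \<Omega>}"
  using vertex_closure open_dom by (auto simp: interior_vertices_def mesh_vertices_def frontier_def interior_open)

lemma finite_vertices: "finite (\<Union>\<T>)" using finite_mesh finite_cell by blast

lemma wts:
  assumes "z \<in> T" "T \<in> \<T>" "z \<in> \<Omega>"
  shows "\<And>K. K \<in> star \<T> z \<Longrightarrow> 0 \<le> \<alpha> z K" "(\<Sum>K\<in>star \<T> z. \<alpha> z K) = 1"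
    "(\<Sum>K\<in>star \<T> z. \<alpha> z K *\<^sub>R barycenter K) = z"
  using weights assms unfolding valid_weights_def interior_vertices_eq by blast+

lemma dom_sets: "\<Omega> \<in> sets lebesgue" using open_dom by auto

lemma dom_lmeasurable: "\<Omega> \<in> lmeasurable" using open_dom bounded_dom by (intro bounded_set_imp_lmeasurable) auto

lemma int_cell_sets: "T \<in> \<T> \<Longrightarrow> interior (convex hull T) \<in> sets (lebesgue_on \<Omega>)"
  using interior_cell dom_sets by (subst sets_restrict_space_iff) auto

lemma emeasure_cell: "T \<in> \<T> \<Longrightarrow> emeasure lebesgue (convex hull T) = ennreal (measure lebesgue (convex hull T))"
  using lmeasurable_compact[OF compact_cell] by (simp add: emeasure_eq_measure2)

lemma measure_cell_pos: "T \<in> \<T> \<Longrightarrow> measure lebesgue (convex hull T) > 0"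
  using simplex_measure(1)[OF cell] .

lemma integrable_ci:
  fixes f :: "'a \<Rightarrow> real"
  assumes "integrable (lebesgue_on \<Omega>) f" "K \<in> \<T>"
  shows "integrable (lebesgue_on \<Omega>) (\<lambda>y. f y * indicator (interior (convex hull K)) y)"
  using integrable_real_mult_indicator[OF int_cell_sets[OF assms(2)] assms(1)] .

lemma cl_eq:
  assumes f: "integrable (lebesgue_on \<Omega>) f"
  shows "cl z f = (\<Sum>K\<in>star \<T> z. \<alpha> z K / measure lebesgue (convex hull K) * ci K f)"
proof -
  have "cl z f = integral\<^sup>L (lebesgue_on \<Omega>) (\<lambda>y. \<Sum>K\<in>star \<T> z. \<alpha> z K / measure lebesgue (convex hull K) * (f y * indicator (interior (convex hull K)) y))"
    unfolding cl_def phi_def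
    by (intro Bochner_Integration.integral_cong) (auto simp: sum_distrib_left indicator_def intro!: sum.cong)
  also have "\<dots> = (\<Sum>K\<in>star \<T> z. integral\<^sup>L (lebesgue_on \<Omega>) (\<lambda>y. \<alpha> z K / measure lebesgue (convex hull K) * (f y * indicator (interior (convex hull K)) y)))"
    using integrable_ci[OF f] by (intro Bochner_Integration.integral_sum) (auto simp: star_def)
  also have "\<dots> = (\<Sum>K\<in>star \<T> z. \<alpha> z K / measure lebesgue (convex hull K) * ci K f)"
    unfolding ci_def by simp
  finally show ?thesis .
qed

lemma ci_lebesgue:
  assumes "K \<in> \<T>" shows "ci K f = (LINT y|lebesgue. f y * indicator (interior (convex hull K)) y)"
  unfolding ci_def using dom_sets interior_cell[OF assms]
  by (subst integral_restrict_space) (auto simp: indicator_def intro!: Bochner_Integration.integral_cong)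

lemma ci_bound:
  assumes K: "K \<in> \<T>" and f[measurable]: "f \<in> borel_measurable lebesgue"
  shows "ennreal ((ci K f)\<^sup>2) \<le> emeasure lebesgue (convex hull K) * sqint (convex hull K) f"
proof -
  let ?I = "interior (convex hull K)"
  have I[measurable]: "?I \<in> sets lebesgue" by auto
  let ?g = "\<lambda>y. f y * indicator ?I y"
  \<comment> \<open>If the integrand is not integrable the integral has the default value 0, and the
    bound holds trivially.\<close>
  have "ennreal \<bar>ci K f\<bar> \<le> (\<integral>\<^sup>+y. ennreal \<bar>?g y\<bar> \<partial>lebesgue)"
    unfolding ci_lebesgue[OF K]
    using integral_norm_bound_ennreal[of lebesgue ?g]
    by (cases "integrable lebesgue ?g") (auto simp: not_integrable_integral_eq)
  also have "\<dots> = (\<integral>\<^sup>+y. (ennreal \<bar>f y\<bar> * indicator ?I y) * indicator ?I y \<partial>lebesgue)"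
    by (intro nn_integral_cong) (auto simp: indicator_def)
  finally have "(ennreal \<bar>ci K f\<bar>)\<^sup>2 \<le> (\<integral>\<^sup>+y. (ennreal \<bar>f y\<bar> * indicator ?I y) * indicator ?I y \<partial>lebesgue)\<^sup>2"
    by (rule power_mono) simp
  also have "\<dots> \<le> (\<integral>\<^sup>+y. (ennreal \<bar>f y\<bar> * indicator ?I y)\<^sup>2 \<partial>lebesgue) * (\<integral>\<^sup>+y. (indicator ?I y)\<^sup>2 \<partial>lebesgue)"
    by (rule Cauchy_Schwarz_nn_integral) measurable
  also have "(\<integral>\<^sup>+y. (indicator ?I y)\<^sup>2 \<partial>lebesgue) = emeasure lebesgue ?I"
  proof -
    have "(\<integral>\<^sup>+y. (indicator ?I y)\<^sup>2 \<partial>lebesgue) = (\<integral>\<^sup>+y. indicator ?I y \<partial>lebesgue)"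
      by (intro nn_integral_cong) (auto simp: indicator_def)
    then show ?thesis by simp
  qed
  also have "(\<integral>\<^sup>+y. (ennreal \<bar>f y\<bar> * indicator ?I y)\<^sup>2 \<partial>lebesgue) = sqint ?I f"
    unfolding sqint_def by (intro nn_integral_cong) (auto simp: indicator_def ennreal_power)
  also have "sqint ?I f * emeasure lebesgue ?I \<le> sqint (convex hull K) f * emeasure lebesgue (convex hull K)"
    by (intro mult_mono sqint_mono emeasure_mono interior_subset cell_sets K) auto
  finally show ?thesis by (simp add: ennreal_power mult.commute)
qed

text \<open>Bounds the ratio of the volumes of two cells at a common vertex.\<close>

definition "Q = \<kappa> * (2 * c2) ^ n"

lemma Q_ge1: "Q \<ge> 1"
proof -
  have "1 \<le> (2 * c2) ^ n" using c2_ge1 by (intro one_le_power) simp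
  then have "1 * 1 \<le> \<kappa> * (2 * c2) ^ n" using \<kappa> by (intro mult_mono) auto
  then show ?thesis by (simp add: Q_def)
qed

lemma measure_ratio:
  assumes "A \<in> star \<T> z" "B \<in> star \<T> z"
  shows "measure lebesgue (convex hull A) \<le> Q * measure lebesgue (convex hull B)"
proof -
  have AB: "A \<in> \<T>" "B \<in> \<T>" "z \<in> A" "z \<in> B" using assms by (auto simp: star_def)
  have "measure lebesgue (convex hull A) \<le> (2 * diameter A) ^ DIM('a)" by (rule simplex_measure(2)[OF cell[OF AB(1)]])
  also have "\<dots> \<le> (2 * (c2 * diameter B)) ^ DIM('a)"
    using comparable[OF AB(1,3,2,4)] diam_pos[OF AB(1)] by (intro power_mono) auto
  also have "\<dots> = (2 * c2) ^ DIM('a) * diameter B ^ DIM('a)" by (simp add: power_mult_distrib)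
  also have "\<dots> \<le> (2 * c2) ^ DIM('a) * (\<kappa> * measure lebesgue (convex hull B))"
    using shape_cell[OF AB(2)] c2_ge1 by (intro mult_left_mono) auto
  finally show ?thesis by (simp add: Q_def n[symmetric] mult_ac)
qed

text \<open>Jensen for the convex weights: the square of the weighted mean of cell means is at most
  the weighted mean of their squares. Each square is bounded by Cauchy-Schwarz on its cell, and
  \<open>Q\<close> exchanges the volume of that cell for the volume of \<open>T\<close>.\<close>

lemma cl_bound:
  assumes T: "z \<in> T" "T \<in> \<T>" and z: "z \<in> \<Omega>"
    and f: "f \<in> borel_measurable lebesgue" "integrable (lebesgue_on \<Omega>) f"
    and E: "\<And>K. K \<in> star \<T> z \<Longrightarrow> sqint (convex hull K) f \<le> E"
  shows "ennreal ((cl z f)\<^sup>2) * emeasure lebesgue (convex hull T) \<le> ennreal Q * E"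
proof (cases "E = top")
  case True
  then show ?thesis using Q_ge1 by (simp add: ennreal_mult_top)
next
  case False
  let ?m = "\<lambda>K. measure lebesgue (convex hull K)"
  define e where "e = enn2real E"
  have e: "E = ennreal e" "e \<ge> 0" using False by (auto simp: e_def less_top)
  have ci: "(ci K f)\<^sup>2 \<le> ?m K * e" if K: "K \<in> star \<T> z" for K
  proof -
    have KT: "K \<in> \<T>" using K by (simp add: star_def)
    have "ennreal ((ci K f)\<^sup>2) \<le> emeasure lebesgue (convex hull K) * sqint (convex hull K) f" by (rule ci_bound[OF KT f(1)])
    also have "\<dots> \<le> ennreal (?m K) * ennreal e"
      unfolding emeasure_cell[OF KT] e(1)[symmetric] by (intro mult_left_mono E K) auto
    also have "\<dots> = ennreal (?m K * e)" using e(2) by (simp add: ennreal_mult)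
    finally show ?thesis using e(2) by (simp add: ennreal_le_iff)
  qed
  have "(cl z f)\<^sup>2 = (\<Sum>K\<in>star \<T> z. sqrt (\<alpha> z K) * (sqrt (\<alpha> z K) * (ci K f / ?m K)))\<^sup>2"
    unfolding cl_eq[OF f(2)] using wts(1)[OF T z] by (simp add: mult.assoc[symmetric])
  also have "\<dots> \<le> (\<Sum>K\<in>star \<T> z. (sqrt (\<alpha> z K))\<^sup>2) * (\<Sum>K\<in>star \<T> z. (sqrt (\<alpha> z K) * (ci K f / ?m K))\<^sup>2)"
    by (rule Cauchy_Schwarz_ineq_sum)
  also have "\<dots> = (\<Sum>K\<in>star \<T> z. \<alpha> z K * (ci K f / ?m K)\<^sup>2)"
  proof -
    have "(\<Sum>K\<in>star \<T> z. (sqrt (\<alpha> z K))\<^sup>2) = 1" using wts(1,2)[OF T z] by simp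
    moreover have "(\<Sum>K\<in>star \<T> z. (sqrt (\<alpha> z K) * (ci K f / ?m K))\<^sup>2) = (\<Sum>K\<in>star \<T> z. \<alpha> z K * (ci K f / ?m K)\<^sup>2)"
      unfolding power_mult_distrib using wts(1)[OF T z] by simp
    ultimately show ?thesis by simp
  qed
  finally have 1: "(cl z f)\<^sup>2 \<le> (\<Sum>K\<in>star \<T> z. \<alpha> z K * (ci K f / ?m K)\<^sup>2)" .
  have "(cl z f)\<^sup>2 * ?m T \<le> (\<Sum>K\<in>star \<T> z. \<alpha> z K * (ci K f / ?m K)\<^sup>2) * ?m T"
    using 1 by (rule mult_right_mono) simp
  also have "\<dots> = (\<Sum>K\<in>star \<T> z. \<alpha> z K * ((ci K f / ?m K)\<^sup>2 * ?m T))"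
    by (simp add: sum_distrib_right mult.assoc)
  also have "\<dots> \<le> (\<Sum>K\<in>star \<T> z. \<alpha> z K * (Q * e))"
  proof (intro sum_mono mult_left_mono wts(1)[OF T z])
    fix K assume K: "K \<in> star \<T> z"
    have mK: "?m K > 0" using measure_cell_pos K by (simp add: star_def)
    have "(ci K f / ?m K)\<^sup>2 * ?m T \<le> (?m K * e / (?m K)\<^sup>2) * (Q * ?m K)"
      unfolding power_divide using ci[OF K] measure_ratio[OF starI[OF T] K] mK e(2)
      by (intro mult_mono divide_right_mono) auto
    also have "\<dots> = Q * e" using mK by (simp add: power2_eq_square)
    finally show "(ci K f / ?m K)\<^sup>2 * ?m T \<le> Q * e" .
  qed auto
  also have "\<dots> = Q * e" using wts(2)[OF T z] by (simp add: sum_distrib_right[symmetric])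
  finally have "(cl z f)\<^sup>2 * ?m T \<le> Q * e" .
  then have "ennreal ((cl z f)\<^sup>2 * ?m T) \<le> ennreal (Q * e)" by (rule ennreal_leI)
  then show ?thesis using e Q_ge1 by (simp add: emeasure_cell[OF T(2)] ennreal_mult)
qed

lemma affine_measurable: "(\<lambda>x::'a. a \<bullet> x + b) \<in> borel_measurable lebesgue"
proof -
  have "(\<lambda>x::'a. a \<bullet> x + b) \<in> borel_measurable borel" by measurable
  then show ?thesis by (auto intro: measurable_completion)
qed

lemma affine_integrable: "integrable (lebesgue_on \<Omega>) (\<lambda>x. a \<bullet> x + b)"
proof -
  interpret F: finite_measure "lebesgue_on \<Omega>" by (rule finite_measure_lebesgue_on[OF dom_lmeasurable])
  obtain r where r: "\<forall>x\<in>\<Omega>. norm x \<le> r" using bounded_dom unfolding bounded_iff by blast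
  show ?thesis
  proof (rule F.integrable_const_bound[of _ "norm a * r + \<bar>b\<bar>"])
    show "AE x in lebesgue_on \<Omega>. norm (a \<bullet> x + b) \<le> norm a * r + \<bar>b\<bar>"
    proof (rule AE_I2)
      fix x assume "x \<in> space (lebesgue_on \<Omega>)"
      then have "\<bar>a \<bullet> x\<bar> \<le> norm a * r"
        using r by (intro order_trans[OF Cauchy_Schwarz_ineq2 mult_left_mono]) auto
      then show "norm (a \<bullet> x + b) \<le> norm a * r + \<bar>b\<bar>" by simp
    qed
    show "(\<lambda>x. a \<bullet> x + b) \<in> borel_measurable (lebesgue_on \<Omega>)"
      by (rule measurable_restrict_space1[OF affine_measurable])
  qed
qed

lemma ci_affine:
  assumes K: "K \<in> \<T>"
  shows "ci K (\<lambda>x. a \<bullet> x + b) = measure lebesgue (convex hull K) * (a \<bullet> barycenter K + b)"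
proof -
  note hb = cell_mean_affine[OF cell[OF K], of a b]
  have neg: "convex hull K - interior (convex hull K) \<in> null_sets lebesgue"
    using negligible_convex_frontier[OF convex_convex_hull, of K] compact_imp_closed[OF compact_cell[OF K]]
    by (simp add: frontier_def negligible_iff_null_sets)
  have "ci K (\<lambda>x. a \<bullet> x + b) = (LINT y|lebesgue. (a \<bullet> y + b) * indicator (convex hull K) y)"
    unfolding ci_lebesgue[OF K]
  proof (rule integral_cong_AE)
    show "(\<lambda>y. (a \<bullet> y + b) * indicator (interior (convex hull K)) y) \<in> borel_measurable lebesgue"
      using affine_measurable[of a b] by (intro borel_measurable_times borel_measurable_indicator) auto
    show "(\<lambda>y. (a \<bullet> y + b) * indicator (convex hull K) y) \<in> borel_measurable lebesgue"
      using hb by (auto simp: has_bochner_integral_iff)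
    show "AE y in lebesgue. (a \<bullet> y + b) * indicator (interior (convex hull K)) y = (a \<bullet> y + b) * indicator (convex hull K) y"
      by (rule AE_I'[OF neg]) (use interior_subset in \<open>auto simp: indicator_def split: if_splits\<close>)
  qed
  also have "\<dots> = measure lebesgue (convex hull K) * (a \<bullet> barycenter K + b)"
    using hb by (simp add: has_bochner_integral_iff)
  finally show ?thesis .
qed

text \<open>Cell means of an affine function are its values at barycentres, and the weighted
  barycentres average to \<open>z\<close>.\<close>

lemma cl_affine:
  assumes T: "z \<in> T" "T \<in> \<T>" and z: "z \<in> \<Omega>"
  shows "cl z (\<lambda>x. a \<bullet> x + b) = a \<bullet> z + b"
proof -
  have "cl z (\<lambda>x. a \<bullet> x + b) = (\<Sum>K\<in>star \<T> z. \<alpha> z K * (a \<bullet> barycenter K + b))"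
    unfolding cl_eq[OF affine_integrable] using ci_affine measure_cell_pos
    by (intro sum.cong) (auto simp: star_def less_imp_neq[symmetric])
  also have "\<dots> = a \<bullet> (\<Sum>K\<in>star \<T> z. \<alpha> z K *\<^sub>R barycenter K) + b * (\<Sum>K\<in>star \<T> z. \<alpha> z K)"
    by (simp add: inner_sum_right sum_distrib_left sum.distrib algebra_simps)
  finally show ?thesis using wts(2,3)[OF T z] by simp
qed

lemma cl_diff_affine:
  assumes T: "z \<in> T" "T \<in> \<T>" and z: "z \<in> \<Omega>" and f: "integrable (lebesgue_on \<Omega>) f"
  shows "cl z (\<lambda>x. f x - (a \<bullet> x + b)) = cl z f - (a \<bullet> z + b)"
proof -
  have "cl z (\<lambda>x. f x - (a \<bullet> x + b)) = cl z f - cl z (\<lambda>x. a \<bullet> x + b)"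
    unfolding cl_eq[OF f] cl_eq[OF affine_integrable] cl_eq[OF Bochner_Integration.integrable_diff[OF f affine_integrable]]
    unfolding sum_subtractf[symmetric]
  proof (rule sum.cong[OF refl])
    fix K assume "K \<in> star \<T> z"
    then have K: "K \<in> \<T>" by (simp add: star_def)
    have "ci K (\<lambda>x. f x - (a \<bullet> x + b)) = ci K f - ci K (\<lambda>x. a \<bullet> x + b)"
      unfolding ci_def left_diff_distrib
      by (rule Bochner_Integration.integral_diff[OF integrable_ci[OF f K] integrable_ci[OF affine_integrable K]])
    then show "\<alpha> z K / measure lebesgue (convex hull K) * ci K (\<lambda>x. f x - (a \<bullet> x + b)) =
      \<alpha> z K / measure lebesgue (convex hull K) * ci K f - \<alpha> z K / measure lebesgue (convex hull K) * ci K (\<lambda>x. a \<bullet> x + b)"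
      by (simp add: right_diff_distrib)
  qed
  then show ?thesis by (simp add: cl_affine[OF T z])
qed

text \<open>\<open>hat\<close> picks an arbitrary cell through \<open>SOME\<close>. Coordinates
  agree on common faces, so the value may be computed in any cell containing
  \<open>x\<close>.\<close>

lemma hat_cell:
  assumes T: "T \<in> \<T>" "x \<in> convex hull T"
  shows "hat \<T> z x = (if z \<in> T then lam T z x else 0)"
proof (cases "\<exists>A\<in>\<T>. z \<in> A \<and> x \<in> convex hull A")
  case True
  define A where "A = (SOME A. A \<in> \<T> \<and> z \<in> A \<and> x \<in> convex hull A)"
  have A: "A \<in> \<T>" "z \<in> A" "x \<in> convex hull A"
    using someI_ex[of "\<lambda>A. A \<in> \<T> \<and> z \<in> A \<and> x \<in> convex hull A"] True by (auto simp: A_def)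
  have "hat \<T> z x = lam A z x"
    using True bary_eq_lam[OF cell[OF A(1)] A(2,3)] by (simp add: hat_def A_def)
  then show ?thesis
    using lam_agree[OF A(1) T(1) A(3) T(2) A(2)] common_face[OF A(1) T(1) A(3) T(2)] A(2) by auto
next
  case False then show ?thesis using T by (auto simp: hat_def)
qed

section \<open>The interpolant cell by cell\<close>

lemma hat_outside: "x \<notin> closure \<Omega> \<Longrightarrow> hat \<T> z x = 0"
  using cell_sub by (auto simp: hat_def)

lemma clement_cell:
  assumes T: "T \<in> \<T>" "x \<in> convex hull T"
  shows "clement \<Omega> \<T> \<alpha> v x = (\<Sum>z\<in>T. cz z v * lam T z x)"
proof -
  have "clement \<Omega> \<T> \<alpha> v x = (\<Sum>z\<in>interior_vertices \<Omega> \<T>. if z \<in> T then cl z v * lam T z x else 0)"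
    unfolding clement_def cl_def[symmetric] using hat_cell[OF T] by (intro sum.cong) auto
  also have "\<dots> = (\<Sum>z\<in>interior_vertices \<Omega> \<T> \<inter> T. cl z v * lam T z x)"
    by (rule sum.inter_restrict[symmetric], rule finite_subset[OF _ finite_vertices]) (auto simp: interior_vertices_eq)
  also have "\<dots> = (\<Sum>z\<in>interior_vertices \<Omega> \<T> \<inter> T. cz z v * lam T z x)"
    by (intro sum.cong) (auto simp: interior_vertices_eq cz_def)
  also have "\<dots> = (\<Sum>z\<in>T. cz z v * lam T z x)"
    using T finite_cell by (intro sum.mono_neutral_left) (auto simp: interior_vertices_eq cz_def)
  finally show ?thesis .
qed

lemma clement_outside: "x \<notin> closure \<Omega> \<Longrightarrow> clement \<Omega> \<T> \<alpha> v x = 0"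
  by (simp add: clement_def hat_outside)

text \<open>The affine pieces on finitely many closed cells paste to a continuous function on the
  closed domain; outside, the interpolant is zero.\<close>

lemma clement_measurable: "clement \<Omega> \<T> \<alpha> v \<in> borel_measurable lebesgue"
proof -
  let ?J = "clement \<Omega> \<T> \<alpha> v"
  have lc: "continuous_on S (lam T z)" for S T and z :: 'a unfolding lam_def by (intro continuous_intros)
  have "continuous_on (\<Union>T\<in>\<T>. convex hull T) ?J"
  proof (rule continuous_on_closed_Union)
    fix T assume T: "T \<in> \<T>"
    have "continuous_on (convex hull T) (\<lambda>x. \<Sum>z\<in>T. cz z v * lam T z x)" by (intro continuous_intros lc)
    then show "continuous_on (convex hull T) ?J"
      by (rule continuous_on_eq) (simp add: clement_cell[OF T])
    show "closed (convex hull T)" using compact_cell[OF T] by (rule compact_imp_closed)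
  qed (rule finite_mesh)
  then have "continuous_on (closure \<Omega>) ?J" using cover by simp
  then have "(\<lambda>x. indicator (closure \<Omega>) x *\<^sub>R ?J x) \<in> borel_measurable borel"
    by (intro borel_measurable_continuous_on_indicator) auto
  moreover have "(\<lambda>x. indicator (closure \<Omega>) x *\<^sub>R ?J x) = ?J"
    using clement_outside by (auto simp: fun_eq_iff indicator_def)
  ultimately have "?J \<in> borel_measurable borel" by simp
  then show ?thesis by (auto intro: measurable_completion)
qed

lemma lam_measurable: "lam T z \<in> borel_measurable lebesgue"
proof -
  have "lam T z \<in> borel_measurable borel" unfolding lam_def by measurable
  then show ?thesis by (auto intro: measurable_completion)
qed

lemma card_cell: "T \<in> \<T> \<Longrightarrow> card T = n + 1" using cell n by (simp add: full_simplex_def)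

lemma sqint_lam_sum:
  assumes T: "T \<in> \<T>"
  shows "sqint (convex hull T) (\<lambda>x. \<Sum>z\<in>T. d z * lam T z x) \<le>
    ennreal (real n + 1) * (\<Sum>z\<in>T. ennreal ((d z)\<^sup>2) * emeasure lebesgue (convex hull T))"
proof -
  note [measurable] = lam_measurable cell_sets[OF T]
  have "sqint (convex hull T) (\<lambda>x. \<Sum>z\<in>T. d z * lam T z x) \<le>
    ennreal (real (card T)) * (\<Sum>z\<in>T. sqint (convex hull T) (\<lambda>x. d z * lam T z x))"
    by (rule sqint_sum[OF finite_cell[OF T]]) measurable
  also have "\<dots> \<le> ennreal (real (card T)) * (\<Sum>z\<in>T. sqint (convex hull T) (\<lambda>x. d z))"
  proof (intro mult_left_mono sum_mono sqint_mono_fun)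
    fix z x assume zx: "z \<in> T" "x \<in> convex hull T"
    have "\<bar>lam T z x\<bar> \<le> 1" using lam_le_1[OF cell[OF T] zx] in_hull_iff[OF cell[OF T]] zx by auto
    then have "\<bar>d z\<bar> * \<bar>lam T z x\<bar> \<le> \<bar>d z\<bar> * 1" by (intro mult_left_mono) auto
    then show "\<bar>d z * lam T z x\<bar> \<le> \<bar>d z\<bar>" by (simp add: abs_mult)
  qed auto
  finally show ?thesis by (simp add: sqint_const[OF cell_sets[OF T]] card_cell[OF T] add.commute)
qed

text \<open>An affine function is the combination of the coordinates with its own nodal values.
  Subtracting it leaves its approximation error on the cell and an affine function whose nodal
  values are the nodal errors.\<close>

lemma clement_error_cell:
  assumes T: "T \<in> \<T>" and [measurable]: "v \<in> borel_measurable lebesgue"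
  shows "sqint (convex hull T) (\<lambda>x. v x - clement \<Omega> \<T> \<alpha> v x) \<le>
    2 * sqint (convex hull T) (\<lambda>x. v x - (a \<bullet> x + b)) +
    2 * (ennreal (real n + 1) * (\<Sum>z\<in>T. ennreal ((a \<bullet> z + b - cz z v)\<^sup>2) * emeasure lebesgue (convex hull T)))"
proof -
  note [measurable] = lam_measurable cell_sets[OF T] affine_measurable
  let ?P = "\<lambda>x. a \<bullet> x + b"
  have P: "?P x = (\<Sum>z\<in>T. ?P z * lam T z x)" for x
  proof -
    have "(\<Sum>z\<in>T. ?P z * lam T z x) = a \<bullet> (\<Sum>z\<in>T. lam T z x *\<^sub>R z) + b * (\<Sum>z\<in>T. lam T z x)"
      by (simp add: inner_sum_right sum_distrib_left sum.distrib[symmetric] algebra_simps)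
    then show ?thesis using lam_combination[OF cell[OF T]] by simp
  qed
  have "sqint (convex hull T) (\<lambda>x. v x - clement \<Omega> \<T> \<alpha> v x) =
    sqint (convex hull T) (\<lambda>x. (v x - ?P x) + (\<Sum>z\<in>T. (?P z - cz z v) * lam T z x))"
  proof (rule sqint_cong)
    fix x assume "x \<in> convex hull T"
    then show "\<bar>v x - clement \<Omega> \<T> \<alpha> v x\<bar> = \<bar>(v x - ?P x) + (\<Sum>z\<in>T. (?P z - cz z v) * lam T z x)\<bar>"
      unfolding left_diff_distrib sum_subtractf P[symmetric] by (simp add: clement_cell[OF T])
  qed
  also have "\<dots> \<le> 2 * sqint (convex hull T) (\<lambda>x. v x - ?P x) + 2 * sqint (convex hull T) (\<lambda>x. \<Sum>z\<in>T. (?P z - cz z v) * lam T z x)"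
    by (rule sqint_add) measurable
  also have "\<dots> \<le> 2 * sqint (convex hull T) (\<lambda>x. v x - ?P x) +
    2 * (ennreal (real n + 1) * (\<Sum>z\<in>T. ennreal ((?P z - cz z v)\<^sup>2) * emeasure lebesgue (convex hull T)))"
    by (intro add_left_mono mult_left_mono sqint_lam_sum T) auto
  finally show ?thesis .
qed

lemma weak_pair_integrable:
  assumes "weak_pair \<Omega> v g" shows "integrable (lebesgue_on \<Omega>) v"
  using assms by (simp add: weak_pair_def has_weak_grad_def)

text \<open>The factor is \<open>2 * Q\<close> for passing from \<open>cl z v\<close> to a constant
  on the star and \<open>2 * 4\<close> for passing from that constant to the one on
  \<open>T\<close>. The sum of the three Poincare constants covers interior and boundary vertices at
  once.\<close>

definition "cV = (2 * Q + 8) * (cA + cT + cB)"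

lemma consts_nonneg: "0 \<le> cA" "0 \<le> cT" "0 \<le> cB" "0 \<le> cV" "0 \<le> Q"
proof -
  show A: "0 \<le> cA" unfolding cA_def using c2_ge1 c3_pos by simp
  show T: "0 \<le> cT" unfolding cT_def using c1_ge1 by simp
  show B: "0 \<le> cB" unfolding cB_def using c4_pos by simp
  show Q: "0 \<le> Q" using Q_ge1 by simp
  show "0 \<le> cV" unfolding cV_def using A T B Q by simp
qed

text \<open>The nodal errors are stated separately from the error on the cell because gradient
  stability needs precisely them.\<close>

lemma first_order:
  assumes zp: "zero_pair \<Omega> v g" and T: "T \<in> \<T>"
  shows "\<exists>m. sqint (convex hull T) (\<lambda>x. v x - m) \<le> ennreal (cT * (diameter T)\<^sup>2) * sqint (convex hull T) (\<lambda>x. norm (g x)) \<and>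
    (\<forall>z\<in>T. ennreal ((m - cz z v)\<^sup>2) * emeasure lebesgue (convex hull T) \<le> ennreal (cV * (diameter T)\<^sup>2) * sqint (starset z) (\<lambda>x. norm (g x)))"
proof -
  have wp: "weak_pair \<Omega> v g" using zp by (simp add: zero_pair_def)
  note [measurable] = weak_pair_facts(3,4)[OF wp] cell_sets[OF T]
  let ?h2 = "(diameter T)\<^sup>2" and ?K = "convex hull T"
  obtain m where m: "sqint ?K (\<lambda>x. v x - m) \<le> ennreal (cT * ?h2) * sqint ?K (\<lambda>x. norm (g x))"
    using cell_poincare[OF wp T] by blast
  have "ennreal ((m - cz z v)\<^sup>2) * emeasure lebesgue ?K \<le> ennreal (cV * ?h2) * sqint (starset z) (\<lambda>x. norm (g x))"
    if z: "z \<in> T" for z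
  proof -
    let ?X = "sqint (starset z) (\<lambda>x. norm (g x))"
    define s where "s = (cA + cT + cB) * ?h2"
    have s: "0 \<le> s" "cA * ?h2 \<le> s" "cT * ?h2 \<le> s" "cB * ?h2 \<le> s"
      unfolding s_def using consts_nonneg by (auto intro!: mult_right_mono)
    define E where "E = ennreal s * ?X"
    have mE: "sqint ?K (\<lambda>x. v x - m) \<le> E"
      unfolding E_def using s by (intro order_trans[OF m] mult_mono ennreal_leI sqint_mono starset_cell z T) auto
    have final: "ennreal (2 * Q + 8) * E = ennreal (cV * ?h2) * ?X"
    proof -
      have "cV * ?h2 = (2 * Q + 8) * s" by (simp add: cV_def s_def mult.assoc)
      then have "ennreal (cV * ?h2) = ennreal (2 * Q + 8) * ennreal s"
        using consts_nonneg s by (simp only:) (rule ennreal_mult, auto)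
      then show ?thesis by (simp only: E_def mult.assoc)
    qed
    have split: "ennreal (2 * Q + 8) * E = 2 * (ennreal Q * E) + 8 * E"
      using consts_nonneg by (simp add: ennreal_plus ennreal_numeral_mult distrib_right mult.assoc)
    show ?thesis
    proof (cases "z \<in> \<Omega>")
      case True
      obtain c where c: "\<forall>K\<in>star \<T> z. sqint (convex hull K) (\<lambda>x. v x - c) \<le> ennreal (cA * ?h2) * ?X"
        using star_poincare[OF wp z T True] by blast
      have cE: "sqint (convex hull K) (\<lambda>x. v x - c) \<le> E" if "K \<in> star \<T> z" for K
        unfolding E_def using s c that by (intro order_trans[OF _ mult_right_mono[OF ennreal_leI[OF s(2)]]]) auto
      \<comment> \<open>The constant is written as an affine function with zero gradient so that the
        exactness lemma for affine functions applies.\<close>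
      have "ennreal ((cl z (\<lambda>x. v x - (0 \<bullet> x + c)))\<^sup>2) * emeasure lebesgue ?K \<le> ennreal Q * E"
      proof (rule cl_bound[OF z T True])
        show "(\<lambda>x. v x - (0 \<bullet> x + c)) \<in> borel_measurable lebesgue"
          by (rule borel_measurable_diff[OF _ affine_measurable]) measurable
        show "integrable (lebesgue_on \<Omega>) (\<lambda>x. v x - (0 \<bullet> x + c))"
          by (rule Bochner_Integration.integrable_diff[OF weak_pair_integrable[OF wp] affine_integrable])
      qed (use cE in simp)
      then have 1: "ennreal ((c - cl z v)\<^sup>2) * emeasure lebesgue ?K \<le> ennreal Q * E"
        unfolding cl_diff_affine[OF z T True weak_pair_integrable[OF wp]] by (simp add: power2_commute)
      have "ennreal ((m - c)\<^sup>2) * emeasure lebesgue ?K \<le> 2 * sqint ?K (\<lambda>x. v x - m) + 2 * sqint ?K (\<lambda>x. v x - c)"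
        by (rule const_compare) measurable
      also have "\<dots> \<le> 2 * E + 2 * E" by (intro add_mono mult_left_mono mE cE starI z T) auto
      finally have 2: "ennreal ((m - c)\<^sup>2) * emeasure lebesgue ?K \<le> 4 * E" by (simp add: distrib_right[symmetric])
      have "(m - cl z v)\<^sup>2 \<le> 2 * (c - cl z v)\<^sup>2 + 2 * (m - c)\<^sup>2"
        using zero_le_power2[of "(c - cl z v) - (m - c)"] by (simp add: power2_eq_square algebra_simps)
      then have "ennreal ((m - cl z v)\<^sup>2) \<le> 2 * ennreal ((c - cl z v)\<^sup>2) + 2 * ennreal ((m - c)\<^sup>2)"
        unfolding ennreal_numeral_mult[symmetric] by (subst ennreal_plus[symmetric]) (auto simp del: ennreal_plus intro!: ennreal_leI)
      then have "ennreal ((m - cl z v)\<^sup>2) * emeasure lebesgue ?K \<le> (2 * ennreal ((c - cl z v)\<^sup>2) + 2 * ennreal ((m - c)\<^sup>2)) * emeasure lebesgue ?K"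
        by (rule mult_right_mono) simp
      also have "\<dots> = 2 * (ennreal ((c - cl z v)\<^sup>2) * emeasure lebesgue ?K) + 2 * (ennreal ((m - c)\<^sup>2) * emeasure lebesgue ?K)"
        by (simp add: distrib_right mult.assoc)
      also have "\<dots> \<le> 2 * (ennreal Q * E) + 2 * (4 * E)"
        by (intro add_mono mult_left_mono 1 2) auto
      also have "\<dots> = ennreal (cV * ?h2) * ?X" unfolding final[symmetric] split by (simp add: mult.assoc[symmetric])
      finally show ?thesis using True by (simp add: cz_def)
    next
      case False
      then have zf: "z \<in> frontier \<Omega>" using vertex_closure[OF z T] open_dom by (simp add: frontier_def interior_open)
      \<comment> \<open>At a boundary vertex the nodal value is 0, and \<open>v\<close> itself is
        small by the Friedrichs inequality, so 0 plays the part of the constant on the star.\<close>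
      have vE: "sqint ?K (\<lambda>x. v x - 0) \<le> E"
        unfolding E_def using boundary_friedrichs[OF zp z T zf] s by (auto intro: order_trans[OF _ mult_right_mono[OF ennreal_leI]])
      have "ennreal ((m - 0)\<^sup>2) * emeasure lebesgue ?K \<le> 2 * sqint ?K (\<lambda>x. v x - m) + 2 * sqint ?K (\<lambda>x. v x - 0)"
        by (rule const_compare) measurable
      also have "\<dots> \<le> 2 * E + 2 * E" by (intro add_mono mult_left_mono mE vE) auto
      also have "\<dots> = 4 * E" by (simp add: distrib_right[symmetric])
      also have "\<dots> \<le> 8 * E" by (intro mult_right_mono) auto
      also have "\<dots> \<le> 2 * (ennreal Q * E) + 8 * E" by simp
      also have "\<dots> = ennreal (cV * ?h2) * ?X" unfolding final[symmetric] split ..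
      finally show ?thesis using False by (simp add: cz_def)
    qed
  qed
  then show ?thesis using m by blast
qed

lemma starset_patch: "z \<in> T \<Longrightarrow> starset z \<subseteq> patch \<T> T"
  by (auto simp: starset_def patch_def)

lemma cell_patch: "T \<in> \<T> \<Longrightarrow> convex hull T \<subseteq> patch \<T> T"
proof -
  assume T: "T \<in> \<T>"
  have "T \<noteq> {}" using card_cell[OF T] by auto
  then show ?thesis using starset_cell[OF _ T] starset_patch by blast
qed

definition "C2 = 2 * cT + 2 * (real n + 1)\<^sup>2 * cV"

lemma error_first_order:
  assumes zp: "zero_pair \<Omega> v g" and T: "T \<in> \<T>"
  shows "sqint (convex hull T) (\<lambda>x. v x - clement \<Omega> \<T> \<alpha> v x) \<le> ennreal (C2 * (diameter T)\<^sup>2) * sqint (patch \<T> T) (\<lambda>x. norm (g x))"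
proof -
  let ?h2 = "(diameter T)\<^sup>2" and ?K = "convex hull T" and ?X = "sqint (patch \<T> T) (\<lambda>x. norm (g x))"
  have vm: "v \<in> borel_measurable lebesgue" using zp unfolding zero_pair_def by (blast intro: weak_pair_facts(3))
  obtain m where m: "sqint ?K (\<lambda>x. v x - m) \<le> ennreal (cT * ?h2) * sqint ?K (\<lambda>x. norm (g x))"
    "\<forall>z\<in>T. ennreal ((m - cz z v)\<^sup>2) * emeasure lebesgue ?K \<le> ennreal (cV * ?h2) * sqint (starset z) (\<lambda>x. norm (g x))"
    using first_order[OF zp T] by blast
  have "sqint ?K (\<lambda>x. v x - clement \<Omega> \<T> \<alpha> v x) \<le> 2 * sqint ?K (\<lambda>x. v x - (0 \<bullet> x + m)) +
    2 * (ennreal (real n + 1) * (\<Sum>z\<in>T. ennreal ((0 \<bullet> z + m - cz z v)\<^sup>2) * emeasure lebesgue ?K))"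
    by (rule clement_error_cell[OF T vm])
  also have "\<dots> \<le> 2 * (ennreal (cT * ?h2) * ?X) + 2 * (ennreal (real n + 1) * (\<Sum>z\<in>T. ennreal (cV * ?h2) * ?X))"
  proof (intro add_mono mult_left_mono sum_mono)
    show "sqint ?K (\<lambda>x. v x - (0 \<bullet> x + m)) \<le> ennreal (cT * ?h2) * ?X"
      using order_trans[OF m(1) mult_left_mono[OF sqint_mono[OF cell_patch[OF T]]]] by simp
    fix z assume z: "z \<in> T"
    show "ennreal ((0 \<bullet> z + m - cz z v)\<^sup>2) * emeasure lebesgue ?K \<le> ennreal (cV * ?h2) * ?X"
      using order_trans[OF bspec[OF m(2) z] mult_left_mono[OF sqint_mono[OF starset_patch[OF z]]]] by simp
  qed auto
  also have "\<dots> = ennreal (C2 * ?h2) * ?X"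
  proof -
    have 1: "(\<Sum>z\<in>T. ennreal (cV * ?h2) * ?X) = ennreal (real n + 1) * (ennreal (cV * ?h2) * ?X)"
      using card_cell[OF T] by (simp add: ennreal_of_nat_eq_real_of_nat add.commute)
    have "C2 * ?h2 = 2 * (cT * ?h2) + 2 * ((real n + 1) * ((real n + 1) * (cV * ?h2)))"
      by (simp add: C2_def power2_eq_square algebra_simps)
    then have 2: "ennreal (C2 * ?h2) = 2 * ennreal (cT * ?h2) + 2 * (ennreal (real n + 1) * (ennreal (real n + 1) * ennreal (cV * ?h2)))"
      using consts_nonneg by (simp only: ennreal_numeral_mult[symmetric])
        (simp add: ennreal_mult[symmetric] ennreal_numeral_mult[symmetric] ennreal_plus[symmetric] del: ennreal_plus)
    show ?thesis unfolding 1 2 by (simp add: distrib_right mult.assoc)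
  qed
  finally show ?thesis .
qed

end

section \<open>Second-order approximation\<close>

lemma ennreal_mult_assoc: "0 \<le> x \<Longrightarrow> ennreal x * (ennreal y * Y) = ennreal (x * y) * Y"
  by (simp add: ennreal_mult' mult.assoc)

lemma ennreal_add_mult: "0 \<le> x \<Longrightarrow> 0 \<le> y \<Longrightarrow> ennreal x * Y + ennreal y * Y = ennreal (x + y) * Y"
  by (simp add: ennreal_plus distrib_right)

lemma numeral_mult_ennreal: "numeral k * (ennreal x * Y) = ennreal (numeral k * x) * Y"
  by (simp add: ennreal_numeral_mult mult.assoc)

lemma test_fn_facts:
  assumes "test_fn \<Omega> \<phi>"
  shows "C1 \<phi> (grad \<phi>)" "\<And>x. x \<notin> \<Omega> \<Longrightarrow> \<phi> x = 0 \<and> grad \<phi> x = 0"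
    "\<exists>N. \<forall>x. \<bar>\<phi> x\<bar> \<le> N \<and> norm (grad \<phi> x) \<le> N"
proof -
  show C: "C1 \<phi> (grad \<phi>)" using assms unfolding test_fn_def by (blast intro: smooth_C1)
  define S where "S = closure {x. \<phi> x \<noteq> 0}"
  have S: "compact S" "S \<subseteq> \<Omega>" and \<phi>0: "\<And>x. x \<notin> S \<Longrightarrow> \<phi> x = 0"
    using assms closure_subset[of "{x. \<phi> x \<noteq> 0}"] by (auto simp: test_fn_def S_def)
  have grad0: "grad \<phi> x = 0" if "x \<notin> S" for x
  proof -
    have "open (- S)" by (rule open_Compl[OF compact_imp_closed[OF S(1)]])
    have "((\<lambda>_. 0) has_derivative (\<lambda>_. 0)) (at x)" by simp
    then have "(\<phi> has_derivative (\<lambda>_. 0)) (at x)"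
      by (rule has_derivative_transform_within_open[OF _ \<open>open (- S)\<close>]) (use that \<phi>0 in auto)
    then have "(\<lambda>h. grad \<phi> x \<bullet> h) = (\<lambda>_. 0)" using C has_derivative_unique unfolding C1_def by blast
    then have "grad \<phi> x \<bullet> grad \<phi> x = 0" by metis
    then show ?thesis by simp
  qed
  show "\<And>x. x \<notin> \<Omega> \<Longrightarrow> \<phi> x = 0 \<and> grad \<phi> x = 0" using \<phi>0 grad0 S(2) by blast
  have "continuous_on S (grad \<phi>)" "continuous_on S \<phi>"
    using C C1_continuous[OF C] by (auto simp: C1_def intro: continuous_on_subset)
  then have "bounded (grad \<phi> ` S)" "bounded (\<phi> ` S)"
    by (auto intro!: compact_imp_bounded compact_continuous_image S)
  then obtain M N where M: "\<forall>y\<in>grad \<phi> ` S. norm y \<le> M" and N: "\<forall>y\<in>\<phi> ` S. norm y \<le> N" unfolding bounded_iff by blast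
  have "\<bar>\<phi> x\<bar> \<le> max \<bar>M\<bar> \<bar>N\<bar> \<and> norm (grad \<phi> x) \<le> max \<bar>M\<bar> \<bar>N\<bar>" for x
  proof (cases "x \<in> S")
    case True
    then have "norm (grad \<phi> x) \<le> M" "norm (\<phi> x) \<le> N" using M N by blast+
    then show ?thesis by auto
  next
    case False then show ?thesis using grad0 \<phi>0 by simp
  qed
  then show "\<exists>N. \<forall>x. \<bar>\<phi> x\<bar> \<le> N \<and> norm (grad \<phi> x) \<le> N" by blast
qed

lemma has_weak_grad_cong:
  assumes "\<And>x. x \<in> \<Omega> \<Longrightarrow> f x = f' x" "\<And>x. x \<in> \<Omega> \<Longrightarrow> G x = G' x"
  shows "has_weak_grad \<Omega> f G \<longleftrightarrow> has_weak_grad \<Omega> f' G'"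
proof -
  have 1: "integrable (lebesgue_on \<Omega>) f \<longleftrightarrow> integrable (lebesgue_on \<Omega>) f'"
    using assms by (intro Bochner_Integration.integrable_cong) auto
  have 2: "integrable (lebesgue_on \<Omega>) (\<lambda>x. G x \<bullet> i) \<longleftrightarrow> integrable (lebesgue_on \<Omega>) (\<lambda>x. G' x \<bullet> i)" for i
    using assms by (intro Bochner_Integration.integrable_cong) auto
  have 3: "integral\<^sup>L (lebesgue_on \<Omega>) (\<lambda>x. f x * h x) = integral\<^sup>L (lebesgue_on \<Omega>) (\<lambda>x. f' x * h x)" for h
    using assms by (intro Bochner_Integration.integral_cong) auto
  have 4: "integral\<^sup>L (lebesgue_on \<Omega>) (\<lambda>x. (G x \<bullet> i) * h x) = integral\<^sup>L (lebesgue_on \<Omega>) (\<lambda>x. (G' x \<bullet> i) * h x)" for h i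
    using assms by (intro Bochner_Integration.integral_cong) auto
  show ?thesis unfolding has_weak_grad_def 1 2 3 4 ..
qed

lemma has_weak_grad_diff:
  fixes u v :: "'a::euclidean_space \<Rightarrow> real"
  assumes u: "has_weak_grad \<Omega> u G" and v: "has_weak_grad \<Omega> v H"
  shows "has_weak_grad \<Omega> (\<lambda>x. u x - v x) (\<lambda>x. G x - H x)"
  unfolding has_weak_grad_def
proof (intro conjI ballI allI impI)
  have iu: "integrable (lebesgue_on \<Omega>) u" and iv: "integrable (lebesgue_on \<Omega>) v" using u v by (auto simp: has_weak_grad_def)
  have iG: "integrable (lebesgue_on \<Omega>) (\<lambda>x. G x \<bullet> i)" and iH: "integrable (lebesgue_on \<Omega>) (\<lambda>x. H x \<bullet> i)" if "i \<in> Basis" for i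
    using u v that by (auto simp: has_weak_grad_def)
  show "integrable (lebesgue_on \<Omega>) (\<lambda>x. u x - v x)" using iu iv by simp
  show "integrable (lebesgue_on \<Omega>) (\<lambda>x. (G x - H x) \<bullet> i)" if "i \<in> Basis" for i
    using iG[OF that] iH[OF that] by (simp add: inner_diff_left)
  fix \<phi> and i :: 'a assume \<phi>: "test_fn \<Omega> \<phi>" and i: "i \<in> Basis"
  note tf = test_fn_facts[OF \<phi>]
  obtain N where N: "\<And>x. \<bar>\<phi> x\<bar> \<le> N" "\<And>x. norm (grad \<phi> x) \<le> N" using tf(3) by blast
  have m: "\<phi> \<in> borel_measurable (lebesgue_on \<Omega>)" "(\<lambda>x. grad \<phi> x \<bullet> i) \<in> borel_measurable (lebesgue_on \<Omega>)"
    using C1_measurable(3,4)[OF tf(1)] by (auto intro!: measurable_restrict_space1)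
  have ib: "integrable (lebesgue_on \<Omega>) (\<lambda>x. f x * k x)"
    if f: "integrable (lebesgue_on \<Omega>) f" and k: "k \<in> borel_measurable (lebesgue_on \<Omega>)" "\<And>x. \<bar>k x\<bar> \<le> N" for f k :: "'a \<Rightarrow> real"
  proof (rule Bochner_Integration.integrable_bound[OF integrable_mult_right[OF f, of N]])
    show "(\<lambda>x. f x * k x) \<in> borel_measurable (lebesgue_on \<Omega>)" using f k(1) by (intro borel_measurable_times) auto
    have "0 \<le> N" using k(2)[of undefined] by linarith
    show "AE x in lebesgue_on \<Omega>. norm (f x * k x) \<le> norm (N * f x)"
    proof (rule AE_I2)
      fix x
      have "\<bar>f x\<bar> * \<bar>k x\<bar> \<le> \<bar>f x\<bar> * N" using k(2)[of x] by (rule mult_left_mono) simp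
      then show "norm (f x * k x) \<le> norm (N * f x)" using \<open>0 \<le> N\<close> by (simp add: abs_mult mult.commute)
    qed
  qed
  have gi: "frechet_derivative \<phi> (at x) i = grad \<phi> x \<bullet> i" for x by (simp add: C1_frechet[OF tf(1)])
  have gN: "\<bar>grad \<phi> x \<bullet> i\<bar> \<le> N" for x using Basis_le_norm[OF i, of "grad \<phi> x"] N(2)[of x] by simp
  have "integral\<^sup>L (lebesgue_on \<Omega>) (\<lambda>x. (u x - v x) * frechet_derivative \<phi> (at x) i) =
    integral\<^sup>L (lebesgue_on \<Omega>) (\<lambda>x. u x * frechet_derivative \<phi> (at x) i) - integral\<^sup>L (lebesgue_on \<Omega>) (\<lambda>x. v x * frechet_derivative \<phi> (at x) i)"
    unfolding gi left_diff_distrib using ib[OF iu m(2) gN] ib[OF iv m(2) gN] by (rule Bochner_Integration.integral_diff)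
  also have "\<dots> = - integral\<^sup>L (lebesgue_on \<Omega>) (\<lambda>x. (G x \<bullet> i) * \<phi> x) + integral\<^sup>L (lebesgue_on \<Omega>) (\<lambda>x. (H x \<bullet> i) * \<phi> x)"
  proof -
    have "integral\<^sup>L (lebesgue_on \<Omega>) (\<lambda>x. u x * frechet_derivative \<phi> (at x) i) = - integral\<^sup>L (lebesgue_on \<Omega>) (\<lambda>x. (G x \<bullet> i) * \<phi> x)"
      using u \<phi> i unfolding has_weak_grad_def by blast
    moreover have "integral\<^sup>L (lebesgue_on \<Omega>) (\<lambda>x. v x * frechet_derivative \<phi> (at x) i) = - integral\<^sup>L (lebesgue_on \<Omega>) (\<lambda>x. (H x \<bullet> i) * \<phi> x)"
      using v \<phi> i unfolding has_weak_grad_def by blast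
    ultimately show ?thesis by simp
  qed
  also have "\<dots> = - integral\<^sup>L (lebesgue_on \<Omega>) (\<lambda>x. ((G x - H x) \<bullet> i) * \<phi> x)"
    unfolding inner_diff_left left_diff_distrib
    using Bochner_Integration.integral_diff[OF ib[OF iG[OF i] m(1) N(1)] ib[OF iH[OF i] m(1) N(1)]] by simp
  finally show "integral\<^sup>L (lebesgue_on \<Omega>) (\<lambda>x. (u x - v x) * frechet_derivative \<phi> (at x) i) = - integral\<^sup>L (lebesgue_on \<Omega>) (\<lambda>x. ((G x - H x) \<bullet> i) * \<phi> x)" .
qed

section \<open>Nodal errors of second order\<close>

context mesh_weights
begin

lemma affine_weak_grad: "has_weak_grad \<Omega> (\<lambda>x. a \<bullet> x + b) (\<lambda>x. a)"
proof -
  obtain r where r: "\<forall>x\<in>\<Omega>. norm x \<le> r" using bounded_dom unfolding bounded_iff by blast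
  show ?thesis
  proof (rule weak_grad_lipschitz[OF open_dom bounded_dom affine_measurable, where B = "norm a * r + \<bar>b\<bar>" and M = "norm a"])
    show "\<bar>a \<bullet> x + b\<bar> \<le> norm a * r + \<bar>b\<bar>" if "x \<in> \<Omega>" for x
    proof -
      have "\<bar>a \<bullet> x\<bar> \<le> norm a * r" using r that by (intro order_trans[OF Cauchy_Schwarz_ineq2 mult_left_mono]) auto
      then show ?thesis by simp
    qed
    show "\<bar>a \<bullet> x + b - (a \<bullet> y + b)\<bar> \<le> norm a * dist x y" for x y
      using Cauchy_Schwarz_ineq2[of a "x - y"] by (simp add: inner_diff_right dist_norm)
    show "AE x in lebesgue. x \<in> \<Omega> \<longrightarrow> ((\<lambda>x. a \<bullet> x + b) has_derivative (\<lambda>h. a \<bullet> h)) (at x)"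
      by (intro AE_I2 impI) (auto intro!: derivative_eq_intros)
    show "integrable (lebesgue_on \<Omega>) (\<lambda>x. a \<bullet> i)" for i using affine_integrable[of 0 "a \<bullet> i"] by simp
  qed auto
qed

text \<open>A cell leaves the domain only through its boundary, which is a null set.\<close>

lemma sqint_cell_cong:
  assumes T: "T \<in> \<T>" and eq: "\<And>x. x \<in> \<Omega> \<Longrightarrow> f x = f' x"
  shows "sqint (convex hull T) f = sqint (convex hull T) f'"
proof (rule sqint_cong_AE)
  have neg: "convex hull T - interior (convex hull T) \<in> null_sets lebesgue"
    using negligible_convex_frontier[OF convex_convex_hull, of T] compact_imp_closed[OF compact_cell[OF T]]
    by (simp add: frontier_def negligible_iff_null_sets)
  show "AE x in lebesgue. x \<in> convex hull T \<longrightarrow> f x = f' x"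
    by (rule AE_I'[OF neg]) (use eq interior_cell[OF T] in auto)
qed

text \<open>The indicators restore the convention that a weak pair vanishes outside the domain; an
  affine function does not.\<close>

lemma weak_pair_sub_affine:
  assumes wp: "weak_pair \<Omega> v g"
  shows "weak_pair \<Omega> (\<lambda>x. indicator \<Omega> x * (v x - (a \<bullet> x + b))) (\<lambda>x. indicator \<Omega> x *\<^sub>R (g x - a))"
  unfolding weak_pair_def
proof (intro conjI open_dom bounded_dom allI impI)
  note [measurable] = weak_pair_facts(3,4)[OF wp] dom_sets affine_measurable
  have wg: "has_weak_grad \<Omega> (\<lambda>x. v x - (a \<bullet> x + b)) (\<lambda>x. g x - a)"
    using has_weak_grad_diff[OF _ affine_weak_grad] wp by (simp add: weak_pair_def)
  show "has_weak_grad \<Omega> (\<lambda>x. indicator \<Omega> x * (v x - (a \<bullet> x + b))) (\<lambda>x. indicator \<Omega> x *\<^sub>R (g x - a))"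
    by (rule iffD1[OF has_weak_grad_cong wg]) auto
  show "(\<lambda>x. indicator \<Omega> x * (v x - (a \<bullet> x + b))) \<in> borel_measurable lebesgue" by measurable
  show "(\<lambda>x. indicator \<Omega> x *\<^sub>R (g x - a)) \<in> borel_measurable lebesgue" by measurable
  obtain r where r: "\<forall>x\<in>\<Omega>. norm x \<le> r" using bounded_dom unfolding bounded_iff by blast
  have fin: "emeasure lebesgue \<Omega> < \<infinity>" using fmeasurableD2[OF dom_lmeasurable] by (simp add: less_top)
  have UN: "sqint UNIV (\<lambda>x. indicator \<Omega> x * k x) \<le> sqint \<Omega> k" for k :: "'a \<Rightarrow> real"
    unfolding sqint_def by (intro nn_integral_mono) (auto simp: indicator_def)
  have "sqint UNIV (\<lambda>x. indicator \<Omega> x * (v x - (a \<bullet> x + b))) \<le> sqint \<Omega> (\<lambda>x. v x - (a \<bullet> x + b))" by (rule UN)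
  also have "\<dots> \<le> 2 * sqint \<Omega> v + 2 * sqint \<Omega> (\<lambda>x. a \<bullet> x + b)" by (rule sqint_diff) measurable
  also have "\<dots> \<le> 2 * sqint UNIV v + 2 * sqint \<Omega> (\<lambda>x. norm a * r + \<bar>b\<bar>)"
  proof (intro add_mono mult_left_mono sqint_mono sqint_mono_fun)
    fix x assume "x \<in> \<Omega>"
    then have "\<bar>a \<bullet> x\<bar> \<le> norm a * r" using r by (intro order_trans[OF Cauchy_Schwarz_ineq2 mult_left_mono]) auto
    then show "\<bar>a \<bullet> x + b\<bar> \<le> \<bar>norm a * r + \<bar>b\<bar>\<bar>" by simp
  qed auto
  also have "\<dots> < \<infinity>" using weak_pair_facts(5)[OF wp] fin
    by (simp add: sqint_const[OF dom_sets] ennreal_mult_less_top)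
  finally show "sqint UNIV (\<lambda>x. indicator \<Omega> x * (v x - (a \<bullet> x + b))) < \<infinity>" .
  have "sqint UNIV (\<lambda>x. norm (indicator \<Omega> x *\<^sub>R (g x - a))) = sqint UNIV (\<lambda>x. indicator \<Omega> x * norm (g x - a))"
    by (rule sqint_cong) (auto simp: indicator_def)
  also have "\<dots> \<le> sqint \<Omega> (\<lambda>x. norm (g x - a))" by (rule UN)
  also have "\<dots> \<le> 2 * sqint \<Omega> (\<lambda>x. norm ((g x - a) - g x)) + 2 * sqint \<Omega> (\<lambda>x. norm (g x))"
    by (rule sqint_norm_grad_le) measurable
  also have "\<dots> \<le> 2 * sqint \<Omega> (\<lambda>x. norm a) + 2 * sqint UNIV (\<lambda>x. norm (g x))"
    by (intro add_mono mult_left_mono sqint_mono) auto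
  also have "\<dots> < \<infinity>" using weak_pair_facts(6)[OF wp] fin
    by (simp add: sqint_const[OF dom_sets] ennreal_mult_less_top)
  finally show "sqint UNIV (\<lambda>x. norm (indicator \<Omega> x *\<^sub>R (g x - a))) < \<infinity>" .
qed auto

text \<open>A constant adapted to \<open>T\<close> is also good on any other cell \<open>K\<close>
  of the star, because both can be compared with the constant \<open>c\<close> adapted to the whole
  star; the volume ratio \<open>Q\<close> moves the difference of the constants from
  \<open>T\<close> to \<open>K\<close>.\<close>

lemma compare_constants:
  assumes KT: "K \<in> star \<T> z" "T \<in> star \<T> z" and [measurable]: "f \<in> borel_measurable lebesgue"
    and E: "sqint (convex hull K) (\<lambda>x. f x - c) \<le> E" "sqint (convex hull T) (\<lambda>x. f x - c) \<le> E" "sqint (convex hull T) (\<lambda>x. f x - a) \<le> E"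
  shows "sqint (convex hull K) (\<lambda>x. f x - a) \<le> ennreal (2 + 8 * Q) * E"
proof -
  have T: "K \<in> \<T>" "T \<in> \<T>" using KT by (auto simp: star_def)
  note [measurable] = cell_sets[OF T(1)] cell_sets[OF T(2)]
  have "ennreal ((c - a)\<^sup>2) * emeasure lebesgue (convex hull T) \<le> 2 * E + 2 * E"
    by (rule order_trans[OF const_compare add_mono[OF mult_left_mono[OF E(2)] mult_left_mono[OF E(3)]]]) auto
  then have 1: "ennreal ((c - a)\<^sup>2) * emeasure lebesgue (convex hull T) \<le> 4 * E" by (simp add: distrib_right[symmetric])
  have "sqint (convex hull K) (\<lambda>x. c - a) = ennreal ((c - a)\<^sup>2) * ennreal (measure lebesgue (convex hull K))"
    using emeasure_cell[OF T(1)] by (simp add: sqint_const[OF cell_sets[OF T(1)]])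
  also have "\<dots> \<le> ennreal ((c - a)\<^sup>2) * ennreal (Q * measure lebesgue (convex hull T))"
    by (intro mult_left_mono ennreal_leI measure_ratio[OF KT]) auto
  also have "\<dots> = ennreal Q * (ennreal ((c - a)\<^sup>2) * emeasure lebesgue (convex hull T))"
    using Q_ge1 by (simp add: emeasure_cell[OF T(2)] ennreal_mult mult_ac)
  also have "\<dots> \<le> ennreal Q * (4 * E)" by (intro mult_left_mono 1) auto
  finally have 2: "sqint (convex hull K) (\<lambda>x. c - a) \<le> ennreal Q * (4 * E)" .
  have "sqint (convex hull K) (\<lambda>x. f x - a) = sqint (convex hull K) (\<lambda>x. (f x - c) + (c - a))" by simp
  also have "\<dots> \<le> 2 * sqint (convex hull K) (\<lambda>x. f x - c) + 2 * sqint (convex hull K) (\<lambda>x. c - a)"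
    by (rule sqint_add) measurable
  also have "\<dots> \<le> 2 * E + 2 * (ennreal Q * (4 * E))" by (intro add_mono mult_left_mono E 2) auto
  also have "\<dots> = ennreal (2 + 8 * Q) * E"
  proof -
    have "ennreal (2 + 8 * Q) = 2 + 8 * ennreal Q"
      using Q_ge1 by (simp add: ennreal_plus ennreal_numeral_mult)
    moreover have "2 * (ennreal Q * (4 * E)) = 8 * ennreal Q * E"
      by (simp add: mult.assoc[symmetric] mult.commute[of "ennreal Q" 4])
    ultimately show ?thesis by (simp add: distrib_right)
  qed
  finally show ?thesis .
qed

lemma sqint_starset_le:
  assumes "f \<in> borel_measurable lebesgue"
  shows "sqint (starset z) f \<le> (\<Sum>K\<in>star \<T> z. sqint (convex hull K) f)"
  by (rule sqint_Union_le[OF finite_star _ assms]) (auto simp: starset_def star_def intro: cell_sets)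

lemma sum_star_le:
  assumes "\<And>K. K \<in> star \<T> z \<Longrightarrow> s K \<le> (B::ennreal)"
  shows "(\<Sum>K\<in>star \<T> z. s K) \<le> ennreal (real N0) * B"
proof -
  have "(\<Sum>K\<in>star \<T> z. s K) \<le> (\<Sum>K\<in>star \<T> z. B)" by (rule sum_mono[OF assms])
  also have "\<dots> = ennreal (real (card (star \<T> z))) * B" by (simp add: ennreal_of_nat_eq_real_of_nat)
  also have "\<dots> \<le> ennreal (real N0) * B" using card_star[of z] by (intro mult_right_mono ennreal_leI) auto
  finally show ?thesis .
qed

text \<open>\<open>c6\<close> measures how well the gradient on the star is approximated by the
  constant vector chosen on \<open>T\<close>; \<open>cI\<close> and \<open>cJ\<close> are the nodal
  error constants at interior and boundary vertices. The power of \<open>c4\<close> in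
  \<open>cJ\<close> arises from extending a bound near the vertex to the whole cell.\<close>

definition "c6 = real N0 * (2 + 8 * Q) * (cA + cT)"
definition "cI = Q * ((2 + 8 * Q) * (cA * c6 + cT\<^sup>2))"
definition "cJ = 1 / c4 ^ n * (2 * ((2 + 8 * 2 ^ n) * cT\<^sup>2) + 2 * (4 * (real N0 * (8 * c2\<^sup>2 * 2 ^ n))))"

text \<open>Poincare on the star is used twice: for the components of the gradient, to carry the
  vector \<open>a\<close> from \<open>T\<close> to the star, and then for \<open>v\<close> minus the
  affine function, whose gradient is thereby small. Exactness of \<open>cl\<close> turns the second
  estimate into one for the nodal error.\<close>

lemma second_order_interior:
  assumes wp: "weak_pair \<Omega> v g" and H: "\<And>i. i \<in> Basis \<Longrightarrow> weak_pair \<Omega> (\<lambda>x. g x \<bullet> i) (H i)" and z: "z \<in> T" "T \<in> \<T>" "z \<in> \<Omega>"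
    and a: "\<And>i. i \<in> Basis \<Longrightarrow> sqint (convex hull T) (\<lambda>x. g x \<bullet> i - a \<bullet> i) \<le> ennreal (cT * (diameter T)\<^sup>2) * sqint (starset z) (\<lambda>x. norm (H i x))"
    and b: "sqint (convex hull T) (\<lambda>x. v x - (a \<bullet> x + b)) \<le> ennreal (cT\<^sup>2 * (diameter T)^4) * (\<Sum>i\<in>Basis. sqint (starset z) (\<lambda>x. norm (H i x)))"
  shows "ennreal ((a \<bullet> z + b - cl z v)\<^sup>2) * emeasure lebesgue (convex hull T) \<le>
    ennreal (cI * (diameter T)^4) * (\<Sum>i\<in>Basis. sqint (starset z) (\<lambda>x. norm (H i x)))"
proof -
  let ?h = "diameter T" and ?S = "starset z"
  define Y where "Y = (\<Sum>i\<in>Basis. sqint ?S (\<lambda>x. norm (H i x)))"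
  note [measurable] = weak_pair_facts(3,4)[OF wp] dom_sets affine_measurable
  have c6: "0 \<le> c6" unfolding c6_def using consts_nonneg by simp
  have gi: "sqint (convex hull K) (\<lambda>x. g x \<bullet> i - a \<bullet> i) \<le> ennreal (2 + 8 * Q) * (ennreal ((cA + cT) * ?h\<^sup>2) * sqint ?S (\<lambda>x. norm (H i x)))"
    if K: "K \<in> star \<T> z" and i: "i \<in> Basis" for K i
  proof -
    obtain c where c: "\<forall>K\<in>star \<T> z. sqint (convex hull K) (\<lambda>x. g x \<bullet> i - c) \<le> ennreal (cA * ?h\<^sup>2) * sqint ?S (\<lambda>x. norm (H i x))"
      using star_poincare[OF H[OF i] z] by blast
    have cE: "sqint (convex hull K) (\<lambda>x. g x \<bullet> i - c) \<le> ennreal ((cA + cT) * ?h\<^sup>2) * sqint ?S (\<lambda>x. norm (H i x))" if "K \<in> star \<T> z" for K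
      using consts_nonneg by (intro order_trans[OF bspec[OF c that]] mult_right_mono ennreal_leI) auto
    have aE: "sqint (convex hull T) (\<lambda>x. g x \<bullet> i - a \<bullet> i) \<le> ennreal ((cA + cT) * ?h\<^sup>2) * sqint ?S (\<lambda>x. norm (H i x))"
      using consts_nonneg by (intro order_trans[OF a[OF i]] mult_right_mono ennreal_leI) auto
    show ?thesis by (rule compare_constants[OF K starI[OF z(1,2)] _ cE[OF K] cE[OF starI[OF z(1,2)]] aE]) measurable
  qed
  let ?u = "\<lambda>x. indicator \<Omega> x * (v x - (a \<bullet> x + b))" and ?G = "\<lambda>x. indicator \<Omega> x *\<^sub>R (g x - a)"
  have wu: "weak_pair \<Omega> ?u ?G" by (rule weak_pair_sub_affine[OF wp])
  have Gm: "(\<lambda>x. norm (?G x)) \<in> borel_measurable lebesgue" by measurable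
  have "sqint ?S (\<lambda>x. norm (?G x)) \<le> (\<Sum>K\<in>star \<T> z. sqint (convex hull K) (\<lambda>x. norm (?G x)))"
    by (rule sqint_starset_le[OF Gm])
  also have "\<dots> \<le> ennreal (real N0) * (ennreal (2 + 8 * Q) * (ennreal ((cA + cT) * ?h\<^sup>2) * Y))"
  proof (rule sum_star_le)
    fix K assume K: "K \<in> star \<T> z"
    have Ks: "convex hull K \<in> sets lebesgue" using K cell_sets by (simp add: star_def)
    have "sqint (convex hull K) (\<lambda>x. norm (?G x)) \<le> sqint (convex hull K) (\<lambda>x. norm (g x - a))"
      by (rule sqint_mono_fun) (auto simp: indicator_def)
    also have "\<dots> = (\<Sum>i\<in>Basis. sqint (convex hull K) (\<lambda>x. (g x - a) \<bullet> i))"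
      by (rule sqint_norm_le) (use Ks in measurable)
    also have "\<dots> \<le> (\<Sum>i\<in>Basis. ennreal (2 + 8 * Q) * (ennreal ((cA + cT) * ?h\<^sup>2) * sqint ?S (\<lambda>x. norm (H i x))))"
      using gi[OF K] by (intro sum_mono) (simp add: inner_diff_left)
    finally show "sqint (convex hull K) (\<lambda>x. norm (?G x)) \<le> ennreal (2 + 8 * Q) * (ennreal ((cA + cT) * ?h\<^sup>2) * Y)"
      by (simp add: Y_def sum_distrib_left)
  qed
  also have "\<dots> = ennreal (c6 * ?h\<^sup>2) * Y"
    using consts_nonneg by (subst ennreal_mult_assoc, simp)+ (simp add: c6_def mult.assoc)
  finally have GS: "sqint ?S (\<lambda>x. norm (?G x)) \<le> ennreal (c6 * ?h\<^sup>2) * Y" .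
  obtain c where c: "\<forall>K\<in>star \<T> z. sqint (convex hull K) (\<lambda>x. ?u x - c) \<le> ennreal (cA * ?h\<^sup>2) * sqint ?S (\<lambda>x. norm (?G x))"
    using star_poincare[OF wu z] by blast
  define E where "E = ennreal ((cA * c6 + cT\<^sup>2) * ?h^4) * Y"
  have cE: "sqint (convex hull K) (\<lambda>x. ?u x - c) \<le> E" if "K \<in> star \<T> z" for K
  proof -
    have "sqint (convex hull K) (\<lambda>x. ?u x - c) \<le> ennreal (cA * ?h\<^sup>2) * (ennreal (c6 * ?h\<^sup>2) * Y)"
      by (intro order_trans[OF bspec[OF c that]] mult_left_mono GS) auto
    also have "\<dots> = ennreal (cA * c6 * ?h^4) * Y"
      using consts_nonneg by (subst ennreal_mult_assoc) (simp, simp add: power2_eq_square power4_eq_xxxx mult_ac)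
    also have "\<dots> \<le> E" unfolding E_def using consts_nonneg by (intro mult_right_mono ennreal_leI) auto
    finally show ?thesis .
  qed
  have bE: "sqint (convex hull T) (\<lambda>x. ?u x - 0) \<le> E"
  proof -
    have "sqint (convex hull T) (\<lambda>x. ?u x - 0) = sqint (convex hull T) (\<lambda>x. v x - (a \<bullet> x + b))"
      by (rule sqint_cell_cong[OF z(2)]) simp
    also have "\<dots> \<le> ennreal (cT\<^sup>2 * ?h^4) * Y" using b by (simp add: Y_def)
    also have "\<dots> \<le> E" unfolding E_def using consts_nonneg c6 by (intro mult_right_mono ennreal_leI) auto
    finally show ?thesis .
  qed
  have "ennreal ((cl z (\<lambda>x. v x - (a \<bullet> x + b)))\<^sup>2) * emeasure lebesgue (convex hull T) \<le> ennreal Q * (ennreal (2 + 8 * Q) * E)"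
  proof (rule cl_bound[OF z])
    show "(\<lambda>x. v x - (a \<bullet> x + b)) \<in> borel_measurable lebesgue"
      by (rule borel_measurable_diff[OF _ affine_measurable]) measurable
    show "integrable (lebesgue_on \<Omega>) (\<lambda>x. v x - (a \<bullet> x + b))"
      by (rule Bochner_Integration.integrable_diff[OF weak_pair_integrable[OF wp] affine_integrable])
    fix K assume K: "K \<in> star \<T> z"
    have "sqint (convex hull K) (\<lambda>x. v x - (a \<bullet> x + b)) = sqint (convex hull K) (\<lambda>x. ?u x - 0)"
      by (rule sqint_cell_cong) (use K in \<open>auto simp: star_def\<close>)
    also have "\<dots> \<le> ennreal (2 + 8 * Q) * E"
      by (rule compare_constants[OF K starI[OF z(1,2)] _ cE[OF K] cE[OF starI[OF z(1,2)]] bE]) (rule weak_pair_facts(3)[OF wu])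
    finally show "sqint (convex hull K) (\<lambda>x. v x - (a \<bullet> x + b)) \<le> ennreal (2 + 8 * Q) * E" .
  qed
  also have "\<dots> = ennreal (cI * ?h^4) * Y"
    unfolding E_def using consts_nonneg by (subst ennreal_mult_assoc, simp)+ (simp add: cI_def mult.assoc)
  finally show ?thesis
    unfolding cl_diff_affine[OF z weak_pair_integrable[OF wp]] Y_def by (simp add: power2_commute)
qed

text \<open>The nodal value of the interpolant is 0 here, so the affine approximation itself must be
  shown to be small at \<open>z\<close>. That value is a combination of the approximation error, its
  composition with the halving map, and the homogeneity defect of \<open>v\<close>.\<close>

lemma second_order_boundary:
  assumes zp: "zero_pair \<Omega> v g" and H: "\<And>i. i \<in> Basis \<Longrightarrow> weak_pair \<Omega> (\<lambda>x. g x \<bullet> i) (H i)" and z: "z \<in> T" "T \<in> \<T>" and zf: "z \<in> frontier \<Omega>"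
    and b: "sqint (convex hull T) (\<lambda>x. v x - (a \<bullet> x + b)) \<le> ennreal (cT\<^sup>2 * (diameter T)^4) * (\<Sum>i\<in>Basis. sqint (starset z) (\<lambda>x. norm (H i x)))"
  shows "ennreal ((a \<bullet> z + b)\<^sup>2) * emeasure lebesgue (convex hull T) \<le>
    ennreal (cJ * (diameter T)^4) * (\<Sum>i\<in>Basis. sqint (starset z) (\<lambda>x. norm (H i x)))"
proof -
  have wp: "weak_pair \<Omega> v g" using zp by (simp add: zero_pair_def)
  let ?h = "diameter T" and ?S = "starset z" and ?P = "\<lambda>x. a \<bullet> x + b" and ?d = "dil (1/2) z"
  define Y where "Y = (\<Sum>i\<in>Basis. sqint ?S (\<lambda>x. norm (H i x)))"
  \<comment> \<open>Small enough for the boundary estimate of the defect, and large enough to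
    contain the contraction of the cell by \<open>c4\<close>.\<close>
  define A where "A = convex hull T \<inter> cball z (c4 * ?h)"
  have dm[measurable]: "?d \<in> lebesgue \<rightarrow>\<^sub>M lebesgue" by (rule dil_lebesgue_measurable) simp
  note [measurable] = weak_pair_facts(3,4)[OF wp] dom_sets affine_measurable starset_sets
  have As[measurable]: "A \<in> sets lebesgue" unfolding A_def using cell_sets[OF z(2)] by auto
  have Pm: "?P \<in> borel_measurable lebesgue" by (rule affine_measurable)
  have um[measurable]: "(\<lambda>x. v x - ?P x) \<in> borel_measurable lebesgue" by (rule borel_measurable_diff[OF _ Pm]) measurable
  have um2[measurable]: "(\<lambda>x. v (?d x) - ?P (?d x)) \<in> borel_measurable lebesgue"
    using measurable_compose[OF dm um] .
  define F where "F = ennreal (cT\<^sup>2 * ?h^4) * Y"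
  have uF: "sqint (convex hull T) (\<lambda>x. v x - ?P x) \<le> F" using b by (simp add: F_def Y_def)
  have uA: "sqint A (\<lambda>x. v x - ?P x) \<le> F" by (rule order_trans[OF sqint_mono uF]) (simp add: A_def)
  have udA: "sqint A (\<lambda>x. v (?d x) - ?P (?d x)) \<le> ennreal (2 ^ n) * F"
  proof -
    have "sqint A (\<lambda>x. v (?d x) - ?P (?d x)) \<le> ennreal (1 / (1/2) ^ DIM('a)) * sqint (convex hull T) (\<lambda>x. v x - ?P x)"
      by (rule sqint_dil[OF um cell_sets[OF z(2)]]) (use vertex_dil(1)[OF z] in \<open>auto simp: A_def\<close>)
    also have "\<dots> \<le> ennreal (1 / (1/2) ^ DIM('a)) * F" by (intro mult_left_mono uF) auto
    finally show ?thesis by (simp add: power_one_over n[symmetric])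
  qed
  have gS: "sqint ?S (\<lambda>x. norm (g x - g (?d x))) \<le> ennreal (real N0) * (ennreal (8 * c2\<^sup>2 * 2 ^ n * ?h\<^sup>2) * Y)"
  proof -
    have "sqint ?S (\<lambda>x. norm (g x - g (?d x))) \<le> (\<Sum>K\<in>star \<T> z. sqint (convex hull K) (\<lambda>x. norm (g x - g (?d x))))"
      by (rule sqint_starset_le) measurable
    also have "\<dots> \<le> ennreal (real N0) * (ennreal (8 * c2\<^sup>2 * 2 ^ n * ?h\<^sup>2) * Y)"
    proof (rule sum_star_le)
      fix K assume K: "K \<in> star \<T> z"
      then have KT: "K \<in> \<T>" "z \<in> K" by (auto simp: star_def)
      have Ks[measurable]: "convex hull K \<in> sets lebesgue" by (rule cell_sets[OF KT(1)])
      have "sqint (convex hull K) (\<lambda>x. norm (g x - g (?d x))) = (\<Sum>i\<in>Basis. sqint (convex hull K) (\<lambda>x. (g x - g (?d x)) \<bullet> i))"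
        by (rule sqint_norm_le) measurable
      also have "\<dots> \<le> (\<Sum>i\<in>Basis. ennreal (8 * c2\<^sup>2 * 2 ^ n * ?h\<^sup>2) * sqint ?S (\<lambda>x. norm (H i x)))"
      proof (rule sum_mono)
        fix i :: 'a assume i: "i \<in> Basis"
        have "sqint (convex hull K) (\<lambda>x. (g x - g (?d x)) \<bullet> i) = sqint (convex hull K) (\<lambda>x. g (?d x) \<bullet> i - g x \<bullet> i)"
          by (rule sqint_cong) (simp add: inner_diff_left)
        \<comment> \<open>Comparing the gradient with its halved version costs one further
          derivative; second derivatives enter here.\<close>
        also have "\<dots> \<le> ennreal (8 * (c2 * ?h)\<^sup>2 / (1/2) ^ DIM('a)) * sqint (convex hull K) (\<lambda>x. norm (H i x))"
        proof (rule H1_dilation[OF H[OF i] convex_convex_hull simplex_interior[OF cell[OF KT(1)]] interior_cell[OF KT(1)] hull_inc[OF KT(2)] compact_imp_closed[OF compact_cell[OF KT(1)]]])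
          fix x assume "x \<in> convex hull K"
          then show "dist z x \<le> c2 * ?h"
            using simplex_diameter(3)[OF cell[OF KT(1)] hull_inc[OF KT(2)]] comparable[OF KT z(2,1)] order_trans by blast
        qed auto
        also have "\<dots> \<le> ennreal (8 * (c2 * ?h)\<^sup>2 / (1/2) ^ DIM('a)) * sqint ?S (\<lambda>x. norm (H i x))"
          by (intro mult_left_mono sqint_mono starset_cell KT) auto
        also have "8 * (c2 * ?h)\<^sup>2 / (1/2) ^ DIM('a) = 8 * c2\<^sup>2 * 2 ^ n * ?h\<^sup>2"
          by (simp add: power_one_over n[symmetric] power_mult_distrib mult_ac)
        finally show "sqint (convex hull K) (\<lambda>x. (g x - g (?d x)) \<bullet> i) \<le> ennreal (8 * c2\<^sup>2 * 2 ^ n * ?h\<^sup>2) * sqint ?S (\<lambda>x. norm (H i x))" .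
      qed
      finally show "sqint (convex hull K) (\<lambda>x. norm (g x - g (?d x))) \<le> ennreal (8 * c2\<^sup>2 * 2 ^ n * ?h\<^sup>2) * Y"
        by (simp add: Y_def sum_distrib_left)
    qed
    finally show ?thesis .
  qed
  have wA: "sqint A (\<lambda>x. v x - 2 * v (?d x)) \<le> ennreal (4 * ?h\<^sup>2) * (ennreal (real N0) * (ennreal (8 * c2\<^sup>2 * 2 ^ n * ?h\<^sup>2) * Y))"
  proof -
    have "sqint A (\<lambda>x. v x - 2 * v (?d x)) \<le> sqint (cball z (c4 * ?h)) (\<lambda>x. v x - 2 * v (?d x))"
      by (rule sqint_mono) (simp add: A_def)
    also have "\<dots> \<le> ennreal (4 * ?h\<^sup>2) * sqint ?S (\<lambda>x. norm (g x - g (?d x)))" by (rule boundary_defect[OF zp z zf])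
    also have "\<dots> \<le> ennreal (4 * ?h\<^sup>2) * (ennreal (real N0) * (ennreal (8 * c2\<^sup>2 * 2 ^ n * ?h\<^sup>2) * Y))"
      by (intro mult_left_mono gS) auto
    finally show ?thesis .
  qed
  define B where "B = 2 * ((2 + 8 * 2 ^ n) * cT\<^sup>2) + 2 * (4 * (real N0 * (8 * c2\<^sup>2 * 2 ^ n)))"
  have B: "0 \<le> B" unfolding B_def using consts_nonneg by simp
  have PA: "sqint A (\<lambda>x. ?P z) \<le> ennreal (B * ?h^4) * Y"
  proof -
    have "sqint A (\<lambda>x. ?P z) = sqint A (\<lambda>x. ((v x - ?P x) - 2 * (v (?d x) - ?P (?d x))) - (v x - 2 * v (?d x)))"
    proof (rule sqint_cong)
      fix x
      \<comment> \<open>\<open>?d x\<close> is the midpoint of \<open>z\<close> and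
        \<open>x\<close>, and an affine function takes the mean value there.\<close>
      have "2 * ?P (?d x) - ?P x = ?P z"
        by (simp add: dil_def inner_add_right inner_diff_right field_simps)
      then show "\<bar>?P z\<bar> = \<bar>((v x - ?P x) - 2 * (v (?d x) - ?P (?d x))) - (v x - 2 * v (?d x))\<bar>" by (simp add: algebra_simps)
    qed
    also have "\<dots> \<le> 2 * sqint A (\<lambda>x. (v x - ?P x) - 2 * (v (?d x) - ?P (?d x))) + 2 * sqint A (\<lambda>x. v x - 2 * v (?d x))"
      by (rule sqint_diff[OF borel_measurable_diff[OF um borel_measurable_times[OF _ um2]]]) measurable
    also have "\<dots> \<le> 2 * (2 * F + 2 * (ennreal (2\<^sup>2) * (ennreal (2 ^ n) * F))) + 2 * (ennreal (4 * ?h\<^sup>2) * (ennreal (real N0) * (ennreal (8 * c2\<^sup>2 * 2 ^ n * ?h\<^sup>2) * Y)))"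
    proof (intro add_mono mult_left_mono wA)
      have "sqint A (\<lambda>x. (v x - ?P x) - 2 * (v (?d x) - ?P (?d x))) \<le> 2 * sqint A (\<lambda>x. v x - ?P x) + 2 * sqint A (\<lambda>x. 2 * (v (?d x) - ?P (?d x)))"
        by (rule sqint_diff[OF um borel_measurable_times[OF _ um2] As]) simp
      also have "sqint A (\<lambda>x. 2 * (v (?d x) - ?P (?d x))) = ennreal (2\<^sup>2) * sqint A (\<lambda>x. v (?d x) - ?P (?d x))"
        by (rule sqint_cmult[OF um2 As])
      also have "2 * sqint A (\<lambda>x. v x - ?P x) + 2 * (ennreal (2\<^sup>2) * sqint A (\<lambda>x. v (?d x) - ?P (?d x))) \<le> 2 * F + 2 * (ennreal (2\<^sup>2) * (ennreal (2 ^ n) * F))"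
        by (intro add_mono mult_left_mono uA udA) auto
      finally show "sqint A (\<lambda>x. (v x - ?P x) - 2 * (v (?d x) - ?P (?d x))) \<le> 2 * F + 2 * (ennreal (2\<^sup>2) * (ennreal (2 ^ n) * F))" .
    qed auto
    also have "\<dots> = ennreal (2 * (2 * (cT\<^sup>2 * ?h^4) + 2 * (2\<^sup>2 * (2 ^ n * (cT\<^sup>2 * ?h^4)))) + 2 * (4 * ?h\<^sup>2 * (real N0 * (8 * c2\<^sup>2 * 2 ^ n * ?h\<^sup>2)))) * Y"
      unfolding F_def using consts_nonneg
      by (simp only: ennreal_mult_assoc numeral_mult_ennreal ennreal_add_mult mult_nonneg_nonneg add_nonneg_nonneg zero_le_power2 zero_le_power zero_le_numeral of_nat_0_le_iff zero_le_even_power even_numeral)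
    also have "2 * (2 * (cT\<^sup>2 * ?h^4) + 2 * (2\<^sup>2 * (2 ^ n * (cT\<^sup>2 * ?h^4)))) + 2 * (4 * ?h\<^sup>2 * (real N0 * (8 * c2\<^sup>2 * 2 ^ n * ?h\<^sup>2))) = B * ?h^4"
      by (simp add: B_def power2_eq_square power4_eq_xxxx algebra_simps)
    finally show ?thesis .
  qed
  have "ennreal ((?P z)\<^sup>2) * emeasure lebesgue (convex hull T) = sqint (convex hull T) (\<lambda>x. ?P z)"
    by (rule sqint_const[OF cell_sets[OF z(2)], symmetric])
  \<comment> \<open>For a constant this only compares volumes: the contraction of the cell by
    \<open>c4\<close> lies in \<open>A\<close>.\<close>
  also have "\<dots> \<le> ennreal (1 / c4 ^ DIM('a)) * sqint A (\<lambda>x. ?P z)"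
  proof (rule sqint_dil[of "\<lambda>_. ?P z" A c4 "convex hull T" z])
    show "dil c4 z x \<in> A" if "x \<in> convex hull T" for x
      using vertex_dil[OF z that] c4_pos c4_le by (simp add: A_def)
  qed (use As c4_pos in auto)
  also have "\<dots> \<le> ennreal (1 / c4 ^ DIM('a)) * (ennreal (B * ?h^4) * Y)" by (intro mult_left_mono PA) auto
  also have "\<dots> = ennreal (cJ * ?h^4) * Y"
    using c4_pos by (subst ennreal_mult_assoc) (auto simp: cJ_def B_def n[symmetric])
  finally show ?thesis by (simp add: Y_def)
qed

definition "C3 = 2 * cT\<^sup>2 + 2 * ((real n + 1) * ((real n + 1) * (cI + cJ)))"

lemma error_second_order:
  assumes zp: "zero_pair \<Omega> v g" and H: "\<And>i. i \<in> Basis \<Longrightarrow> weak_pair \<Omega> (\<lambda>x. g x \<bullet> i) (H i)" and T: "T \<in> \<T>"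
  shows "sqint (convex hull T) (\<lambda>x. v x - clement \<Omega> \<T> \<alpha> v x) \<le>
    ennreal (C3 * (diameter T)^4) * (\<Sum>i\<in>Basis. sqint (patch \<T> T) (\<lambda>x. norm (H i x)))"
proof -
  have wp: "weak_pair \<Omega> v g" using zp by (simp add: zero_pair_def)
  let ?h = "diameter T" and ?K = "convex hull T"
  define Y where "Y S = (\<Sum>i\<in>Basis. sqint S (\<lambda>x. norm (H i x)))" for S
  have Ymono: "S \<subseteq> S' \<Longrightarrow> Y S \<le> Y S'" for S S' unfolding Y_def by (intro sum_mono sqint_mono)
  note [measurable] = weak_pair_facts(3,4)[OF wp] dom_sets affine_measurable cell_sets[OF T]
  have "\<forall>i\<in>Basis. \<exists>c. sqint ?K (\<lambda>x. g x \<bullet> i - c) \<le> ennreal (cT * ?h\<^sup>2) * sqint ?K (\<lambda>x. norm (H i x))"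
    using cell_poincare[OF H T] by blast
  then obtain c where c: "\<And>i. i \<in> Basis \<Longrightarrow> sqint ?K (\<lambda>x. g x \<bullet> i - c i) \<le> ennreal (cT * ?h\<^sup>2) * sqint ?K (\<lambda>x. norm (H i x))"
    by metis
  define a where "a = (\<Sum>i\<in>Basis. c i *\<^sub>R i)"
  have a: "sqint ?K (\<lambda>x. g x \<bullet> i - a \<bullet> i) \<le> ennreal (cT * ?h\<^sup>2) * sqint ?K (\<lambda>x. norm (H i x))" if "i \<in> Basis" for i
    using c[OF that] that by (simp add: a_def)
  let ?u = "\<lambda>x. indicator \<Omega> x * (v x - (a \<bullet> x + 0))" and ?G = "\<lambda>x. indicator \<Omega> x *\<^sub>R (g x - a)"
  \<comment> \<open>The slope \<open>a\<close> comes from Poincare for the gradient components and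
    the offset \<open>b\<close> from Poincare for the remainder. The two applications in succession
    produce the square of \<open>cT\<close> and the fourth power of the diameter.\<close>
  obtain b where b0: "sqint ?K (\<lambda>x. ?u x - b) \<le> ennreal (cT * ?h\<^sup>2) * sqint ?K (\<lambda>x. norm (?G x))"
    using cell_poincare[OF weak_pair_sub_affine[OF wp] T] by blast
  have "sqint ?K (\<lambda>x. norm (?G x)) \<le> sqint ?K (\<lambda>x. norm (g x - a))"
    by (rule sqint_mono_fun) (auto simp: indicator_def)
  also have "\<dots> = (\<Sum>i\<in>Basis. sqint ?K (\<lambda>x. (g x - a) \<bullet> i))"
    by (rule sqint_norm_le) measurable
  also have "\<dots> \<le> (\<Sum>i\<in>Basis. ennreal (cT * ?h\<^sup>2) * sqint ?K (\<lambda>x. norm (H i x)))"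
    using a by (intro sum_mono) (simp add: inner_diff_left)
  finally have G: "sqint ?K (\<lambda>x. norm (?G x)) \<le> ennreal (cT * ?h\<^sup>2) * Y ?K"
    by (simp add: Y_def sum_distrib_left)
  have b: "sqint ?K (\<lambda>x. v x - (a \<bullet> x + b)) \<le> ennreal (cT\<^sup>2 * ?h^4) * Y ?K"
  proof -
    have "sqint ?K (\<lambda>x. v x - (a \<bullet> x + b)) = sqint ?K (\<lambda>x. ?u x - b)"
      by (rule sqint_cell_cong[OF T]) simp
    also have "\<dots> \<le> ennreal (cT * ?h\<^sup>2) * (ennreal (cT * ?h\<^sup>2) * Y ?K)"
      by (intro order_trans[OF b0] mult_left_mono G) auto
    also have "\<dots> = ennreal (cT\<^sup>2 * ?h^4) * Y ?K"
      using consts_nonneg by (subst ennreal_mult_assoc) (simp, simp add: power2_eq_square power4_eq_xxxx mult_ac)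
    finally show ?thesis .
  qed
  have bz: "sqint ?K (\<lambda>x. v x - (a \<bullet> x + b)) \<le> ennreal (cT\<^sup>2 * ?h^4) * Y (starset z)" if "z \<in> T" for z
    by (intro order_trans[OF b] mult_left_mono Ymono starset_cell that T) auto
  have cIJ: "0 \<le> cI" "0 \<le> cJ" unfolding cI_def cJ_def c6_def using consts_nonneg c4_pos by auto
  have vert: "ennreal ((a \<bullet> z + b - cz z v)\<^sup>2) * emeasure lebesgue ?K \<le> ennreal ((cI + cJ) * ?h^4) * Y (patch \<T> T)" if z: "z \<in> T" for z
  proof -
    have "ennreal ((a \<bullet> z + b - cz z v)\<^sup>2) * emeasure lebesgue ?K \<le> ennreal ((cI + cJ) * ?h^4) * Y (starset z)"
    proof (cases "z \<in> \<Omega>")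
      case True
      have "ennreal ((a \<bullet> z + b - cl z v)\<^sup>2) * emeasure lebesgue ?K \<le> ennreal (cI * ?h^4) * Y (starset z)"
        unfolding Y_def
      proof (rule second_order_interior[OF wp H z T True _ bz[OF z, unfolded Y_def]])
        show "sqint ?K (\<lambda>x. g x \<bullet> i - a \<bullet> i) \<le> ennreal (cT * ?h\<^sup>2) * sqint (starset z) (\<lambda>x. norm (H i x))" if "i \<in> Basis" for i
          by (intro order_trans[OF a[OF that]] mult_left_mono sqint_mono starset_cell z T) auto
      qed
      also have "\<dots> \<le> ennreal ((cI + cJ) * ?h^4) * Y (starset z)"
        using cIJ by (intro mult_right_mono ennreal_leI) auto
      finally show ?thesis using True by (simp add: cz_def)
    next
      case False
      then have zf: "z \<in> frontier \<Omega>" using vertex_closure[OF z T] open_dom by (simp add: frontier_def interior_open)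
      have "ennreal ((a \<bullet> z + b)\<^sup>2) * emeasure lebesgue ?K \<le> ennreal (cJ * ?h^4) * Y (starset z)"
        unfolding Y_def by (rule second_order_boundary[OF zp H z T zf bz[OF z, unfolded Y_def]])
      also have "\<dots> \<le> ennreal ((cI + cJ) * ?h^4) * Y (starset z)"
        using cIJ by (intro mult_right_mono ennreal_leI) auto
      finally show ?thesis using False by (simp add: cz_def)
    qed
    also have "\<dots> \<le> ennreal ((cI + cJ) * ?h^4) * Y (patch \<T> T)" by (intro mult_left_mono Ymono starset_patch z) auto
    finally show ?thesis .
  qed
  have "sqint ?K (\<lambda>x. v x - clement \<Omega> \<T> \<alpha> v x) \<le> 2 * sqint ?K (\<lambda>x. v x - (a \<bullet> x + b)) +
    2 * (ennreal (real n + 1) * (\<Sum>z\<in>T. ennreal ((a \<bullet> z + b - cz z v)\<^sup>2) * emeasure lebesgue ?K))"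
    by (rule clement_error_cell[OF T weak_pair_facts(3)[OF wp]])
  also have "\<dots> \<le> 2 * (ennreal (cT\<^sup>2 * ?h^4) * Y (patch \<T> T)) +
    2 * (ennreal (real n + 1) * (\<Sum>z\<in>T. ennreal ((cI + cJ) * ?h^4) * Y (patch \<T> T)))"
    by (intro add_mono mult_left_mono sum_mono vert order_trans[OF b mult_left_mono[OF Ymono[OF cell_patch[OF T]]]]) auto
  also have "(\<Sum>z\<in>T. ennreal ((cI + cJ) * ?h^4) * Y (patch \<T> T)) = ennreal (real n + 1) * (ennreal ((cI + cJ) * ?h^4) * Y (patch \<T> T))"
    using card_cell[OF T] by (simp add: ennreal_of_nat_eq_real_of_nat add.commute)
  also have "2 * (ennreal (cT\<^sup>2 * ?h^4) * Y (patch \<T> T)) + 2 * (ennreal (real n + 1) * (ennreal (real n + 1) * (ennreal ((cI + cJ) * ?h^4) * Y (patch \<T> T))))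
    = ennreal (2 * (cT\<^sup>2 * ?h^4) + 2 * ((real n + 1) * ((real n + 1) * ((cI + cJ) * ?h^4)))) * Y (patch \<T> T)"
    using cIJ by (simp only: ennreal_mult_assoc numeral_mult_ennreal ennreal_add_mult mult_nonneg_nonneg add_nonneg_nonneg zero_le_power2 zero_le_one zero_le_numeral of_nat_0_le_iff zero_le_even_power even_numeral)
  also have "2 * (cT\<^sup>2 * ?h^4) + 2 * ((real n + 1) * ((real n + 1) * ((cI + cJ) * ?h^4))) = C3 * ?h^4"
    by (simp add: C3_def algebra_simps)
  finally show ?thesis by (simp add: Y_def)
qed

end

section \<open>Global stability\<close>

context mesh_weights
begin

lemma frontier_cell: "T \<in> \<T> \<Longrightarrow> negligible (convex hull T - interior (convex hull T))"
  using negligible_convex_frontier[OF convex_convex_hull, of T] compact_imp_closed[OF compact_cell]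
  by (simp add: frontier_def)

lemma interior_disjoint:
  assumes "A \<in> \<T>" "B \<in> \<T>" "x \<in> interior (convex hull A)" "x \<in> interior (convex hull B)"
  shows "A = B"
proof (rule ccontr)
  assume "A \<noteq> B"
  let ?I = "interior (convex hull A) \<inter> interior (convex hull B)"
  have "negligible ?I"
    by (rule negligible_subset[OF negligible_inter[OF assms(1,2) \<open>A \<noteq> B\<close>]]) (use interior_subset in blast)
  moreover have "open ?I" "?I \<noteq> {}" using assms(3,4) by auto
  ultimately show False using open_not_negligible by blast
qed

lemma sum_interior:
  assumes "T \<in> \<T>" "x \<in> interior (convex hull T)"
  shows "(\<Sum>K\<in>\<T>. if x \<in> interior (convex hull K) then c K else 0) = c T"
proof -
  have "(\<Sum>K\<in>\<T>. if x \<in> interior (convex hull K) then c K else 0) = (\<Sum>K\<in>\<T>. if K = T then c K else 0)"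
    using assms interior_disjoint by (intro sum.cong) auto
  then show ?thesis using finite_mesh assms(1) by simp
qed

text \<open>Passing to open cells changes nothing up to null sets, and open cells are pairwise
  disjoint.\<close>

lemma sum_cells_le:
  assumes [measurable]: "f \<in> borel_measurable lebesgue"
  shows "(\<Sum>K\<in>\<T>. sqint (convex hull K) f) \<le> sqint UNIV f"
proof -
  have [measurable]: "interior A \<in> sets lebesgue" for A :: "'a set" by auto
  have "(\<Sum>K\<in>\<T>. sqint (convex hull K) f) \<le> (\<Sum>K\<in>\<T>. sqint (interior (convex hull K)) f)"
    by (intro sum_mono sqint_null_diff frontier_cell)
  also have "\<dots> = (\<integral>\<^sup>+x. (\<Sum>K\<in>\<T>. ennreal ((f x)\<^sup>2) * indicator (interior (convex hull K)) x) \<partial>lebesgue)"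
    unfolding sqint_def by (subst nn_integral_sum) measurable
  also have "\<dots> \<le> sqint UNIV f"
    unfolding sqint_def
  proof (intro nn_integral_mono)
    fix x
    have eq: "(\<Sum>K\<in>\<T>. ennreal ((f x)\<^sup>2) * indicator (interior (convex hull K)) x) =
      (\<Sum>K\<in>\<T>. if x \<in> interior (convex hull K) then ennreal ((f x)\<^sup>2) else 0)"
      by (intro sum.cong) auto
    show "(\<Sum>K\<in>\<T>. ennreal ((f x)\<^sup>2) * indicator (interior (convex hull K)) x) \<le> ennreal ((f x)\<^sup>2) * indicator UNIV x"
    proof (cases "\<exists>T\<in>\<T>. x \<in> interior (convex hull T)")
      case True
      then obtain T where "T \<in> \<T>" "x \<in> interior (convex hull T)" by blast
      from sum_interior[OF this, of "\<lambda>_. ennreal ((f x)\<^sup>2)"] show ?thesis by (simp add: eq)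
    next
      case False
      then have "(\<Sum>K\<in>\<T>. if x \<in> interior (convex hull K) then ennreal ((f x)\<^sup>2) else 0) = 0" by (intro sum.neutral) auto
      then show ?thesis by (simp add: eq)
    qed
  qed
  finally show ?thesis .
qed

text \<open>Double counting: the term of a cell \<open>K\<close> occurs once for each of its
  \<open>n + 1\<close> vertices and each of the at most \<open>N0\<close> cells \<open>T\<close> at
  that vertex.\<close>

lemma overlap:
  fixes s :: "'a set \<Rightarrow> ennreal"
  shows "(\<Sum>T\<in>\<T>. \<Sum>z\<in>T. \<Sum>K\<in>star \<T> z. s K) \<le> ennreal ((real n + 1) * real N0) * (\<Sum>K\<in>\<T>. s K)"
proof -
  let ?V = "\<Union>\<T>"
  have "(\<Sum>T\<in>\<T>. \<Sum>z\<in>T. \<Sum>K\<in>star \<T> z. s K) = (\<Sum>T\<in>\<T>. \<Sum>z\<in>?V. if z \<in> T then \<Sum>K\<in>star \<T> z. s K else 0)"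
  proof (rule sum.cong[OF refl])
    fix T assume "T \<in> \<T>"
    then have "?V \<inter> T = T" by blast
    then show "(\<Sum>z\<in>T. \<Sum>K\<in>star \<T> z. s K) = (\<Sum>z\<in>?V. if z \<in> T then \<Sum>K\<in>star \<T> z. s K else 0)"
      using sum.inter_restrict[OF finite_vertices, of "\<lambda>z. \<Sum>K\<in>star \<T> z. s K" T] by simp
  qed
  also have "\<dots> = (\<Sum>z\<in>?V. \<Sum>T\<in>\<T>. if z \<in> T then \<Sum>K\<in>star \<T> z. s K else 0)" by (rule sum.swap)
  also have "\<dots> = (\<Sum>z\<in>?V. ennreal (real (card (star \<T> z))) * (\<Sum>K\<in>star \<T> z. s K))"
  proof (rule sum.cong[OF refl])
    fix z
    have "(\<Sum>T\<in>\<T>. if z \<in> T then \<Sum>K\<in>star \<T> z. s K else 0) = (\<Sum>T\<in>star \<T> z. \<Sum>K\<in>star \<T> z. s K)"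
      unfolding star_def by (rule sum.inter_filter[OF finite_mesh, symmetric])
    then show "(\<Sum>T\<in>\<T>. if z \<in> T then \<Sum>K\<in>star \<T> z. s K else 0) = ennreal (real (card (star \<T> z))) * (\<Sum>K\<in>star \<T> z. s K)"
      by (simp add: ennreal_of_nat_eq_real_of_nat)
  qed
  also have "\<dots> \<le> (\<Sum>z\<in>?V. ennreal (real N0) * (\<Sum>K\<in>star \<T> z. s K))"
    using card_star by (intro sum_mono mult_right_mono ennreal_leI) auto
  also have "\<dots> = ennreal (real N0) * (\<Sum>z\<in>?V. \<Sum>K\<in>\<T>. if z \<in> K then s K else 0)"
    unfolding sum_distrib_left[symmetric] star_def by (simp add: sum.inter_filter[OF finite_mesh])
  also have "(\<Sum>z\<in>?V. \<Sum>K\<in>\<T>. if z \<in> K then s K else 0) = (\<Sum>K\<in>\<T>. \<Sum>z\<in>?V. if z \<in> K then s K else 0)" by (rule sum.swap)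
  also have "\<dots> = (\<Sum>K\<in>\<T>. ennreal (real n + 1) * s K)"
  proof (rule sum.cong[OF refl])
    fix K assume K: "K \<in> \<T>"
    have "(\<Sum>z\<in>?V. if z \<in> K then s K else 0) = (\<Sum>z\<in>?V \<inter> K. s K)"
      by (rule sum.inter_restrict[OF finite_vertices, symmetric])
    also have "?V \<inter> K = K" using K by blast
    finally show "(\<Sum>z\<in>?V. if z \<in> K then s K else 0) = ennreal (real n + 1) * s K"
      using card_cell[OF K] by (simp add: ennreal_of_nat_eq_real_of_nat add.commute)
  qed
  also have "ennreal (real N0) * (\<Sum>K\<in>\<T>. ennreal (real n + 1) * s K) = ennreal ((real n + 1) * real N0) * (\<Sum>K\<in>\<T>. s K)"
    unfolding sum_distrib_left[symmetric] by (subst ennreal_mult_assoc) (auto simp: mult.commute)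
  finally show ?thesis .
qed

definition "C4 = (real n + 1) * Q * ((real n + 1) * real N0)"

lemma clement_L2_stable:
  assumes v: "v \<in> borel_measurable lebesgue" "integrable (lebesgue_on \<Omega>) v"
  shows "sqint \<Omega> (clement \<Omega> \<T> \<alpha> v) \<le> ennreal C4 * sqint UNIV v"
proof -
  let ?s = "\<lambda>K. sqint (convex hull K) v"
  have cellb: "sqint (convex hull T) (clement \<Omega> \<T> \<alpha> v) \<le> ennreal ((real n + 1) * Q) * (\<Sum>z\<in>T. \<Sum>K\<in>star \<T> z. ?s K)"
    if T: "T \<in> \<T>" for T
  proof -
    have "sqint (convex hull T) (clement \<Omega> \<T> \<alpha> v) = sqint (convex hull T) (\<lambda>x. \<Sum>z\<in>T. cz z v * lam T z x)"
      by (rule sqint_cong) (simp add: clement_cell[OF T])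
    also have "\<dots> \<le> ennreal (real n + 1) * (\<Sum>z\<in>T. ennreal ((cz z v)\<^sup>2) * emeasure lebesgue (convex hull T))"
      by (rule sqint_lam_sum[OF T])
    also have "\<dots> \<le> ennreal (real n + 1) * (\<Sum>z\<in>T. ennreal Q * (\<Sum>K\<in>star \<T> z. ?s K))"
    proof (intro mult_left_mono sum_mono)
      fix z assume z: "z \<in> T"
      show "ennreal ((cz z v)\<^sup>2) * emeasure lebesgue (convex hull T) \<le> ennreal Q * (\<Sum>K\<in>star \<T> z. ?s K)"
      proof (cases "z \<in> \<Omega>")
        case True
        have "?s K \<le> (\<Sum>K\<in>star \<T> z. ?s K)" if "K \<in> star \<T> z" for K
          using that finite_star by (intro member_le_sum) auto
        then show ?thesis using cl_bound[OF z T True v] True by (simp add: cz_def)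
      qed (simp add: cz_def)
    qed auto
    also have "\<dots> = ennreal ((real n + 1) * Q) * (\<Sum>z\<in>T. \<Sum>K\<in>star \<T> z. ?s K)"
      unfolding sum_distrib_left[symmetric] by (rule ennreal_mult_assoc) simp
    finally show ?thesis .
  qed
  have "sqint \<Omega> (clement \<Omega> \<T> \<alpha> v) \<le> (\<Sum>T\<in>\<T>. sqint (convex hull T) (clement \<Omega> \<T> \<alpha> v))"
    by (rule sqint_Union_le[OF finite_mesh _ clement_measurable cell_sets]) (use cover closure_subset in auto)
  also have "\<dots> \<le> (\<Sum>T\<in>\<T>. ennreal ((real n + 1) * Q) * (\<Sum>z\<in>T. \<Sum>K\<in>star \<T> z. ?s K))"
    by (intro sum_mono cellb)
  also have "\<dots> \<le> ennreal ((real n + 1) * Q) * (ennreal ((real n + 1) * real N0) * sqint UNIV v)"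
    unfolding sum_distrib_left[symmetric]
    by (intro mult_left_mono order_trans[OF overlap mult_left_mono[OF sum_cells_le]] v) auto
  also have "\<dots> = ennreal C4 * sqint UNIV v"
    unfolding C4_def using consts_nonneg by (intro ennreal_mult_assoc) auto
  finally show ?thesis .
qed

text \<open>The nodal values depend on \<open>v\<close> only through its integrals over the open
  cells, and the piecewise constant projection preserves these.\<close>

lemma clement_P0:
  assumes v: "integrable (lebesgue_on \<Omega>) v"
  shows "clement \<Omega> \<T> \<alpha> v = clement \<Omega> \<T> \<alpha> (P0 \<T> v)"
proof -
  let ?m = "\<lambda>K. measure lebesgue (convex hull K)" and ?I = "\<lambda>K. interior (convex hull K)"
  let ?a = "\<lambda>K. integral\<^sup>L (lebesgue_on (convex hull K)) v / ?m K"
  have P: "P0 \<T> v y = (\<Sum>K\<in>\<T>. ?a K * indicator (?I K) y)" for y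
    unfolding P0_def by (intro sum.cong) auto
  have Pi: "integrable (lebesgue_on \<Omega>) (P0 \<T> v)"
    unfolding P
  proof (intro Bochner_Integration.integrable_sum)
    fix K assume K: "K \<in> \<T>"
    show "integrable (lebesgue_on \<Omega>) (\<lambda>y. ?a K * indicator (?I K) y)"
      using integrable_ci[OF affine_integrable K, of 0 "?a K"] by simp
  qed
  have ci: "ci K (P0 \<T> v) = ci K v" if K: "K \<in> \<T>" for K
  proof -
    have mI: "measure lebesgue (?I K) = ?m K"
    proof -
      have "(?I K - convex hull K) \<union> (convex hull K - ?I K) = convex hull K - ?I K" using interior_subset by blast
      then have "negligible ((?I K - convex hull K) \<union> (convex hull K - ?I K))" using frontier_cell[OF K] by simp
      then show ?thesis
        using measure_negligible_symdiff[of "convex hull K" "?I K"] lmeasurable_compact[OF compact_cell[OF K]] by (simp add: Un_commute)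
    qed
    have "ci K (P0 \<T> v) = (LINT y|lebesgue. ?a K * indicator (?I K) y)"
      unfolding ci_lebesgue[OF K]
    proof (intro Bochner_Integration.integral_cong refl)
      fix y
      show "P0 \<T> v y * indicator (?I K) y = ?a K * indicator (?I K) y"
        using sum_interior[OF K, of y ?a] by (cases "y \<in> ?I K") (auto simp: P0_def)
    qed
    also have "\<dots> = integral\<^sup>L (lebesgue_on (convex hull K)) v" using mI measure_cell_pos[OF K] by simp
    also have "\<dots> = (LINT y:convex hull K|lebesgue. v y)"
      unfolding set_lebesgue_integral_def using cell_sets[OF K] by (intro integral_restrict_space) auto
    also have "\<dots> = (LINT y:?I K|lebesgue. v y)"
    proof -
      have "integrable lebesgue (\<lambda>y. indicator (?I K) y *\<^sub>R v y)"
      proof -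
        have "set_integrable lebesgue \<Omega> v"
          using v dom_sets unfolding set_integrable_def by (subst (asm) integrable_restrict_space) auto
        then have "set_integrable lebesgue (?I K) v" by (rule set_integrable_subset[OF _ _ interior_cell[OF K]]) auto
        then show ?thesis by (simp add: set_integrable_def)
      qed
      then have 1: "v absolutely_integrable_on ?I K" by (simp add: set_integrable_def)
      have neg: "negligible {x \<in> convex hull K - ?I K. v x \<noteq> 0}" "negligible {x \<in> ?I K - convex hull K. v x \<noteq> 0}"
        using frontier_cell[OF K] interior_subset[of "convex hull K"]
        by (auto intro: negligible_subset)
      have 2: "v absolutely_integrable_on convex hull K" using absolutely_integrable_spike_set[OF 1 neg(2,1)] .
      show ?thesis
        unfolding set_lebesgue_integral_eq_integral(2)[OF 1] set_lebesgue_integral_eq_integral(2)[OF 2]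
        by (rule integral_spike_set[OF neg])
    qed
    also have "\<dots> = ci K v" unfolding ci_lebesgue[OF K] set_lebesgue_integral_def by (simp add: mult.commute)
    finally show ?thesis .
  qed
  have "cl z v = cl z (P0 \<T> v)" for z
    unfolding cl_eq[OF v] cl_eq[OF Pi] using ci by (intro sum.cong) (auto simp: star_def)
  then show ?thesis unfolding clement_def cl_def by (simp add: fun_eq_iff)
qed

section \<open>The piecewise gradient of the interpolant\<close>

definition "dT v T = (\<Sum>z\<in>T. cz z v *\<^sub>R lgrad T z)"
definition "gJ v x = (\<Sum>K\<in>\<T>. if x \<in> interior (convex hull K) then dT v K else 0)"

lemma clement_cell_diff:
  assumes "T \<in> \<T>" "x \<in> convex hull T" "y \<in> convex hull T"
  shows "clement \<Omega> \<T> \<alpha> v x - clement \<Omega> \<T> \<alpha> v y = dT v T \<bullet> (x - y)"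
  unfolding clement_cell[OF assms(1,2)] clement_cell[OF assms(1,3)] dT_def
  by (simp add: inner_sum_left lam_diff[symmetric] sum_subtractf[symmetric] right_diff_distrib)

text \<open>The closed cells cut the parameter interval of the segment into finitely many closed
  pieces, on each of which the interpolant is affine in the parameter; Lipschitz bounds with a
  common constant paste.\<close>

lemma clement_segment_lipschitz:
  assumes xy: "closed_segment x y \<subseteq> \<Omega>"
  shows "\<bar>clement \<Omega> \<T> \<alpha> v x - clement \<Omega> \<T> \<alpha> v y\<bar> \<le> (\<Sum>T\<in>\<T>. norm (dT v T)) * dist x y"
proof -
  define p where "p t = (1 - t) *\<^sub>R x + t *\<^sub>R y" for t :: real
  let ?J = "clement \<Omega> \<T> \<alpha> v" and ?M = "\<Sum>T\<in>\<T>. norm (dT v T)"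
  have pc: "continuous_on UNIV p" unfolding p_def by (intro continuous_intros)
  have "(?M * dist x y)-lipschitz_on {0..1} (\<lambda>t. ?J (p t))"
  proof (rule lipschitz_on_closed_Union[of \<T> _ "\<lambda>T. {t. p t \<in> convex hull T}"])
    fix T assume T: "T \<in> \<T>"
    show "closed {t. p t \<in> convex hull T}"
      using closed_vimage[OF compact_imp_closed[OF compact_cell[OF T]] pc] by (simp add: vimage_def)
    show "(?M * dist x y)-lipschitz_on {t. p t \<in> convex hull T} (\<lambda>t. ?J (p t))"
    proof (rule lipschitz_onI)
      fix s t assume st: "s \<in> {t. p t \<in> convex hull T}" "t \<in> {t. p t \<in> convex hull T}"
      have ps: "p s - p t = (t - s) *\<^sub>R (x - y)" by (simp add: p_def algebra_simps)
      have "dist (?J (p s)) (?J (p t)) \<le> norm (dT v T) * norm (p s - p t)"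
        using clement_cell_diff[OF T, of "p s" "p t" v] st Cauchy_Schwarz_ineq2[of "dT v T" "p s - p t"] by (simp add: dist_real_def)
      also have "\<dots> = norm (dT v T) * dist x y * dist s t" by (simp add: ps dist_norm abs_minus_commute)
      also have "\<dots> \<le> ?M * dist x y * dist s t"
        using T finite_mesh by (intro mult_right_mono member_le_sum) auto
      finally show "dist (?J (p s)) (?J (p t)) \<le> ?M * dist x y * dist s t" .
    qed (auto intro!: mult_nonneg_nonneg sum_nonneg)
  next
    show "{0..1} \<subseteq> (\<Union>T\<in>\<T>. {t. p t \<in> convex hull T})"
    proof
      fix t :: real assume t: "t \<in> {0..1}"
      then have "p t \<in> closure \<Omega>" using xy closure_subset unfolding p_def closed_segment_def by fastforce
      then show "t \<in> (\<Union>T\<in>\<T>. {t. p t \<in> convex hull T})" using cover by blast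
    qed
  qed (auto simp: finite_mesh intro!: mult_nonneg_nonneg sum_nonneg)
  then have "dist (?J (p 0)) (?J (p 1)) \<le> ?M * dist x y * dist (0::real) 1" by (rule lipschitz_onD) auto
  then show ?thesis by (simp add: p_def dist_real_def)
qed

lemma gJ_interior: "T \<in> \<T> \<Longrightarrow> x \<in> interior (convex hull T) \<Longrightarrow> gJ v x = dT v T"
  unfolding gJ_def by (rule sum_interior)

lemma gJ_measurable: "gJ v \<in> borel_measurable lebesgue"
proof -
  have "gJ v = (\<lambda>x. \<Sum>K\<in>\<T>. indicator (interior (convex hull K)) x *\<^sub>R dT v K)"
    unfolding gJ_def by (intro ext sum.cong) auto
  also have "\<dots> \<in> borel_measurable lebesgue" by (intro borel_measurable_sum borel_measurable_scaleR borel_measurable_indicator) auto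
  finally show ?thesis .
qed

lemma clement_weak_grad: "has_weak_grad \<Omega> (clement \<Omega> \<T> \<alpha> v) (gJ v)"
proof (rule weak_grad_lipschitz[OF open_dom bounded_dom clement_measurable _ clement_segment_lipschitz _ gJ_measurable])
  let ?J = "clement \<Omega> \<T> \<alpha> v"
  show "\<bar>?J x\<bar> \<le> (\<Sum>T\<in>\<T>. \<Sum>z\<in>T. \<bar>cz z v\<bar>)" if x: "x \<in> \<Omega>" for x
  proof -
    obtain T where T: "T \<in> \<T>" "x \<in> convex hull T" using x cover closure_subset by blast
    have "\<bar>?J x\<bar> \<le> (\<Sum>z\<in>T. \<bar>cz z v\<bar>)"
      unfolding clement_cell[OF T]
    proof (rule order_trans[OF sum_abs sum_mono])
      fix z assume z: "z \<in> T"
      have "\<bar>lam T z x\<bar> \<le> 1" using lam_le_1[OF cell[OF T(1)] z T(2)] in_hull_iff[OF cell[OF T(1)]] z T(2) by auto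
      then have "\<bar>cz z v\<bar> * \<bar>lam T z x\<bar> \<le> \<bar>cz z v\<bar> * 1" by (intro mult_left_mono) auto
      then show "\<bar>cz z v * lam T z x\<bar> \<le> \<bar>cz z v\<bar>" by (simp add: abs_mult)
    qed
    also have "\<dots> \<le> (\<Sum>T\<in>\<T>. \<Sum>z\<in>T. \<bar>cz z v\<bar>)" using T finite_mesh by (intro member_le_sum sum_nonneg) auto
    finally show ?thesis .
  qed
  show "0 \<le> (\<Sum>T\<in>\<T>. norm (dT v T))" by (intro sum_nonneg) auto
  \<comment> \<open>Outside the cell boundaries the interpolant is affine near each point of the
    domain, so the classical derivative exists almost everywhere.\<close>
  let ?N = "\<Union>T\<in>\<T>. convex hull T - interior (convex hull T)"
  have "negligible ?N" using finite_mesh frontier_cell by (intro negligible_Union) auto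
  then have "?N \<in> null_sets lebesgue" using negligible_iff_null_sets by blast
  then show "AE x in lebesgue. x \<in> \<Omega> \<longrightarrow> (?J has_derivative (\<lambda>h. gJ v x \<bullet> h)) (at x)"
  proof (rule AE_I')
    show "{x \<in> space lebesgue. \<not> (x \<in> \<Omega> \<longrightarrow> (?J has_derivative (\<lambda>h. gJ v x \<bullet> h)) (at x))} \<subseteq> ?N"
    proof (rule ccontr)
      assume "\<not> ?thesis"
      then obtain x where x: "x \<in> \<Omega>" "\<not> (?J has_derivative (\<lambda>h. gJ v x \<bullet> h)) (at x)" "x \<notin> ?N" by blast
      obtain T where T: "T \<in> \<T>" "x \<in> convex hull T" using x cover closure_subset by blast
      then have xi: "x \<in> interior (convex hull T)" using x(3) by blast
      have "((\<lambda>y. ?J x + dT v T \<bullet> (y - x)) has_derivative (\<lambda>h. dT v T \<bullet> h)) (at x)"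
        by (auto intro!: derivative_eq_intros)
      then have "(?J has_derivative (\<lambda>h. dT v T \<bullet> h)) (at x)"
      proof (rule has_derivative_transform_within_open[OF _ open_interior xi])
        fix y assume "y \<in> interior (convex hull T)"
        then have "y \<in> convex hull T" using interior_subset by blast
        from clement_cell_diff[OF T(1) this T(2), of v] show "?J x + dT v T \<bullet> (y - x) = ?J y" by simp
      qed
      then show False using x(2) gJ_interior[OF T(1) xi] by simp
    qed
  qed
  fix i :: 'a
  interpret F: finite_measure "lebesgue_on \<Omega>" by (rule finite_measure_lebesgue_on[OF dom_lmeasurable])
  show "integrable (lebesgue_on \<Omega>) (\<lambda>x. gJ v x \<bullet> i)"
  proof (rule F.integrable_const_bound[of _ "(\<Sum>T\<in>\<T>. norm (dT v T)) * norm i"])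
    show "AE x in lebesgue_on \<Omega>. norm (gJ v x \<bullet> i) \<le> (\<Sum>T\<in>\<T>. norm (dT v T)) * norm i"
    proof (rule AE_I2)
      fix x
      have "norm (gJ v x) \<le> (\<Sum>T\<in>\<T>. norm (dT v T))"
        unfolding gJ_def by (rule order_trans[OF norm_sum sum_mono]) auto
      then have "norm (gJ v x) * norm i \<le> (\<Sum>T\<in>\<T>. norm (dT v T)) * norm i" by (rule mult_right_mono) simp
      then show "norm (gJ v x \<bullet> i) \<le> (\<Sum>T\<in>\<T>. norm (dT v T)) * norm i"
        using Cauchy_Schwarz_ineq2[of "gJ v x" i] by simp
    qed
    show "(\<lambda>x. gJ v x \<bullet> i) \<in> borel_measurable (lebesgue_on \<Omega>)"
      by (rule measurable_restrict_space1) (intro borel_measurable_inner gJ_measurable borel_measurable_const)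
  qed
qed

text \<open>The coordinates sum to the constant 1. Hence the cell gradient does not change when a
  constant is subtracted from all nodal values.\<close>

lemma lgrad_sum:
  assumes T: "T \<in> \<T>" shows "(\<Sum>z\<in>T. lgrad T z) = 0"
proof -
  have "(\<Sum>z\<in>T. lgrad T z) \<bullet> h = 0" for h
  proof -
    have "(\<Sum>z\<in>T. lgrad T z) \<bullet> h = (\<Sum>z\<in>T. lam T z h - lam T z 0)"
      by (simp add: inner_sum_left lam_diff)
    then show ?thesis using lam_combination(1)[OF cell[OF T]] by (simp add: sum_subtractf)
  qed
  then have "(\<Sum>z\<in>T. lgrad T z) \<bullet> (\<Sum>z\<in>T. lgrad T z) = 0" by blast
  then show ?thesis by simp
qed

definition "C5 = (real n + 1) * c1\<^sup>2 * cV * ((real n + 1) * real N0)"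

text \<open>An inverse estimate: coordinate gradients are of size \<open>c1 / diameter T\<close>,
  while the nodal values differ from the constant \<open>m\<close> by an amount of first order, so
  the powers of the diameter cancel.\<close>

lemma clement_grad_stable:
  assumes zp: "zero_pair \<Omega> v g"
  shows "sqint \<Omega> (\<lambda>x. norm (gJ v x)) \<le> ennreal C5 * sqint UNIV (\<lambda>x. norm (g x))"
proof -
  have wp: "weak_pair \<Omega> v g" using zp by (simp add: zero_pair_def)
  note [measurable] = weak_pair_facts(3,4)[OF wp] gJ_measurable
  let ?s = "\<lambda>K. sqint (convex hull K) (\<lambda>x. norm (g x))"
  let ?c = "(real n + 1) * c1\<^sup>2 * cV"
  have cellb: "sqint (convex hull T) (\<lambda>x. norm (gJ v x)) \<le> ennreal ?c * (\<Sum>z\<in>T. \<Sum>K\<in>star \<T> z. ?s K)"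
    if T: "T \<in> \<T>" for T
  proof -
    let ?K = "convex hull T" and ?h = "diameter T"
    have h: "?h > 0" by (rule diam_pos[OF T])
    obtain m where m: "\<forall>z\<in>T. ennreal ((m - cz z v)\<^sup>2) * emeasure lebesgue ?K \<le> ennreal (cV * ?h\<^sup>2) * sqint (starset z) (\<lambda>x. norm (g x))"
      using first_order[OF zp T] by blast
    have d: "dT v T = (\<Sum>z\<in>T. (cz z v - m) *\<^sub>R lgrad T z)"
      using lgrad_sum[OF T] by (simp add: dT_def scaleR_diff_left sum_subtractf scaleR_sum_right[symmetric])
    have nd: "(norm (dT v T))\<^sup>2 \<le> (real n + 1) * (\<Sum>z\<in>T. (m - cz z v)\<^sup>2 * (c1 / ?h)\<^sup>2)"
    proof -
      have "norm (dT v T) \<le> (\<Sum>z\<in>T. \<bar>m - cz z v\<bar> * (c1 / ?h))"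
        unfolding d
      proof (rule order_trans[OF norm_sum sum_mono])
        fix z assume z: "z \<in> T"
        have "norm (lgrad T z) \<le> c1 / ?h" using lgrad_cell[OF T z] h by (simp add: pos_le_divide_eq)
        then show "norm ((cz z v - m) *\<^sub>R lgrad T z) \<le> \<bar>m - cz z v\<bar> * (c1 / ?h)"
          unfolding norm_scaleR abs_minus_commute[of m] by (rule mult_left_mono) simp
      qed
      then have "(norm (dT v T))\<^sup>2 \<le> (\<Sum>z\<in>T. 1 * (\<bar>m - cz z v\<bar> * (c1 / ?h)))\<^sup>2" by (intro power_mono) auto
      also have "\<dots> \<le> (\<Sum>z\<in>T. 1\<^sup>2) * (\<Sum>z\<in>T. (\<bar>m - cz z v\<bar> * (c1 / ?h))\<^sup>2)" by (rule Cauchy_Schwarz_ineq_sum)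
      finally show ?thesis unfolding power_mult_distrib power2_abs using card_cell[OF T] by (simp add: add.commute)
    qed
    have "sqint ?K (\<lambda>x. norm (gJ v x)) \<le> sqint (interior ?K) (\<lambda>x. norm (gJ v x))"
      by (rule sqint_null_diff[OF frontier_cell[OF T]])
    also have "\<dots> = sqint (interior ?K) (\<lambda>x. norm (dT v T))"
      by (rule sqint_cong) (simp add: gJ_interior[OF T])
    also have "\<dots> \<le> sqint ?K (\<lambda>x. norm (dT v T))" by (rule sqint_mono[OF interior_subset])
    also have "\<dots> = ennreal ((norm (dT v T))\<^sup>2) * emeasure lebesgue ?K" by (rule sqint_const[OF cell_sets[OF T]])
    also have "\<dots> \<le> ennreal ((real n + 1) * (\<Sum>z\<in>T. (m - cz z v)\<^sup>2 * (c1 / ?h)\<^sup>2)) * emeasure lebesgue ?K"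
      by (intro mult_right_mono ennreal_leI nd) auto
    also have "\<dots> = ennreal ((real n + 1) * (c1 / ?h)\<^sup>2) * (\<Sum>z\<in>T. ennreal ((m - cz z v)\<^sup>2) * emeasure lebesgue ?K)"
    proof -
      have "(real n + 1) * (\<Sum>z\<in>T. (m - cz z v)\<^sup>2 * (c1 / ?h)\<^sup>2) = (real n + 1) * (c1 / ?h)\<^sup>2 * (\<Sum>z\<in>T. (m - cz z v)\<^sup>2)"
        by (simp add: sum_distrib_right[symmetric] mult_ac) (simp add: sum_distrib_left)
      then show ?thesis by (simp only:) (simp add: ennreal_mult sum_nonneg sum_ennreal sum_distrib_right[symmetric] mult.assoc)
    qed
    also have "\<dots> \<le> ennreal ((real n + 1) * (c1 / ?h)\<^sup>2) * (\<Sum>z\<in>T. ennreal (cV * ?h\<^sup>2) * (\<Sum>K\<in>star \<T> z. ?s K))"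
    proof (intro mult_left_mono sum_mono)
      fix z assume z: "z \<in> T"
      have "sqint (starset z) (\<lambda>x. norm (g x)) \<le> (\<Sum>K\<in>star \<T> z. ?s K)" by (rule sqint_starset_le) measurable
      then show "ennreal ((m - cz z v)\<^sup>2) * emeasure lebesgue ?K \<le> ennreal (cV * ?h\<^sup>2) * (\<Sum>K\<in>star \<T> z. ?s K)"
        by (intro order_trans[OF bspec[OF m z]] mult_left_mono) auto
    qed auto
    also have "\<dots> = ennreal ((real n + 1) * (c1 / ?h)\<^sup>2 * (cV * ?h\<^sup>2)) * (\<Sum>z\<in>T. \<Sum>K\<in>star \<T> z. ?s K)"
      unfolding sum_distrib_left[symmetric] by (rule ennreal_mult_assoc) simp
    also have "(real n + 1) * (c1 / ?h)\<^sup>2 * (cV * ?h\<^sup>2) = ?c" using h by (simp add: power_divide)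
    finally show ?thesis .
  qed
  have "sqint \<Omega> (\<lambda>x. norm (gJ v x)) \<le> (\<Sum>T\<in>\<T>. sqint (convex hull T) (\<lambda>x. norm (gJ v x)))"
    by (rule sqint_Union_le[OF finite_mesh _ _ cell_sets]) (use cover closure_subset gJ_measurable in auto)
  also have "\<dots> \<le> (\<Sum>T\<in>\<T>. ennreal ?c * (\<Sum>z\<in>T. \<Sum>K\<in>star \<T> z. ?s K))"
    by (intro sum_mono cellb)
  also have "\<dots> \<le> ennreal ?c * (ennreal ((real n + 1) * real N0) * sqint UNIV (\<lambda>x. norm (g x)))"
    unfolding sum_distrib_left[symmetric]
    by (intro mult_left_mono order_trans[OF overlap mult_left_mono[OF sum_cells_le]]) auto
  also have "\<dots> = ennreal C5 * sqint UNIV (\<lambda>x. norm (g x))"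
    unfolding C5_def using consts_nonneg by (intro ennreal_mult_assoc) auto
  finally show ?thesis .
qed

end

section \<open>Sobolev functions and their extension by zero\<close>

lemma sqint_eq_L2norm:
  assumes "S \<in> sets lebesgue" "integrable (lebesgue_on S) (\<lambda>x. (f x)\<^sup>2)"
  shows "sqint S f = ennreal ((L2norm S f)\<^sup>2)"
  using assms by (simp add: sqint_lebesgue_on L2norm_def nn_integral_eq_integral)

lemma L2norm_le:
  assumes S: "S \<in> sets lebesgue" "S' \<in> sets lebesgue" and f': "integrable (lebesgue_on S') (\<lambda>x. (f' x)\<^sup>2)"
    and le: "sqint S f \<le> ennreal k * sqint S' f'" and k: "0 \<le> k" "sqrt k \<le> c"
  shows "L2norm S f \<le> c * L2norm S' f'"
proof -
  have pos: "0 \<le> L2norm S f" "0 \<le> L2norm S' f'" "0 \<le> c"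
    using k by (auto simp: L2norm_def intro: order_trans[OF real_sqrt_ge_zero])
  show ?thesis
  proof (cases "integrable (lebesgue_on S) (\<lambda>x. (f x)\<^sup>2)")
    case True
    have "ennreal ((L2norm S f)\<^sup>2) \<le> ennreal k * ennreal ((L2norm S' f')\<^sup>2)"
      using le by (simp only: sqint_eq_L2norm[OF S(1) True] sqint_eq_L2norm[OF S(2) f'])
    also have "\<dots> = ennreal ((sqrt k * L2norm S' f')\<^sup>2)" using k by (simp add: ennreal_mult power_mult_distrib)
    finally have "(L2norm S f)\<^sup>2 \<le> (sqrt k * L2norm S' f')\<^sup>2" by (simp add: ennreal_le_iff)
    then have "L2norm S f \<le> sqrt k * L2norm S' f'" by (rule power2_le_imp_le) (use k pos in simp)
    also have "\<dots> \<le> c * L2norm S' f'" using k pos by (intro mult_right_mono)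
    finally show ?thesis .
  next
    case False
    \<comment> \<open>A non-integrable square gives the default integral 0, so the norm is 0 and the
      inequality is trivial.\<close>
    then have "L2norm S f = 0" by (simp add: L2norm_def not_integrable_integral_eq)
    then show ?thesis using pos by simp
  qed
qed

definition zext :: "'a set \<Rightarrow> ('a \<Rightarrow> 'b::real_vector) \<Rightarrow> 'a \<Rightarrow> 'b" where
  "zext \<Omega> f x = (if x \<in> \<Omega> then f x else 0)"

lemma zext_simps [simp]: "x \<in> \<Omega> \<Longrightarrow> zext \<Omega> f x = f x" "x \<notin> \<Omega> \<Longrightarrow> zext \<Omega> f x = 0"
  by (auto simp: zext_def)

lemma zext_measurable:
  fixes f :: "'a::euclidean_space \<Rightarrow> 'b::real_normed_vector"
  assumes "\<Omega> \<in> sets lebesgue" "f \<in> borel_measurable (lebesgue_on \<Omega>)"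
  shows "zext \<Omega> f \<in> borel_measurable lebesgue"
proof -
  have "zext \<Omega> f = (\<lambda>x. indicator \<Omega> x *\<^sub>R f x)" by (auto simp: zext_def indicator_def)
  then show ?thesis using assms by (simp add: borel_measurable_restrict_space_iff)
qed

lemma sqint_UNIV: "(\<And>x. x \<notin> S \<Longrightarrow> f x = 0) \<Longrightarrow> sqint UNIV f = sqint S f"
  by (intro antisym sqint_mono_zero) auto

lemma sqint_zext: "sqint UNIV (zext \<Omega> f) = sqint \<Omega> f"
proof -
  have "sqint UNIV (zext \<Omega> f) = sqint \<Omega> (zext \<Omega> f)" by (rule sqint_UNIV) simp
  also have "\<dots> = sqint \<Omega> f" by (rule sqint_cong) simp
  finally show ?thesis .
qed

lemma sqint_zext_norm: "sqint UNIV (\<lambda>x. norm (zext \<Omega> f x)) = sqint \<Omega> (\<lambda>x. norm (f x))"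
proof -
  have "sqint UNIV (\<lambda>x. norm (zext \<Omega> f x)) = sqint \<Omega> (\<lambda>x. norm (zext \<Omega> f x))" by (rule sqint_UNIV) simp
  also have "\<dots> = sqint \<Omega> (\<lambda>x. norm (f x))" by (rule sqint_cong) simp
  finally show ?thesis .
qed

lemma weak_pair_zext:
  assumes \<Omega>: "open \<Omega>" "bounded \<Omega>" and v: "L2 \<Omega> v" and g: "L2v \<Omega> g" and w: "has_weak_grad \<Omega> v g"
  shows "weak_pair \<Omega> (zext \<Omega> v) (zext \<Omega> g)"
proof -
  have S: "\<Omega> \<in> sets lebesgue" using \<Omega>(1) by auto
  have "has_weak_grad \<Omega> (zext \<Omega> v) (zext \<Omega> g)" using w by (subst has_weak_grad_cong[of \<Omega> _ v _ g]) auto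
  moreover have "zext \<Omega> v \<in> borel_measurable lebesgue" "zext \<Omega> g \<in> borel_measurable lebesgue"
    using v g by (auto simp: L2_def L2v_def intro!: zext_measurable S)
  moreover have "sqint UNIV (zext \<Omega> v) < \<infinity>" "sqint UNIV (\<lambda>x. norm (zext \<Omega> g x)) < \<infinity>"
    unfolding sqint_zext sqint_zext_norm sqint_L2norm[OF S v] sqint_L2norm[OF S L2v_norm[OF g]] by auto
  ultimately show ?thesis using \<Omega> by (simp add: weak_pair_def)
qed

text \<open>The approximating test functions of the definition vanish with their gradients outside
  the domain. They therefore approximate the extension by zero on the whole space, which interior
  mollification would not do.\<close>

lemma H10_zero_pair:
  assumes \<Omega>: "open \<Omega>" "bounded \<Omega>" and H: "H10 \<Omega> v g"
  shows "zero_pair \<Omega> (zext \<Omega> v) (zext \<Omega> g)"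
  unfolding zero_pair_def
proof (intro conjI allI impI)
  have S[measurable]: "\<Omega> \<in> sets lebesgue" using \<Omega>(1) by auto
  have lm: "\<Omega> \<in> lmeasurable" using \<Omega> by (intro bounded_set_imp_lmeasurable) auto
  show wp: "weak_pair \<Omega> (zext \<Omega> v) (zext \<Omega> g)" using H by (intro weak_pair_zext \<Omega>) (auto simp: H10_def)
  note [measurable] = weak_pair_facts(3,4)[OF wp]
  have L: "L2 \<Omega> v" "L2v \<Omega> g" using H by (auto simp: H10_def)
  fix \<delta> :: real assume \<delta>: "\<delta> > 0"
  obtain \<phi>s where t: "\<And>k. test_fn \<Omega> (\<phi>s k)"
    and lim: "(\<lambda>k. (L2norm \<Omega> (\<lambda>x. v x - \<phi>s k x))\<^sup>2 + (L2normv \<Omega> (\<lambda>x. g x - grad (\<phi>s k) x))\<^sup>2) \<longlonglongrightarrow> 0"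
    using H unfolding H10_def by blast
  from order_tendstoD(2)[OF lim \<delta>] obtain k
    where k: "(L2norm \<Omega> (\<lambda>x. v x - \<phi>s k x))\<^sup>2 + (L2normv \<Omega> (\<lambda>x. g x - grad (\<phi>s k) x))\<^sup>2 < \<delta>"
    unfolding eventually_sequentially by blast
  define \<phi> where "\<phi> = \<phi>s k"
  note f = test_fn_facts[OF t[of k], folded \<phi>_def]
  have [measurable]: "\<phi> \<in> borel_measurable lebesgue" "grad \<phi> \<in> borel_measurable lebesgue" using C1_measurable[OF f(1)] by auto
  obtain N where N: "\<And>x. \<bar>\<phi> x\<bar> \<le> N" "\<And>x. norm (grad \<phi> x) \<le> N" using f(3) by blast
  have fin: "sqint \<Omega> (\<lambda>x. N) < \<infinity>" using lm by (simp add: sqint_const[OF S] emeasure_eq_measure2 ennreal_mult_less_top)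
  have 1: "sqint \<Omega> \<phi> < \<infinity>" "sqint \<Omega> (\<lambda>x. norm (grad \<phi> x)) < \<infinity>"
    by (rule order_le_less_trans[OF sqint_mono_fun fin], use order_trans[OF N(1) abs_ge_self] order_trans[OF N(2) abs_ge_self] in simp)+
  have d1: "sqint \<Omega> (\<lambda>x. \<phi> x - zext \<Omega> v x) < \<infinity>"
  proof -
    have "sqint \<Omega> (\<lambda>x. \<phi> x - zext \<Omega> v x) \<le> 2 * sqint \<Omega> \<phi> + 2 * sqint \<Omega> (zext \<Omega> v)" by (rule sqint_diff) measurable
    also have "\<dots> < \<infinity>" using 1 order_le_less_trans[OF sqint_mono[OF subset_UNIV] weak_pair_facts(5)[OF wp], of \<Omega>]
      by (auto simp: ennreal_mult_less_top)
    finally show ?thesis .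
  qed
  have d2: "sqint \<Omega> (\<lambda>x. norm (grad \<phi> x - zext \<Omega> g x)) < \<infinity>"
  proof -
    have "sqint \<Omega> (\<lambda>x. norm (grad \<phi> x - zext \<Omega> g x)) \<le> sqint \<Omega> (\<lambda>x. norm (grad \<phi> x) + norm (zext \<Omega> g x))"
      by (rule sqint_mono_fun) (use norm_triangle_ineq4 in auto)
    also have "\<dots> \<le> 2 * sqint \<Omega> (\<lambda>x. norm (grad \<phi> x)) + 2 * sqint \<Omega> (\<lambda>x. norm (zext \<Omega> g x))" by (rule sqint_add) measurable
    also have "\<dots> < \<infinity>" using 1 order_le_less_trans[OF sqint_mono[OF subset_UNIV] weak_pair_facts(6)[OF wp], of \<Omega>]
      by (auto simp: ennreal_mult_less_top)
    finally show ?thesis .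
  qed
  have "sqint UNIV (\<lambda>x. \<phi> x - zext \<Omega> v x) \<le> ennreal \<delta>"
  proof -
    have "sqint UNIV (\<lambda>x. \<phi> x - zext \<Omega> v x) = sqint \<Omega> (\<lambda>x. \<phi> x - zext \<Omega> v x)" by (rule sqint_UNIV) (simp add: f(2))
    also have "\<dots> = ennreal ((L2norm \<Omega> (\<lambda>x. \<phi> x - zext \<Omega> v x))\<^sup>2)"
      by (rule sqint_L2norm[OF S L2I_sqint[OF S _ d1]], rule measurable_restrict_space1) measurable
    also have "L2norm \<Omega> (\<lambda>x. \<phi> x - zext \<Omega> v x) = L2norm \<Omega> (\<lambda>x. v x - \<phi> x)"
      unfolding L2norm_def by (intro arg_cong[of _ _ sqrt] Bochner_Integration.integral_cong) (auto simp: power2_commute)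
    also have "ennreal ((L2norm \<Omega> (\<lambda>x. v x - \<phi> x))\<^sup>2) \<le> ennreal \<delta>"
      using k unfolding \<phi>_def by (intro ennreal_leI) (smt (verit) zero_le_power2)
    finally show ?thesis .
  qed
  moreover have "sqint UNIV (\<lambda>x. norm (grad \<phi> x - zext \<Omega> g x)) \<le> ennreal \<delta>"
  proof -
    have "sqint UNIV (\<lambda>x. norm (grad \<phi> x - zext \<Omega> g x)) = sqint \<Omega> (\<lambda>x. norm (grad \<phi> x - zext \<Omega> g x))"
      by (rule sqint_UNIV) (simp add: f(2))
    also have "\<dots> = ennreal ((L2norm \<Omega> (\<lambda>x. norm (grad \<phi> x - zext \<Omega> g x)))\<^sup>2)"
      by (rule sqint_L2norm[OF S L2I_sqint[OF S _ d2]], rule measurable_restrict_space1) measurable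
    also have "L2norm \<Omega> (\<lambda>x. norm (grad \<phi> x - zext \<Omega> g x)) = L2normv \<Omega> (\<lambda>x. g x - grad \<phi> x)"
      unfolding L2norm_def L2normv_def by (intro arg_cong[of _ _ sqrt] Bochner_Integration.integral_cong) (auto simp: norm_minus_commute)
    also have "ennreal ((L2normv \<Omega> (\<lambda>x. g x - grad \<phi> x))\<^sup>2) \<le> ennreal \<delta>"
      using k unfolding \<phi>_def by (intro ennreal_leI) (smt (verit) zero_le_power2)
    finally show ?thesis .
  qed
  ultimately show "\<exists>u D. C1 u D \<and> (\<forall>x. x \<notin> \<Omega> \<longrightarrow> u x = 0 \<and> D x = 0) \<and>
      sqint UNIV (\<lambda>x. u x - zext \<Omega> v x) \<le> ennreal \<delta> \<and> sqint UNIV (\<lambda>x. norm (D x - zext \<Omega> g x)) \<le> ennreal \<delta>"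
    using f(1,2) by blast
qed

section \<open>The estimates in terms of norms on cells and patches\<close>

context mesh_weights
begin

text \<open>Patches are closed and may contain boundary points of the domain. These lie on
  boundaries of cells and form a null set, so integrability on the open domain suffices.\<close>

lemma closure_integrable:
  fixes f :: "'a \<Rightarrow> real"
  assumes f: "integrable (lebesgue_on \<Omega>) f" and S: "S \<in> sets lebesgue" "S \<subseteq> closure \<Omega>"
  shows "integrable (lebesgue_on S) f"
proof -
  have "closure \<Omega> - \<Omega> \<subseteq> (\<Union>T\<in>\<T>. convex hull T - interior (convex hull T))"
    using cover interior_cell by blast
  moreover have "negligible (\<Union>T\<in>\<T>. convex hull T - interior (convex hull T))"
    using finite_mesh frontier_cell by (intro negligible_Union) auto
  ultimately have neg: "negligible (closure \<Omega> - \<Omega>)" by (rule negligible_subset[rotated])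
  have "set_integrable lebesgue \<Omega> f"
    using f dom_sets unfolding set_integrable_def by (subst (asm) integrable_restrict_space) auto
  then have "f absolutely_integrable_on (\<Omega> \<inter> S)"
    by (rule set_integrable_subset) (use dom_sets S in auto)
  then have "f absolutely_integrable_on S"
    by (rule absolutely_integrable_spike_set) (use S in \<open>auto intro!: negligible_subset[OF neg]\<close>)
  then show ?thesis using S unfolding set_integrable_def by (subst integrable_restrict_space) auto
qed

lemma patch_sets: "patch \<T> T \<in> sets lebesgue"
proof -
  have "closed (patch \<T> T)"
    unfolding patch_def
  proof (intro closed_Union)
    have "(\<lambda>K. convex hull K) ` (\<Union>z\<in>T. star \<T> z) \<subseteq> (\<lambda>K. convex hull K) ` \<T>" by (auto simp: star_def)
    then show "finite ((\<lambda>K. convex hull K) ` (\<Union>z\<in>T. star \<T> z))"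
      using finite_mesh by (meson finite_imageI finite_subset)
    show "\<forall>S\<in>(\<lambda>K. convex hull K) ` (\<Union>z\<in>T. star \<T> z). closed S"
      using compact_cell by (auto simp: star_def intro: compact_imp_closed)
  qed
  then show ?thesis by auto
qed

lemma patch_closure: "patch \<T> T \<subseteq> closure \<Omega>"
  using cell_sub by (auto simp: patch_def star_def)

lemma clement_zext: "clement \<Omega> \<T> \<alpha> (zext \<Omega> v) = clement \<Omega> \<T> \<alpha> v"
proof -
  have "integral\<^sup>L (lebesgue_on \<Omega>) (\<lambda>y. zext \<Omega> v y * phi \<T> \<alpha> z y) = integral\<^sup>L (lebesgue_on \<Omega>) (\<lambda>y. v y * phi \<T> \<alpha> z y)" for z
    by (intro Bochner_Integration.integral_cong) auto
  then show ?thesis by (simp add: clement_def fun_eq_iff)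
qed

lemma L2_integrable: "L2 \<Omega> v \<Longrightarrow> integrable (lebesgue_on \<Omega>) v"
proof -
  interpret F: finite_measure "lebesgue_on \<Omega>" by (rule finite_measure_lebesgue_on[OF dom_lmeasurable])
  show "L2 \<Omega> v \<Longrightarrow> integrable (lebesgue_on \<Omega>) v" by (auto simp: L2_def intro: F.square_integrable_imp_integrable)
qed

text \<open>The earlier constants bound squared norms, hence the roots; a sum of nonnegative terms
  dominates each of them.\<close>

definition "Cmax = sqrt C2 + sqrt C3 + sqrt C4 + sqrt C5"

lemma C_nonneg: "0 \<le> C2" "0 \<le> C3" "0 \<le> C4" "0 \<le> C5"
proof -
  have "0 \<le> cI" "0 \<le> cJ" unfolding cI_def cJ_def c6_def using consts_nonneg c4_pos by auto
  then show "0 \<le> C3" unfolding C3_def using consts_nonneg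
    by (intro add_nonneg_nonneg mult_nonneg_nonneg) simp_all
  show "0 \<le> C2" unfolding C2_def using consts_nonneg
    by (intro add_nonneg_nonneg mult_nonneg_nonneg) simp_all
  show "0 \<le> C4" "0 \<le> C5" unfolding C4_def C5_def using consts_nonneg
    by (intro mult_nonneg_nonneg, simp_all)+
qed

lemma sqrt_le_Cmax: "sqrt C2 \<le> Cmax" "sqrt C3 \<le> Cmax" "sqrt C4 \<le> Cmax" "sqrt C5 \<le> Cmax"
  unfolding Cmax_def using C_nonneg[THEN real_sqrt_ge_zero] by linarith+

theorem clement_error_H1:
  assumes T: "T \<in> \<T>" and H: "H10 \<Omega> v g"
  shows "L2norm (convex hull T) (\<lambda>x. v x - clement \<Omega> \<T> \<alpha> v x) \<le> Cmax * diameter T * L2normv (patch \<T> T) g"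
  unfolding L2normv_norm
proof (rule L2norm_le[OF cell_sets[OF T] patch_sets])
  show "integrable (lebesgue_on (patch \<T> T)) (\<lambda>x. (norm (g x))\<^sup>2)"
    using H by (intro closure_integrable[OF _ patch_sets patch_closure]) (auto simp: H10_def L2v_def)
  have "sqint (convex hull T) (\<lambda>x. v x - clement \<Omega> \<T> \<alpha> v x) = sqint (convex hull T) (\<lambda>x. zext \<Omega> v x - clement \<Omega> \<T> \<alpha> (zext \<Omega> v) x)"
    by (rule sqint_cell_cong[OF T]) (simp add: clement_zext)
  also have "\<dots> \<le> ennreal (C2 * (diameter T)\<^sup>2) * sqint (patch \<T> T) (\<lambda>x. norm (zext \<Omega> g x))"
    by (rule error_first_order[OF H10_zero_pair[OF open_dom bounded_dom H] T])
  also have "\<dots> \<le> ennreal (C2 * (diameter T)\<^sup>2) * sqint (patch \<T> T) (\<lambda>x. norm (g x))"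
    by (intro mult_left_mono sqint_mono_fun) (auto simp: zext_def)
  finally show "sqint (convex hull T) (\<lambda>x. v x - clement \<Omega> \<T> \<alpha> v x) \<le> ennreal (C2 * (diameter T)\<^sup>2) * sqint (patch \<T> T) (\<lambda>x. norm (g x))" .
  show "sqrt (C2 * (diameter T)\<^sup>2) \<le> Cmax * diameter T"
    using sqrt_le_Cmax(1) diam_pos[OF T] by (simp add: real_sqrt_mult mult_right_mono)
qed (use C_nonneg in simp)

theorem clement_error_H2:
  assumes T: "T \<in> \<T>" and H: "H10 \<Omega> v g" and H2: "\<And>i. i \<in> Basis \<Longrightarrow> L2v \<Omega> (H i) \<and> has_weak_grad \<Omega> (\<lambda>x. g x \<bullet> i) (H i)"
  shows "L2norm (convex hull T) (\<lambda>x. v x - clement \<Omega> \<T> \<alpha> v x)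
    \<le> Cmax * (diameter T)\<^sup>2 * sqrt (integral\<^sup>L (lebesgue_on (patch \<T> T)) (\<lambda>x. \<Sum>i\<in>Basis. (norm (H i x))\<^sup>2))"
proof -
  let ?P = "patch \<T> T"
  \<comment> \<open>The Frobenius norm of the weak Hessian, used as a scalar function so that
    \<open>L2norm_le\<close> applies.\<close>
  define F where "F x = sqrt (\<Sum>i\<in>Basis. (norm (H i x))\<^sup>2)" for x
  have F2: "(F x)\<^sup>2 = (\<Sum>i\<in>Basis. (norm (H i x))\<^sup>2)" for x by (simp add: F_def sum_nonneg)
  have int: "integrable (lebesgue_on ?P) (\<lambda>x. (norm (H i x))\<^sup>2)" if "i \<in> Basis" for i
    using H2[OF that] by (intro closure_integrable[OF _ patch_sets patch_closure]) (auto simp: L2v_def)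
  have intF: "integrable (lebesgue_on ?P) (\<lambda>x. (F x)\<^sup>2)"
    unfolding F2 using int by (rule Bochner_Integration.integrable_sum)
  have wp: "weak_pair \<Omega> (\<lambda>x. zext \<Omega> g x \<bullet> i) (zext \<Omega> (H i))" if i: "i \<in> Basis" for i
  proof -
    have g: "g \<in> borel_measurable (lebesgue_on \<Omega>)" "integrable (lebesgue_on \<Omega>) (\<lambda>x. (norm (g x))\<^sup>2)"
      using H by (auto simp: H10_def L2v_def)
    have "L2 \<Omega> (\<lambda>x. g x \<bullet> i)"
      unfolding L2_def
    proof
      show m: "(\<lambda>x. g x \<bullet> i) \<in> borel_measurable (lebesgue_on \<Omega>)" using g(1) by (intro borel_measurable_inner) auto
      show "integrable (lebesgue_on \<Omega>) (\<lambda>x. (g x \<bullet> i)\<^sup>2)"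
      proof (rule Bochner_Integration.integrable_bound[OF g(2)])
        show "AE x in lebesgue_on \<Omega>. norm ((g x \<bullet> i)\<^sup>2) \<le> norm ((norm (g x))\<^sup>2)"
          using Basis_le_norm[OF i] by (intro AE_I2) (auto intro!: power_mono simp: abs_le_square_iff[symmetric])
      qed (use m in measurable)
    qed
    from weak_pair_zext[OF open_dom bounded_dom this] H2[OF i]
    have "weak_pair \<Omega> (zext \<Omega> (\<lambda>x. g x \<bullet> i)) (zext \<Omega> (H i))" by blast
    moreover have "zext \<Omega> (\<lambda>x. g x \<bullet> i) = (\<lambda>x. zext \<Omega> g x \<bullet> i)" by (auto simp: zext_def)
    ultimately show ?thesis by simp
  qed
  have "L2norm (convex hull T) (\<lambda>x. v x - clement \<Omega> \<T> \<alpha> v x) \<le> Cmax * (diameter T)\<^sup>2 * L2norm ?P F"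
  proof (rule L2norm_le[OF cell_sets[OF T] patch_sets intF])
    have "sqint (convex hull T) (\<lambda>x. v x - clement \<Omega> \<T> \<alpha> v x) = sqint (convex hull T) (\<lambda>x. zext \<Omega> v x - clement \<Omega> \<T> \<alpha> (zext \<Omega> v) x)"
      by (rule sqint_cell_cong[OF T]) (simp add: clement_zext)
    also have "\<dots> \<le> ennreal (C3 * (diameter T)^4) * (\<Sum>i\<in>Basis. sqint ?P (\<lambda>x. norm (zext \<Omega> (H i) x)))"
      by (rule error_second_order[OF H10_zero_pair[OF open_dom bounded_dom H] wp T])
    also have "\<dots> \<le> ennreal (C3 * (diameter T)^4) * (\<Sum>i\<in>Basis. sqint ?P (\<lambda>x. norm (H i x)))"
      by (intro mult_left_mono sum_mono sqint_mono_fun) (auto simp: zext_def)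
    also have "(\<Sum>i\<in>Basis. sqint ?P (\<lambda>x. norm (H i x))) = (\<Sum>i\<in>Basis. ennreal (integral\<^sup>L (lebesgue_on ?P) (\<lambda>x. (norm (H i x))\<^sup>2)))"
      by (intro sum.cong refl, subst sqint_eq_L2norm[OF patch_sets int]) (auto simp: L2norm_def)
    also have "\<dots> = ennreal ((L2norm ?P F)\<^sup>2)"
      by (simp add: L2norm_def F2 sum_ennreal Bochner_Integration.integral_sum int sum_nonneg)
    also have "\<dots> = sqint ?P F" by (rule sqint_eq_L2norm[OF patch_sets intF, symmetric])
    finally show "sqint (convex hull T) (\<lambda>x. v x - clement \<Omega> \<T> \<alpha> v x) \<le> ennreal (C3 * (diameter T)^4) * sqint ?P F" .
    have "sqrt (C3 * (diameter T)^4) = sqrt C3 * (diameter T)\<^sup>2"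
      by (simp add: real_sqrt_mult) (metis abs_power2 power_mult real_sqrt_abs num_double numeral_times_numeral)
    then show "sqrt (C3 * (diameter T)^4) \<le> Cmax * (diameter T)\<^sup>2"
      using sqrt_le_Cmax(2) by (simp add: mult_right_mono)
  qed (use C_nonneg in simp)
  then show ?thesis by (simp add: L2norm_def F2)
qed

theorem clement_stable_L2:
  assumes v: "L2 \<Omega> v"
  shows "L2norm \<Omega> (clement \<Omega> \<T> \<alpha> v) \<le> Cmax * L2norm \<Omega> v"
proof (rule L2norm_le[OF dom_sets dom_sets _ _ C_nonneg(3) sqrt_le_Cmax(3)])
  show "integrable (lebesgue_on \<Omega>) (\<lambda>x. (v x)\<^sup>2)" using v by (simp add: L2_def)
  have "integrable (lebesgue_on \<Omega>) (zext \<Omega> v)"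
    using L2_integrable[OF v] by (subst Bochner_Integration.integrable_cong[where g = v]) auto
  from clement_L2_stable[OF zext_measurable[OF dom_sets] this] v
  show "sqint \<Omega> (clement \<Omega> \<T> \<alpha> v) \<le> ennreal C4 * sqint \<Omega> v" by (simp add: clement_zext sqint_zext L2_def)
qed

theorem clement_stable_H1:
  assumes H: "H10 \<Omega> v g"
  shows "\<exists>gJ. has_weak_grad \<Omega> (clement \<Omega> \<T> \<alpha> v) gJ \<and> L2normv \<Omega> gJ \<le> Cmax * L2normv \<Omega> g"
proof (intro exI conjI)
  show "has_weak_grad \<Omega> (clement \<Omega> \<T> \<alpha> v) (gJ (zext \<Omega> v))"
    using clement_weak_grad[of "zext \<Omega> v"] by (simp only: clement_zext)
  show "L2normv \<Omega> (gJ (zext \<Omega> v)) \<le> Cmax * L2normv \<Omega> g"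
    unfolding L2normv_norm
  proof (rule L2norm_le[OF dom_sets dom_sets _ _ C_nonneg(4) sqrt_le_Cmax(4)])
    show "integrable (lebesgue_on \<Omega>) (\<lambda>x. (norm (g x))\<^sup>2)" using H by (simp add: H10_def L2v_def)
    show "sqint \<Omega> (\<lambda>x. norm (gJ (zext \<Omega> v) x)) \<le> ennreal C5 * sqint \<Omega> (\<lambda>x. norm (g x))"
      using clement_grad_stable[OF H10_zero_pair[OF open_dom bounded_dom H]] by (simp only: sqint_zext_norm)
  qed
qed

end

theorem mainTheorem6:
  fixes \<Omega> :: "'a::euclidean_space set" and \<kappa> :: real
  assumes "DIM('a) = 2 \<or> DIM('a) = 3"
    and "lipschitz_domain \<Omega>" and "connected \<Omega>"
  shows "\<exists>C. \<forall>\<T> \<alpha>. simplicial_mesh \<Omega> \<T> \<and> shape_regular_by \<kappa> \<T> \<and> valid_weights \<Omega> \<T> \<alpha> \<longrightarrow>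
     (\<forall>v. L2 \<Omega> v \<longrightarrow> clement \<Omega> \<T> \<alpha> v = clement \<Omega> \<T> \<alpha> (P0 \<T> v))
   \<and> (\<forall>T\<in>\<T>. \<forall>v g. H10 \<Omega> v g \<longrightarrow>
        L2norm (convex hull T) (\<lambda>x. v x - clement \<Omega> \<T> \<alpha> v x)
          \<le> C * diameter T * L2normv (patch \<T> T) g)
   \<and> (\<forall>T\<in>\<T>. \<forall>v g H. H10 \<Omega> v g \<and> (\<forall>i\<in>Basis. L2v \<Omega> (H i) \<and> has_weak_grad \<Omega> (\<lambda>x. g x \<bullet> i) (H i)) \<longrightarrow>
        L2norm (convex hull T) (\<lambda>x. v x - clement \<Omega> \<T> \<alpha> v x)
          \<le> C * (diameter T)\<^sup>2 *
             sqrt (integral\<^sup>L (lebesgue_on (patch \<T> T)) (\<lambda>x. \<Sum>i\<in>Basis. (norm (H i x))\<^sup>2)))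
   \<and> (\<forall>v. L2 \<Omega> v \<longrightarrow> L2norm \<Omega> (clement \<Omega> \<T> \<alpha> v) \<le> C * L2norm \<Omega> v)
   \<and> (\<forall>v g. H10 \<Omega> v g \<longrightarrow>
        (\<exists>gJ. has_weak_grad \<Omega> (clement \<Omega> \<T> \<alpha> v) gJ \<and> L2normv \<Omega> gJ \<le> C * L2normv \<Omega> g))"
proof -
  obtain R L where RL: "R > 0" "L \<ge> 0" "\<forall>z\<in>frontier \<Omega>. \<exists>e f. graph_at \<Omega> R L z e f"
    using lipschitz_domain_uniform[OF assms(2)] by blast
  \<comment> \<open>The constant is formed before mesh and weights are fixed: its arguments are the
    domain, the shape constant, the chart data and the dimension.\<close>
  let ?C = "mesh_weights.Cmax \<Omega> (max 1 \<kappa>) R L (DIM('a))"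
  show ?thesis
  proof (intro exI[of _ ?C] allI impI)
    fix \<T> :: "'a set set" and \<alpha>
    assume A: "simplicial_mesh \<Omega> \<T> \<and> shape_regular_by \<kappa> \<T> \<and> valid_weights \<Omega> \<T> \<alpha>"
    interpret mesh_weights \<Omega> \<T> "max 1 \<kappa>" R L "DIM('a)" \<alpha>
    proof
      \<comment> \<open>Replacing \<open>\<kappa>\<close> by \<open>max 1 \<kappa>\<close> only
        weakens shape regularity and provides the lower bound 1 that the constants rely on.\<close>
      show "shape_regular_by (max 1 \<kappa>) \<T>"
        unfolding shape_regular_by_def
      proof
        fix T assume "T \<in> \<T>"
        then have "diameter T ^ DIM('a) \<le> \<kappa> * measure lebesgue (convex hull T)"
          using A by (simp add: shape_regular_by_def)
        also have "\<dots> \<le> max 1 \<kappa> * measure lebesgue (convex hull T)" by (intro mult_right_mono) auto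
        finally show "diameter T ^ DIM('a) \<le> max 1 \<kappa> * measure lebesgue (convex hull T)" .
      qed
    qed (use assms A RL in \<open>auto simp: lipschitz_domain_def\<close>)
    show "(\<forall>v. L2 \<Omega> v \<longrightarrow> clement \<Omega> \<T> \<alpha> v = clement \<Omega> \<T> \<alpha> (P0 \<T> v))
   \<and> (\<forall>T\<in>\<T>. \<forall>v g. H10 \<Omega> v g \<longrightarrow>
        L2norm (convex hull T) (\<lambda>x. v x - clement \<Omega> \<T> \<alpha> v x)
          \<le> ?C * diameter T * L2normv (patch \<T> T) g)
   \<and> (\<forall>T\<in>\<T>. \<forall>v g H. H10 \<Omega> v g \<and> (\<forall>i\<in>Basis. L2v \<Omega> (H i) \<and> has_weak_grad \<Omega> (\<lambda>x. g x \<bullet> i) (H i)) \<longrightarrow>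
        L2norm (convex hull T) (\<lambda>x. v x - clement \<Omega> \<T> \<alpha> v x)
          \<le> ?C * (diameter T)\<^sup>2 *
             sqrt (integral\<^sup>L (lebesgue_on (patch \<T> T)) (\<lambda>x. \<Sum>i\<in>Basis. (norm (H i x))\<^sup>2)))
   \<and> (\<forall>v. L2 \<Omega> v \<longrightarrow> L2norm \<Omega> (clement \<Omega> \<T> \<alpha> v) \<le> ?C * L2norm \<Omega> v)
   \<and> (\<forall>v g. H10 \<Omega> v g \<longrightarrow>
        (\<exists>gJ. has_weak_grad \<Omega> (clement \<Omega> \<T> \<alpha> v) gJ \<and> L2normv \<Omega> gJ \<le> ?C * L2normv \<Omega> g))"
    proof (intro conjI allI impI ballI, goal_cases)
      case (1 v) show ?case by (rule clement_P0[OF L2_integrable[OF 1]])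
    next
      case (2 T v g) then show ?case by (intro clement_error_H1)
    next
      case (3 T v g H) then show ?case by (intro clement_error_H2) blast+
    next
      case (4 v) then show ?case by (rule clement_stable_L2)
    next
      case (5 v g) then show ?case by (rule clement_stable_H1)
    qed
  qed
qed

end
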